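(* Let $\mathscr{F}=\ell\boxtimes\mathcal{F}$ be a reduced convex pre-foliation of co-degree $1$ and degree $d\geq3$ on $\mathbb{P}^2_{\mathbb{C}}$. Then the $d$-web $\mathrm{Leg}\,\mathscr{F}$ on $\check{\mathbb{P}}^2_{\mathbb{C}}$ is flat.
   Context: Foliations and pre-foliations. A holomorphic foliation of degree $n$ on $\mathbb{P}^2_{\mathbb{C}}$ is given in homogeneous coordinates by a 1-form $\Omega_0=a\,dx+b\,dy+c\,dz$, with $a,b,c$ homogeneous of degree $n+1$ without common factor and $xa+yb+zc=0$. A pre-foliation of co-degree $1$ and degree $d$ on $\mathbb{P}^2_{\mathbb{C}}$ is a pair, written $\ell\boxtimes\mathcal{F}$, of a line $\ell$ and a holomorphic foliation $\mathcal{F}$ of degree $d-1$. Reduced convexity. A foliation of degree $n\ge1$ on $\mathbb{P}^2_{\mathbb{C}}$ has at most $3n$ distinct invariant lines; it is called reduced convex if it has exactly $3n$ of them (it is then convex, i.e. its leaves other than straight lines have no inflection points). The pre-foliation $\ell\boxtimes\mathcal F$ is reduced convex if $\mathcal F$ is reduced convex and $\ell$ is invariant by $\mathcal F$. Legendre transform. If $\ell\boxtimes\mathcal F$ is given in an affine chart by $f(x,y)(A\,dx+B\,dy)$ ($f=0$ being an equation of $\ell$), then in the affine chart $(p,q)$ of $\check{\mathbb{P}}^2_{\mathbb{C}}$ associated to the line $\{y=px-q\}$, $\mathrm{Leg}(\ell\boxtimes\mathcal F)$ is the $d$-web given by $f(x,px-q)\big(A(x,px-q)+pB(x,px-q)\big)=0$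 with $x=dq/dp$. Equivalently $\mathrm{Leg}(\ell\boxtimes\mathcal F)=\mathrm{Leg}\,\ell\boxtimes\mathrm{Leg}\,\mathcal F$, where $\mathrm{Leg}\,\ell$ is the pencil of lines through the point $\check\ell$ dual to $\ell$, and the tangents of $\mathrm{Leg}\,\mathcal F$ at a generic $L\in\check{\mathbb{P}}^2_{\mathbb{C}}$ are the lines dual to the tangency points of $L$ with $\mathcal F$. Curvature. At a generic point a $d$-web is a superposition $\mathcal F_1\boxtimes\cdots\boxtimes\mathcal F_d$ of $d$ pairwise transverse foliations, $\mathcal F_i:\omega_i=0$. Put $\omega_i\wedge\omega_j=\delta_{ij}\,dx\wedge dy$. For $r<s<t$ let $\eta_{rst}$ be the unique meromorphic 1-form with $d(\delta_{st}\omega_r)=\eta_{rst}\wedge\delta_{st}\omega_r$, $d(\delta_{tr}\omega_s)=\eta_{rst}\wedge\delta_{tr}\omega_s$, $d(\delta_{rs}\omega_t)=\eta_{rst}\wedge\delta_{rs}\omega_t$. The curvature $K(\mathcal W)=d\big(\sum_{r<s<t}\eta_{rst}\big)$ is a well-defined global meromorphic 2-form; $\mathcal W$ is flat if $K(\mathcal W)\equiv0$. *)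

theory Defs
  imports "HOL-Analysis.Analysis"
begin

text \<open>Polynomials over the infinite field of complex numbers are identified with
  polynomial functions.\<close>

inductive polyfun :: "(complex^3 \<Rightarrow> complex) \<Rightarrow> bool" where
  const: "polyfun (\<lambda>X. c)"
| coord: "polyfun (\<lambda>X. X $ i)"
| add: "polyfun f \<Longrightarrow> polyfun g \<Longrightarrow> polyfun (\<lambda>X. f X + g X)"
| mult: "polyfun f \<Longrightarrow> polyfun g \<Longrightarrow> polyfun (\<lambda>X. f X * g X)"

definition homogeneous_poly :: "nat \<Rightarrow> (complex^3 \<Rightarrow> complex) \<Rightarrow> bool" where
  "homogeneous_poly k f \<longleftrightarrow> polyfun f \<and> (\<forall>t X. f (t *s X) = t ^ k * f X)"

text \<open>A map \<open>\<Omega>\<close> stands for the 1-form with coefficients \<open>\<Omega> X $ 1\<close>, \<open>\<Omega> X $ 2\<close>,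
  \<open>\<Omega> X $ 3\<close> on \<open>dx\<close>, \<open>dy\<close>, \<open>dz\<close>.\<close>

definition common_factor :: "(complex^3 \<Rightarrow> complex) \<Rightarrow> (complex^3 \<Rightarrow> complex^3) \<Rightarrow> bool" where
  "common_factor h \<Omega> \<longleftrightarrow>
     polyfun h \<and> (\<forall>i. \<exists>u. polyfun u \<and> (\<forall>X. \<Omega> X $ i = h X * u X))"

definition foliation :: "nat \<Rightarrow> (complex^3 \<Rightarrow> complex^3) \<Rightarrow> bool" where
  "foliation n \<Omega> \<longleftrightarrow>
     (\<forall>i. homogeneous_poly (n + 1) (\<lambda>X. \<Omega> X $ i)) \<and>
     (\<forall>h. common_factor h \<Omega> \<longrightarrow> h constant_on UNIV) \<and>
     (\<forall>X. scalar_product X (\<Omega> X) = 0)"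

text \<open>A line of the projective plane is identified with the plane through the origin over it.\<close>

definition line_of :: "complex^3 \<Rightarrow> (complex^3) set" where
  "line_of l = {X. scalar_product l X = 0}"

definition proj_lines :: "(complex^3) set set" where
  "proj_lines = {line_of l | l. l \<noteq> 0}"

text \<open>A line is invariant if the pull-back of \<open>\<Omega>\<close> to it vanishes; the tangent space
  of the plane \<open>L\<close> at each of its points is \<open>L\<close> itself.\<close>

definition invariant_line :: "(complex^3 \<Rightarrow> complex^3) \<Rightarrow> (complex^3) set \<Rightarrow> bool" where
  "invariant_line \<Omega> L \<longleftrightarrow> L \<in> proj_lines \<and> (\<forall>X\<in>L. \<forall>v\<in>L. scalar_product (\<Omega> X) v = 0)"

definition reduced_convex_foliation :: "nat \<Rightarrow> (complex^3 \<Rightarrow> complex^3) \<Rightarrow> bool" where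
  "reduced_convex_foliation n \<Omega> \<longleftrightarrow>
     n \<ge> 1 \<and> foliation n \<Omega> \<and>
     finite {L. invariant_line \<Omega> L} \<and> card {L. invariant_line \<Omega> L} = 3 * n"

text \<open>The pair \<open>l\<close>, \<open>\<Omega>\<close> represents the pre-foliation formed by the line \<open>line_of l\<close> and
  the foliation defined by \<open>\<Omega>\<close>.\<close>

definition pre_foliation :: "nat \<Rightarrow> complex^3 \<Rightarrow> (complex^3 \<Rightarrow> complex^3) \<Rightarrow> bool" where
  "pre_foliation d l \<Omega> \<longleftrightarrow> d \<ge> 1 \<and> l \<noteq> 0 \<and> foliation (d - 1) \<Omega>"

definition reduced_convex_pre_foliation ::
    "nat \<Rightarrow> complex^3 \<Rightarrow> (complex^3 \<Rightarrow> complex^3) \<Rightarrow> bool" where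
  "reduced_convex_pre_foliation d l \<Omega> \<longleftrightarrow>
     pre_foliation d l \<Omega> \<and> reduced_convex_foliation (d - 1) \<Omega> \<and> invariant_line \<Omega> (line_of l)"

text \<open>An invertible matrix \<open>M\<close> gives homogeneous coordinates \<open>Y\<close> by \<open>X = M *v Y\<close>, hence the
  affine chart \<open>Y = (x, y, 1)\<close>.  In this chart the pre-foliation is
  \<open>f(x,y) (A dx + B dy)\<close>, where \<open>A\<close>, \<open>B\<close> are the first two coefficients of the pull-back of
  \<open>\<Omega>\<close>.\<close>

definition affine_pt :: "complex^3^3 \<Rightarrow> complex \<Rightarrow> complex \<Rightarrow> complex^3" where
  "affine_pt M x y = M *v vector [x, y, 1]"

definition affine_line_eq :: "complex^3^3 \<Rightarrow> complex^3 \<Rightarrow> complex \<Rightarrow> complex \<Rightarrow> complex" where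
  "affine_line_eq M l x y = scalar_product l (affine_pt M x y)"

definition affine_form ::
    "complex^3^3 \<Rightarrow> (complex^3 \<Rightarrow> complex^3) \<Rightarrow> complex \<Rightarrow> complex \<Rightarrow> complex^3" where
  "affine_form M \<Omega> x y = transpose M *v \<Omega> (affine_pt M x y)"

text \<open>Left-hand side of the implicit differential equation, in \<open>x = dq/dp\<close>, of the Legendre
  transform in the dual affine chart of the lines \<open>y = p x - q\<close>.\<close>

definition Leg ::
    "complex^3^3 \<Rightarrow> complex^3 \<Rightarrow> (complex^3 \<Rightarrow> complex^3) \<Rightarrow> complex \<times> complex \<Rightarrow> complex \<Rightarrow> complex"
  where
  "Leg M l \<Omega> = (\<lambda>(p, q) x. affine_line_eq M l x (p * x - q) *
       (affine_form M \<Omega> x (p * x - q) $ 1 + p * affine_form M \<Omega> x (p * x - q) $ 2))"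

text \<open>A pair-valued map \<open>\<omega>\<close> stands for the 1-form \<open>fst \<circ> \<omega> dp + snd \<circ> \<omega> dq\<close>; a 2-form is
  given by its coefficient on \<open>dp \<and> dq\<close>.\<close>

type_synonym form1 = "complex \<times> complex \<Rightarrow> complex \<times> complex"

definition holomorphic2_on ::
    "(complex \<times> complex \<Rightarrow> complex) \<Rightarrow> (complex \<times> complex) set \<Rightarrow> bool" where
  "holomorphic2_on f U \<longleftrightarrow>
     (\<forall>z\<in>U. \<exists>a b. (f has_derivative (\<lambda>(h, k). a * h + b * k)) (at z within U))"

definition holomorphic_form1_on :: "form1 \<Rightarrow> (complex \<times> complex) set \<Rightarrow> bool" where
  "holomorphic_form1_on \<omega> U \<longleftrightarrow> holomorphic2_on (fst \<circ> \<omega>) U \<and> holomorphic2_on (snd \<circ> \<omega>) U"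

definition wedge :: "complex \<times> complex \<Rightarrow> complex \<times> complex \<Rightarrow> complex" where
  "wedge u v = fst u * snd v - snd u * fst v"

definition scale_covec :: "complex \<Rightarrow> complex \<times> complex \<Rightarrow> complex \<times> complex" where
  "scale_covec c u = (c * fst u, c * snd u)"

definition ext_deriv :: "form1 \<Rightarrow> complex \<times> complex \<Rightarrow> complex" where
  "ext_deriv \<omega> = (\<lambda>(p, q). deriv (\<lambda>s. snd (\<omega> (s, q))) p - deriv (\<lambda>s. fst (\<omega> (p, s))) q)"

text \<open>The 1-form \<open>eta \<omega> r s t\<close> of three pairwise transverse foliations; the defining equations
  are linear in its value at each point.\<close>

definition eta :: "(nat \<Rightarrow> form1) \<Rightarrow> nat \<Rightarrow> nat \<Rightarrow> nat \<Rightarrow> form1" where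
  "eta \<omega> r s t z = (THE e.
     (\<forall>(i, j, k) \<in> {(r, s, t), (s, t, r), (t, r, s)}.
        ext_deriv (\<lambda>w. scale_covec (wedge (\<omega> j w) (\<omega> k w)) (\<omega> i w)) z
          = wedge e (scale_covec (wedge (\<omega> j z) (\<omega> k z)) (\<omega> i z))))"

definition web_curvature :: "nat \<Rightarrow> (nat \<Rightarrow> form1) \<Rightarrow> complex \<times> complex \<Rightarrow> complex" where
  "web_curvature d \<omega> =
     ext_deriv (\<lambda>z. \<Sum>(r, s, t) \<in> {(r, s, t). r < s \<and> s < t \<and> t < d}. eta \<omega> r s t z)"

text \<open>On \<open>U\<close> the web \<open>P = 0\<close> is the superposition of the \<open>d\<close> pairwise transverse foliations
  \<open>\<omega> i = 0\<close>.  The polynomial \<open>P z\<close> is read as a binary form of degree \<open>d\<close> in \<open>(dp, dq)\<close>: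
  the foliation \<open>dp = 0\<close>, that is \<open>dq/dp = \<infinity>\<close>, contributes a factor without \<open>x\<close>, so the
  degree of \<open>P z\<close> in \<open>x\<close> may be less than \<open>d\<close>.\<close>

definition web_presentation ::
    "nat \<Rightarrow> (complex \<times> complex \<Rightarrow> complex \<Rightarrow> complex) \<Rightarrow> (complex \<times> complex) set \<Rightarrow>
     (nat \<Rightarrow> form1) \<Rightarrow> bool" where
  "web_presentation d P U \<omega> \<longleftrightarrow>
     open U \<and>
     (\<forall>i<d. holomorphic_form1_on (\<omega> i) U) \<and>
     (\<forall>i<d. \<forall>j<d. i \<noteq> j \<longrightarrow> (\<forall>z\<in>U. wedge (\<omega> i z) (\<omega> j z) \<noteq> 0)) \<and>
     (\<forall>z\<in>U. \<exists>c. c \<noteq> 0 \<and> (\<forall>x. P z x = c * (\<Prod>i<d. fst (\<omega> i z) + snd (\<omega> i z) * x)))"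

definition flat_in_chart ::
    "nat \<Rightarrow> (complex \<times> complex \<Rightarrow> complex \<Rightarrow> complex) \<Rightarrow> bool" where
  "flat_in_chart d P \<longleftrightarrow>
     (\<forall>U \<omega>. web_presentation d P U \<omega> \<longrightarrow> (\<forall>z\<in>U. web_curvature d \<omega> z = 0))"

text \<open>The charts of all invertible \<open>M\<close> cover the dual plane: the chart of \<open>M\<close> contains the
  lines that avoid the point \<open>M *v (0, 1, 0)\<close>.\<close>

definition Leg_flat :: "nat \<Rightarrow> complex^3 \<Rightarrow> (complex^3 \<Rightarrow> complex^3) \<Rightarrow> bool" where
  "Leg_flat d l \<Omega> \<longleftrightarrow> (\<forall>M. invertible M \<longrightarrow> flat_in_chart d (Leg M l \<Omega>))"

end

theory Submission
  imports Defs "HOL-Complex_Analysis.Complex_Analysis" "HOL-Computational_Algebra.Fundamental_Theorem_Algebra"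
begin

text \<open>
  Let a line of the plane turn about a fixed point \<open>E\<close>. Evaluated along the corresponding direction of
  the dual plane, the sum of the forms \<open>\<eta>\<^sub>r\<^sub>s\<^sub>t\<close> is, up to logarithmic derivatives of the
  coefficients, a trace: the sum over the tangency points of the line with the foliation of a rational
  function built from the first three derivatives of the tangency polynomial. As a function in the
  pencil of lines through \<open>E\<close> the trace is rational. The foliation is reduced convex, so its
  inflection polynomial, of degree \<open>3 * n\<close>, is the product of the equations of the invariant lines;
  hence a line through a generic \<open>E\<close> is simply tangent to the foliation at every regular point, and
  counting the invariant lines through a singular point bounds its degeneracy, so that the tangencies
  near it are modelled by the roots of a binomial. Therefore the trace has only simple poles, at the
  lines through a singular point and at the tangent line of the leaf through \<open>E\<close>; their residues are
  constants that do not depend on \<open>E\<close>, and the trace vanishes at infinity. By Liouville's theorem it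
  is a sum of logarithmic derivatives with constant coefficients. Two positions of \<open>E\<close> on the line
  determine \<open>\<Sum> \<eta>\<^sub>r\<^sub>s\<^sub>t\<close>, which is thus generically, and by continuity everywhere, a linear
  combination of logarithmic differentials and hence closed.
\<close>

text \<open>The tangency points are algebraic functions of the line, so the curvature cannot be
  computed leaf by leaf. The way out: write the forms of the web as b_i (dQ - x_i dP), where the
  line turns about a fixed point along dP = 0. Apart from logarithmic derivatives of the b_i and of
  the differences x_i - x_j, the dQ-coefficient of the sum is minus the sum of \<kappa>_i *
  P'''(x_i) / (6 * P'(x_i)). Here P is the polynomial with roots x_i and \<kappa>_i is the second
  derivative of the i-th leaf as a graph Q(P). For a leaf of Leg F, \<kappa>_i is a rational
  function of the tangency point, so the sum over the roots is symmetric, hence a trace. The leaves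
  of Leg l are straight and have \<kappa> = 0; thus l enters only as a factor of P. A summand can be
  singular where a tangency point meets l. Since l is invariant and misses the centre of the pencil,
  this happens only at singular points; there it changes the residue but creates no new
  pole.\<close>

no_notation fps_nth (infixl "$" 75)

section \<open>Roots of polynomials and removable singularities\<close>

text \<open>The logarithmic derivative is the sum of 1 / (z - w) over the roots with multiplicity,
  each term being at most 1 / r. The inequality is multiplied out so that splitting off one root is
  an induction step.\<close>

lemma poly_deriv_bound_away_from_roots:
  fixes P :: "complex poly"
  assumes "r \<ge> 0" "P \<noteq> 0" "\<And>w. poly P w = 0 \<Longrightarrow> r \<le> cmod (z - w)"
  shows "r * cmod (poly (pderiv P) z) \<le> real (degree P) * cmod (poly P z)"
  using assms
proof (induction "degree P" arbitrary: P)
  case 0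
  then obtain c where "P = [:c:]" by (metis degree_eq_zeroE)
  then show ?case by (simp add: pderiv_pCons)
next
  case (Suc k)
  obtain w where w: "poly P w = 0"
    using Fundamental_Theorem_Algebra.fundamental_theorem_of_algebra[of P] Suc.hyps(2)
    by (metis Zero_not_Suc constant_degree)
  then obtain Q where Q: "P = [:-w, 1:] * Q"
    using poly_eq_0_iff_dvd by (metis dvdE)
  with Suc.prems have Q0: "Q \<noteq> 0" by auto
  then have "degree P = Suc (degree Q)"
    unfolding Q by (subst degree_mult_eq) auto
  then have k: "k = degree Q" using Suc.hyps(2) by simp
  have IH: "r * cmod (poly (pderiv Q) z) \<le> real (degree Q) * cmod (poly Q z)"
  proof (rule Suc.hyps(1)[OF k Suc.prems(1) Q0])
    show "r \<le> cmod (z - u)" if "poly Q u = 0" for u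
      using that Suc.prems(3)[of u] by (simp add: Q)
  qed
  have rw: "r \<le> cmod (z - w)" by (rule Suc.prems(3)[OF w])
  have "poly (pderiv P) z = poly Q z + (z - w) * poly (pderiv Q) z"
    unfolding Q pderiv_mult by (simp add: pderiv_pCons) (simp add: algebra_simps)
  then have "cmod (poly (pderiv P) z) \<le> cmod (poly Q z) + cmod (z - w) * cmod (poly (pderiv Q) z)"
    using norm_triangle_ineq[of "poly Q z" "(z - w) * poly (pderiv Q) z"] by (simp only: norm_mult)
  from mult_left_mono[OF this Suc.prems(1)]
  have "r * cmod (poly (pderiv P) z) \<le> r * cmod (poly Q z) + cmod (z - w) * (r * cmod (poly (pderiv Q) z))"
    by (simp only: distrib_left mult.left_commute)
  also have "\<dots> \<le> cmod (z - w) * cmod (poly Q z) + cmod (z - w) * (real (degree Q) * cmod (poly Q z))"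
    by (intro add_mono mult_right_mono mult_left_mono rw IH) auto
  also have "\<dots> = real (degree P) * cmod (poly P z)"
  proof -
    have "poly P z = (z - w) * poly Q z" by (simp add: Q algebra_simps)
    then show ?thesis
      unfolding \<open>degree P = Suc (degree Q)\<close> by (simp add: norm_mult distrib_right)
  qed
  finally show ?case .
qed

text \<open>Quantitative continuity of roots: a small value with a derivative that is not small
  forces a root nearby. Only the upper bound \<open>n\<close> of the degree enters, so the estimate
  is uniform in families whose degree jumps.\<close>

lemma poly_nearby_root:
  fixes P :: "complex poly"
  assumes "poly (pderiv P) z \<noteq> 0" "degree P \<le> n"
  shows "\<exists>w. poly P w = 0 \<and> cmod (w - z) \<le> real n * cmod (poly P z / poly (pderiv P) z)"
proof -
  have P0: "P \<noteq> 0" using assms by auto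
  have fin: "finite {w. poly P w = 0}" using poly_roots_finite[OF P0] .
  have "\<not> constant (poly P)"
  proof
    assume "constant (poly P)"
    then obtain c where "P = [:c:]" by (metis constant_degree degree_eq_zeroE)
    with assms(1) show False by (simp add: pderiv_pCons)
  qed
  then have "{w. poly P w = 0} \<noteq> {}" using Fundamental_Theorem_Algebra.fundamental_theorem_of_algebra by blast
  then obtain w where w: "poly P w = 0" "\<And>u. poly P u = 0 \<Longrightarrow> cmod (z - w) \<le> cmod (z - u)"
    using ex_min_if_finite[of "(\<lambda>w. cmod (z - w)) ` {w. poly P w = 0}"] fin
    by (force simp: not_less)
  have "cmod (z - w) * cmod (poly (pderiv P) z) \<le> real (degree P) * cmod (poly P z)"
    by (rule poly_deriv_bound_away_from_roots) (use w P0 in auto)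
  also have "\<dots> \<le> real n * cmod (poly P z)"
    using assms(2) by (intro mult_right_mono) auto
  finally have "cmod (w - z) \<le> real n * cmod (poly P z / poly (pderiv P) z)"
    using assms(1) by (simp add: norm_divide field_simps norm_minus_commute)
  then show ?thesis using w by blast
qed

lemma card_simple_roots:
  fixes P :: "complex poly"
  assumes "P \<noteq> 0" "\<And>x. poly P x = 0 \<Longrightarrow> poly (pderiv P) x \<noteq> 0"
  shows "card {x. poly P x = 0} = degree P"
  using assms
proof (induction "degree P" arbitrary: P)
  case 0
  then obtain c where "P = [:c:]" by (metis degree_eq_zeroE)
  then show ?case using 0 by auto
next
  case (Suc k)
  obtain w where w: "poly P w = 0"
    using Fundamental_Theorem_Algebra.fundamental_theorem_of_algebra[of P] Suc.hyps(2)
    by (metis Zero_not_Suc constant_degree)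
  then obtain Q where Q: "P = [:-w, 1:] * Q"
    using poly_eq_0_iff_dvd by (metis dvdE)
  with Suc.prems have Q0: "Q \<noteq> 0" by auto
  then have "degree P = Suc (degree Q)"
    unfolding Q by (subst degree_mult_eq) auto
  then have k: "k = degree Q" using Suc.hyps(2) by simp
  have d: "poly (pderiv P) x = poly Q x + (x - w) * poly (pderiv Q) x" for x
    unfolding Q pderiv_mult by (simp add: pderiv_pCons) (simp add: algebra_simps)
  have "card {x. poly Q x = 0} = degree Q"
    by (rule Suc.hyps(1)[OF k Q0]) (use Suc.prems(2) d Q in force)
  moreover have "{x. poly P x = 0} = insert w {x. poly Q x = 0}"
    unfolding Q by auto
  moreover have "poly Q w \<noteq> 0"
    using Suc.prems(2)[OF w] d[of w] by auto
  ultimately show ?case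
    using \<open>degree P = Suc (degree Q)\<close> poly_roots_finite[OF Q0] by simp
qed

lemma card_other_simple_roots:
  fixes R :: "complex poly"
  assumes P: "P = [:-a, 1:] ^ k * R" and "poly R a \<noteq> 0"
    and simple: "\<And>x. poly P x = 0 \<Longrightarrow> x \<noteq> a \<Longrightarrow> poly (pderiv P) x \<noteq> 0"
  shows "card ({x. poly P x = 0} - {a}) + k = degree P"
proof -
  have R0: "R \<noteq> 0" using assms by auto
  have "card {x. poly R x = 0} = degree R"
  proof (rule card_simple_roots[OF R0])
    fix x assume x: "poly R x = 0"
    then have "x \<noteq> a" using assms by auto
    moreover have "poly (pderiv P) x = (x - a) ^ k * poly (pderiv R) x"
      unfolding P using x by (simp add: pderiv_mult algebra_simps)
    ultimately show "poly (pderiv R) x \<noteq> 0" using simple[of x] x by (auto simp: P)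
  qed
  moreover have "{x. poly P x = 0} - {a} = {x. poly R x = 0}"
    using assms by (auto simp: P)
  moreover have "degree P = k + degree R"
    unfolding P using R0 by (subst degree_mult_eq) (auto simp: degree_power_eq)
  ultimately show ?thesis by simp
qed

text \<open>The limit condition makes every singularity removable by Riemann's theorem, and the
  entire extension vanishes by Liouville. It is meant for the difference between the trace and its
  expected partial fractions.\<close>

lemma liouville_finite_singularities:
  fixes f :: "complex \<Rightarrow> complex"
  assumes "finite K" "\<And>z. z \<notin> K \<Longrightarrow> f field_differentiable at z"
    and lim: "\<And>k. k \<in> K \<Longrightarrow> ((\<lambda>z. (z - k) * f z) \<longlongrightarrow> 0) (at k)"
    and inf: "(f \<longlongrightarrow> 0) at_infinity"
    and "z \<notin> K"
  shows "f z = 0"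
proof -
  have "f holomorphic_on (UNIV - K)"
    using assms(2) by (auto simp: holomorphic_on_def field_differentiable_at_within)
  moreover have big: "f \<in> O[at k](\<lambda>_. 1)" if k: "k \<in> K" for k
  proof -
    have "open (UNIV - (K - {k}))" using assms(1) by (simp add: open_Diff finite_imp_closed)
    moreover have "f holomorphic_on (UNIV - (K - {k})) - {k}"
      unfolding holomorphic_on_def using assms(2) by (blast intro: field_differentiable_at_within)
    ultimately obtain g where g: "g holomorphic_on UNIV - (K - {k})"
        "\<forall>z\<in>UNIV - (K - {k}) - {k}. g z = f z"
      using holomorphic_on_extend_lim[where f = f and \<xi> = k and S = "UNIV - (K - {k})"] lim[OF k] k
      by (auto simp: interior_open)
    then have "isCont g k"
      using k continuous_on_eq_continuous_at[OF \<open>open (UNIV - (K - {k}))\<close>, of g]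
        holomorphic_on_imp_continuous_on by blast
    then have "g \<in> O[at k](\<lambda>_. 1)" by (rule continuous_imp_bigo_1)
    moreover have "eventually (\<lambda>z. g z = f z) (at k)"
      unfolding eventually_at_topological
      using g(2) \<open>open (UNIV - (K - {k}))\<close> k by (intro exI[of _ "UNIV - (K - {k})"]) auto
    ultimately show ?thesis using landau_o.big.in_cong[of g f "at k"] by blast
  qed
  ultimately obtain g where g: "g holomorphic_on UNIV" "\<And>z. z \<in> UNIV - K \<Longrightarrow> g z = f z"
    using removable_singularities[OF assms(1), of UNIV f] big by auto
  have "eventually (\<lambda>z. z \<notin> K) at_infinity"
  proof -
    obtain B where "\<And>k. k \<in> K \<Longrightarrow> cmod k \<le> B"
      using finite_imp_bounded[OF assms(1)] bounded_iff by metis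
    then have "z \<notin> K" if "cmod z \<ge> B + 1" for z using that by force
    then show ?thesis unfolding eventually_at_infinity by blast
  qed
  then have "(g \<longlongrightarrow> 0) at_infinity"
    using inf by (rule_tac Lim_transform_eventually[where f=f]) (auto elim!: eventually_mono simp: g)
  then have "g z = 0" using Liouville_weak_0[OF g(1)] by blast
  then show ?thesis using g assms by auto
qed

section \<open>Polynomial functions in three variables\<close>

abbreviation sprod :: "complex^3 \<Rightarrow> complex^3 \<Rightarrow> complex" (infixl "\<odot>" 70)
  where "sprod \<equiv> scalar_product"

lemma sprod_3: "v \<odot> w = v $ 1 * w $ 1 + v $ 2 * w $ 2 + v $ 3 * w $ 3"
  by (simp add: scalar_product_def sum_3)

lemma sprod_linear [simp]:
  "(u + v) \<odot> w = u \<odot> w + v \<odot> w" "w \<odot> (u + v) = w \<odot> u + w \<odot> v"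
  "(u - v) \<odot> w = u \<odot> w - v \<odot> w" "w \<odot> (u - v) = w \<odot> u - w \<odot> v"
  "(c *s v) \<odot> w = c * (v \<odot> w)" "w \<odot> (c *s v) = c * (w \<odot> v)"
  "(- v) \<odot> w = - (v \<odot> w)" "w \<odot> (- v) = - (w \<odot> v)"
  "0 \<odot> w = 0" "w \<odot> 0 = 0"
  by (simp_all add: sprod_3 algebra_simps)

lemma sprod_commute: "v \<odot> w = w \<odot> v"
  by (simp add: sprod_3 mult.commute)

lemma polyfun_sum: "(\<And>i. i \<in> S \<Longrightarrow> polyfun (f i)) \<Longrightarrow> polyfun (\<lambda>X. \<Sum>i\<in>S. f i X)"
  by (induction S rule: infinite_finite_induct) (auto intro: polyfun.intros)

lemma polyfun_prod: "(\<And>i. i \<in> S \<Longrightarrow> polyfun (f i)) \<Longrightarrow> polyfun (\<lambda>X. \<Prod>i\<in>S. f i X)"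
  by (induction S rule: infinite_finite_induct) (auto intro: polyfun.intros)

lemma polyfun_cmult: "polyfun f \<Longrightarrow> polyfun (\<lambda>X. c * f X)"
  using polyfun.mult[OF polyfun.const] .

lemma polyfun_uminus: "polyfun f \<Longrightarrow> polyfun (\<lambda>X. - f X)"
  using polyfun_cmult[of f "-1"] by simp

lemma polyfun_diff: "polyfun f \<Longrightarrow> polyfun g \<Longrightarrow> polyfun (\<lambda>X. f X - g X)"
  using polyfun.add[OF _ polyfun_uminus, of f g] by simp

lemma polyfun_sprod:
  assumes "\<And>i. polyfun (\<lambda>X. F X $ i)" "\<And>i. polyfun (\<lambda>X. G X $ i)"
  shows "polyfun (\<lambda>X. F X \<odot> G X)"
  unfolding sprod_3 by (intro polyfun.add polyfun.mult assms)

lemmas polyfun_intros = polyfun.intros polyfun_sum polyfun_prod polyfun_cmult polyfun_uminus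
  polyfun_diff polyfun_sprod

lemma polyfun_compose:
  assumes "polyfun g" "\<And>i. polyfun (\<lambda>X. A X $ i)"
  shows "polyfun (\<lambda>X. g (A X))"
  using assms(1) by induction (auto intro: polyfun_intros assms)

lemma polyfun_continuous: "polyfun g \<Longrightarrow> continuous_on UNIV g"
  by (induction rule: polyfun.induct) (auto intro!: continuous_intros)

lemma polyfun_tendsto:
  assumes "polyfun g" "(c \<longlongrightarrow> X) F"
  shows "((\<lambda>u. g (c u)) \<longlongrightarrow> g X) F"
proof -
  have "isCont g X" using polyfun_continuous[OF assms(1)] by (simp add: continuous_on_eq_continuous_at)
  then show ?thesis using assms(2) by (rule isCont_tendsto_compose)
qed

definition grad :: "(complex^3 \<Rightarrow> complex) \<Rightarrow> complex^3 \<Rightarrow> complex^3" where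
  "grad g X = (\<chi> j. deriv (\<lambda>h. g (X + h *s axis j 1)) 0)"

text \<open>The gradient is built along the inductive definition together with its chain rule for
  curves, so the product rule of one variable is the only analytic input.\<close>

lemma polyfun_grad_ex:
  assumes "polyfun g"
  shows "\<exists>G. (\<forall>i. polyfun (\<lambda>X. G X $ i)) \<and>
    (\<forall>c c' u. (\<forall>i. ((\<lambda>h. c h $ i) has_field_derivative c' $ i) (at u)) \<longrightarrow>
       ((\<lambda>h. g (c h)) has_field_derivative (G (c u) \<odot> c')) (at u))"
  using assms
proof induction
  case (const c)
  show ?case by (rule exI[of _ "\<lambda>_. 0"]) (auto intro: polyfun_intros)
next
  case (coord i)
  show ?case
    by (rule exI[of _ "\<lambda>_. axis i 1"])
      (auto intro: polyfun_intros simp: scalar_product_def axis_def if_distrib[of "\<lambda>x. x * _"] cong: if_cong)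
next
  case (add f g)
  then obtain F G where "\<forall>i. polyfun (\<lambda>X. F X $ i)" "\<forall>i. polyfun (\<lambda>X. G X $ i)"
    and FG: "\<And>c c' u. (\<forall>i. ((\<lambda>h. c h $ i) has_field_derivative c' $ i) (at u)) \<Longrightarrow>
       ((\<lambda>h. f (c h)) has_field_derivative (F (c u) \<odot> c')) (at u)"
       "\<And>c c' u. (\<forall>i. ((\<lambda>h. c h $ i) has_field_derivative c' $ i) (at u)) \<Longrightarrow>
       ((\<lambda>h. g (c h)) has_field_derivative (G (c u) \<odot> c')) (at u)"
    by metis
  then show ?case
    by (intro exI[of _ "\<lambda>X. F X + G X"]) (auto intro!: polyfun_intros DERIV_add)
next
  case (mult f g)
  then obtain F G where *: "\<forall>i. polyfun (\<lambda>X. F X $ i)" "\<forall>i. polyfun (\<lambda>X. G X $ i)"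
    and FG: "\<And>c c' u. (\<forall>i. ((\<lambda>h. c h $ i) has_field_derivative c' $ i) (at u)) \<Longrightarrow>
       ((\<lambda>h. f (c h)) has_field_derivative (F (c u) \<odot> c')) (at u)"
       "\<And>c c' u. (\<forall>i. ((\<lambda>h. c h $ i) has_field_derivative c' $ i) (at u)) \<Longrightarrow>
       ((\<lambda>h. g (c h)) has_field_derivative (G (c u) \<odot> c')) (at u)"
    by metis
  show ?case
  proof (intro exI[of _ "\<lambda>X. g X *s F X + f X *s G X"] conjI allI impI)
    show "polyfun (\<lambda>X. (g X *s F X + f X *s G X) $ i)" for i
      using * mult by (auto intro!: polyfun_intros)
    fix c :: "complex \<Rightarrow> complex^3" and c' u assume "\<forall>i. ((\<lambda>h. c h $ i) has_field_derivative c' $ i) (at u)"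
    from DERIV_mult[OF FG(1)[OF this] FG(2)[OF this]]
    show "((\<lambda>h. f (c h) * g (c h)) has_field_derivative
           (g (c u) *s F (c u) + f (c u) *s G (c u)) \<odot> c') (at u)"
      by (simp add: algebra_simps)
  qed
qed

lemma line_comp_deriv: "((\<lambda>h. (X + h *s V) $ i) has_field_derivative V $ i) (at u)"
  by (auto intro!: derivative_eq_intros)

lemma
  assumes g: "polyfun g"
  shows polyfun_grad: "polyfun (\<lambda>X. grad g X $ i)"
    and polyfun_chain: "\<And>c c' u. (\<And>i. ((\<lambda>h. c h $ i) has_field_derivative c' $ i) (at u)) \<Longrightarrow>
       ((\<lambda>h. g (c h)) has_field_derivative (grad g (c u) \<odot> c')) (at u)"
proof -
  obtain G where G: "\<And>i. polyfun (\<lambda>X. G X $ i)"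
    "\<And>c c' u. (\<And>i. ((\<lambda>h. c h $ i) has_field_derivative c' $ i) (at u)) \<Longrightarrow>
       ((\<lambda>h. g (c h)) has_field_derivative (G (c u) \<odot> c')) (at u)"
    using polyfun_grad_ex[OF g] by metis
  have "grad g = G"
  proof
    fix X
    have "deriv (\<lambda>h. g (X + h *s axis j 1)) 0 = G X $ j" for j
    proof -
      have "((\<lambda>h. g (X + h *s axis j 1)) has_field_derivative
          (G (X + 0 *s axis j 1) \<odot> axis j 1)) (at 0)"
        by (rule G(2)) (rule line_comp_deriv)
      then show ?thesis
        by (intro DERIV_imp_deriv)
          (simp add: scalar_product_def axis_def if_distrib[of "\<lambda>x. _ * x"] cong: if_cong)
    qed
    then show "grad g X = G X" by (simp add: grad_def vec_eq_iff)
  qed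
  with G show "polyfun (\<lambda>X. grad g X $ i)"
    "\<And>c c' u. (\<And>i. ((\<lambda>h. c h $ i) has_field_derivative c' $ i) (at u)) \<Longrightarrow>
       ((\<lambda>h. g (c h)) has_field_derivative (grad g (c u) \<odot> c')) (at u)" by auto
qed

section \<open>Directional derivatives and restriction to lines\<close>

definition dird :: "(complex^3 \<Rightarrow> complex) \<Rightarrow> complex^3 \<Rightarrow> complex^3 \<Rightarrow> complex" where
  "dird g V X = grad g X \<odot> V"

lemma polyfun_dird: "polyfun g \<Longrightarrow> polyfun (dird g V)"
  unfolding dird_def by (intro polyfun_intros polyfun_grad)

lemma dird_line: "polyfun g \<Longrightarrow> ((\<lambda>h. g (X + h *s V)) has_field_derivative dird g V (X + u *s V)) (at u)"
  unfolding dird_def by (rule polyfun_chain[OF _ line_comp_deriv])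

lemma dird_eqI:
  assumes "polyfun g" "((\<lambda>h. g (X + h *s V)) has_field_derivative d) (at 0)"
  shows "dird g V X = d"
  using DERIV_unique[OF dird_line[OF assms(1), of X V 0] assms(2)] by simp

lemma dird_linear [simp]: "dird g (U + V) X = dird g U X + dird g V X"
  "dird g (U - V) X = dird g U X - dird g V X"
  "dird g (c *s V) X = c * dird g V X" "dird g (- V) X = - dird g V X" "dird g 0 X = 0"
  by (simp_all add: dird_def)

lemma dird_sum_fun:
  assumes "polyfun f" "polyfun g"
  shows "dird (\<lambda>X. f X + g X) V X = dird f V X + dird g V X"
  by (rule dird_eqI)
    (use assms dird_line[of f X V 0] dird_line[of g X V 0] in \<open>auto intro!: polyfun_intros DERIV_add\<close>)

lemma dird_cmult_fun:
  assumes "polyfun f"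
  shows "dird (\<lambda>X. c * f X) V X = c * dird f V X"
  by (rule dird_eqI)
    (use assms dird_line[of f X V 0] in \<open>auto intro!: polyfun_intros DERIV_cmult\<close>)

definition line_poly :: "(complex^3 \<Rightarrow> complex) \<Rightarrow> complex^3 \<Rightarrow> complex^3 \<Rightarrow> complex poly" where
  "line_poly g X V = (THE P. \<forall>x. poly P x = g (X + x *s V))"

text \<open>The coefficients are polynomial in the direction for a fixed base point; for homogeneous
  functions \<open>polyfun_coeff_base\<close> gives the converse dependence.\<close>

lemma line_poly_ex:
  assumes "polyfun g"
  shows "\<exists>G. (\<forall>k. polyfun (\<lambda>V. coeff (G V) k)) \<and> (\<forall>V x. poly (G V) x = g (X + x *s V))"
  using assms
proof induction
  case (const c)
  show ?case by (rule exI[of _ "\<lambda>_. [:c:]"]) (auto intro: polyfun_intros)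
next
  case (coord i)
  have "polyfun (\<lambda>V. coeff [:X $ i, V $ i:] k)" for k
    by (cases k rule: nat.exhaust; cases "k - 1") (auto intro: polyfun_intros simp: coeff_pCons split: nat.splits)
  then show ?case by (intro exI[of _ "\<lambda>V. [:X $ i, V $ i:]"]) auto
next
  case (add f g)
  then obtain F G where "\<forall>k. polyfun (\<lambda>V. coeff (F V) k)" "\<forall>k. polyfun (\<lambda>V. coeff (G V) k)"
    "\<forall>V x. poly (F V) x = f (X + x *s V)" "\<forall>V x. poly (G V) x = g (X + x *s V)" by metis
  then show ?case by (intro exI[of _ "\<lambda>V. F V + G V"]) (auto intro: polyfun_intros)
next
  case (mult f g)
  then obtain F G where "\<forall>k. polyfun (\<lambda>V. coeff (F V) k)" "\<forall>k. polyfun (\<lambda>V. coeff (G V) k)"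
    "\<forall>V x. poly (F V) x = f (X + x *s V)" "\<forall>V x. poly (G V) x = g (X + x *s V)" by metis
  then show ?case
    by (intro exI[of _ "\<lambda>V. F V * G V"]) (auto intro!: polyfun_intros simp: coeff_mult)
qed

lemma poly_eqI_cofinite:
  fixes P Q :: "complex poly"
  assumes "finite K" "\<And>x. x \<notin> K \<Longrightarrow> poly P x = poly Q x"
  shows "P = Q"
proof (rule ccontr)
  assume "P \<noteq> Q"
  then have "finite {x. poly (P - Q) x = 0}" by (intro poly_roots_finite) auto
  then have "finite (K \<union> {x. poly (P - Q) x = 0})" using assms(1) by auto
  moreover have "K \<union> {x. poly (P - Q) x = 0} = UNIV" using assms(2) by auto
  ultimately show False using infinite_UNIV_char_0 by metis
qed

lemma
  assumes "polyfun g"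
  shows poly_line_poly [simp]: "poly (line_poly g X V) x = g (X + x *s V)"
    and polyfun_coeff_line_poly: "polyfun (\<lambda>V. coeff (line_poly g X V) k)"
proof -
  obtain G where G: "\<forall>k. polyfun (\<lambda>V. coeff (G V) k)" "\<forall>V x. poly (G V) x = g (X + x *s V)"
    using line_poly_ex[OF assms] by metis
  have "line_poly g X V = G V" for V
    unfolding line_poly_def using G(2) by (intro the_equality) (auto intro: poly_eqI_cofinite[of "{}"])
  with G show "poly (line_poly g X V) x = g (X + x *s V)"
    "polyfun (\<lambda>V. coeff (line_poly g X V) k)" by auto
qed

lemma pderiv_line_poly:
  assumes "polyfun g"
  shows "pderiv (line_poly g X V) = line_poly (dird g V) X V"
proof (rule poly_eqI_cofinite[of "{}"])
  fix x
  have "((\<lambda>x. poly (line_poly g X V) x) has_field_derivative poly (pderiv (line_poly g X V)) x) (at x)"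
    by (rule poly_DERIV)
  then show "poly (pderiv (line_poly g X V)) x = poly (line_poly (dird g V) X V) x"
    using DERIV_unique dird_line[OF assms, of X V x] assms
    by (simp add: polyfun_dird) blast
qed simp

text \<open>Going to infinity along the line means approaching \<open>E\<close>: by homogeneity,
  replacing \<open>x\<close> by \<open>1 / x\<close> exchanges \<open>X\<close> and \<open>E\<close>
  and so reverses the list of coefficients.\<close>

lemma homogeneous_line_poly:
  assumes "polyfun g" and hom: "\<And>t X. t \<noteq> 0 \<Longrightarrow> g (t *s X) = t ^ k * g X"
  shows "degree (line_poly g X E) \<le> k" "coeff (line_poly g X E) k = g E"
proof -
  let ?P = "line_poly g X E" and ?Q = "line_poly g E X"
  let ?m = "degree ?Q"
  \<comment> \<open>\<open>reflect_poly\<close> reverses with respect to the actual degree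
    \<open>?m\<close>, which may differ from \<open>k\<close>; the two monomials make up for the
    difference.\<close>
  have eq: "monom 1 ?m * ?P = monom 1 k * reflect_poly ?Q"
  proof (rule poly_eqI_cofinite[of "{0}"])
    fix x :: complex assume "x \<notin> {0}"
    then have x: "x \<noteq> 0" by simp
    have "X + x *s E = x *s (E + inverse x *s X)" using x by (simp add: vec_eq_iff field_simps)
    then have "g (X + x *s E) = x ^ k * g (E + inverse x *s X)" using hom[OF x] by metis
    then show "poly (monom 1 ?m * ?P) x = poly (monom 1 k * reflect_poly ?Q) x"
      using x assms(1) by (simp add: poly_monom poly_reflect_poly_nz)
  qed simp
  have "coeff (monom 1 ?m * ?P) (?m + j) = coeff ?P j" for j
    by (simp add: coeff_monom_mult)
  moreover have "coeff (monom 1 k * reflect_poly ?Q) (?m + j) = 0" if "j > k" for j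
    using that by (auto simp: coeff_monom_mult intro!: coeff_eq_0
        intro: le_less_trans[OF degree_reflect_poly_le])
  ultimately show "degree ?P \<le> k" using eq by (intro degree_le) metis
  have "coeff ?P k = coeff (reflect_poly ?Q) ?m"
    using arg_cong[OF eq, of "\<lambda>P. coeff P (?m + k)"] by (simp add: coeff_monom_mult)
  also have "\<dots> = poly ?Q 0" by (simp add: coeff_reflect_poly poly_0_coeff_0)
  finally show "coeff ?P k = g E" using assms(1) by simp
qed

text \<open>On the line through \<open>X\<close> and \<open>Y\<close> both functions are non-zero
  polynomials of one variable, hence so is their product. This irreducibility of affine space allows
  finitely many genericity conditions to be imposed together.\<close>

lemma polyfun_common_nonzero:
  assumes "polyfun f" "polyfun g" "f X \<noteq> 0" "g Y \<noteq> 0"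
  shows "\<exists>Z. f Z \<noteq> 0 \<and> g Z \<noteq> 0"
proof -
  let ?P = "line_poly f X (Y - X) * line_poly g X (Y - X)"
  have "poly (line_poly f X (Y - X)) 0 \<noteq> 0" "poly (line_poly g X (Y - X)) 1 \<noteq> 0"
    using assms by simp_all
  then have "?P \<noteq> 0" by (metis mult_eq_0_iff poly_0)
  then obtain x where "poly ?P x \<noteq> 0" using poly_all_0_iff_0 by blast
  then show ?thesis using assms by (auto intro!: exI[of _ "X + x *s (Y - X)"])
qed

lemma polyfun_prod_nonzero:
  assumes "finite S" "\<And>i. i \<in> S \<Longrightarrow> polyfun (f i)" "\<And>i. i \<in> S \<Longrightarrow> \<exists>X. f i X \<noteq> 0"
  shows "\<exists>X. (\<Prod>i\<in>S. f i X) \<noteq> 0"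
  using assms
proof (induction S rule: finite_induct)
  case (insert i S)
  have "\<exists>X. (\<Prod>i\<in>S. f i X) \<noteq> 0" using insert.prems by (intro insert.IH) auto
  then obtain Y where "(\<Prod>i\<in>S. f i Y) \<noteq> 0" ..
  moreover obtain X where "f i X \<noteq> 0" using insert.prems by auto
  ultimately have "\<exists>Z. f i Z \<noteq> 0 \<and> (\<Prod>i\<in>S. f i Z) \<noteq> 0"
    using insert.prems insert.hyps by (intro polyfun_common_nonzero[of "f i" "\<lambda>X. \<Prod>i\<in>S. f i X"]) (auto intro: polyfun_intros)
  then show ?case using insert.hyps by auto
qed simp

lemma polyfun_zero_dense:
  assumes "polyfun f" "polyfun g" "g Y \<noteq> 0" "\<And>X. g X \<noteq> 0 \<Longrightarrow> f X = 0"
  shows "f X = 0"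
  using polyfun_common_nonzero[of f g X Y] assms by blast

text \<open>Hadamard's lemma with a continuous quotient. It controls the first order in
  \<open>t\<close> while \<open>x\<close> moves at the same time, as the root branches do.\<close>

lemma polyfun_divided_difference:
  assumes "polyfun g"
  shows "\<exists>G1. continuous_on UNIV (\<lambda>(t, x). G1 t x) \<and>
     (\<forall>t x. g (s + t *s N + x *s E) = g (s + x *s E) + t * G1 t x)"
  using assms
proof induction
  case (const c)
  show ?case by (rule exI[of _ "\<lambda>_ _. 0"]) auto
next
  case (coord i)
  show ?case by (rule exI[of _ "\<lambda>_ _. N $ i"]) (auto simp: algebra_simps intro!: continuous_intros)
next
  case (add f g)
  then obtain F G where "continuous_on UNIV (\<lambda>(t, x). F t x)" "continuous_on UNIV (\<lambda>(t, x). G t x)"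
    "\<And>t x. f (s + t *s N + x *s E) = f (s + x *s E) + t * F t x"
    "\<And>t x. g (s + t *s N + x *s E) = g (s + x *s E) + t * G t x" by metis
  then show ?case
    by (intro exI[of _ "\<lambda>t x. F t x + G t x"])
      (auto simp: algebra_simps split_beta intro!: continuous_intros)
next
  case (mult f g)
  then obtain F G where *: "continuous_on UNIV (\<lambda>(t, x). F t x)" "continuous_on UNIV (\<lambda>(t, x). G t x)"
    "\<And>t x. f (s + t *s N + x *s E) = f (s + x *s E) + t * F t x"
    "\<And>t x. g (s + t *s N + x *s E) = g (s + x *s E) + t * G t x" by metis
  have "continuous_on UNIV (\<lambda>z :: complex \<times> complex. f (s + snd z *s E))" if "polyfun f" for f and E :: "complex^3"
  proof -
    have "continuous_on UNIV (\<lambda>z. f ((\<lambda>z :: complex \<times> complex. s + snd z *s E) z))"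
      by (rule continuous_on_compose2[OF polyfun_continuous[OF that]])
        (auto simp: vector_scalar_mult_def intro!: continuous_intros)
    then show ?thesis by simp
  qed
  note c = this[OF mult(1)] this[OF mult(2)]
  show ?case
    by (intro exI[of _ "\<lambda>t x. F t x * g (s + x *s E) + f (s + x *s E) * G t x + t * F t x * G t x"] conjI)
      (use * c in \<open>auto simp: algebra_simps split_beta intro!: continuous_intros\<close>)
qed

lemma polyfun_scaled_difference:
  assumes "polyfun g"
  shows "\<exists>G1. (\<forall>F t x a b. ((t::complex\<Rightarrow>complex) \<longlongrightarrow> a) F \<longrightarrow> (x \<longlongrightarrow> b) F \<longrightarrow> ((\<lambda>u. G1 (t u) (x u)) \<longlongrightarrow> G1 a b) F) \<and>
     (\<forall>t x. g (s + t *s N + x *s E) = g (s + x *s E) + t * G1 t x) \<and>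
     (\<forall>x. G1 0 x = dird g N (s + x *s E))"
proof -
  obtain G1 where G: "continuous_on UNIV (\<lambda>(t, x). G1 t x)"
     "\<And>t x. g (s + t *s N + x *s E) = g (s + x *s E) + t * G1 t x"
    using polyfun_divided_difference[OF assms] by metis
  have lim: "((\<lambda>u. G1 (t u) (x u)) \<longlongrightarrow> G1 a b) F" if "(t \<longlongrightarrow> a) F" "(x \<longlongrightarrow> b) F" for F a b and t x :: "complex \<Rightarrow> complex"
  proof -
    have "isCont (\<lambda>(t, x). G1 t x) (a, b)" using G(1) by (simp add: continuous_on_eq_continuous_at)
    from isCont_tendsto_compose[OF this tendsto_Pair[OF that]] show ?thesis by simp
  qed
  have "G1 0 x = dird g N (s + x *s E)" for x
  proof (rule sym, rule dird_eqI[OF assms])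
    have "((\<lambda>h. G1 h x) \<longlongrightarrow> G1 0 x) (at 0)" by (rule lim) (auto intro!: tendsto_intros)
    moreover have "g (s + x *s E + h *s N) = g (s + h *s N + x *s E)" for h by (simp add: algebra_simps)
    ultimately show "((\<lambda>h. g (s + x *s E + h *s N)) has_field_derivative G1 0 x) (at 0)"
      unfolding DERIV_def by (simp add: G(2)) (erule Lim_transform_eventually, auto simp: eventually_at_filter)
  qed
  with lim G(2) show ?thesis by (intro exI[of _ G1]) auto
qed

section \<open>Cross product, triple product and Cramer's rule\<close>

definition cr :: "complex^3 \<Rightarrow> complex^3 \<Rightarrow> complex^3" where
  "cr X Y = vector [X $ 2 * Y $ 3 - X $ 3 * Y $ 2, X $ 3 * Y $ 1 - X $ 1 * Y $ 3,
     X $ 1 * Y $ 2 - X $ 2 * Y $ 1]"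

lemma cr_nth [simp]:
  "cr X Y $ 1 = X $ 2 * Y $ 3 - X $ 3 * Y $ 2"
  "cr X Y $ 2 = X $ 3 * Y $ 1 - X $ 1 * Y $ 3"
  "cr X Y $ 3 = X $ 1 * Y $ 2 - X $ 2 * Y $ 1"
  by (simp_all add: cr_def)

definition tri :: "complex^3 \<Rightarrow> complex^3 \<Rightarrow> complex^3 \<Rightarrow> complex" where
  "tri X Y Z = cr X Y \<odot> Z"

lemma tri_expand: "tri X Y Z = (X $ 2 * Y $ 3 - X $ 3 * Y $ 2) * Z $ 1
   + (X $ 3 * Y $ 1 - X $ 1 * Y $ 3) * Z $ 2 + (X $ 1 * Y $ 2 - X $ 2 * Y $ 1) * Z $ 3"
  by (simp add: tri_def sprod_3)

lemma tri_linear [simp]: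
  "tri (X + X') Y Z = tri X Y Z + tri X' Y Z" "tri (X - X') Y Z = tri X Y Z - tri X' Y Z"
  "tri (c *s X) Y Z = c * tri X Y Z"
  "tri X (Y + Y') Z = tri X Y Z + tri X Y' Z" "tri X (Y - Y') Z = tri X Y Z - tri X Y' Z"
  "tri X (c *s Y) Z = c * tri X Y Z"
  "tri X Y (Z + Z') = tri X Y Z + tri X Y Z'" "tri X Y (Z - Z') = tri X Y Z - tri X Y Z'"
  "tri X Y (c *s Z) = c * tri X Y Z"
  "tri X X Z = 0" "tri X Y Y = 0" "tri X Y X = 0" "tri 0 Y Z = 0" "tri X 0 Z = 0" "tri X Y 0 = 0"
  by (simp_all add: tri_expand algebra_simps)

lemma tri_rotate: "tri X Y Z = tri Y Z X"
  by (simp add: tri_expand algebra_simps)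

lemma tri_swap: "tri X Y Z = - tri Y X Z"
  by (simp add: tri_expand algebra_simps)

lemma polyfun_tri: "polyfun (tri X Y)"
  unfolding tri_def by (intro polyfun_intros)

lemma cramer: "tri X Y Z *s W = tri W Y Z *s X + tri X W Z *s Y + tri X Y W *s Z"
  by (simp add: vec_eq_iff forall_3 tri_expand) (simp add: algebra_simps)

lemma sprod_eq_zero_iff: "(\<forall>W. v \<odot> W = 0) \<longleftrightarrow> v = 0"
proof
  assume *: "\<forall>W. v \<odot> W = 0"
  have "v \<odot> axis i 1 = v $ i" for i
    by (simp add: scalar_product_def axis_def if_distrib[of "\<lambda>x. _ * x"] cong: if_cong)
  with * show "v = 0" by (simp add: vec_eq_iff)
qed simp

lemma sprod_nonzero: "v \<noteq> 0 \<Longrightarrow> \<exists>W. v \<odot> W \<noteq> 0"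
  using sprod_eq_zero_iff by blast

lemma sprod_basis_zero:
  assumes "tri X Y Z \<noteq> 0" "v \<odot> X = 0" "v \<odot> Y = 0" "v \<odot> Z = 0"
  shows "v = 0"
proof -
  have "v \<odot> (tri X Y Z *s W) = 0" for W unfolding cramer[of X Y Z W] using assms by simp
  then have "v \<odot> W = 0" for W using assms(1) by simp
  then show ?thesis using sprod_eq_zero_iff by blast
qed

lemma cr_zero_imp_parallel:
  assumes "cr X Y = 0" "X \<noteq> 0"
  shows "\<exists>k. Y = k *s X"
proof -
  from assms have "X $ 1 \<noteq> 0 \<or> X $ 2 \<noteq> 0 \<or> X $ 3 \<noteq> 0" by (auto simp: vec_eq_iff forall_3)
  moreover have "X $ 2 * Y $ 3 = X $ 3 * Y $ 2" "X $ 3 * Y $ 1 = X $ 1 * Y $ 3" "X $ 1 * Y $ 2 = X $ 2 * Y $ 1"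
    using assms(1) by (auto simp: vec_eq_iff forall_3)
  ultimately consider "Y = (Y $ 1 / X $ 1) *s X" | "Y = (Y $ 2 / X $ 2) *s X" | "Y = (Y $ 3 / X $ 3) *s X"
    by (auto simp: vec_eq_iff forall_3 field_simps)
  then show ?thesis by cases blast+
qed

lemma cr_cr: "cr (cr X N) v = (X \<odot> v) *s N - (N \<odot> v) *s X"
  by (simp add: vec_eq_iff forall_3 sprod_3 algebra_simps)

lemma tri_nonzero_ex:
  assumes "cr X Y \<noteq> 0" shows "\<exists>Z. tri X Y Z \<noteq> 0"
  using sprod_nonzero[OF assms] by (simp add: tri_def)

lemma plane_basis:
  assumes "X \<noteq> 0" "v \<noteq> 0" "v \<odot> X = 0"
  shows "\<exists>E N. v \<odot> E = 0 \<and> tri X E N \<noteq> 0"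
proof -
  obtain N where N: "v \<odot> N \<noteq> 0" using sprod_nonzero[OF assms(2)] by blast
  have "cr (cr X N) v \<noteq> 0"
    using N assms by (simp add: cr_cr sprod_commute vec_eq_iff)
  then obtain W where W: "cr (cr X N) v \<odot> W \<noteq> 0" using sprod_nonzero by blast
  have "tri X (cr v W) N = - (cr (cr X N) v \<odot> W)"
    by (simp add: tri_expand sprod_3 algebra_simps)
  moreover have "v \<odot> cr v W = 0" by (simp add: sprod_3 algebra_simps)
  ultimately show ?thesis using W by (metis neg_equal_0_iff_equal)
qed

lemma vec3_expand: "X = X $ 1 *s axis 1 1 + X $ 2 *s axis 2 1 + X $ 3 *s (axis 3 1 :: complex^3)"
  by (simp add: vec_eq_iff forall_3 axis_def)

section \<open>Inflection points and invariant lines\<close>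

locale convex_foliation =
  fixes n :: nat and \<Omega> :: "complex^3 \<Rightarrow> complex^3"
  assumes n_pos: "n \<ge> 1"
    and homogeneous: "\<And>i. homogeneous_poly (n + 1) (\<lambda>X. \<Omega> X $ i)"
    and radial: "\<And>X. X \<odot> \<Omega> X = 0"
    and fin_inv: "finite {L. invariant_line \<Omega> L}"
    and card_inv: "card {L. invariant_line \<Omega> L} = 3 * n"
begin

abbreviation Inv :: "(complex^3) set set" where "Inv \<equiv> {L. invariant_line \<Omega> L}"

definition om :: "complex^3 \<Rightarrow> complex^3 \<Rightarrow> complex" where
  "om W X = \<Omega> X \<odot> W"

definition Am :: "complex^3 \<Rightarrow> complex^3 \<Rightarrow> complex^3 \<Rightarrow> complex" where
  "Am V W X = dird (om W) V X"

lemma polyfun_Omega: "polyfun (\<lambda>X. \<Omega> X $ i)"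
  using homogeneous by (simp add: homogeneous_poly_def)

lemma polyfun_om: "polyfun (om W)"
  unfolding om_def by (intro polyfun_intros polyfun_Omega)

lemma polyfun_Am: "polyfun (Am V W)"
  unfolding Am_def by (intro polyfun_dird polyfun_om)

lemma Omega_hom: "\<Omega> (t *s X) = t ^ (n + 1) *s \<Omega> X"
  using homogeneous by (simp add: homogeneous_poly_def vec_eq_iff)

lemma om_hom: "om W (t *s X) = t ^ (n + 1) * om W X"
  unfolding om_def Omega_hom by simp

lemma om_linear [simp]: "om (V + W) X = om V X + om W X" "om (V - W) X = om V X - om W X"
  "om (c *s V) X = c * om V X"
  by (simp_all add: om_def)

lemma om_self [simp]: "om X X = 0"
  using radial by (simp add: om_def sprod_commute)

lemma Omega_self [simp]: "\<Omega> X \<odot> X = 0"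
  using radial by (simp add: sprod_commute)

lemma Am_linear [simp]: "Am (U + V) W X = Am U W X + Am V W X"
  "Am (U - V) W X = Am U W X - Am V W X"
  "Am (c *s V) W X = c * Am V W X"
  "Am U (V + W) X = Am U V X + Am U W X"
  "Am U (V - W) X = Am U V X - Am U W X"
  "Am U (c *s W) X = c * Am U W X"
proof -
  show 1: "Am U (V + W) X = Am U V X + Am U W X" for U V W
    unfolding Am_def om_linear[abs_def] using polyfun_om dird_sum_fun[of "om V" "om W" U X]
    by (simp add: ext[of "om (V + W)" "\<lambda>X. om V X + om W X"])
  show 2: "Am U (c *s W) X = c * Am U W X" for U c W
    unfolding Am_def using polyfun_om dird_cmult_fun[of "om W" c U X]
    by (simp add: ext[of "om (c *s W)" "\<lambda>X. c * om W X"])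
  show "Am U (V - W) X = Am U V X - Am U W X"
    using 1[of U V "(-1) *s W"] unfolding 2 by simp
qed (simp_all add: Am_def)

lemma Am_euler_left: "Am X W X = of_nat (n + 1) * om W X"
proof -
  have "om W (X + h *s X) = (1 + h) ^ (n + 1) * om W X" for h
  proof -
    have "X + h *s X = (1 + h) *s X" by (simp add: vec_eq_iff algebra_simps)
    then show ?thesis by (simp only: om_hom)
  qed
  moreover have "((\<lambda>h. (1 + h) ^ (n + 1) * om W X) has_field_derivative of_nat (n + 1) * om W X) (at 0)"
    by (auto intro!: derivative_eq_intros)
  ultimately show ?thesis unfolding Am_def by (intro dird_eqI polyfun_om) (simp only: )
qed

lemma Am_euler_right: "Am V X X = - om V X"
proof -
  have "om X (X + h *s V) = - h * om V (X + h *s V)" for h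
    using om_self[of "X + h *s V"] unfolding om_linear by (simp add: eq_neg_iff_add_eq_0)
  moreover have "((\<lambda>h. - h * om V (X + h *s V)) has_field_derivative - om V X) (at 0)"
    using dird_line[OF polyfun_om, of V X V 0] by (auto intro!: derivative_eq_intros)
  ultimately show ?thesis unfolding Am_def by (intro dird_eqI polyfun_om) (simp only: )
qed

lemma Am_hom:
  assumes "t \<noteq> 0"
  shows "Am V W (t *s X) = t ^ n * Am V W X"
proof -
  have "om W (t *s X + h *s V) = t ^ (n + 1) * om W (X + (h / t) *s V)" for h
  proof -
    have "t *s X + h *s V = t *s (X + (h / t) *s V)" using assms by (simp add: vec_eq_iff algebra_simps)
    then show ?thesis by (simp only: om_hom)
  qed
  moreover have "((\<lambda>h. t ^ (n + 1) * om W (X + (h / t) *s V)) has_field_derivative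
      t ^ (n + 1) * (dird (om W) V (X + (0 / t) *s V) * (1 / t))) (at 0)"
    by (intro DERIV_cmult DERIV_chain2[OF dird_line[OF polyfun_om]] DERIV_cdivide DERIV_ident)
  ultimately have "Am V W (t *s X) = t ^ (n + 1) * (dird (om W) V (X + (0 / t) *s V) * (1 / t))"
    unfolding Am_def by (intro dird_eqI polyfun_om) (simp only: )
  then show ?thesis using assms by (simp add: Am_def)
qed

text \<open>The homogeneous vector field \<open>Z\<close> defines the foliation: it is tangent to the kernel of \<open>\<Omega>\<close>,
  and \<open>Infl\<close> is its inflection polynomial, whose degree \<open>3 * n\<close> equals the number of invariant lines.\<close>

definition Z :: "complex^3 \<Rightarrow> complex^3" where
  "Z X = (- 1 / of_nat (n + 2)) *s vector [
     Am (axis 2 1) (axis 3 1) X - Am (axis 3 1) (axis 2 1) X,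
     Am (axis 3 1) (axis 1 1) X - Am (axis 1 1) (axis 3 1) X,
     Am (axis 1 1) (axis 2 1) X - Am (axis 2 1) (axis 1 1) X]"

text \<open>\<open>Z\<close> is the curl of \<open>\<Omega>\<close> divided by
  \<open>- (n + 2)\<close>, and the identity is Cartan's formula for the radial field: the
  contraction of \<open>\<Omega>\<close> with it vanishes, and its Lie derivative multiplies
  \<open>\<Omega>\<close> by \<open>n + 2\<close>, namely \<open>n + 1\<close> from the coefficients
  and 1 from the differentials.\<close>

lemma cr_Z: "cr X (Z X) = \<Omega> X"
proof -
  have key: "Am U X X - Am X U X = - of_nat (n + 2) * om U X" for U
    by (simp add: Am_euler_left Am_euler_right algebra_simps)
  have ex: "Am U X X = X $ 1 * Am U (axis 1 1) X + X $ 2 * Am U (axis 2 1) X + X $ 3 * Am U (axis 3 1) X" for U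
    using arg_cong[OF vec3_expand[of X], of "\<lambda>W. Am U W X"] by (simp only: Am_linear)
  have ex': "Am X U X = X $ 1 * Am (axis 1 1) U X + X $ 2 * Am (axis 2 1) U X + X $ 3 * Am (axis 3 1) U X" for U
    using arg_cong[OF vec3_expand[of X], of "\<lambda>V. Am V U X"] by (simp only: Am_linear)
  have om: "om (axis i 1) X = \<Omega> X $ i" for i
    by (simp add: om_def scalar_product_def axis_def if_distrib[of "\<lambda>x. _ * x"] cong: if_cong)
  have nz: "of_nat (n + 2) \<noteq> (0 :: complex)" using of_nat_eq_0_iff by (metis add_is_0 zero_neq_numeral)
  define m where "m = (of_nat (n + 2) :: complex)"
  have "m \<noteq> 0" using nz by (simp add: m_def)
  have mZ: "m * Z X $ 1 = Am (axis 3 1) (axis 2 1) X - Am (axis 2 1) (axis 3 1) X"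
    "m * Z X $ 2 = Am (axis 1 1) (axis 3 1) X - Am (axis 3 1) (axis 1 1) X"
    "m * Z X $ 3 = Am (axis 2 1) (axis 1 1) X - Am (axis 1 1) (axis 2 1) X"
    using \<open>m \<noteq> 0\<close> unfolding Z_def m_def[symmetric] by simp_all
  have "m * cr X (Z X) $ 1 = X $ 2 * (m * Z X $ 3) - X $ 3 * (m * Z X $ 2)"
    "m * cr X (Z X) $ 2 = X $ 3 * (m * Z X $ 1) - X $ 1 * (m * Z X $ 3)"
    "m * cr X (Z X) $ 3 = X $ 1 * (m * Z X $ 2) - X $ 2 * (m * Z X $ 1)"
    by (simp_all add: algebra_simps)
  moreover have key': "m * \<Omega> X $ 1 = X $ 2 * (Am (axis 2 1) (axis 1 1) X - Am (axis 1 1) (axis 2 1) X)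
      - X $ 3 * (Am (axis 1 1) (axis 3 1) X - Am (axis 3 1) (axis 1 1) X)"
    "m * \<Omega> X $ 2 = X $ 3 * (Am (axis 3 1) (axis 2 1) X - Am (axis 2 1) (axis 3 1) X)
      - X $ 1 * (Am (axis 2 1) (axis 1 1) X - Am (axis 1 1) (axis 2 1) X)"
    "m * \<Omega> X $ 3 = X $ 1 * (Am (axis 1 1) (axis 3 1) X - Am (axis 3 1) (axis 1 1) X)
      - X $ 2 * (Am (axis 3 1) (axis 2 1) X - Am (axis 2 1) (axis 3 1) X)"
    using key[of "axis 1 1"] key[of "axis 2 1"] key[of "axis 3 1"]
    unfolding ex ex' om m_def[symmetric] by (simp_all add: algebra_simps)
  ultimately have "m * cr X (Z X) $ 1 = m * \<Omega> X $ 1" "m * cr X (Z X) $ 2 = m * \<Omega> X $ 2" "m * cr X (Z X) $ 3 = m * \<Omega> X $ 3"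
    unfolding mZ key' by (simp_all only: ring_distribs)
  then show ?thesis using \<open>m \<noteq> 0\<close> by (simp add: vec_eq_iff forall_3)
qed

lemma polyfun_Z: "polyfun (\<lambda>X. Z X $ i)"
proof -
  have "\<forall>i. polyfun (\<lambda>X. Z X $ i)"
    unfolding forall_3 Z_def vector_smult_component vector_3 
    by (intro conjI polyfun_intros polyfun_Am)
  then show ?thesis by blast
qed

lemma Z_hom: "t \<noteq> 0 \<Longrightarrow> Z (t *s X) = t ^ n *s Z X"
  unfolding Z_def by (simp add: vec_eq_iff forall_3 Am_hom algebra_simps)

text \<open>Differentiating \<open>\<Omega> X \<odot> Z X = 0\<close> along \<open>Z\<close>
  identifies this with minus the determinant of \<open>X\<close>, \<open>Z\<close> and the
  derivative of \<open>Z\<close> along itself, the classical equation of the inflection points of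
  the leaves.\<close>

definition Infl :: "complex^3 \<Rightarrow> complex" where
  "Infl X = Am (Z X) (Z X) X"

lemma polyfun_Infl: "polyfun Infl"
proof -
  have "Infl X = (\<Sum>i\<in>UNIV. \<Sum>j\<in>UNIV. Z X $ i * (Z X $ j * Am (axis j 1) (axis i 1) X))" for X
    unfolding Infl_def
    by (subst (1 2) vec3_expand[of "Z X"]) (simp only: Am_linear sum_3 distrib_left add.assoc)
  then have "Infl = (\<lambda>X. \<Sum>i\<in>UNIV. \<Sum>j\<in>UNIV. Z X $ i * (Z X $ j * Am (axis j 1) (axis i 1) X))" by blast
  then show ?thesis by (simp only:) (intro polyfun_intros polyfun_Z polyfun_Am)
qed

lemma Infl_hom: "t \<noteq> 0 \<Longrightarrow> Infl (t *s X) = t ^ (3 * n) * Infl X"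
  unfolding Infl_def by (simp add: Z_hom Am_hom numeral_3_eq_3 power_add)

text \<open>Up to a factor and modulo \<open>X\<close>, the field \<open>Z\<close> is
  \<open>om N X *s E - om E X *s N\<close>, and the multiples of \<open>X\<close> drop out by the
  Euler relations. At a tangency point, where \<open>om E X = 0\<close>, only the first term
  survives; so at a regular one the contact of the line through \<open>X\<close> and
  \<open>E\<close> is simple exactly when \<open>Infl X \<noteq> 0\<close>.\<close>

lemma Infl_frame: "(tri X E N)\<^sup>2 * Infl X =
   (om N X)\<^sup>2 * Am E E X - om N X * om E X * (Am N E X + Am E N X) + (om E X)\<^sup>2 * Am N N X"
proof -
  have om: "om N X = tri X (Z X) N" "om E X = tri X (Z X) E"
    by (simp_all add: om_def cr_Z tri_def)
  have Z: "tri X E N *s Z X = tri (Z X) E N *s X + (om N X *s E - om E X *s N)"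
  proof -
    have "tri X E (Z X) = - tri X (Z X) E" by (simp add: tri_expand algebra_simps)
    then show ?thesis
      unfolding cramer[of X E N "Z X"] using om by (simp add: vec_eq_iff)
  qed
  have "(tri X E N)\<^sup>2 * Infl X = Am (tri X E N *s Z X) (tri X E N *s Z X) X"
    by (simp add: Infl_def power2_eq_square)
  also have "\<dots> = (om N X)\<^sup>2 * Am E E X - om N X * om E X * (Am N E X + Am E N X) + (om E X)\<^sup>2 * Am N N X"
    unfolding Z by (simp add: Am_euler_left Am_euler_right power2_eq_square algebra_simps)
  finally show ?thesis .
qed

section \<open>Invariant lines and the factorization of the inflection polynomial\<close>

definition nv :: "(complex^3) set \<Rightarrow> complex^3" where
  "nv L = (SOME v. v \<noteq> 0 \<and> L = line_of v)"

lemma nv: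
  assumes "L \<in> proj_lines"
  shows nv_nonzero: "nv L \<noteq> 0" and mem_line: "X \<in> L \<longleftrightarrow> nv L \<odot> X = 0"
proof -
  have "\<exists>v. v \<noteq> 0 \<and> L = line_of v" using assms by (auto simp: proj_lines_def)
  from someI_ex[OF this] have "nv L \<noteq> 0" "L = line_of (nv L)" by (simp_all add: nv_def)
  then show "nv L \<noteq> 0" "X \<in> L \<longleftrightarrow> nv L \<odot> X = 0" by (auto simp: line_of_def)
qed

lemma Inv_lines: "L \<in> Inv \<Longrightarrow> L \<in> proj_lines" by (simp add: invariant_line_def)

lemma Inv_om: "L \<in> Inv \<Longrightarrow> X \<in> L \<Longrightarrow> V \<in> L \<Longrightarrow> om V X = 0"
  by (simp add: invariant_line_def om_def)

text \<open>\<open>\<Omega> X\<close> kills the plane \<open>L\<close> and the transverse vector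
  \<open>E\<close>, hence every vector.\<close>

lemma transverse_imp_singular:
  assumes L: "L \<in> Inv" "X \<in> L" "E \<notin> L" "om E X = 0"
  shows "\<Omega> X = 0"
proof -
  have "\<Omega> X \<odot> W = 0" for W
  proof -
    define k where "k = nv L \<odot> W / (nv L \<odot> E)"
    have "nv L \<odot> E \<noteq> 0" using L mem_line[OF Inv_lines] by blast
    then have "W - k *s E \<in> L" unfolding mem_line[OF Inv_lines[OF L(1)]] by (simp add: k_def)
    from Inv_om[OF L(1,2) this] show ?thesis using L(4) by (simp add: om_def)
  qed
  then show ?thesis using sprod_eq_zero_iff by blast
qed

lemma Infl_on_Inv:
  assumes L: "L \<in> Inv" "X \<in> L" "X \<noteq> 0"
  shows "Infl X = 0"
proof -
  obtain E N where EN: "nv L \<odot> E = 0" "tri X E N \<noteq> 0"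
    using plane_basis[OF L(3) nv_nonzero[OF Inv_lines[OF L(1)]]] L mem_line[OF Inv_lines] by blast
  have om: "om E (X + h *s E) = 0" for h
    using Inv_om[OF L(1)] EN(1) L mem_line[OF Inv_lines[OF L(1)]] by simp
  then have "Am E E X = 0"
    unfolding Am_def by (intro dird_eqI polyfun_om) auto
  moreover have "om E X = 0" using om[of 0] by simp
  ultimately show ?thesis using Infl_frame[of X E N] EN by simp
qed

lemma line_not_all_Inv: "\<exists>X. X \<noteq> 0 \<and> (\<forall>L\<in>Inv. X \<notin> L)" 
proof -
  have "\<exists>X. (\<Prod>L\<in>Inv. nv L \<odot> X) \<noteq> 0"
    using fin_inv sprod_nonzero[OF nv_nonzero[OF Inv_lines]]
    by (intro polyfun_prod_nonzero) (auto intro!: polyfun_intros)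
  then obtain X where "(\<Prod>L\<in>Inv. nv L \<odot> X) \<noteq> 0" by blast
  then have *: "\<forall>L\<in>Inv. nv L \<odot> X \<noteq> 0" using fin_inv by simp
  have "Inv \<noteq> {}" 
  proof
    assume "Inv = {}"
    then have "card Inv = 0" by (simp only: card.empty)
    then show False using card_inv n_pos by simp
  qed
  with * have "X \<noteq> 0" by auto
  then show ?thesis using * mem_line[OF Inv_lines] by blast
qed

text \<open>If every point is an inflection, the leaves are straight. Along the tangent line at
  \<open>E0\<close> the restriction \<open>P\<close> of \<open>om X\<close> satisfies the linear
  differential equation \<open>B\<^sup>2 * pderiv P = P * Q\<close> read off from
  \<open>Infl_frame\<close>, with \<open>P\<close> vanishing and \<open>B\<close> not vanishing at
  0. Hence \<open>P = 0\<close>.\<close>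

lemma tangent_line_invariant:
  assumes "\<And>X. Infl X = 0" and E0: "\<Omega> E0 \<noteq> 0"
  shows "invariant_line \<Omega> (line_of (\<Omega> E0))"
proof -
  have main: "om V X = 0" if X: "om X E0 = 0" and V: "om V E0 = 0" for X V
  proof (cases "cr E0 X = 0")
    case True
    have "E0 \<noteq> 0" using E0 Omega_hom[of 0 E0] by auto
    then obtain k where "X = k *s E0" using cr_zero_imp_parallel[OF True] by blast
    then show ?thesis using V by (simp only: om_hom) simp
  next
    case False
    then obtain N where N: "tri E0 X N \<noteq> 0" using tri_nonzero_ex by blast
    have N0: "om N E0 \<noteq> 0" using sprod_basis_zero[OF N, of "\<Omega> E0"] X E0
      by (auto simp: om_def)
    define P B Q where "P = line_poly (om X) E0 X" and "B = line_poly (om N) E0 X"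
      and "Q = B * (line_poly (Am N X) E0 X + line_poly (Am X N) E0 X) - P * line_poly (Am N N) E0 X"
    have "B\<^sup>2 * pderiv P = P * Q"
    proof (rule poly_eqI_cofinite[of "{}"])
      fix x
      show "poly (B\<^sup>2 * pderiv P) x = poly (P * Q) x"
        using Infl_frame[of "E0 + x *s X" X N] assms(1)[of "E0 + x *s X"]
        by (simp add: P_def B_def Q_def pderiv_line_poly polyfun_om polyfun_Am Am_def[symmetric, abs_def] power2_eq_square algebra_simps)
    qed simp
    have P0: "poly P 0 = 0" "poly B 0 \<noteq> 0" using X N0 by (simp_all add: P_def B_def polyfun_om)
    \<comment> \<open>Algebraic uniqueness for this equation: otherwise the left side would vanish
      at 0 to an order one below that of \<open>P\<close>.\<close>
    have "P = 0"
    proof (rule ccontr)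
      assume P: "P \<noteq> 0"
      have "order 0 P \<noteq> 0" using P P0 order_root by blast
      have "pderiv P \<noteq> 0"
      proof
        assume "pderiv P = 0"
        then obtain c where "P = [:c:]" using pderiv_iszero by blast
        then show False using P P0 by simp
      qed
      then have nz: "B\<^sup>2 * pderiv P \<noteq> 0" using P0 by auto
      then have "order 0 (B\<^sup>2 * pderiv P) = order 0 (pderiv P)"
        using P0 order_root[of "B\<^sup>2" 0] by (subst order_mult) (auto simp: order_0I)
      moreover have "order 0 (P * Q) \<ge> order 0 P"
        using nz \<open>B\<^sup>2 * pderiv P = P * Q\<close> by (simp add: order_mult)
      moreover have "order 0 P = Suc (order 0 (pderiv P))"
        using order_pderiv[OF P P0(1)] .
      ultimately show False using \<open>B\<^sup>2 * pderiv P = P * Q\<close> by simp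
    qed
    then have z: "om X (E0 + x *s X) = 0" for x
      using poly_line_poly[OF polyfun_om, of X E0 X x] by (simp add: P_def)
    then have z0: "om E0 (E0 + x *s X) = 0" for x
      using om_self[of "E0 + x *s X"] by (simp del: om_self)
    have "tri E0 X V = 0"
    proof (rule ccontr)
      assume "tri E0 X V \<noteq> 0"
      from sprod_basis_zero[OF this, of "\<Omega> E0"] show False
        using X V E0 by (auto simp: om_def)
    qed
    then have "tri E0 X N *s V = tri V X N *s E0 + tri E0 V N *s X"
      using cramer[of E0 X N V] by simp
    then have *: "tri E0 X N * om V Y = tri V X N * om E0 Y + tri E0 V N * om X Y" for Y
    proof -
      have "om (tri E0 X N *s V) Y = om (tri V X N *s E0 + tri E0 V N *s X) Y"
        by (simp only: \<open>tri E0 X N *s V = _\<close>)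
      then show ?thesis by simp
    qed
    then have zV: "om V (E0 + x *s X) = 0" for x 
    proof -
      have "tri E0 X N * om V (E0 + x *s X) = 0" for x using * z z0 by simp
      then show ?thesis using N by simp
    qed
    \<comment> \<open>The points \<open>X + y *s E0\<close> with \<open>y \<noteq> 0\<close> are
      multiples of points already treated; \<open>X\<close> itself follows because the polynomial in
      \<open>y\<close> is then zero.\<close>
    have "poly (line_poly (om V) X E0) y = poly 0 y" if "y \<notin> {0}" for y
    proof -
      have "X + y *s E0 = y *s (E0 + inverse y *s X)" using that by (simp add: vec_eq_iff field_simps)
      then have "om V (X + y *s E0) = 0" using zV by (simp only: om_hom) simp
      then show ?thesis by (simp add: polyfun_om)
    qed
    then have "line_poly (om V) X E0 = 0" by (intro poly_eqI_cofinite[of "{0}"]) auto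
    then show ?thesis using poly_line_poly[OF polyfun_om, of V X E0 0] by simp
  qed
  have "line_of (\<Omega> E0) \<in> proj_lines" using E0 by (auto simp: proj_lines_def)
  then show ?thesis using main by (auto simp: invariant_line_def line_of_def om_def)
qed

text \<open>Otherwise the tangent line at a regular point off the finitely many invariant lines
  would be a further invariant line. If there is no such point, then \<open>\<Omega>\<close> is zero
  and every line is invariant.\<close>

lemma Infl_nonzero: "\<exists>X. Infl X \<noteq> 0"
proof (rule ccontr)
  assume "\<not> (\<exists>X. Infl X \<noteq> 0)"
  then have I: "Infl X = 0" for X by blast
  obtain X where X: "X \<noteq> 0" "\<forall>L\<in>Inv. X \<notin> L" using line_not_all_Inv by blast
  show False
  proof (cases "\<exists>E0. \<Omega> E0 \<noteq> 0 \<and> (\<Prod>L\<in>Inv. nv L \<odot> E0) \<noteq> 0")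
    case True
    then obtain E0 where E0: "\<Omega> E0 \<noteq> 0" "(\<Prod>L\<in>Inv. nv L \<odot> E0) \<noteq> 0" by blast
    have "line_of (\<Omega> E0) \<in> Inv" using tangent_line_invariant[OF I E0(1)] by simp
    moreover have "E0 \<in> line_of (\<Omega> E0)" using radial by (simp add: line_of_def sprod_commute)
    ultimately show False using E0(2) fin_inv mem_line[OF Inv_lines] by auto
  next
    case False
    have "om V Y = 0" for V Y
    proof (rule polyfun_zero_dense[of "om V" "\<lambda>E. \<Prod>L\<in>Inv. nv L \<odot> E"])
      show "(\<Prod>L\<in>Inv. nv L \<odot> X) \<noteq> 0" using X fin_inv mem_line[OF Inv_lines] by auto
      show "om V E = 0" if "(\<Prod>L\<in>Inv. nv L \<odot> E) \<noteq> 0" for E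
      proof -
        have "\<Omega> E = 0" using False that by blast
        then show ?thesis by (simp add: om_def)
      qed
    qed (auto intro!: polyfun_intros polyfun_om)
    moreover obtain v where "v \<noteq> 0" "v \<odot> X = 0"
    proof -
      obtain Y where "cr X Y \<noteq> 0"
      proof -
        have "cr X (axis 1 1) $ 2 = X $ 3" "cr X (axis 1 1) $ 3 = - X $ 2" "cr X (axis 2 1) $ 3 = X $ 1"
          by (simp_all add: axis_def)
        moreover have "X $ 1 \<noteq> 0 \<or> X $ 2 \<noteq> 0 \<or> X $ 3 \<noteq> 0" using X(1) by (auto simp: vec_eq_iff forall_3)
        ultimately have "cr X (axis 1 1) \<noteq> 0 \<or> cr X (axis 2 1) \<noteq> 0"
          by (metis neg_equal_0_iff_equal zero_index)
        then show ?thesis using that by blast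
      qed
      moreover have "cr X Y \<odot> X = 0" by (simp add: sprod_3 algebra_simps)
      ultimately show ?thesis using that by blast
    qed
    ultimately have "line_of v \<in> Inv" "X \<in> line_of v"
      by (auto simp: invariant_line_def proj_lines_def line_of_def om_def)
    then show False using X by blast
  qed
qed

lemma nv_independent:
  assumes "L1 \<in> Inv" "L2 \<in> Inv" "L1 \<noteq> L2"
  shows "nv L1 \<noteq> k *s nv L2" 
proof
  assume eq: "nv L1 = k *s nv L2"
  then have "k \<noteq> 0" using nv_nonzero[OF Inv_lines[OF assms(1)]] by auto
  then have "X \<in> L1 \<longleftrightarrow> X \<in> L2" for X
    unfolding mem_line[OF Inv_lines[OF assms(1)]] mem_line[OF Inv_lines[OF assms(2)]] eq by simp
  then show False using assms by blast
qed

text \<open>On a generic line \<open>Infl\<close> has degree at most \<open>3 * n\<close> and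
  vanishes at the \<open>3 * n\<close> distinct intersections with the invariant lines. Once the
  leading coefficients are matched, the difference of both sides has more zeros than its degree;
  density gives the rest.\<close>

lemma Infl_product: "\<exists>c. c \<noteq> 0 \<and> (\<forall>X. Infl X = c * (\<Prod>L\<in>Inv. nv L \<odot> X))"
proof -
  obtain X0 where X0: "X0 \<noteq> 0" "\<forall>L\<in>Inv. X0 \<notin> L" using line_not_all_Inv by blast
  obtain E1 where E1: "Infl E1 \<noteq> 0" using Infl_nonzero by blast
  have Pr: "polyfun (\<lambda>X. \<Prod>L\<in>Inv. nv L \<odot> X)" by (auto intro!: polyfun_intros)
  obtain E where E: "Infl E \<noteq> 0" "(\<Prod>L\<in>Inv. nv L \<odot> E) \<noteq> 0"
    using polyfun_common_nonzero[OF polyfun_Infl Pr E1, of X0] X0 fin_inv mem_line[OF Inv_lines] by auto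
  then have nE: "nv L \<odot> E \<noteq> 0" if "L \<in> Inv" for L using that fin_inv by auto
  define c where "c = Infl E / (\<Prod>L\<in>Inv. nv L \<odot> E)"
  define pr where "pr = {(L1, L2) \<in> Inv \<times> Inv. L1 \<noteq> L2}"
  \<comment> \<open>\<open>g X \<noteq> 0\<close> says that the line through \<open>X\<close> and
    \<open>E\<close> meets the invariant lines at pairwise distinct parameters.\<close>
  define g where "g X = (\<Prod>(L1, L2)\<in>pr. (nv L1 \<odot> X) * (nv L2 \<odot> E) - (nv L2 \<odot> X) * (nv L1 \<odot> E))" for X
  have finpr: "finite pr" unfolding pr_def using fin_inv by (auto intro: finite_subset[of _ "Inv \<times> Inv"])
  have gp: "polyfun g" unfolding g_def split_beta by (intro polyfun_intros)
  have "\<exists>X. g X \<noteq> 0" unfolding g_def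
  proof (rule polyfun_prod_nonzero[OF finpr])
    fix z assume "z \<in> pr"
    then obtain L1 L2 where z: "z = (L1, L2)" and L: "L1 \<in> Inv" "L2 \<in> Inv" "L1 \<noteq> L2" by (auto simp: pr_def)
    show "polyfun (\<lambda>X. case z of (L1, L2) \<Rightarrow> (nv L1 \<odot> X) * (nv L2 \<odot> E) - (nv L2 \<odot> X) * (nv L1 \<odot> E))"
      unfolding z split_beta by (intro polyfun_intros)
    have "(nv L2 \<odot> E) *s nv L1 - (nv L1 \<odot> E) *s nv L2 \<noteq> 0"
    proof
      assume "(nv L2 \<odot> E) *s nv L1 - (nv L1 \<odot> E) *s nv L2 = 0"
      then have "nv L1 = ((nv L1 \<odot> E) / (nv L2 \<odot> E)) *s nv L2"
        using nE[OF L(2)] by (simp add: vec_eq_iff field_simps)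
      then show False using nv_independent[OF L] by blast
    qed
    from sprod_nonzero[OF this] show "\<exists>X. (case z of (L1, L2) \<Rightarrow> (nv L1 \<odot> X) * (nv L2 \<odot> E) - (nv L2 \<odot> X) * (nv L1 \<odot> E)) \<noteq> 0"
      by (auto simp: z mult.commute)
  qed
  then obtain Y where Y: "g Y \<noteq> 0" by blast
  have "Infl X - c * (\<Prod>L\<in>Inv. nv L \<odot> X) = 0" for X
  proof (rule polyfun_zero_dense[OF _ gp Y])
    show "polyfun (\<lambda>X. Infl X - c * (\<Prod>L\<in>Inv. nv L \<odot> X))" by (intro polyfun_intros polyfun_Infl)
    fix X assume gX: "g X \<noteq> 0"
    define y where "y L = - (nv L \<odot> X) / (nv L \<odot> E)" for L
    have inj: "inj_on y Inv"
    proof (rule inj_onI, rule ccontr)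
      fix L1 L2 assume L: "L1 \<in> Inv" "L2 \<in> Inv" "y L1 = y L2" "L1 \<noteq> L2"
      then have "(nv L1 \<odot> X) * (nv L2 \<odot> E) - (nv L2 \<odot> X) * (nv L1 \<odot> E) = 0"
        using nE by (simp add: y_def field_simps)
      moreover have "(L1, L2) \<in> pr" using L by (simp add: pr_def)
      ultimately show False using gX finpr unfolding g_def by (auto simp: prod_zero_iff)
    qed
    define P where "P = line_poly Infl X E"
    define R where "R = smult (Infl E) (\<Prod>L\<in>Inv. [:- y L, 1:])"
    have degR: "degree (\<Prod>L\<in>Inv. [:- y L, 1:]) = 3 * n"
      using card_inv by (subst degree_prod_eq_sum_degree) auto
    have leadR: "coeff (\<Prod>L\<in>Inv. [:- y L, 1:]) (3 * n) = 1"
      using lead_coeff_prod[of "\<lambda>L. [:- y L, 1:]" Inv] degR by simp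
    have P: "degree P \<le> 3 * n" "coeff P (3 * n) = Infl E"
      unfolding P_def by (rule homogeneous_line_poly[OF polyfun_Infl Infl_hom]; simp)+
    have "P - R = 0"
    proof (rule ccontr)
      assume nz: "P - R \<noteq> 0"
      have "coeff (P - R) (3 * n) = 0" using P leadR by (simp add: R_def)
      moreover have "degree (P - R) \<le> 3 * n" using P degR by (intro degree_diff_le) (auto simp: R_def)
      ultimately have "degree (P - R) < 3 * n"
      proof -
        have "degree (P - R) \<noteq> 3 * n"
          using leading_coeff_neq_0[OF nz] \<open>coeff (P - R) (3 * n) = 0\<close> by metis
        then show ?thesis using \<open>degree (P - R) \<le> 3 * n\<close> by linarith
      qed
      moreover have "y ` Inv \<subseteq> {x. poly (P - R) x = 0}"
      proof clarsimp
        fix L assume L: "invariant_line \<Omega> L"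
        \<comment> \<open>\<open>Infl_on_Inv\<close> speaks of non-zero vectors. If \<open>X\<close>
          were a multiple of \<open>E\<close>, all parameters would coincide, but there are at least
          three invariant lines.\<close>
        have "X + y L *s E \<noteq> 0"
        proof
          assume "X + y L *s E = 0"
          then have X: "X = (- y L) *s E" by (simp add: vec_eq_iff eq_neg_iff_add_eq_0)
          have "card (Inv - {L}) \<noteq> 0" using card_inv n_pos fin_inv L by (simp add: card_Diff_singleton)
          then have "Inv - {L} \<noteq> {}" by fastforce
          then obtain L' where "L' \<in> Inv" "L' \<noteq> L" by blast
          moreover have "y L' = y L" unfolding y_def[of L'] using nE[OF \<open>L' \<in> Inv\<close>] by (subst X) simp
          ultimately show False using inj L by (auto dest: inj_onD)
        qed
        moreover have "X + y L *s E \<in> L"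
          unfolding mem_line[OF Inv_lines[of L, simplified, OF L]] using nE[of L] L by (simp add: y_def)
        ultimately have "Infl (X + y L *s E) = 0" using Infl_on_Inv L by simp
        moreover have "poly R (y L) = 0" using L fin_inv by (auto simp: R_def poly_prod prod_zero_iff)
        ultimately show "poly P (y L) = poly R (y L)" by (simp add: P_def polyfun_Infl)
      qed
      then have "card (y ` Inv) \<le> degree (P - R)"
        using card_mono[OF poly_roots_finite[OF nz]] card_poly_roots_bound[OF nz] by (meson le_trans)
      ultimately show False using card_image[OF inj] card_inv by simp
    qed
    then have "poly P 0 = poly R 0" by simp
    then have "Infl X = Infl E * (\<Prod>L\<in>Inv. (nv L \<odot> X) / (nv L \<odot> E))"
      by (simp add: P_def R_def polyfun_Infl poly_prod y_def)
    then show "Infl X - c * (\<Prod>L\<in>Inv. nv L \<odot> X) = 0" by (simp add: c_def prod_dividef)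
  qed
  then have "\<forall>X. Infl X = c * (\<Prod>L\<in>Inv. nv L \<odot> X)" by simp
  moreover have "c \<noteq> 0" using E by (simp add: c_def)
  ultimately show ?thesis by blast
qed

end

section \<open>Singular points\<close>

lemma coplanar_combination:
  assumes "v \<noteq> 0" "v \<odot> X = 0" "v \<odot> Y = 0" "v \<odot> W = 0" "cr X Y \<noteq> 0"
  shows "\<exists>a b. W = a *s X + b *s Y"
proof -
  obtain N where N: "tri X Y N \<noteq> 0" using tri_nonzero_ex[OF assms(5)] by blast
  have "tri X Y W = 0" using sprod_basis_zero[of X Y W v] assms by blast
  then have "tri X Y N *s W = tri W Y N *s X + tri X W N *s Y" using cramer[of X Y N W] by simp
  then have "W = (tri W Y N / tri X Y N) *s X + (tri X W N / tri X Y N) *s Y"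
    using N by (simp add: vec_eq_iff field_simps)
  then show ?thesis by blast
qed

lemma cr_smult [simp]: "cr X (k *s X) = 0" "cr (k *s X) X = 0" "cr X X = 0" "cr 0 X = 0" "cr X 0 = 0"
  by (simp_all add: vec_eq_iff forall_3 algebra_simps)

lemma cr_nonzero_ex:
  assumes "X \<noteq> 0" shows "\<exists>Y. cr X Y \<noteq> 0"
proof -
  have "cr X (axis 1 1) $ 2 = X $ 3" "cr X (axis 1 1) $ 3 = - X $ 2" "cr X (axis 2 1) $ 3 = X $ 1"
    by (simp_all add: axis_def)
  moreover have "X $ 1 \<noteq> 0 \<or> X $ 2 \<noteq> 0 \<or> X $ 3 \<noteq> 0" using assms by (auto simp: vec_eq_iff forall_3)
  ultimately have "cr X (axis 1 1) \<noteq> 0 \<or> cr X (axis 2 1) \<noteq> 0"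
    by (metis neg_equal_0_iff_equal zero_index)
  then show ?thesis by blast
qed

context convex_foliation
begin

lemma generic_off_Inv:
  assumes "s \<noteq> 0"
  shows "\<exists>X. (\<forall>L\<in>Inv. X \<notin> L) \<and> cr s X \<noteq> 0"
proof -
  obtain Y where "cr s Y \<noteq> 0" using cr_nonzero_ex[OF assms] by blast
  then obtain W where W: "tri s Y W \<noteq> 0" using tri_nonzero_ex by blast
  obtain X0 where X0: "\<forall>L\<in>Inv. X0 \<notin> L" using line_not_all_Inv by blast
  have "polyfun (\<lambda>X. \<Prod>L\<in>Inv. nv L \<odot> X)" by (auto intro!: polyfun_intros)
  moreover have "(\<Prod>L\<in>Inv. nv L \<odot> X0) \<noteq> 0" using X0 fin_inv mem_line[OF Inv_lines] by auto
  ultimately obtain X where X: "(\<Prod>L\<in>Inv. nv L \<odot> X) \<noteq> 0" "tri s Y X \<noteq> 0"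
    using polyfun_common_nonzero[OF _ polyfun_tri _ W] by blast
  have "cr s X \<noteq> 0"
  proof
    assume "cr s X = 0"
    then obtain k where "X = k *s s" using cr_zero_imp_parallel assms by blast
    then show False using X by simp
  qed
  then show ?thesis using X fin_inv mem_line[OF Inv_lines] by auto
qed

lemma lines_eqI:
  assumes "L \<in> proj_lines" "L' \<in> proj_lines" "X \<in> L" "X \<in> L'" "Y \<in> L" "Y \<in> L'" "cr X Y \<noteq> 0"
  shows "L = L'"
proof -
  have *: "L1 \<subseteq> L2" if L: "L1 \<in> proj_lines" "L2 \<in> proj_lines" "X \<in> L1" "X \<in> L2" "Y \<in> L1" "Y \<in> L2" for L1 L2
  proof
    fix W assume "W \<in> L1"
    then have "nv L1 \<odot> W = 0" "nv L1 \<odot> X = 0" "nv L1 \<odot> Y = 0" using L by (simp_all add: mem_line)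
    then obtain a b where "W = a *s X + b *s Y"
      using coplanar_combination[OF nv_nonzero[OF L(1)] _ _ _ assms(7)] by blast
    then show "W \<in> L2" using L by (simp add: mem_line)
  qed
  show ?thesis using *[of L L'] *[of L' L] assms by blast
qed

lemma lines_subset_eq:
  assumes "L \<in> proj_lines" "L' \<in> proj_lines" "L \<subseteq> L'"
  shows "L = L'"
proof -
  obtain X where X: "nv L \<odot> X = 0" "X \<noteq> 0"
  proof -
    obtain Y where "cr (nv L) Y \<noteq> 0" using cr_nonzero_ex nv_nonzero[OF assms(1)] by blast
    moreover have "nv L \<odot> cr (nv L) Y = 0" by (simp add: sprod_3 algebra_simps)
    ultimately show ?thesis using that by blast
  qed
  obtain E N where "nv L \<odot> E = 0" "tri X E N \<noteq> 0" using plane_basis[OF X(2) nv_nonzero[OF assms(1)] X(1)] by blast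
  moreover from this have "cr X E \<noteq> 0" by (auto simp: tri_def)
  ultimately show ?thesis using lines_eqI[of L L' X E] X assms mem_line[OF assms(1)] by blast
qed

text \<open>Otherwise every line through \<open>s\<close> would be invariant, including one through
  a point off all invariant lines.\<close>

lemma polar_nonzero:
  assumes "s \<noteq> 0" "\<Omega> s = 0"
  shows "\<exists>E. om s E \<noteq> 0"
proof (rule ccontr)
  assume "\<not> (\<exists>E. om s E \<noteq> 0)"
  then have z: "om s E = 0" for E by blast
  obtain X where X: "\<forall>L\<in>Inv. X \<notin> L" "cr s X \<noteq> 0" using generic_off_Inv[OF assms(1)] by blast
  have sX: "cr s X \<odot> s = 0" "cr s X \<odot> X = 0" by (simp_all add: sprod_3 algebra_simps)
  have "om V Y = 0" if Y: "cr s X \<odot> Y = 0" and V: "cr s X \<odot> V = 0" for V Y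
  proof (cases "cr s Y = 0")
    case True
    then obtain k where "Y = k *s s" using cr_zero_imp_parallel assms(1) by blast
    then show ?thesis using Omega_hom[of k s] assms(2) by (simp add: om_def)
  next
    case False
    then obtain a b where "V = a *s s + b *s Y"
      using coplanar_combination[OF X(2) sX(1) Y V] by blast
    then show ?thesis using z by simp
  qed
  then have "line_of (cr s X) \<in> Inv"
    using X(2) by (auto simp: invariant_line_def proj_lines_def line_of_def om_def)
  moreover have "X \<in> line_of (cr s X)" using sX by (simp add: line_of_def)
  ultimately show False using X by blast
qed

text \<open>Expansion at \<open>s\<close> of the tangency polynomial of the line through
  \<open>s\<close> with direction \<open>E\<close>. For fixed \<open>k\<close> and \<open>s\<close>
  it is a form of degree \<open>k + 1\<close> in \<open>E\<close>.\<close>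

definition H :: "nat \<Rightarrow> complex^3 \<Rightarrow> complex^3 \<Rightarrow> complex" where
  "H k s E = coeff (line_poly (om E) s E) k"

lemma polyfun_H: "polyfun (H k s)"
proof -
  have "line_poly (om E) s E = (\<Sum>i\<in>UNIV. smult (E $ i) (line_poly (\<lambda>X. \<Omega> X $ i) s E))" for E
    by (rule poly_eqI_cofinite[of "{}"])
      (simp_all add: polyfun_om polyfun_Omega poly_sum om_def scalar_product_def mult.commute)
  then have "H k s = (\<lambda>E. \<Sum>i\<in>UNIV. E $ i * coeff (line_poly (\<lambda>X. \<Omega> X $ i) s E) k)"
    by (simp add: H_def fun_eq_iff coeff_sum)
  then show ?thesis by (simp only:) (intro polyfun_intros polyfun_coeff_line_poly polyfun_Omega)
qed

lemma H_hom: "H k s (y *s E) = y ^ (k + 1) * H k s E"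
proof -
  have "line_poly (om (y *s E)) s (y *s E) = smult y (pcompose (line_poly (om E) s E) [:0, y:])"
    by (rule poly_eqI_cofinite[of "{}"])
      (simp_all add: polyfun_om poly_pcompose mult.commute vector_smult_assoc)
  then show ?thesis by (simp add: H_def coeff_pcompose_linear)
qed

lemma H_scale:
  assumes "m \<noteq> 0"
  shows "H k (m *s s) E = m ^ (n + 1) / m ^ k * H k s E"
proof -
  have "line_poly (om E) (m *s s) E = smult (m ^ (n + 1)) (pcompose (line_poly (om E) s E) [:0, 1 / m:])"
  proof (rule poly_eqI_cofinite[of "{}"])
    fix x
    have "m *s s + x *s E = m *s (s + (x / m) *s E)" using assms by (simp add: vec_eq_iff field_simps)
    then have "om E (m *s s + x *s E) = m ^ (n + 1) * om E (s + (x / m) *s E)" by (simp only: om_hom)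
    then show "poly (line_poly (om E) (m *s s) E) x
      = poly (smult (m ^ (n + 1)) (pcompose (line_poly (om E) s E) [:0, 1 / m:])) x"
      by (simp add: polyfun_om poly_pcompose)
  qed simp
  then show ?thesis by (simp add: H_def coeff_pcompose_linear power_divide)
qed

definition sing :: "complex^3 \<Rightarrow> bool" where "sing s \<longleftrightarrow> s \<noteq> 0 \<and> \<Omega> s = 0"

text \<open>\<open>tau s\<close> is the order of contact at \<open>s\<close> of the foliation with a generic line through \<open>s\<close>.\<close>

definition tau :: "complex^3 \<Rightarrow> nat" where "tau s = (LEAST k. \<exists>E. H k s E \<noteq> 0)"

lemma tau_scale: "m \<noteq> 0 \<Longrightarrow> tau (m *s s) = tau s"
  by (simp add: tau_def H_scale)

lemma tau_ex:
  assumes "sing s"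
  shows "\<exists>E. H (tau s) s E \<noteq> 0"
proof -
  have "\<exists>k E. H k s E \<noteq> 0"
  proof (rule ccontr)
    assume "\<not> (\<exists>k E. H k s E \<noteq> 0)"
    then have "line_poly (om E) s E = 0" for E by (simp add: H_def poly_eq_iff)
    then have z: "om E (s + x *s E) = 0" for E x using poly_line_poly[OF polyfun_om, of E s E x] by simp
    have "om s X = 0" for X
      using z[of "X - s" 1] om_self[of X] by (simp del: om_self)
    then show False using polar_nonzero assms by (auto simp: sing_def)
  qed
  then show ?thesis unfolding tau_def by (rule LeastI_ex)
qed

lemma below_tau: "k < tau s \<Longrightarrow> H k s E = 0"
  unfolding tau_def using not_less_Least by blast

lemma H_1: "H 1 s E = Am E E s"
proof -
  have "poly (pderiv (line_poly (om E) s E)) 0 = Am E E s"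
    unfolding pderiv_line_poly[OF polyfun_om] Am_def by (simp add: polyfun_dird polyfun_om)
  then show ?thesis by (simp add: H_def poly_0_coeff_0 coeff_pderiv)
qed

lemma H_0: "H 0 s E = om E s"
  using poly_line_poly[OF polyfun_om, of E s E 0] by (simp add: H_def poly_0_coeff_0)

lemma tau_pos: "sing s \<Longrightarrow> tau s \<ge> 1"
  using tau_ex[of s] H_0 by (cases "tau s") (auto simp: sing_def om_def)

definition line_count :: "complex^3 \<Rightarrow> nat" where "line_count s = card {L \<in> Inv. s \<in> L}"

text \<open>The invariant lines through \<open>s\<close> are zeros of the tangent cone
  \<open>H (tau s) s\<close>, a non-zero form of degree \<open>tau s + 1\<close> on the pencil of
  lines through \<open>s\<close>.\<close>

lemma line_count_le_tau:
  assumes s: "sing s"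
  shows "line_count s \<le> tau s + 1"
proof -
  have s0: "s \<noteq> 0" using s by (simp add: sing_def)
  obtain E1 where E1: "H (tau s) s E1 \<noteq> 0" using tau_ex[OF s] by blast
  have "cr s E1 \<noteq> 0"
  proof
    assume "cr s E1 = 0"
    then obtain k where k: "E1 = k *s s" using cr_zero_imp_parallel s0 by blast
    have "line_poly (om E1) s E1 = 0"
    proof (rule poly_eqI_cofinite[of "{}"])
      fix x
      have "s + x *s E1 = (1 + x * k) *s s" unfolding k by (simp add: vec_eq_iff algebra_simps)
      then show "poly (line_poly (om E1) s E1) x = poly 0 x"
        using Omega_hom[of "1 + x * k" s] s by (simp add: polyfun_om om_def sing_def)
    qed simp
    then show False using E1 by (simp add: H_def)
  qed
  then obtain W where W: "tri s E1 W \<noteq> 0" using tri_nonzero_ex by blast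
  obtain X0 where X0: "\<forall>L\<in>Inv. X0 \<notin> L" using line_not_all_Inv by blast
  have "polyfun (\<lambda>X. \<Prod>L\<in>Inv. nv L \<odot> X)" by (auto intro!: polyfun_intros)
  moreover have "(\<Prod>L\<in>Inv. nv L \<odot> X0) \<noteq> 0" using X0 fin_inv mem_line[OF Inv_lines] by auto
  ultimately obtain E2 where E2: "(\<Prod>L\<in>Inv. nv L \<odot> E2) \<noteq> 0" "tri s E1 E2 \<noteq> 0"
    using polyfun_common_nonzero[OF _ polyfun_tri _ W] by blast
  then have nE2: "nv L \<odot> E2 \<noteq> 0" if "L \<in> Inv" for L using that fin_inv by auto
  define P where "P = line_poly (H (tau s) s) E1 E2"
  have deg: "degree P \<le> tau s + 1"
    unfolding P_def by (rule homogeneous_line_poly[OF polyfun_H H_hom])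
  have "poly P 0 \<noteq> 0" using E1 by (simp add: P_def polyfun_H)
  then have P0: "P \<noteq> 0" by auto
  define y where "y L = - (nv L \<odot> E1) / (nv L \<odot> E2)" for L
  have mem: "E1 + y L *s E2 \<in> L" if "L \<in> Inv" for L
    unfolding mem_line[OF Inv_lines[OF that]] using nE2[OF that] by (simp add: y_def)
  have "inj_on y {L \<in> Inv. s \<in> L}"
  proof (rule inj_onI)
    fix L L' assume L: "L \<in> {L \<in> Inv. s \<in> L}" "L' \<in> {L \<in> Inv. s \<in> L}" "y L = y L'"
    have "cr s (E1 + y L *s E2) \<noteq> 0"
    proof
      assume "cr s (E1 + y L *s E2) = 0"
      then obtain k where "E1 + y L *s E2 = k *s s" using cr_zero_imp_parallel s0 by blast
      then have "tri s (E1 + y L *s E2) E2 = 0" by simp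
      then show False using E2 by simp
    qed
    then show "L = L'" using lines_eqI[of L L' s "E1 + y L *s E2"] mem[of L] mem[of L'] L Inv_lines by auto
  qed
  then have "line_count s = card (y ` {L \<in> Inv. s \<in> L})" by (simp add: line_count_def card_image)
  also have "\<dots> \<le> card {x. poly P x = 0}"
  proof (rule card_mono[OF poly_roots_finite[OF P0]], safe)
    fix L assume L: "invariant_line \<Omega> L" "s \<in> L"
    then have LI: "L \<in> Inv" by simp
    define V where "V = E1 + y L *s E2"
    have "V \<in> L" using mem[OF LI] by (simp add: V_def)
    then have "om V (s + x *s V) = 0" for x
      using L mem_line[OF Inv_lines[OF LI]] by (intro Inv_om[OF LI]) simp_all
    then have "line_poly (om V) s V = 0"
      by (intro poly_eqI_cofinite[of "{}"]) (simp_all add: polyfun_om)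
    then show "poly P (y L) = 0" by (simp add: P_def polyfun_H V_def[symmetric] H_def)
  qed
  also have "\<dots> \<le> tau s + 1" using card_poly_roots_bound[OF P0] deg by simp
  finally show ?thesis .
qed

text \<open>In the factorization of \<open>Infl\<close>, each invariant line through
  \<open>s\<close> contributes one simple zero along the transverse direction \<open>E\<close>, and
  the other factors do not vanish at \<open>s\<close>.\<close>

lemma Infl_order:
  assumes E: "\<forall>L\<in>Inv. nv L \<odot> E \<noteq> 0"
  shows "coeff (line_poly Infl s E) (line_count s) \<noteq> 0"
proof -
  obtain c where c: "c \<noteq> 0" "\<And>X. Infl X = c * (\<Prod>L\<in>Inv. nv L \<odot> X)" using Infl_product by blast
  define R where "R = smult c ((\<Prod>L\<in>{L \<in> Inv. s \<in> L}. [:nv L \<odot> E:]) * (\<Prod>L\<in>{L \<in> Inv. s \<notin> L}. [:nv L \<odot> s, nv L \<odot> E:]))"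
  have un: "Inv = {L \<in> Inv. s \<in> L} \<union> {L \<in> Inv. s \<notin> L}" by blast
  have "line_poly Infl s E = monom 1 (line_count s) * R"
  proof (rule poly_eqI_cofinite[of "{}"])
    fix x
    have "(\<Prod>L\<in>Inv. nv L \<odot> (s + x *s E)) = (\<Prod>L\<in>{L \<in> Inv. s \<in> L}. nv L \<odot> (s + x *s E)) * (\<Prod>L\<in>{L \<in> Inv. s \<notin> L}. nv L \<odot> (s + x *s E))"
      using fin_inv by (subst un) (intro prod.union_disjoint, auto)
    also have "(\<Prod>L\<in>{L \<in> Inv. s \<in> L}. nv L \<odot> (s + x *s E)) = (\<Prod>L\<in>{L \<in> Inv. s \<in> L}. x * (nv L \<odot> E))"
      using mem_line[OF Inv_lines] by (intro prod.cong) auto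
    also have "\<dots> = x ^ line_count s * (\<Prod>L\<in>{L \<in> Inv. s \<in> L}. nv L \<odot> E)" by (simp add: prod.distrib line_count_def)
    finally show "poly (line_poly Infl s E) x = poly (monom 1 (line_count s) * R) x"
      by (simp add: polyfun_Infl c(2) R_def poly_monom poly_prod algebra_simps)
  qed simp
  then have "coeff (line_poly Infl s E) (line_count s) = poly R 0"
    by (simp add: coeff_monom_mult poly_0_coeff_0)
  also have "\<dots> \<noteq> 0"
    using fin_inv E c(1) mem_line[OF Inv_lines] by (simp add: R_def poly_prod)
  finally show ?thesis .
qed

lemma Infl_frame_poly:
  shows "smult ((tri s E N)\<^sup>2) (line_poly Infl s E) =
    (line_poly (om N) s E)\<^sup>2 * pderiv (line_poly (om E) s E)
    - line_poly (om N) s E * line_poly (om E) s E * (line_poly (Am N E) s E + line_poly (Am E N) s E)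
    + (line_poly (om E) s E)\<^sup>2 * line_poly (Am N N) s E"
proof (rule poly_eqI_cofinite[of "{}"])
  fix x
  show "poly (smult ((tri s E N)\<^sup>2) (line_poly Infl s E)) x = poly ((line_poly (om N) s E)\<^sup>2 * pderiv (line_poly (om E) s E)
    - line_poly (om N) s E * line_poly (om E) s E * (line_poly (Am N E) s E + line_poly (Am E N) s E)
    + (line_poly (om E) s E)\<^sup>2 * line_poly (Am N N) s E) x"
    using Infl_frame[of "s + x *s E" E N]
    by (simp add: polyfun_Infl pderiv_line_poly polyfun_om polyfun_Am Am_def[symmetric, abs_def])
qed simp

lemma X_dvd_ex:
  fixes P :: "complex poly"
  assumes "\<And>k. k < m \<Longrightarrow> coeff P k = 0"
  shows "\<exists>Q. P = monom 1 m * Q \<and> poly Q 0 = coeff P m"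
proof -
  have "monom 1 m dvd P" using assms by (simp add: monom_1_dvd_iff')
  then obtain Q where "P = monom 1 m * Q" by blast
  then show ?thesis by (auto simp: coeff_monom_mult poly_0_coeff_0)
qed

lemma line_poly_coeff_0: "polyfun g \<Longrightarrow> coeff (line_poly g s E) 0 = g s"
  using poly_line_poly[of g s E 0] by (simp add: poly_0_coeff_0)

lemma line_poly_coeff_1:
  assumes "polyfun g" shows "coeff (line_poly g s E) 1 = dird g E s"
proof -
  have "poly (pderiv (line_poly g s E)) 0 = dird g E s"
    unfolding pderiv_line_poly[OF assms] by (simp add: polyfun_dird assms)
  then show ?thesis by (simp add: poly_0_coeff_0 coeff_pderiv)
qed

text \<open>The vanishing order \<open>line_count s\<close> of \<open>Infl\<close> along the line is
  compared with \<open>Infl_frame_poly\<close>, in which \<open>om E\<close> and \<open>om N\<close>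
  vanish at \<open>s\<close>. Order two is automatic, and the bound \<open>tau s + 1\<close> forbids
  further degeneration. So the linear part is invertible if \<open>tau s = 1\<close>; if
  \<open>tau s \<ge> 2\<close> it is a non-zero skew form, a multiple of x dy - y dx, and the
  singularity is radial.\<close>

lemma sing_frame:
  assumes s: "sing s" and D: "tri s E N \<noteq> 0" and E: "\<forall>L\<in>Inv. nv L \<odot> E \<noteq> 0"
  shows two_lines: "line_count s \<ge> 2"
    and det_nonzero: "tau s = 1 \<Longrightarrow> Am E E s * Am N N s - Am E N s * Am N E s \<noteq> 0"
    and rotation_nonzero: "tau s \<ge> 2 \<Longrightarrow> Am N E s \<noteq> 0"
proof -
  have om0: "om V s = 0" for V using s by (simp add: sing_def om_def)
  let ?Q = "line_poly Infl s E"
  obtain b where b: "line_poly (om N) s E = monom 1 1 * b" "poly b 0 = Am E N s"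
    using X_dvd_ex[of 1 "line_poly (om N) s E"] line_poly_coeff_0[OF polyfun_om] line_poly_coeff_1[OF polyfun_om] om0
    by (auto simp: Am_def)
  obtain f where f: "line_poly (om E) s E = monom 1 1 * f" "poly f 0 = Am E E s"
    using X_dvd_ex[of 1 "line_poly (om E) s E"] line_poly_coeff_0[OF polyfun_om] line_poly_coeff_1[OF polyfun_om] om0
    by (auto simp: Am_def)
  define S where "S = b\<^sup>2 * pderiv (line_poly (om E) s E) - b * f * (line_poly (Am N E) s E + line_poly (Am E N) s E) + f\<^sup>2 * line_poly (Am N N) s E"
  have "(monom 1 1)\<^sup>2 = (monom 1 2 :: complex poly)" by (simp add: power2_eq_square mult_monom numeral_2_eq_2)
  then have QS: "smult ((tri s E N)\<^sup>2) ?Q = monom 1 2 * S"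
    unfolding Infl_frame_poly b(1) f(1) S_def pderiv_line_poly[OF polyfun_om] 
    by (simp add: power2_eq_square algebra_simps f(1)[symmetric])
  have nz: "coeff (smult ((tri s E N)\<^sup>2) ?Q) (line_count s) \<noteq> 0" using Infl_order[OF E] D by simp
  then show two: "line_count s \<ge> 2" unfolding QS by (auto simp: coeff_monom_mult split: if_splits)
  show "Am E E s * Am N N s - Am E N s * Am N E s \<noteq> 0" if "tau s = 1"
  proof -
    have "line_count s = 2" using two line_count_le_tau[OF s] that by simp
    then have "poly S 0 \<noteq> 0" using nz unfolding QS by (simp add: coeff_monom_mult poly_0_coeff_0)
    moreover have "poly S 0 = Am E E s * (Am E E s * Am N N s - Am E N s * Am N E s)"
      using b(2) f(2) by (simp add: S_def polyfun_Am Am_def[symmetric, abs_def] pderiv_line_poly polyfun_om power2_eq_square algebra_simps)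
    ultimately show ?thesis by auto
  qed
  show "Am N E s \<noteq> 0" if t: "tau s \<ge> 2"
  proof
    assume NE: "Am N E s = 0"
    \<comment> \<open>The form \<open>Am\<close> at \<open>s\<close> is therefore skew, so
      \<open>Am N E s = 0\<close> would annihilate the whole linear part and raise the order of
      \<open>Infl\<close> to \<open>tau s + 2\<close>.\<close>
    have J: "Am V V s = 0" for V using below_tau[of 1 s V] t H_1 by simp
    have EN: "Am E N s = 0" using J[of "E + N"] J[of E] J[of N] NE unfolding Am_linear by simp
    have low: "coeff (line_poly (om N) s E) k = 0" if "k < 2" for k
    proof -
      consider "k = 0" | "k = 1" using \<open>k < 2\<close> by linarith
      then show ?thesis
        using line_poly_coeff_0[OF polyfun_om, of N s E] line_poly_coeff_1[OF polyfun_om, of N s E] om0[of N] EN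
        unfolding Am_def by cases (simp_all only:)
    qed
    obtain b2 where b2: "line_poly (om N) s E = monom 1 2 * b2"
      using X_dvd_ex[of 2, OF low] by blast
    obtain f2 where f2: "line_poly (om E) s E = monom 1 (tau s) * f2"
      using X_dvd_ex[of "tau s" "line_poly (om E) s E"] below_tau by (auto simp: H_def)
    obtain g where g: "pderiv (line_poly (om E) s E) = monom 1 (tau s - 1) * g"
      using X_dvd_ex[of "tau s - 1" "pderiv (line_poly (om E) s E)"] below_tau by (auto simp: H_def coeff_pderiv)
    obtain h where h: "line_poly (Am N E) s E + line_poly (Am E N) s E = monom 1 1 * h"
      using X_dvd_ex[of 1 "line_poly (Am N E) s E + line_poly (Am E N) s E"] line_poly_coeff_0[OF polyfun_Am] NE EN by auto
    obtain h2 where h2: "line_poly (Am N N) s E = monom 1 1 * h2"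
      using X_dvd_ex[of 1 "line_poly (Am N N) s E"] line_poly_coeff_0[OF polyfun_Am] J by auto
    obtain r where r: "tau s = r + 2" using t le_Suc_ex by (metis add.commute)
    have "smult ((tri s E N)\<^sup>2) ?Q = monom 1 (tau s + 2) * (monom 1 1 * b2\<^sup>2 * g - monom 1 1 * b2 * f2 * h + monom 1 (tau s - 1) * f2\<^sup>2 * h2)"
      unfolding Infl_frame_poly g unfolding b2 f2 h h2 r 
      by (simp add: monom_altdef power_add power2_eq_square algebra_simps)
    then have "monom 1 (tau s + 2) dvd smult ((tri s E N)\<^sup>2) ?Q" by simp
    then have "line_count s \<ge> tau s + 2" using nz unfolding monom_1_dvd_iff' by (meson not_le)
    then show False using line_count_le_tau[OF s] by simp
  qed
qed

section \<open>The finite set of singular points and the generic centres of pencils\<close>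

text \<open>The elements of \<open>PP\<close> are the singular points, as lines through the origin.\<close>

definition PP :: "(complex^3) set set" where
  "PP = (\<lambda>(L, L'). L \<inter> L') ` {(L, L') \<in> Inv \<times> Inv. L \<noteq> L'}"

definition rep :: "(complex^3) set \<Rightarrow> complex^3" where "rep a = (SOME v. v \<noteq> 0 \<and> v \<in> a)"

lemma finite_PP: "finite PP"
  unfolding PP_def using fin_inv by (intro finite_imageI) (auto intro: finite_subset[of _ "Inv \<times> Inv"])

lemma PP_cases:
  assumes "a \<in> PP"
  obtains L L' where "L \<in> Inv" "L' \<in> Inv" "L \<noteq> L'" "a = L \<inter> L'"
  using assms by (auto simp: PP_def)

lemma rep:
  assumes "a \<in> PP"
  shows "rep a \<noteq> 0" "rep a \<in> a"
proof -
  obtain L L' where L: "L \<in> Inv" "L' \<in> Inv" "L \<noteq> L'" "a = L \<inter> L'" using PP_cases[OF assms] .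
  have "cr (nv L) (nv L') \<noteq> 0"
    using cr_zero_imp_parallel[of "nv L" "nv L'"] nv_nonzero[OF Inv_lines[OF L(1)]] nv_independent[OF L(2,1)] L(3) by blast
  moreover have "cr (nv L) (nv L') \<in> a"
    unfolding L(4) Int_iff mem_line[OF Inv_lines[OF L(1)]] mem_line[OF Inv_lines[OF L(2)]]
    by (simp add: sprod_3 algebra_simps)
  ultimately have "\<exists>v. v \<noteq> 0 \<and> v \<in> a" by blast
  from someI_ex[OF this] show "rep a \<noteq> 0" "rep a \<in> a" by (simp_all add: rep_def)
qed

text \<open>At the intersection of two invariant lines \<open>\<Omega>\<close> kills both planes,
  which span the space.\<close>

lemma PP_sing: assumes "a \<in> PP" shows "sing (rep a)"
proof -
  obtain L L' where L: "L \<in> Inv" "L' \<in> Inv" "L \<noteq> L'" "a = L \<inter> L'" using PP_cases[OF assms] .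
  have "\<not> L' \<subseteq> L" using lines_subset_eq[of L' L] L Inv_lines by blast
  then obtain E where E: "E \<in> L'" "E \<notin> L" by blast
  have "om E (rep a) = 0" using Inv_om[OF L(2) _ E(1)] rep(2)[OF assms] L(4) by blast
  then have "\<Omega> (rep a) = 0" using transverse_imp_singular[OF L(1) _ E(2)] rep(2)[OF assms] L(4) by blast
  then show ?thesis using rep(1)[OF assms] by (simp add: sing_def)
qed

lemma mem_PP_iff: assumes "a \<in> PP" shows "v \<in> a \<longleftrightarrow> (\<exists>k. v = k *s rep a)"
proof -
  obtain L L' where L: "L \<in> Inv" "L' \<in> Inv" "L \<noteq> L'" "a = L \<inter> L'" using PP_cases[OF assms] .
  show ?thesis
  proof
    assume "v \<in> a"
    then have "cr (rep a) v = 0"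
      using lines_eqI[of L L' "rep a" v] L rep(2)[OF assms] Inv_lines by blast
    then show "\<exists>k. v = k *s rep a" using cr_zero_imp_parallel rep(1)[OF assms] by blast
  next
    assume "\<exists>k. v = k *s rep a"
    then show "v \<in> a" using rep(2)[OF assms] mem_line[OF Inv_lines[OF L(1)]] mem_line[OF Inv_lines[OF L(2)]] L(4) by auto
  qed
qed

lemma reps_independent:
  assumes "a \<in> PP" "b \<in> PP" "a \<noteq> b"
  shows "cr (rep a) (rep b) \<noteq> 0"
proof
  assume "cr (rep a) (rep b) = 0"
  then obtain k where k: "rep b = k *s rep a" using cr_zero_imp_parallel rep(1)[OF assms(1)] by blast
  then have "k \<noteq> 0" using rep(1)[OF assms(2)] by auto
  then have "rep a = (1 / k) *s rep b" using k by simp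
  have "v \<in> a \<longleftrightarrow> v \<in> b" for v
    unfolding mem_PP_iff[OF assms(1)] mem_PP_iff[OF assms(2)]
    using k \<open>rep a = (1 / k) *s rep b\<close> vector_smult_assoc by metis
  then show False using assms by blast
qed

text \<open>A singular point lies on at least two invariant lines by \<open>two_lines\<close>.
  Finiteness of the singular set thus comes from that of \<open>Inv\<close>.\<close>

lemma sing_in_PP:
  assumes s: "sing s"
  shows "\<exists>a\<in>PP. \<exists>k. k \<noteq> 0 \<and> s = k *s rep a"
proof -
  have s0: "s \<noteq> 0" using s by (simp add: sing_def)
  obtain E where E: "\<forall>L\<in>Inv. E \<notin> L" "cr s E \<noteq> 0" using generic_off_Inv[OF s0] by blast
  then obtain N where N: "tri s E N \<noteq> 0" using tri_nonzero_ex by blast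
  have "line_count s \<ge> 2" using two_lines[OF s N] E mem_line[OF Inv_lines] by blast
  then have "\<not> (\<forall>L\<in>{L \<in> Inv. s \<in> L}. \<forall>L'\<in>{L \<in> Inv. s \<in> L}. L = L')"
    unfolding line_count_def using card_le_Suc0_iff_eq[of "{L \<in> Inv. s \<in> L}"] fin_inv by auto
  then obtain L L' where L: "L \<in> Inv" "L' \<in> Inv" "L \<noteq> L'" "s \<in> L \<inter> L'" by blast
  then have "L \<inter> L' \<in> PP" by (force simp: PP_def)
  moreover from this obtain k where k: "s = k *s rep (L \<inter> L')" using mem_PP_iff L(4) by blast
  moreover from k s0 have "k \<noteq> 0" by auto
  ultimately show ?thesis by blast
qed

text \<open>\<open>bad_poly E\<close> vanishes if \<open>E\<close> is on an invariant line, on a line through two singular points, or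
  special with respect to the foliation at a singular point.\<close>

definition bad_poly :: "complex^3 \<Rightarrow> complex" where
  "bad_poly E = (\<Prod>L\<in>Inv. nv L \<odot> E) * (\<Prod>(a, b)\<in>{(a, b) \<in> PP \<times> PP. a \<noteq> b}. tri (rep a) (rep b) E)
    * (\<Prod>a\<in>PP. om (rep a) E * H (tau (rep a)) (rep a) E)"

lemma finite_PP_pairs: "finite {(a, b) \<in> PP \<times> PP. a \<noteq> b}"
  using finite_PP by (auto intro: finite_subset[of _ "PP \<times> PP"])

lemma polyfun_bad_poly: "polyfun bad_poly"
  unfolding bad_poly_def[abs_def] split_beta by (intro polyfun_intros polyfun_tri polyfun_om polyfun_H)

lemma bad_poly_nonzero_iff: "bad_poly E \<noteq> 0 \<longleftrightarrow> (\<forall>L\<in>Inv. nv L \<odot> E \<noteq> 0)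
   \<and> (\<forall>a\<in>PP. \<forall>b\<in>PP. a \<noteq> b \<longrightarrow> tri (rep a) (rep b) E \<noteq> 0)
   \<and> (\<forall>a\<in>PP. om (rep a) E \<noteq> 0 \<and> H (tau (rep a)) (rep a) E \<noteq> 0)"
proof -
  have "finite PP" "finite Inv" "finite {(a, b) \<in> PP \<times> PP. a \<noteq> b}" 
    using finite_PP fin_inv finite_PP_pairs by auto
  then show ?thesis unfolding bad_poly_def by (auto simp: prod_zero_iff)
qed

lemma bad_poly_scale: "k \<noteq> 0 \<Longrightarrow> bad_poly (k *s E) \<noteq> 0 \<longleftrightarrow> bad_poly E \<noteq> 0"
  unfolding bad_poly_nonzero_iff by (simp add: om_hom H_hom)

lemma bad_poly_nonzero: "\<exists>E. bad_poly E \<noteq> 0"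
proof -
  have 1: "\<exists>E. (\<Prod>L\<in>Inv. nv L \<odot> E) \<noteq> 0"
    using fin_inv sprod_nonzero[OF nv_nonzero[OF Inv_lines]]
    by (intro polyfun_prod_nonzero) (auto intro!: polyfun_intros)
  have 2: "\<exists>E. (\<Prod>(a, b)\<in>{(a, b) \<in> PP \<times> PP. a \<noteq> b}. tri (rep a) (rep b) E) \<noteq> 0"
    using finite_PP_pairs tri_nonzero_ex[OF reps_independent]
    by (intro polyfun_prod_nonzero) (auto intro!: polyfun_intros polyfun_tri)
  have 3: "\<exists>E. (\<Prod>a\<in>PP. om (rep a) E * H (tau (rep a)) (rep a) E) \<noteq> 0"
  proof (rule polyfun_prod_nonzero[OF finite_PP])
    fix a assume a: "a \<in> PP"
    obtain E E' where "om (rep a) E \<noteq> 0" "H (tau (rep a)) (rep a) E' \<noteq> 0"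
      using polar_nonzero[of "rep a"] tau_ex[OF PP_sing[OF a]] PP_sing[OF a] by (auto simp: sing_def)
    from polyfun_common_nonzero[OF polyfun_om polyfun_H this]
    show "\<exists>X. om (rep a) X * H (tau (rep a)) (rep a) X \<noteq> 0" by auto
  qed (intro polyfun_intros polyfun_om polyfun_H)
  obtain E3 where E3: "(\<Prod>a\<in>PP. om (rep a) E3 * H (tau (rep a)) (rep a) E3) \<noteq> 0" using 3 by blast
  have p: "polyfun (\<lambda>E. \<Prod>L\<in>Inv. nv L \<odot> E)" 
    "polyfun (\<lambda>E. \<Prod>(a, b)\<in>{(a, b) \<in> PP \<times> PP. a \<noteq> b}. tri (rep a) (rep b) E)"
    "polyfun (\<lambda>E. \<Prod>a\<in>PP. om (rep a) E * H (tau (rep a)) (rep a) E)"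
    unfolding split_beta by (intro polyfun_intros polyfun_tri polyfun_om polyfun_H)+
  obtain E1 E2 where E12: "(\<Prod>L\<in>Inv. nv L \<odot> E1) \<noteq> 0" "(\<Prod>(a, b)\<in>{(a, b) \<in> PP \<times> PP. a \<noteq> b}. tri (rep a) (rep b) E2) \<noteq> 0"
    using 1 2 by blast
  from polyfun_common_nonzero[OF p(1,2) E12] obtain E4 where
    "(\<Prod>L\<in>Inv. nv L \<odot> E4) * (\<Prod>(a, b)\<in>{(a, b) \<in> PP \<times> PP. a \<noteq> b}. tri (rep a) (rep b) E4) \<noteq> 0" by auto
  from polyfun_common_nonzero[OF polyfun.mult[OF p(1,2)] p(3) this E3] show ?thesis
    unfolding bad_poly_def by auto
qed

end

section \<open>Roots of a family of polynomials\<close>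

lemma poly_tendsto_coeffs:
  fixes P :: "'u \<Rightarrow> complex poly"
  assumes "\<And>u. degree (P u) \<le> m" "degree Q \<le> m"
    and "\<And>k. k \<le> m \<Longrightarrow> ((\<lambda>u. coeff (P u) k) \<longlongrightarrow> coeff Q k) F"
    and "(x \<longlongrightarrow> y) F"
  shows "((\<lambda>u. poly (P u) (x u)) \<longlongrightarrow> poly Q y) F"
proof -
  have eq: "poly R z = (\<Sum>k\<le>m. coeff R k * z ^ k)" if "degree R \<le> m" for R :: "complex poly" and z
  proof -
    have "(\<Sum>k\<le>m. coeff R k * z ^ k) = (\<Sum>k\<le>degree R. coeff R k * z ^ k)"
      using that by (intro sum.mono_neutral_right) (auto simp: coeff_eq_0)
    then show ?thesis by (simp add: poly_altdef)
  qed
  show ?thesis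
    unfolding eq[OF assms(1)] eq[OF assms(2)] using assms(3,4) by (intro tendsto_intros) auto
qed

text \<open>A change of scale: \<open>r\<close> tending to 0 resolves a cluster of roots at 0,
  \<open>r\<close> tending to infinity follows an escaping root, and \<open>w\<close> normalizes the
  coefficients.\<close>

definition scaled_poly :: "complex \<Rightarrow> complex \<Rightarrow> complex poly \<Rightarrow> complex poly" where
  "scaled_poly w r P = smult w (pcompose P [:0, r:])"

lemma scaled_poly:
  "coeff (scaled_poly w r P) k = w * r ^ k * coeff P k"
  "poly (scaled_poly w r P) x = w * poly P (x * r)"
  "pderiv (scaled_poly w r P) = scaled_poly (w * r) r (pderiv P)"
proof -
  show "coeff (scaled_poly w r P) k = w * r ^ k * coeff P k" "poly (scaled_poly w r P) x = w * poly P (x * r)"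
    by (simp_all add: scaled_poly_def coeff_pcompose_linear poly_pcompose)
  have "poly (pderiv (scaled_poly w r P)) y = poly (scaled_poly (w * r) r (pderiv P)) y" for y
    by (simp add: scaled_poly_def pderiv_smult pderiv_pcompose poly_pcompose pderiv_pCons)
  then show "pderiv (scaled_poly w r P) = scaled_poly (w * r) r (pderiv P)"
    by (intro poly_eqI_cofinite[of "{}"]) auto
qed

lemma degree_scaled_poly: "degree P \<le> m \<Longrightarrow> degree (scaled_poly w r P) \<le> m"
  by (intro degree_le) (auto simp: scaled_poly coeff_eq_0)

lemma degree_pderiv_le: "degree (P :: complex poly) \<le> m \<Longrightarrow> degree (pderiv P) \<le> m"
  by (simp add: degree_pderiv)

text \<open>The asymptotics of all derivatives along a moving point \<open>x u\<close>, in the form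
  in which they enter the residues of the trace.\<close>

lemma scaled_poly_pderiv_tendsto:
  fixes P :: "'u \<Rightarrow> complex poly"
  assumes "\<And>u. degree (P u) \<le> m" "degree Q \<le> m"
    and "\<And>k. k \<le> m \<Longrightarrow> ((\<lambda>u. w u * r u ^ k * coeff (P u) k) \<longlongrightarrow> coeff Q k) F"
    and "((\<lambda>u. x u / r u) \<longlongrightarrow> y) F" "eventually (\<lambda>u. r u \<noteq> 0) F"
  shows "((\<lambda>u. w u * r u ^ j * poly ((pderiv ^^ j) (P u)) (x u)) \<longlongrightarrow> poly ((pderiv ^^ j) Q) y) F"
proof -
  have it: "(pderiv ^^ j) (scaled_poly w r P) = scaled_poly (w * r ^ j) r ((pderiv ^^ j) P)" for w r P
    by (induction j) (simp_all add: scaled_poly mult_ac)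
  have deg: "degree ((pderiv ^^ j) P) \<le> m" if "degree P \<le> m" for P :: "complex poly"
    using that by (induction j) (auto intro: degree_pderiv_le)
  have "((\<lambda>u. coeff ((pderiv ^^ j) (scaled_poly (w u) (r u) (P u))) k) \<longlongrightarrow> coeff ((pderiv ^^ j) Q) k) F" for k
  proof (induction j arbitrary: k)
    case 0
    show ?case
    proof (cases "k \<le> m")
      case True
      then show ?thesis using assms(3) by (simp add: scaled_poly)
    next
      case False
      have "coeff Q k = 0" by (rule coeff_eq_0) (use False assms(2) in linarith)
      moreover have "coeff (P u) k = 0" for u by (rule coeff_eq_0) (use False assms(1)[of u] in linarith)
      ultimately show ?thesis by (simp add: scaled_poly)
    qed
  next
    case (Suc j)
    then show ?case by (auto simp: coeff_pderiv intro!: tendsto_intros)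
  qed
  then have "((\<lambda>u. poly ((pderiv ^^ j) (scaled_poly (w u) (r u) (P u))) (x u / r u)) \<longlongrightarrow> poly ((pderiv ^^ j) Q) y) F"
    using assms by (intro poly_tendsto_coeffs[of _ m]) (auto intro!: deg degree_scaled_poly)
  then show ?thesis
    by (rule Lim_transform_eventually) (use assms(5) in \<open>auto elim!: eventually_mono simp: it scaled_poly\<close>)
qed

text \<open>The degree may drop in the limit.\<close>

lemma scaled_root_branch:
  fixes P :: "'u \<Rightarrow> complex poly"
  assumes "\<And>u. degree (P u) \<le> m" "degree Q \<le> m"
    and "\<And>k. k \<le> m \<Longrightarrow> ((\<lambda>u. w u * r u ^ k * coeff (P u) k) \<longlongrightarrow> coeff Q k) F"
    and ev: "eventually (\<lambda>u. w u \<noteq> 0 \<and> r u \<noteq> 0) F"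
    and y: "poly Q y = 0" "poly (pderiv Q) y \<noteq> 0"
  shows "\<exists>x. eventually (\<lambda>u. poly (P u) (x u) = 0) F \<and> ((\<lambda>u. x u / r u) \<longlongrightarrow> y) F"
proof -
  have evr: "eventually (\<lambda>u. r u \<noteq> 0) F" using ev by (rule eventually_mono) simp
  have y': "((\<lambda>u. y * r u / r u) \<longlongrightarrow> y) F"
  proof (rule tendsto_eventually)
    show "eventually (\<lambda>u. y * r u / r u = y) F" using evr by eventually_elim simp
  qed
  note lim = scaled_poly_pderiv_tendsto[OF assms(1-3) y' evr]
  have l0: "((\<lambda>u. poly (scaled_poly (w u) (r u) (P u)) y) \<longlongrightarrow> 0) F"
    using lim[of 0] y by (simp add: scaled_poly)
  have l1: "((\<lambda>u. poly (pderiv (scaled_poly (w u) (r u) (P u))) y) \<longlongrightarrow> poly (pderiv Q) y) F"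
    using lim[of 1] by (simp add: scaled_poly)
  define S where "S u = scaled_poly (w u) (r u) (P u)" for u
  \<comment> \<open>The root estimate is applied to the rescaled polynomials at the limit root
    \<open>y\<close>: their values there tend to 0, their derivatives to a non-zero number.\<close>
  have "\<exists>v. poly (pderiv (S u)) y \<noteq> 0 \<longrightarrow> poly (S u) v = 0 \<and> cmod (v - y) \<le> real m * cmod (poly (S u) y / poly (pderiv (S u)) y)" for u
    using poly_nearby_root[of "S u" y m] assms(1) degree_scaled_poly unfolding S_def by blast
  then obtain v where v: "\<And>u. poly (pderiv (S u)) y \<noteq> 0 \<Longrightarrow> poly (S u) (v u) = 0 \<and> cmod (v u - y) \<le> real m * cmod (poly (S u) y / poly (pderiv (S u)) y)"
    by metis
  have evd: "eventually (\<lambda>u. poly (pderiv (S u)) y \<noteq> 0) F"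
    using tendsto_imp_eventually_ne[OF l1 y(2)] by (simp add: S_def)
  have "((\<lambda>u. real m * cmod (poly (S u) y / poly (pderiv (S u)) y)) \<longlongrightarrow> real m * cmod (0 / poly (pderiv Q) y)) F"
    using l0 l1 y(2) unfolding S_def by (intro tendsto_intros)
  then have lim0: "((\<lambda>u. real m * cmod (poly (S u) y / poly (pderiv (S u)) y)) \<longlongrightarrow> 0) F"
    by simp
  have "eventually (\<lambda>u. norm (v u - y) \<le> real m * cmod (poly (S u) y / poly (pderiv (S u)) y)) F"
    using evd by eventually_elim (use v in blast)
  from Lim_null_comparison[OF this lim0] have "((\<lambda>u. v u - y) \<longlongrightarrow> 0) F" .
  then have vy: "(v \<longlongrightarrow> y) F" by (simp add: LIM_zero_iff)
  show ?thesis
  proof (intro exI[of _ "\<lambda>u. v u * r u"] conjI)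
    show "eventually (\<lambda>u. poly (P u) (v u * r u) = 0) F"
      using ev evd
    proof eventually_elim
      case (elim u)
      then have "poly (S u) (v u) = 0" using v by blast
      then show ?case using elim by (simp add: S_def scaled_poly)
    qed
    show "((\<lambda>u. v u * r u / r u) \<longlongrightarrow> y) F"
    proof (rule Lim_transform_eventually[OF vy])
      show "eventually (\<lambda>u. v u = v u * r u / r u) F" using evr by eventually_elim simp
    qed
  qed
qed

lemma tendsto_eventually_neq:
  fixes f g :: "'u \<Rightarrow> complex"
  assumes "(f \<longlongrightarrow> a) F" "(g \<longlongrightarrow> b) F" "a \<noteq> b"
  shows "eventually (\<lambda>u. f u \<noteq> g u) F"
  using tendsto_imp_eventually_ne[OF tendsto_diff[OF assms(1,2)], of 0] assms(3) by simp

text \<open>Justifies the Puiseux substitution \<open>t = u ^ m\<close>: over the complex numbers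
  every small \<open>t\<close> is such a power of a small \<open>u\<close>.\<close>

lemma tendsto_at_0_power:
  fixes g :: "complex \<Rightarrow> complex"
  assumes "((\<lambda>u. g (u ^ m)) \<longlongrightarrow> c) (at 0)" "m \<ge> 1"
  shows "(g \<longlongrightarrow> c) (at 0)"
  unfolding LIM_def
proof (intro allI impI)
  fix e :: real assume "e > 0"
  with assms(1) obtain d where d: "d > 0" "\<And>u. u \<noteq> 0 \<Longrightarrow> cmod u < d \<Longrightarrow> dist (g (u ^ m)) c < e"
    unfolding LIM_def by auto
  show "\<exists>s>0. \<forall>x. x \<noteq> 0 \<and> dist x 0 < s \<longrightarrow> dist (g x) c < e"
  proof (intro exI[of _ "d ^ m"] conjI allI impI)
    fix x :: complex assume x: "x \<noteq> 0 \<and> dist x 0 < d ^ m"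
    obtain u where u: "u ^ m = x"
      using exists_complex_root[of m x] assms(2) by (metis not_one_le_zero)
    then have "cmod u ^ m < d ^ m" using x by (auto simp: norm_power[symmetric])
    then have "cmod u < d" using d(1) by (intro power_less_imp_less_base[of "cmod u" m d]) auto
    moreover have "u \<noteq> 0" using u x assms(2) by (auto simp: zero_power)
    ultimately show "dist (g x) c < e" using d(2)[of u] u by simp
  qed (use d in simp)
qed

section \<open>Tangency polynomials of the lines through a point\<close>

context convex_foliation
begin

lemma homogeneous_line_poly_coeff:
  assumes "polyfun g" and hom: "\<And>t X. t \<noteq> 0 \<Longrightarrow> g (t *s X) = t ^ k * g X" and "j \<le> k"
  shows "coeff (line_poly g X E) (k - j) = coeff (line_poly g E X) j"
proof -
  let ?P = "line_poly g X E" and ?Q = "line_poly g E X"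
  have dP: "degree ?P \<le> k" and dQ: "degree ?Q \<le> k"
    using homogeneous_line_poly(1)[OF assms(1) hom] by blast+
  have eq: "?P = monom 1 (k - degree ?Q) * reflect_poly ?Q"
  proof (rule poly_eqI_cofinite[of "{0}"])
    fix x :: complex assume "x \<notin> {0}"
    then have x: "x \<noteq> 0" by simp
    have "X + x *s E = x *s (E + inverse x *s X)" using x by (simp add: vec_eq_iff field_simps)
    then have "g (X + x *s E) = x ^ k * g (E + inverse x *s X)" using hom[OF x] by metis
    moreover have "x ^ k = x ^ (k - degree ?Q) * x ^ degree ?Q" using dQ by (simp flip: power_add)
    ultimately show "poly ?P x = poly (monom 1 (k - degree ?Q) * reflect_poly ?Q) x"
      using x assms(1) by (simp add: poly_monom poly_reflect_poly_nz)
  qed simp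
  show ?thesis
  proof (cases "j \<le> degree ?Q")
    case True
    have "coeff ?P (k - degree ?Q + i) = coeff (reflect_poly ?Q) i" for i
      by (subst eq) (simp add: coeff_monom_mult)
    from this[of "degree ?Q - j"] show ?thesis using True dQ by (simp add: coeff_reflect_poly)
  next
    case False
    then have "k - j < k - degree ?Q" using assms(3) by simp
    then show ?thesis using False by (subst eq) (simp add: coeff_monom_mult coeff_eq_0)
  qed
qed

text \<open>Reversing the coefficients exchanges base point and direction, and in the direction the
  dependence is polynomial.\<close>

lemma polyfun_coeff_base:
  assumes "polyfun g" and hom: "\<And>t X. t \<noteq> 0 \<Longrightarrow> g (t *s X) = t ^ k * g X"
  shows "polyfun (\<lambda>X. coeff (line_poly g X E) j)"
proof (cases "j \<le> k")
  case True
  then have "coeff (line_poly g X E) j = coeff (line_poly g E X) (k - j)" for X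
    using homogeneous_line_poly_coeff[OF assms, of "k - j" X E] by simp
  then show ?thesis by (simp add: polyfun_coeff_line_poly[OF assms(1)])
next
  case False
  then have "coeff (line_poly g X E) j = 0" for X
    using homogeneous_line_poly(1)[OF assms, of X E] by (intro coeff_eq_0) simp
  then show ?thesis by (simp add: polyfun.const)
qed

text \<open>Multiplied by \<open>x\<close>, the polynomial is minus the restriction of
  \<open>om N\<close>, because \<open>\<Omega>\<close> kills the point \<open>N + x *s E\<close>
  itself. Hence the degree bound \<open>n\<close> instead of \<open>n + 1\<close>, and the top
  coefficients can be read off at \<open>E\<close>. The leading one vanishes exactly when the line
  is tangent to the foliation at \<open>E\<close>.\<close>

lemma pencil_poly:
  shows degree_pencil_poly: "degree (line_poly (om E) N E) \<le> n"
    and lead_pencil_poly: "coeff (line_poly (om E) N E) n = - om N E"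
    and sublead_pencil_poly: "coeff (line_poly (om E) N E) (n - 1) = - Am N N E"
proof -
  have "pCons 0 (line_poly (om E) N E) = - line_poly (om N) N E"
  proof (rule poly_eqI_cofinite[of "{}"])
    fix x
    have "om N (N + x *s E) + x * om E (N + x *s E) = 0"
      using om_self[of "N + x *s E"] by (simp del: om_self)
    then show "poly (pCons 0 (line_poly (om E) N E)) x = poly (- line_poly (om N) N E) x"
      by (simp add: polyfun_om eq_neg_iff_add_eq_0 add.commute)
  qed simp
  then have c: "coeff (line_poly (om E) N E) k = - coeff (line_poly (om N) N E) (Suc k)" for k
    by (metis coeff_minus coeff_pCons_Suc)
  note h = homogeneous_line_poly[OF polyfun_om om_hom, of N N E]
  show "degree (line_poly (om E) N E) \<le> n"
    by (rule degree_le) (use h(1) in \<open>auto simp: c intro!: coeff_eq_0\<close>)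
  show "coeff (line_poly (om E) N E) n = - om N E" using h(2) by (simp add: c)
  have "coeff (line_poly (om N) N E) n = coeff (line_poly (om N) E N) 1"
    using homogeneous_line_poly_coeff[OF polyfun_om om_hom, of 1 N N E] by simp
  then show "coeff (line_poly (om E) N E) (n - 1) = - Am N N E"
    using n_pos line_poly_coeff_1[OF polyfun_om, of N E N] by (simp add: c Am_def)
qed

lemma Infl_nonzero_off:
  assumes "\<forall>L\<in>Inv. nv L \<odot> X \<noteq> 0" shows "Infl X \<noteq> 0"
  using Infl_product assms fin_inv by auto

end

section \<open>The trace in a pencil of lines\<close>

locale convex_prefoliation = convex_foliation +
  fixes l :: "complex^3"
  assumes l_nonzero: "l \<noteq> 0" and l_inv: "invariant_line \<Omega> (line_of l)"

locale good_pencil = convex_prefoliation +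
  fixes E :: "complex^3"
  assumes good: "bad_poly E \<noteq> 0"
begin

lemma E_off: "\<forall>L\<in>Inv. nv L \<odot> E \<noteq> 0" using good bad_poly_nonzero_iff by blast

lemma E_not_mem: "L \<in> Inv \<Longrightarrow> E \<notin> L"
  using E_off mem_line[OF Inv_lines] by blast

lemma lE: "l \<odot> E \<noteq> 0"
  using E_not_mem[of "line_of l"] l_inv by (simp add: line_of_def)

lemma rep_om: "a \<in> PP \<Longrightarrow> om (rep a) E \<noteq> 0" using good bad_poly_nonzero_iff by blast

lemma rep_H: "a \<in> PP \<Longrightarrow> H (tau (rep a)) (rep a) E \<noteq> 0" using good bad_poly_nonzero_iff by blast

text \<open>A line through \<open>E\<close> cannot be tangent to the foliation at a regular point of
  an invariant line, as it is transverse to that line. So \<open>Infl X \<noteq> 0\<close> and the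
  contact is simple. For the invariant line \<open>l\<close> it follows that no denominator of the
  trace vanishes at a regular tangency point.\<close>

lemma regular_simple:
  assumes "tri X E N' \<noteq> 0" "om E X = 0" "\<Omega> X \<noteq> 0"
  shows "Am E E X \<noteq> 0" "l \<odot> X \<noteq> 0"
proof -
  have off: "X \<notin> L" if "L \<in> Inv" for L
    using transverse_imp_singular[OF that _ E_not_mem[OF that] assms(2)] assms(3) by blast
  then have "Infl X \<noteq> 0" using Infl_nonzero_off mem_line[OF Inv_lines] by blast
  then show "Am E E X \<noteq> 0" using Infl_frame[of X E N'] assms by auto
  show "l \<odot> X \<noteq> 0" using off[of "line_of l"] l_inv by (simp add: line_of_def)
qed

definition f1 where "f1 = dird (om E) E"
definition f2 where "f2 = dird f1 E"
definition f3 where "f3 = dird f2 E"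

lemma polyfun_f: "polyfun f1" "polyfun f2" "polyfun f3"
  unfolding f3_def f2_def f1_def by (intro polyfun_dird polyfun_om)+

lemma f1_Am: "f1 X = Am E E X" by (simp add: f1_def Am_def)

lemma pderiv_pencil_poly:
  "poly ((pderiv ^^ 0) (line_poly (om E) N E)) x = om E (N + x *s E)"
  "poly ((pderiv ^^ 1) (line_poly (om E) N E)) x = f1 (N + x *s E)"
  "poly (pderiv (line_poly (om E) N E)) x = f1 (N + x *s E)"
  "poly ((pderiv ^^ 2) (line_poly (om E) N E)) x = f2 (N + x *s E)"
  "poly ((pderiv ^^ 3) (line_poly (om E) N E)) x = f3 (N + x *s E)"
  using polyfun_f by (simp_all add: numeral_2_eq_2 numeral_3_eq_3 pderiv_line_poly polyfun_om f1_def f2_def f3_def)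

text \<open>At a simple root of the tangency polynomial, let \<open>P\<close> be its product with the equation of \<open>l\<close>.
  Then the second factor below is \<open>P''' / (6 P')\<close>; the first one is the second derivative of the
  corresponding leaf of the dual web.\<close>

definition phi :: "complex^3 \<Rightarrow> complex^3 \<Rightarrow> complex" where
  "phi N' X = om N' X / f1 X * (f3 X / (6 * f1 X) + f2 X / (2 * f1 X) * (l \<odot> E) / (l \<odot> X))"

definition rts :: "complex^3 \<Rightarrow> complex set" where "rts N = {x. om E (N + x *s E) = 0}"

text \<open>\<open>N\<close> determines the line and \<open>N'\<close> the direction in which it
  turns. The value is linear in \<open>N'\<close>: a 1-form on the pencil.\<close>

definition T :: "complex^3 \<Rightarrow> complex^3 \<Rightarrow> complex" where
  "T N N' = (\<Sum>x\<in>rts N. phi N' (N + x *s E))"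

lemma T_shift: "T (N + c *s E) N' = T N N'"
proof -
  show ?thesis unfolding T_def rts_def
    by (intro sum.reindex_bij_witness[of _ "\<lambda>x. x - c" "\<lambda>x. x + c"])
      (auto simp: vector_sadd_rdistrib add_ac)
qed

lemma rts_finite:
  assumes "om N E \<noteq> 0"
  shows "finite (rts N)" "card (rts N) \<le> n"
proof -
  let ?P = "line_poly (om E) N E"
  have P: "?P \<noteq> 0" using lead_pencil_poly[of E N] assms by auto
  have "rts N = {x. poly ?P x = 0}" by (simp add: rts_def polyfun_om)
  then show "finite (rts N)" "card (rts N) \<le> n"
    using poly_roots_finite[OF P] card_poly_roots_bound[OF P] degree_pencil_poly[of E N] by auto
qed

text \<open>There are at most \<open>n\<close> tangency points, so \<open>n\<close> distinct
  branches exhaust them. The index type is free in order to join several families of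
  branches.\<close>

lemma T_branches:
  assumes I: "finite I" "card I = n"
    and lead: "eventually (\<lambda>u. om (N u) E \<noteq> 0) F"
    and root: "\<And>i. i \<in> I \<Longrightarrow> eventually (\<lambda>u. om E (N u + x i u *s E) = 0) F"
    and dist: "\<And>i j. i \<in> I \<Longrightarrow> j \<in> I \<Longrightarrow> i \<noteq> j \<Longrightarrow> eventually (\<lambda>u. x i u \<noteq> x j u) F"
  shows "eventually (\<lambda>u. T (N u) N' = (\<Sum>i\<in>I. phi N' (N u + x i u *s E))) F"
proof -
  have "eventually (\<lambda>u. \<forall>i\<in>I. om E (N u + x i u *s E) = 0) F"
    using root I(1) by (simp add: eventually_ball_finite)
  moreover have "eventually (\<lambda>u. \<forall>i\<in>I. \<forall>j\<in>I. i \<noteq> j \<longrightarrow> x i u \<noteq> x j u) F"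
  proof (intro eventually_ball_finite I(1) ballI)
    show "eventually (\<lambda>u. i \<noteq> j \<longrightarrow> x i u \<noteq> x j u) F" if "i \<in> I" "j \<in> I" for i j
      using dist[OF that] by (cases "i = j") auto
  qed
  ultimately show ?thesis using lead
  proof eventually_elim
    case (elim u)
    then have inj: "inj_on (\<lambda>i. x i u) I" by (auto simp: inj_on_def)
    have "(\<lambda>i. x i u) ` I = rts (N u)"
      using rts_finite[OF elim(3)] elim(1) card_image[OF inj] I
      by (intro card_seteq) (auto simp: rts_def)
    then show ?case unfolding T_def using inj by (simp add: sum.reindex flip: \<open>(\<lambda>i. x i u) ` I = rts (N u)\<close>)
  qed
qed

end

lemma tendsto_pencil_point:
  assumes "(t \<longlongrightarrow> a) F" "(x \<longlongrightarrow> b) F"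
  shows "((\<lambda>u. N + t u *s N' + x u *s E) \<longlongrightarrow> N + a *s N' + b *s (E :: complex^3)) F"
    "((\<lambda>u. N + t u *s N') \<longlongrightarrow> N + a *s (N' :: complex^3)) F"
  using assms by (auto intro!: vec_tendstoI tendsto_add tendsto_mult)

lemma tendsto_at_0_pow: "m \<ge> 1 \<Longrightarrow> ((\<lambda>u. u ^ m) \<longlongrightarrow> 0) (at (0::complex))"
  using tendsto_power[OF tendsto_ident_at[of "0 :: complex" UNIV], of m] by (simp add: zero_power)

lemma eventually_at_0_nonzero: "eventually (\<lambda>u::complex. u \<noteq> 0) (at 0)"
  by (simp add: eventually_at_filter)

lemma filterlim_pow_at_0: "m \<ge> 1 \<Longrightarrow> filterlim (\<lambda>u::complex. u ^ m) (at 0) (at 0)"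
  using tendsto_at_0_pow[of m] by (auto simp: filterlim_at eventually_at_filter)

section \<open>The trace at lines without singular points\<close>

context good_pencil
begin

lemma coeff_pencil_tendsto:
  assumes "(t \<longlongrightarrow> 0) F"
  shows "((\<lambda>u. coeff (line_poly (om W) (N + t u *s N') E) k) \<longlongrightarrow> coeff (line_poly (om W) N E) k) F"
  using polyfun_tendsto[OF polyfun_coeff_base[OF polyfun_om om_hom] tendsto_pencil_point(2)[OF assms assms]]
  by simp

text \<open>Implicit differentiation at a simple root: with \<open>Q\<close> the cofactor of the
  root and \<open>G\<close> the divided difference in \<open>u\<close>, the equation reads
  \<open>(y u - i) * poly Q (y u) + u * G u (y u) = 0\<close>, so the difference quotient of
  \<open>y\<close> has a limit.\<close>

lemma branch_deriv:
  assumes y: "(y \<longlongrightarrow> i) (at 0)" "y 0 = i" "eventually (\<lambda>u. om E (N + u *s N' + y u *s E) = 0) (at 0)"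
    and i: "om E (N + i *s E) = 0" "f1 (N + i *s E) \<noteq> 0"
  shows "\<exists>D. (y has_field_derivative D) (at 0)"
proof -
  obtain G where G: "\<And>t x a b. ((t::complex\<Rightarrow>complex) \<longlongrightarrow> a) (at 0) \<Longrightarrow> (x \<longlongrightarrow> b) (at 0) \<Longrightarrow> ((\<lambda>u. G (t u) (x u)) \<longlongrightarrow> G a b) (at 0)"
     "\<And>t x. om E (N + t *s N' + x *s E) = om E (N + x *s E) + t * G t x"
    using polyfun_scaled_difference[OF polyfun_om, of E N N' E] by metis
  let ?P = "line_poly (om E) N E"
  have "poly ?P i = 0" using i by (simp add: polyfun_om)
  then obtain Q where Q: "?P = [:-i, 1:] * Q" using poly_eq_0_iff_dvd by (metis dvdE)
  have "poly (pderiv ?P) i = poly Q i"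
    unfolding Q pderiv_mult by (simp add: pderiv_pCons)
  then have Qi: "poly Q i \<noteq> 0" using i(2) pderiv_pencil_poly(3)[of N i] by simp
  have lim: "((\<lambda>u. - G u (y u) / poly Q (y u)) \<longlongrightarrow> - G 0 i / poly Q i) (at 0)"
    using Qi y(1) G(1) by (intro tendsto_intros) auto
  have "eventually (\<lambda>u. poly Q (y u) \<noteq> 0) (at 0)"
    using tendsto_imp_eventually_ne[OF tendsto_poly[OF y(1)] Qi] by simp
  then have "eventually (\<lambda>u. - G u (y u) / poly Q (y u) = (y (0 + u) - y 0) / u) (at 0)"
    using y(3) eventually_at_0_nonzero
  proof eventually_elim
    case (elim u)
    have "om E (N + y u *s E) = (y u - i) * poly Q (y u)"
      using poly_line_poly[OF polyfun_om, of E N E "y u"] unfolding Q by (simp add: algebra_simps)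
    then have "(y u - i) * poly Q (y u) + u * G u (y u) = 0" using elim(2) G(2)[of u "y u"] by simp
    then show ?case using elim y(2) by (simp add: field_simps eq_neg_iff_add_eq_0)
  qed
  from Lim_transform_eventually[OF lim this] have "(y has_field_derivative (- G 0 i / poly Q i)) (at 0)"
    by (simp add: DERIV_def)
  then show ?thesis by blast
qed

lemma polyfun_curve_differentiable:
  assumes "polyfun g" "(y has_field_derivative D) (at 0)"
  shows "(\<lambda>u. g (N + u *s N' + y u *s E)) field_differentiable at 0"
proof -
  have "((\<lambda>u. (N + u *s N' + y u *s E) $ j) has_field_derivative (N' + D *s E) $ j) (at 0)" for j
    using assms(2) by (auto intro!: derivative_eq_intros)
  from polyfun_chain[OF assms(1) this] show ?thesis by (auto simp: field_differentiable_def)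
qed

lemma regular_differentiable:
  assumes D: "tri N E N' \<noteq> 0" and lead: "om N E \<noteq> 0" and reg: "\<And>x. \<Omega> (N + x *s E) \<noteq> 0"
  shows "(\<lambda>t. T (N + t *s N') N') field_differentiable at 0"
proof -
  let ?P = "line_poly (om E) N E"
  have simple: "f1 (N + x *s E) \<noteq> 0" "l \<odot> (N + x *s E) \<noteq> 0" if "om E (N + x *s E) = 0" for x
    using regular_simple[of "N + x *s E" N'] D that reg by (simp_all add: f1_Am)
  have P0: "?P \<noteq> 0" and degP: "degree ?P = n"
    using lead_pencil_poly[of E N] degree_pencil_poly[of E N] lead by (auto simp: le_antisym le_degree)
  have rt: "rts N = {x. poly ?P x = 0}" by (simp add: rts_def polyfun_om)
  have fin: "finite (rts N)" using rts_finite lead by blast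
  have cd: "card (rts N) = n"
    unfolding rt degP[symmetric]
    by (rule card_simple_roots[OF P0]) (simp add: pderiv_pencil_poly polyfun_om simple)
  have "\<exists>x. eventually (\<lambda>u. om E (N + u *s N' + x u *s E) = 0) (at 0) \<and> (x \<longlongrightarrow> i) (at 0)" if "i \<in> rts N" for i
    using scaled_root_branch[of "\<lambda>u. line_poly (om E) (N + u *s N') E" n ?P "\<lambda>_. 1" "\<lambda>_. 1" "at 0" i]
      degree_pencil_poly coeff_pencil_tendsto[OF tendsto_ident_at] that simple
    by (simp add: pderiv_pencil_poly polyfun_om rts_def)
  then have "\<forall>i\<in>rts N. \<exists>x. eventually (\<lambda>u. om E (N + u *s N' + x u *s E) = 0) (at 0) \<and> (x \<longlongrightarrow> i) (at 0)"
    by blast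
  from bchoice[OF this] obtain x where x: "\<And>i. i \<in> rts N \<Longrightarrow> eventually (\<lambda>u. om E (N + u *s N' + x i u *s E) = 0) (at 0)"
    "\<And>i. i \<in> rts N \<Longrightarrow> (x i \<longlongrightarrow> i) (at 0)" by blast
  \<comment> \<open>The branches are known only along \<open>at 0\<close>; at \<open>u = 0\<close>
    the root itself is filled in, so that the sum formula holds in a full neighbourhood.\<close>
  define y where "y i u = (if u = 0 then i else x i u)" for i u
  have y: "eventually (\<lambda>u. om E (N + u *s N' + y i u *s E) = 0) (at 0)" "(y i \<longlongrightarrow> i) (at 0)" if "i \<in> rts N" for i
  proof -
    have "eventually (\<lambda>u. x i u = y i u) (at 0)"
      using eventually_at_0_nonzero by eventually_elim (simp add: y_def)
    note ev = this
    show "(y i \<longlongrightarrow> i) (at 0)" using Lim_transform_eventually[OF x(2)[OF that] ev] .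
    show "eventually (\<lambda>u. om E (N + u *s N' + y i u *s E) = 0) (at 0)"
      using x(1)[OF that] ev by eventually_elim simp
  qed
  have "eventually (\<lambda>u. T (N + u *s N') N' = (\<Sum>i\<in>rts N. phi N' (N + u *s N' + y i u *s E))) (at 0)"
  proof (rule T_branches[OF fin cd])
    have "((\<lambda>u. om N E + u * om N' E) \<longlongrightarrow> om N E + 0 * om N' E) (at 0)"
      by (intro tendsto_intros)
    then have "((\<lambda>u. om (N + u *s N') E) \<longlongrightarrow> om N E) (at 0)" by simp
    from tendsto_imp_eventually_ne[OF this lead] show "eventually (\<lambda>u. om (N + u *s N') E \<noteq> 0) (at 0)" .
  qed (use y tendsto_eventually_neq in blast)+
  moreover have "T (N + 0 *s N') N' = (\<Sum>i\<in>rts N. phi N' (N + 0 *s N' + y i 0 *s E))"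
    by (simp add: T_def y_def)
  ultimately have ev: "eventually (\<lambda>u. T (N + u *s N') N' = (\<Sum>i\<in>rts N. phi N' (N + u *s N' + y i u *s E))) (nhds 0)"
    by (simp add: eventually_nhds_conv_at)
  have "(\<lambda>u. phi N' (N + u *s N' + y i u *s E)) field_differentiable at 0" if i: "i \<in> rts N" for i
  proof -
    have i': "om E (N + i *s E) = 0" using i by (simp add: rts_def)
    obtain D where D: "(y i has_field_derivative D) (at 0)"
      using branch_deriv[OF y(2)[OF i] _ y(1)[OF i] i' simple(1)[OF i']] by (auto simp: y_def[of i 0])
    note d = polyfun_curve_differentiable[OF _ D]
    have lp: "polyfun (\<lambda>X. l \<odot> X)" by (intro polyfun_intros)
    show ?thesis unfolding phi_def
      by (intro derivative_intros d polyfun_om polyfun_f lp) (use simple[OF i'] in \<open>simp_all add: y_def\<close>)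
  qed
  then have "(\<lambda>u. \<Sum>i\<in>rts N. phi N' (N + u *s N' + y i u *s E)) field_differentiable at 0"
    by (intro field_differentiable_sum)
  then show ?thesis unfolding field_differentiable_def using DERIV_cong_ev[OF refl ev refl] by blast
qed

lemma phi_regular_limit:
  assumes D: "tri N E N' \<noteq> 0" and i: "om E (N + i *s E) = 0" "\<Omega> (N + i *s E) \<noteq> 0"
    and t: "(t \<longlongrightarrow> 0) F" and x: "(x \<longlongrightarrow> i) F"
  shows "((\<lambda>u. t u * phi N' (N + t u *s N' + x u *s E)) \<longlongrightarrow> 0) F"
proof -
  have nz: "f1 (N + i *s E) \<noteq> 0" "l \<odot> (N + i *s E) \<noteq> 0"
    using regular_simple[of "N + i *s E" N'] D i by (simp_all add: f1_Am)
  have lim: "((\<lambda>u. g (N + t u *s N' + x u *s E)) \<longlongrightarrow> g (N + i *s E)) F" if "polyfun g" for g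
    using polyfun_tendsto[OF that tendsto_pencil_point(1)[OF t x]] by simp
  have lp: "polyfun (\<lambda>X. l \<odot> X)" by (intro polyfun_intros)
  have "((\<lambda>u. t u * phi N' (N + t u *s N' + x u *s E)) \<longlongrightarrow> 0 * phi N' (N + i *s E)) F"
    unfolding phi_def by (intro tendsto_intros t lim polyfun_om polyfun_f lp) (use nz in auto)
  then show ?thesis by simp
qed

end

context convex_prefoliation
begin

text \<open>The residue of the trace at the line through \<open>E\<close> and the singular point \<open>s\<close>.\<close>

definition res_const :: "complex^3 \<Rightarrow> complex" where
  "res_const s = (if l \<odot> s = 0 then (of_nat (tau s) - 1) * (of_nat (tau s) + 1) / 6
     else (of_nat (tau s) - 1) * (of_nat (tau s) - 2) / 6)"

lemma res_const_scale: "m \<noteq> 0 \<Longrightarrow> res_const (m *s s) = res_const s"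
  by (simp add: res_const_def tau_scale)

end

section \<open>Residues at the lines through singular points\<close>

context good_pencil
begin

lemma lead_eventually:
  assumes "om N E \<noteq> 0" "(t \<longlongrightarrow> 0) F"
  shows "eventually (\<lambda>u. om (N + t u *s N') E \<noteq> 0) F"
proof -
  have "((\<lambda>u. om N E + t u * om N' E) \<longlongrightarrow> om N E + 0 * om N' E) F"
    using assms(2) by (intro tendsto_intros)
  then have "((\<lambda>u. om (N + t u *s N') E) \<longlongrightarrow> om N E) F" by simp
  from tendsto_imp_eventually_ne[OF this assms(1)] show ?thesis .
qed

text \<open>As \<open>t\<close> tends to 0, exactly \<open>tau s\<close> roots tend to 0. With
  \<open>t = u ^ tau s\<close> they are asymptotic to \<open>y * u\<close> for the roots
  \<open>y\<close> of a binomial, and each contributes the same share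
  \<open>res_const s / of_nat (tau s)\<close>. The other roots stay simple and contribute
  nothing.\<close>

lemma singular_limit:
  assumes s: "sing s" and D: "tri s E N' \<noteq> 0" and lead: "om s E \<noteq> 0" and Ht: "H (tau s) s E \<noteq> 0"
    and reg: "\<And>x. x \<noteq> 0 \<Longrightarrow> \<Omega> (s + x *s E) \<noteq> 0"
  shows "((\<lambda>t. t * T (s + t *s N') N') \<longlongrightarrow> res_const s) (at 0)"
proof -
  define m where "m = tau s"
  have m1: "m \<ge> 1" using tau_pos[OF s] by (simp add: m_def)
  define P where "P t = line_poly (om E) (s + t *s N') E" for t
  have P0: "P 0 = line_poly (om E) s E" by (simp add: P_def)
  define h where "h = H m s E"
  define g1 where "g1 = Am N' E s"
  have h0: "h \<noteq> 0" using Ht by (simp add: h_def m_def)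
  have ck: "coeff (P 0) k = H k s E" for k by (simp add: P0 H_def)
  have ck0: "coeff (P 0) k = 0" if "k < m" for k using that below_tau by (simp add: ck m_def)
  obtain R where R: "P 0 = monom 1 m * R" "poly R 0 = h" using X_dvd_ex[of m "P 0"] ck0 by (auto simp: ck h_def)
  have degP: "degree (P t) \<le> n" for t unfolding P_def by (rule degree_pencil_poly)
  have degP0: "degree (P 0) = n"
    using lead_pencil_poly[of E s] degree_pencil_poly[of E s] lead by (auto simp: P0 le_antisym le_degree)
  have simple: "f1 (s + x *s E) \<noteq> 0" if "om E (s + x *s E) = 0" "x \<noteq> 0" for x
    using regular_simple[of "s + x *s E" N'] D that reg by (simp add: f1_Am)
  define R1 where "R1 = rts s - {0}"
  have rt: "rts s = {x. poly (P 0) x = 0}" by (simp add: rts_def polyfun_om P0)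
  have "P 0 = [:-0, 1:] ^ m * R" using R(1) by (simp add: monom_altdef)
  from card_other_simple_roots[OF this] have card1: "card R1 + m = n"
    using R(2) h0 simple unfolding R1_def rt degP0 
    by (simp add: P0 pderiv_pencil_poly polyfun_om)
  have fin1: "finite R1" using rts_finite[OF lead] by (simp add: R1_def)
  \<comment> \<open>With the weights \<open>u ^ k / u ^ m\<close> only two coefficients survive: the
    lowest one of \<open>P 0\<close>, and the constant one, which is of first order in
    \<open>t\<close> with derivative \<open>g1\<close>. For \<open>m \<ge> 2\<close> the singularity
    is radial, so \<open>g1 \<noteq> 0\<close> and the roots of \<open>Q\<close> are simple.\<close>
  define Q where "Q = monom h m + [:g1:]"
  have Qp: "poly Q y = h * y ^ m + g1" for y by (simp add: Q_def poly_monom)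
  have dQ: "pderiv Q = monom (of_nat m * h) (m - 1)"
    by (simp add: Q_def pderiv_add pderiv_monom pderiv_pCons)
  have Q1: "poly (pderiv Q) y = of_nat m * h * y ^ (m - 1)" for y by (simp add: dQ poly_monom)
  have g1: "g1 \<noteq> 0" if "m \<ge> 2" 
    using rotation_nonzero[OF s D E_off] that by (simp add: m_def g1_def)
  have Qs: "poly (pderiv Q) y \<noteq> 0" if "poly Q y = 0" for y
    using that h0 m1 g1 by (cases "m = 1") (auto simp: Qp Q1 zero_power)
  have degQ: "degree Q = m"
    unfolding Q_def using m1 h0 by (subst degree_add_eq_left) (auto simp: degree_monom_eq)
  then have Q0: "Q \<noteq> 0" using m1 by auto
  define R2 where "R2 = {y. poly Q y = 0}"
  have card2: "card R2 = m" unfolding R2_def degQ[symmetric] by (rule card_simple_roots[OF Q0 Qs])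
  have fin2: "finite R2" using poly_roots_finite[OF Q0] by (simp add: R2_def)
  define t where "t u = u ^ m" for u :: complex
  have t0: "(t \<longlongrightarrow> 0) (at 0)" unfolding t_def by (rule tendsto_at_0_pow[OF m1])
  have cdiff: "((\<lambda>u. (coeff (P (t u)) k - coeff (P 0) k) / t u) \<longlongrightarrow> dird (\<lambda>X. coeff (line_poly (om E) X E) k) N' s) (at 0)" for k
  proof -
    have "((\<lambda>h. coeff (P h) k) has_field_derivative dird (\<lambda>X. coeff (line_poly (om E) X E) k) N' (s + 0 *s N')) (at 0)"
      unfolding P_def by (rule dird_line[OF polyfun_coeff_base[OF polyfun_om om_hom]])
    then have "((\<lambda>h. (coeff (P h) k - coeff (P 0) k) / h) \<longlongrightarrow> dird (\<lambda>X. coeff (line_poly (om E) X E) k) N' s) (at 0)"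
      by (simp add: DERIV_def)
    from filterlim_compose[OF this filterlim_pow_at_0[OF m1]] show ?thesis by (simp add: t_def)
  qed
  have d0: "dird (\<lambda>X. coeff (line_poly (om E) X E) 0) N' s = g1"
    using line_poly_coeff_0[OF polyfun_om] by (simp add: g1_def Am_def)
  have coeffs: "((\<lambda>u. (1 / t u) * u ^ k * coeff (P (t u)) k) \<longlongrightarrow> coeff Q k) (at 0)" for k
  proof (cases "k < m")
    case True
    have "((\<lambda>u. u ^ k * ((coeff (P (t u)) k - coeff (P 0) k) / t u)) \<longlongrightarrow> 0 ^ k * dird (\<lambda>X. coeff (line_poly (om E) X E) k) N' s) (at 0)"
      by (intro tendsto_intros cdiff)
    moreover have "coeff Q k = 0 ^ k * dird (\<lambda>X. coeff (line_poly (om E) X E) k) N' s"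
      using True d0 by (cases k) (auto simp: Q_def)
    ultimately show ?thesis using True by (simp add: ck0 mult.commute)
  next
    case False
    have c: "((\<lambda>u. coeff (P (t u)) k) \<longlongrightarrow> coeff (P 0) k) (at 0)"
      unfolding P_def using coeff_pencil_tendsto[OF t0] by simp
    have "((\<lambda>u. u ^ (k - m) * coeff (P (t u)) k) \<longlongrightarrow> 0 ^ (k - m) * coeff (P 0) k) (at 0)"
      by (intro tendsto_intros c)
    moreover have "0 ^ (k - m) * coeff (P 0) k = coeff Q k"
      using False m1 by (cases "k = m") (auto simp: Q_def ck h_def coeff_pCons split: nat.splits)
    moreover have "eventually (\<lambda>u. u ^ (k - m) * coeff (P (t u)) k = (1 / t u) * u ^ k * coeff (P (t u)) k) (at 0)"
      using eventually_at_0_nonzero by eventually_elim (use False in \<open>simp add: t_def power_diff\<close>)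
    ultimately show ?thesis by (auto intro: Lim_transform_eventually)
  qed
  have degQn: "degree Q \<le> n" using degQ card1 by simp
  have evw: "eventually (\<lambda>u::complex. 1 / t u \<noteq> 0 \<and> u \<noteq> 0) (at 0)"
    using eventually_at_0_nonzero by eventually_elim (simp add: t_def)
  have "\<exists>x. eventually (\<lambda>u. poly (P (t u)) (x u) = 0) (at 0) \<and> ((\<lambda>u. x u / u) \<longlongrightarrow> y) (at 0)" if "y \<in> R2" for y
    using scaled_root_branch[of "\<lambda>u. P (t u)" n Q "\<lambda>u. 1 / t u" "\<lambda>u. u" "at 0" y, OF degP degQn coeffs evw] that Qs
    by (simp add: R2_def)
  then have "\<forall>y\<in>R2. \<exists>x. eventually (\<lambda>u. poly (P (t u)) (x u) = 0) (at 0) \<and> ((\<lambda>u. x u / u) \<longlongrightarrow> y) (at 0)" by blast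
  from bchoice[OF this] obtain x2 where x2: "\<And>y. y \<in> R2 \<Longrightarrow> eventually (\<lambda>u. poly (P (t u)) (x2 y u) = 0) (at 0)"
     "\<And>y. y \<in> R2 \<Longrightarrow> ((\<lambda>u. x2 y u / u) \<longlongrightarrow> y) (at 0)" by blast
  have x20: "(x2 y \<longlongrightarrow> 0) (at 0)" if "y \<in> R2" for y
  proof -
    have "((\<lambda>u. u * (x2 y u / u)) \<longlongrightarrow> 0 * y) (at 0)" by (intro tendsto_intros x2 that)
    moreover have "eventually (\<lambda>u. u * (x2 y u / u) = x2 y u) (at 0)"
      using eventually_at_0_nonzero by eventually_elim simp
    ultimately show ?thesis by (auto intro: Lim_transform_eventually)
  qed
  have "\<exists>x. eventually (\<lambda>u. poly (P (t u)) (x u) = 0) (at 0) \<and> (x \<longlongrightarrow> i) (at 0)" if "i \<in> R1" for i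
    using scaled_root_branch[of "\<lambda>u. P (t u)" n "P 0" "\<lambda>_. 1" "\<lambda>_. 1" "at 0" i] degP
      coeff_pencil_tendsto[OF t0] that simple
    by (simp add: R1_def rt) (simp add: P_def pderiv_pencil_poly polyfun_om)
  then have "\<forall>i\<in>R1. \<exists>x. eventually (\<lambda>u. poly (P (t u)) (x u) = 0) (at 0) \<and> (x \<longlongrightarrow> i) (at 0)" by blast
  from bchoice[OF this] obtain x1 where x1: "\<And>i. i \<in> R1 \<Longrightarrow> eventually (\<lambda>u. poly (P (t u)) (x1 i u) = 0) (at 0)"
     "\<And>i. i \<in> R1 \<Longrightarrow> (x1 i \<longlongrightarrow> i) (at 0)" by blast
  define x where "x = case_sum x1 x2"
  have rootP: "poly (P (t u)) z = om E (s + t u *s N' + z *s E)" for u z by (simp add: P_def polyfun_om)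
  have ev: "eventually (\<lambda>u. T (s + t u *s N') N' = (\<Sum>i\<in>R1 <+> R2. phi N' (s + t u *s N' + x i u *s E))) (at 0)"
  proof (rule T_branches)
    show "finite (R1 <+> R2)" "card (R1 <+> R2) = n" using fin1 fin2 card1 card2 by (simp_all add: card_Plus)
    show "eventually (\<lambda>u. om (s + t u *s N') E \<noteq> 0) (at 0)" using lead_eventually[OF lead t0] .
    show "eventually (\<lambda>u. om E (s + t u *s N' + x i u *s E) = 0) (at 0)" if "i \<in> R1 <+> R2" for i
      using that x1(1) x2(1) by (auto simp: x_def rootP)
    show "eventually (\<lambda>u. x i u \<noteq> x j u) (at 0)" if "i \<in> R1 <+> R2" "j \<in> R1 <+> R2" "i \<noteq> j" for i j
    proof -
      have 12: "eventually (\<lambda>u. x1 a u \<noteq> x2 b u) (at 0)" if "a \<in> R1" "b \<in> R2" for a b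
        using tendsto_eventually_neq[OF x1(2) x20] that by (auto simp: R1_def)
      have 22: "eventually (\<lambda>u. x2 a u \<noteq> x2 b u) (at 0)" if "a \<in> R2" "b \<in> R2" "a \<noteq> b" for a b
        using tendsto_eventually_neq[OF x2(2)[OF that(1)] x2(2)[OF that(2)] that(3)] by (rule eventually_mono) auto
      have 11: "eventually (\<lambda>u. x1 a u \<noteq> x1 b u) (at 0)" if "a \<in> R1" "b \<in> R1" "a \<noteq> b" for a b
        using tendsto_eventually_neq[OF x1(2)[OF that(1)] x1(2)[OF that(2)] that(3)] .
      have 21: "eventually (\<lambda>u. x2 b u \<noteq> x1 a u) (at 0)" if "a \<in> R1" "b \<in> R2" for a b
        using 12[OF that] by (rule eventually_mono) auto
      show ?thesis using that by (cases i; cases j) (auto simp: x_def intro: 11 22 12 21)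
    qed
  qed
  have lim1: "((\<lambda>u. t u * phi N' (s + t u *s N' + x1 i u *s E)) \<longlongrightarrow> 0) (at 0)" if "i \<in> R1" for i
    using phi_regular_limit[OF D _ _ t0 x1(2)[OF that], of] that reg by (auto simp: R1_def rts_def)
  have lim2: "((\<lambda>u. t u * phi N' (s + t u *s N' + x2 y u *s E)) \<longlongrightarrow> res_const s / of_nat m) (at 0)" if y: "y \<in> R2" for y
  proof -
    define Y where "Y u = s + t u *s N' + x2 y u *s E" for u
    have Ys: "(Y \<longlongrightarrow> s) (at 0)" unfolding Y_def using tendsto_pencil_point(1)[OF t0 x20[OF y]] by simp
    have Ylim: "((\<lambda>u. g (Y u)) \<longlongrightarrow> g s) (at 0)" if "polyfun g" for g using polyfun_tendsto[OF that Ys] .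
    have om0: "om V s = 0" for V using s by (simp add: sing_def om_def)
    note F = scaled_poly_pderiv_tendsto[of "\<lambda>u. P (t u)" n Q "\<lambda>u. 1 / t u" "\<lambda>u. u" "at 0" "x2 y" y,
        OF degP degQn coeffs x2(2)[OF y] eventually_at_0_nonzero]
    have F1: "((\<lambda>u. 1 / t u * u * f1 (Y u)) \<longlongrightarrow> poly (pderiv Q) y) (at 0)"
      using F[of 1] by (simp add: P_def pderiv_pencil_poly Y_def)
    have F2: "((\<lambda>u. 1 / t u * u\<^sup>2 * f2 (Y u)) \<longlongrightarrow> poly (pderiv (pderiv Q)) y) (at 0)"
      using F[of 2] unfolding P_def pderiv_pencil_poly by (simp add: Y_def numeral_2_eq_2)
    have F3: "((\<lambda>u. 1 / t u * u ^ 3 * f3 (Y u)) \<longlongrightarrow> poly (pderiv (pderiv (pderiv Q))) y) (at 0)"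
      using F[of 3] unfolding P_def pderiv_pencil_poly by (simp add: Y_def numeral_3_eq_3)
    have Qy: "poly Q y = 0" "poly (pderiv Q) y \<noteq> 0" using y Qs by (auto simp: R2_def)
    show ?thesis
    proof (cases "m = 1")
      case True
      have cst0: "res_const s = 0" using True by (simp add: res_const_def m_def)
      have tu: "t u = u" for u using True by (simp add: t_def)
      have f1s: "f1 s \<noteq> 0" using h0 H_1[of s E] True by (simp add: h_def f1_Am)
      have lY: "l \<odot> Y u = l \<odot> s + u * (l \<odot> N') + x2 y u * (l \<odot> E)" for u by (simp add: Y_def tu)
      \<comment> \<open>Since \<open>f1 s \<noteq> 0\<close>, only the denominator
        \<open>l \<odot> Y u\<close> could produce a pole, namely when \<open>l\<close> passes
        through \<open>s\<close>. It then vanishes to first order only, and \<open>om N'\<close>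
        vanishes at \<open>s\<close>.\<close>
      have "((\<lambda>u. u / (l \<odot> Y u) * om N' (Y u)) \<longlongrightarrow> 0) (at 0)"
      proof (cases "l \<odot> s = 0")
        case False
        have "((\<lambda>u. u / (l \<odot> Y u) * om N' (Y u)) \<longlongrightarrow> 0 / (l \<odot> s) * om N' s) (at 0)"
          using False by (intro tendsto_intros Ylim polyfun_om polyfun_intros)
        then show ?thesis by simp
      next
        case ls: True
        have r: "l \<odot> N' + y * (l \<odot> E) \<noteq> 0"
        proof
          assume 0: "l \<odot> N' + y * (l \<odot> E) = 0"
          text \<open>The direction \<open>V\<close> of the line \<open>l\<close> at \<open>s\<close> would be an eigenvector for the eigenvalue 0 of the linear part of the foliation.\<close>
          define V where "V = N' + y *s E"
          have V: "Am V E s = 0"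
            using Qy(1) H_1[of s E] True by (simp add: V_def Qp g1_def h_def algebra_simps)
          have lV: "l \<odot> V = 0" using 0 by (simp add: V_def)
          have "om V (s + h *s V) = 0" for h
            using Inv_om[of "line_of l" "s + h *s V" V] l_inv ls lV by (simp add: line_of_def)
          then have "Am V V s = 0" unfolding Am_def by (intro dird_eqI polyfun_om) simp
          then have "Am V N' s = 0" using V by (simp add: V_def)
          then have "Am N' N' s = - y * Am E N' s" "Am N' E s = - y * Am E E s"
            using V by (simp_all add: V_def eq_neg_iff_add_eq_0)
          then show False using det_nonzero[OF s D E_off] True by (simp add: m_def)
        qed
        have A0: "((\<lambda>u. l \<odot> N' + x2 y u / u * (l \<odot> E)) \<longlongrightarrow> l \<odot> N' + y * (l \<odot> E)) (at 0)"
          by (intro tendsto_intros x2 y)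
        have "((\<lambda>u. 1 / (l \<odot> N' + x2 y u / u * (l \<odot> E)) * om N' (Y u)) \<longlongrightarrow> 1 / (l \<odot> N' + y * (l \<odot> E)) * om N' s) (at 0)"
          by (intro tendsto_mult tendsto_divide tendsto_const A0 Ylim polyfun_om r)
        moreover have "eventually (\<lambda>u. 1 / (l \<odot> N' + x2 y u / u * (l \<odot> E)) * om N' (Y u) = u / (l \<odot> Y u) * om N' (Y u)) (at 0)"
          using eventually_at_0_nonzero
        proof eventually_elim
          case (elim u)
          then have "l \<odot> Y u = u * (l \<odot> N' + x2 y u / u * (l \<odot> E))" using ls by (simp add: lY field_simps)
          then show ?case using elim by simp
        qed
        ultimately show ?thesis using om0 by (auto intro: Lim_transform_eventually)
      qed
      note A = this
      have "((\<lambda>u. u * (om N' (Y u) / f1 (Y u) * (f3 (Y u) / (6 * f1 (Y u)))) + u / (l \<odot> Y u) * om N' (Y u) * (1 / f1 (Y u) * (f2 (Y u) / (2 * f1 (Y u)) * (l \<odot> E)))) \<longlongrightarrow>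
         0 * (om N' s / f1 s * (f3 s / (6 * f1 s))) + 0 * (1 / f1 s * (f2 s / (2 * f1 s) * (l \<odot> E)))) (at 0)"
        using f1s by (intro tendsto_add tendsto_mult tendsto_divide A tendsto_const tendsto_ident_at Ylim polyfun_om polyfun_f) auto
      moreover have "s + u *s N' + x2 y u *s E = Y u" for u by (simp add: Y_def tu)
      ultimately show ?thesis
        unfolding cst0 tu phi_def by (simp add: algebra_simps)
    next
      case False
      then have m2: "m \<ge> 2" using m1 by simp
      have y0: "y \<noteq> 0" using Qy g1[OF m2] m1 by (auto simp: Qp zero_power)
      have J: "Am V V s = 0" for V using below_tau[of 1 s V] m2 H_1 by (simp add: m_def)
      have EN: "Am E N' s = - g1"
        using J[of "E + N'"] J[of E] J[of N'] unfolding Am_linear by (simp add: g1_def eq_neg_iff_add_eq_0 add.commute)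
      obtain r where r: "m = r + 2" using m2 le_Suc_ex by (metis add.commute)
      have b: "((\<lambda>u. om N' (Y u) / u) \<longlongrightarrow> y * (- g1)) (at 0)"
      proof -
        obtain G where G: "\<And>t x a b. ((t::complex\<Rightarrow>complex) \<longlongrightarrow> a) (at 0) \<Longrightarrow> (x \<longlongrightarrow> b) (at 0) \<Longrightarrow> ((\<lambda>u. G (t u) (x u)) \<longlongrightarrow> G a b) (at 0)"
           "\<And>t x. om N' (s + t *s N' + x *s E) = om N' (s + x *s E) + t * G t x"
          using polyfun_scaled_difference[OF polyfun_om, of N' s N' E] by metis
        obtain B where B: "line_poly (om N') s E = monom 1 1 * B" "poly B 0 = - g1"
          using X_dvd_ex[of 1 "line_poly (om N') s E"] line_poly_coeff_0[OF polyfun_om] line_poly_coeff_1[OF polyfun_om] om0 EN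
          by (auto simp: Am_def)
        have "om N' (s + x *s E) = x * poly B x" for x
          using poly_line_poly[OF polyfun_om, of N' s E x] unfolding B by (simp add: poly_monom)
        then have Y: "om N' (Y u) = x2 y u * poly B (x2 y u) + t u * G (t u) (x2 y u)" for u
          by (simp add: Y_def G(2))
        have "((\<lambda>u. x2 y u / u * poly B (x2 y u) + u * u ^ r * G (t u) (x2 y u)) \<longlongrightarrow> y * poly B 0 + 0 * 0 ^ r * G 0 0) (at 0)"
          by (intro tendsto_intros x2 y x20 G t0)
        moreover have "eventually (\<lambda>u. x2 y u / u * poly B (x2 y u) + u * u ^ r * G (t u) (x2 y u) = om N' (Y u) / u) (at 0)"
          using eventually_at_0_nonzero by eventually_elim (simp add: Y t_def r field_simps)
        ultimately show ?thesis using B(2) by (auto intro: Lim_transform_eventually)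
      qed
      \<comment> \<open>If \<open>l\<close> passes through \<open>s\<close>, then
        \<open>l \<odot> Y u\<close> is asymptotic to \<open>y * u * (l \<odot> E)\<close>, because
        \<open>t u\<close> is of higher order than \<open>u\<close>; otherwise the quotient below
        tends to 0.\<close>
      define \<kappa> where "\<kappa> = (if l \<odot> s = 0 then 1 / y else 0)"
      have lk: "((\<lambda>u. (l \<odot> E) * u / (l \<odot> Y u)) \<longlongrightarrow> \<kappa>) (at 0)"
      proof (cases "l \<odot> s = 0")
        case False
        have "((\<lambda>u. (l \<odot> E) * u / (l \<odot> Y u)) \<longlongrightarrow> (l \<odot> E) * 0 / (l \<odot> s)) (at 0)"
          using False by (intro tendsto_intros Ylim polyfun_intros)
        then show ?thesis using False by (simp add: \<kappa>_def)
      next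
        case True
        have "((\<lambda>u. (l \<odot> E) / (u * u ^ r * (l \<odot> N') + x2 y u / u * (l \<odot> E))) \<longlongrightarrow> (l \<odot> E) / (0 * 0 ^ r * (l \<odot> N') + y * (l \<odot> E))) (at 0)"
          using y0 lE by (intro tendsto_intros x2 y) auto
        moreover have "eventually (\<lambda>u. (l \<odot> E) / (u * u ^ r * (l \<odot> N') + x2 y u / u * (l \<odot> E)) = (l \<odot> E) * u / (l \<odot> Y u)) (at 0)"
          using eventually_at_0_nonzero
        proof eventually_elim
          case (elim u)
          have "l \<odot> Y u = u * (u * u ^ r * (l \<odot> N') + x2 y u / u * (l \<odot> E))"
            using elim True by (simp add: Y_def t_def r field_simps)
          then show ?case using elim by simp
        qed
        ultimately show ?thesis using True lE by (auto intro: Lim_transform_eventually simp: \<kappa>_def)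
      qed
      let ?Q1 = "poly (pderiv Q) y" and ?Q2 = "poly (pderiv (pderiv Q)) y" and ?Q3 = "poly (pderiv (pderiv (pderiv Q))) y"
      let ?F1 = "\<lambda>u. 1 / t u * u * f1 (Y u)" and ?F2 = "\<lambda>u. 1 / t u * u\<^sup>2 * f2 (Y u)" and ?F3 = "\<lambda>u. 1 / t u * u ^ 3 * f3 (Y u)"
      have lim: "((\<lambda>u. om N' (Y u) / u / ?F1 u * (?F3 u / (6 * ?F1 u) + ?F2 u / (2 * ?F1 u) * ((l \<odot> E) * u / (l \<odot> Y u)))) \<longlongrightarrow>
         y * (- g1) / ?Q1 * (?Q3 / (6 * ?Q1) + ?Q2 / (2 * ?Q1) * \<kappa>)) (at 0)"
        using Qy(2) by (intro tendsto_add tendsto_mult tendsto_divide b F1 F2 F3 lk tendsto_const) auto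
      have evq: "eventually (\<lambda>u. om N' (Y u) / u / ?F1 u * (?F3 u / (6 * ?F1 u) + ?F2 u / (2 * ?F1 u) * ((l \<odot> E) * u / (l \<odot> Y u))) = t u * phi N' (Y u)) (at 0)"
        using eventually_at_0_nonzero
      proof eventually_elim
        case (elim u)
        then have "t u \<noteq> 0" by (simp add: t_def)
        then show ?case using elim unfolding phi_def
          by (cases "f1 (Y u) = 0") (simp_all add: field_simps power2_eq_square power3_eq_cube)
      qed
      have q2: "?Q2 = of_nat (r + 1) * ?Q1 / y"
        using y0 by (simp add: dQ pderiv_monom poly_monom r)
      have q3: "?Q3 = of_nat r * of_nat (r + 1) * ?Q1 / y\<^sup>2"
        using y0 by (cases r) (simp_all add: dQ pderiv_monom poly_monom r power2_eq_square)
      have q1: "- g1 = of_nat m * 0 + h * y ^ m" using Qy(1) by (simp add: Qp eq_neg_iff_add_eq_0 neg_eq_iff_add_eq_0 add.commute)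
      have e1: "?Q3 / (6 * ?Q1) + ?Q2 / (2 * ?Q1) * \<kappa> = of_nat r * of_nat (r + 1) / (6 * y\<^sup>2) + of_nat (r + 1) / (2 * y) * \<kappa>"
        unfolding q2 q3 using Qy(2) by (simp add: mult.commute)
      have e2: "y * (- g1) / ?Q1 = y\<^sup>2 / of_nat m"
      proof -
        have "y ^ m = y * y * y ^ r" "y ^ (m - 1) = y * y ^ r" by (simp_all add: r)
        moreover have "of_nat m \<noteq> (0 :: complex)" using m1 by simp
        ultimately show ?thesis unfolding q1 Q1 using h0 y0 by (simp add: field_simps power2_eq_square)
      qed
      \<comment> \<open>Here \<open>r = m - 2\<close>. The first term gives
        \<open>(m - 1) * (m - 2) / 6\<close>; the value \<open>\<kappa> = 1 / y\<close> adds
        \<open>(m - 1) / 2\<close>, in total \<open>(m - 1) * (m + 1) / 6\<close>. These are the two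
        cases of \<open>res_const\<close>.\<close>
      have e3: "y\<^sup>2 / of_nat m * (of_nat r * of_nat (r + 1) / (6 * y\<^sup>2) + of_nat (r + 1) / (2 * y) * \<kappa>) = res_const s / of_nat m"
      proof -
        have "y\<^sup>2 * (of_nat r * of_nat (r + 1) / (6 * y\<^sup>2) + of_nat (r + 1) / (2 * y) * \<kappa>) = res_const s"
          using y0 unfolding res_const_def \<kappa>_def m_def[symmetric] r by (simp add: field_simps power2_eq_square)
        then show ?thesis by simp
      qed
      have lc: "y * (- g1) / ?Q1 * (?Q3 / (6 * ?Q1) + ?Q2 / (2 * ?Q1) * \<kappa>) = res_const s / of_nat m"
        by (simp only: e1 e2 e3)
      from Lim_transform_eventually[OF lim evq] show ?thesis unfolding lc Y_def .
    qed
  qed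
  have "((\<lambda>u. \<Sum>i\<in>R1 <+> R2. t u * phi N' (s + t u *s N' + x i u *s E)) \<longlongrightarrow> (\<Sum>i\<in>R1 <+> R2. case_sum (\<lambda>_. 0) (\<lambda>_. res_const s / of_nat m) i)) (at 0)"
    using lim1 lim2 by (intro tendsto_sum) (auto simp: x_def)
  also have "(\<Sum>i\<in>R1 <+> R2. case_sum (\<lambda>_. 0) (\<lambda>_. res_const s / of_nat m) i) = res_const s"
    using fin1 fin2 card2 m1 by (simp add: sum.Plus)
  finally have lim: "((\<lambda>u. \<Sum>i\<in>R1 <+> R2. t u * phi N' (s + t u *s N' + x i u *s E)) \<longlongrightarrow> res_const s) (at 0)" .
  have "((\<lambda>u. u ^ m * T (s + u ^ m *s N') N') \<longlongrightarrow> res_const s) (at 0)"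
    by (rule Lim_transform_eventually[OF lim])
      (use ev in \<open>eventually_elim, simp add: sum_distrib_left t_def\<close>)
  from tendsto_at_0_power[OF this m1] show ?thesis .
qed

end

lemma dird_scale:
  assumes g: "polyfun g" and hom: "\<And>X. g (t *s X) = c * g X" and t: "t \<noteq> 0"
  shows "dird g V (t *s X) = c / t * dird g V X"
proof (rule dird_eqI[OF g])
  have "g (t *s X + h *s V) = c * g (X + (h / t) *s V)" for h
  proof -
    have "t *s X + h *s V = t *s (X + (h / t) *s V)" using t by (simp add: vec_eq_iff algebra_simps)
    then show ?thesis by (simp only: hom)
  qed
  moreover have "((\<lambda>h. c * g (X + (h / t) *s V)) has_field_derivative c * (dird g V (X + (0 / t) *s V) * (1 / t))) (at 0)"
    by (intro DERIV_cmult DERIV_chain2[OF dird_line[OF g]] DERIV_cdivide DERIV_ident)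
  ultimately show "((\<lambda>h. g (t *s X + h *s V)) has_field_derivative c / t * dird g V X) (at 0)"
    by simp
qed

section \<open>The line tangent at the centre, and the trace in partial fractions\<close>

context good_pencil
begin

text \<open>At the tangent line of the leaf through \<open>E\<close> the leading coefficient of the
  tangency polynomial vanishes: one root goes to infinity, that is, its tangency point runs into
  \<open>E\<close>. The next coefficient is non-zero because \<open>Infl E \<noteq> 0\<close>, so
  exactly one root escapes.\<close>

lemma tangent_limit:
  assumes D: "tri N E N' \<noteq> 0" and tang: "om N E = 0"
  shows "((\<lambda>t. t * T (N + t *s N') N') \<longlongrightarrow> - (of_nat n * (of_nat n - 1) / 2)) (at 0)"
proof -
  define a where "a = - Am N N E"
  define c where "c = - om N' E"
  have "(tri E N N')\<^sup>2 * Infl E \<noteq> 0"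
  proof -
    have "tri E N N' = - tri N E N'" by (rule tri_swap)
    then show ?thesis using D Infl_nonzero_off[OF E_off] by simp
  qed
  then have ac: "a \<noteq> 0" "c \<noteq> 0" unfolding Infl_frame a_def c_def using tang by auto
  define P where "P u = line_poly (om E) (N + u *s N') E" for u
  have P0: "P 0 = line_poly (om E) N E" by (simp add: P_def)
  have degP: "degree (P u) \<le> n" for u unfolding P_def by (rule degree_pencil_poly)
  have cP: "coeff (P u) n = u * c" for u
    unfolding P_def lead_pencil_poly by (simp add: tang c_def)
  have cP1: "coeff (P 0) (n - 1) = a" unfolding P0 a_def by (rule sublead_pencil_poly)
  have nzP: "P 0 \<noteq> 0" using cP1 ac by auto
  have degP0: "degree (P 0) = n - 1"
  proof (rule antisym)
    have "degree (P 0) \<noteq> n" using cP[of 0] leading_coeff_neq_0[OF nzP] by auto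
    then show "degree (P 0) \<le> n - 1" using degP[of 0] by simp
    show "n - 1 \<le> degree (P 0)" using cP1 ac by (intro le_degree) simp
  qed
  have reg: "\<Omega> (N + x *s E) \<noteq> 0" for x
  proof
    assume 0: "\<Omega> (N + x *s E) = 0"
    have "N + x *s E \<noteq> 0"
    proof
      assume "N + x *s E = 0"
      then have "tri (N + x *s E) E N' = 0" by simp
      then show False using D by simp
    qed
    then obtain b k where b: "b \<in> PP" "k \<noteq> 0" "N + x *s E = k *s rep b"
      using sing_in_PP[of "N + x *s E"] 0 by (auto simp: sing_def)
    have "om (N + x *s E) E = 0" using tang by simp
    then show False using b rep_om[OF b(1)] by simp
  qed
  have simple: "f1 (N + x *s E) \<noteq> 0" if "om E (N + x *s E) = 0" for x
    using regular_simple[of "N + x *s E" N'] D that reg by (simp add: f1_Am)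
  define R1 where "R1 = {x. poly (P 0) x = 0}"
  have card1: "card R1 = n - 1" unfolding R1_def degP0[symmetric]
    by (rule card_simple_roots[OF nzP]) (use simple in \<open>simp add: P0 pderiv_pencil_poly polyfun_om\<close>)
  have fin1: "finite R1" unfolding R1_def by (rule poly_roots_finite[OF nzP])
  define y where "y = - a / c"
  have y0: "y \<noteq> 0" using ac by (simp add: y_def)
  obtain p where p: "n = Suc p" using n_pos by (cases n) auto
  \<comment> \<open>At the scale \<open>1 / u\<close> only the two top coefficients matter. The root
    0 of \<open>Q\<close> stands for the bounded roots, and \<open>y\<close> for the escaping
    one.\<close>
  define Q where "Q = monom c n + monom a (n - 1)"
  have degQ: "degree Q \<le> n" unfolding Q_def p by (intro degree_add_le) (auto intro: degree_monom_le[THEN order_trans])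
  have ya: "a = - c * y" using ac by (simp add: y_def)
  have Qy: "poly Q y = 0" by (simp add: Q_def poly_monom p ya)
  have Q1: "poly (pderiv Q) y = c * y ^ p"
    by (cases p) (simp_all add: Q_def pderiv_add pderiv_monom poly_monom p ya algebra_simps)
  have Q2: "poly (pderiv (pderiv Q)) y = 2 * of_nat p * (c * y ^ p) / y"
    using y0 by (cases p; cases "p - 1") (simp_all add: Q_def pderiv_add pderiv_monom poly_monom p ya field_simps power2_eq_square)
  have Q3: "poly (pderiv (pderiv (pderiv Q))) y = 3 * of_nat p * (of_nat p - 1) * (c * y ^ p) / y\<^sup>2"
    using y0 by (cases p; cases "p - 1"; cases "p - 2") (simp_all add: Q_def pderiv_add pderiv_monom poly_monom p ya field_simps power2_eq_square)
  have id0: "((\<lambda>u. u) \<longlongrightarrow> 0) (at (0::complex))" by (rule tendsto_ident_at)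
  have cont: "((\<lambda>u. coeff (line_poly (om W) (N + u *s N') E) k) \<longlongrightarrow> coeff (line_poly (om W) N E) k) (at 0)" for W k
    using coeff_pencil_tendsto[OF id0] .
  have coeffs: "((\<lambda>u. u ^ (n - 1) * (1 / u) ^ k * coeff (P u) k) \<longlongrightarrow> coeff Q k) (at 0)" if "k \<le> n" for k
  proof (cases "k = n")
    case True
    have "eventually (\<lambda>u. c = u ^ (n - 1) * (1 / u) ^ k * coeff (P u) k) (at 0)"
      using eventually_at_0_nonzero by eventually_elim (simp add: True cP, simp add: p field_simps)
    moreover have "coeff Q k = c" by (simp add: Q_def True p)
    ultimately show ?thesis by (auto intro: Lim_transform_eventually[OF tendsto_const])
  next
    case False
    then have k: "k \<le> p" using that p by simp
    have "((\<lambda>u. u ^ (p - k) * coeff (P u) k) \<longlongrightarrow> 0 ^ (p - k) * coeff (P 0) k) (at 0)"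
      unfolding P0 unfolding P_def by (intro tendsto_intros cont)
    moreover have "0 ^ (p - k) * coeff (P 0) k = coeff Q k"
      using k cP1 by (cases "k = p") (auto simp: Q_def p)
    moreover have "eventually (\<lambda>u. u ^ (p - k) * coeff (P u) k = u ^ (n - 1) * (1 / u) ^ k * coeff (P u) k) (at 0)"
      using eventually_at_0_nonzero by eventually_elim (use k in \<open>simp add: p power_diff field_simps\<close>)
    ultimately show ?thesis by (auto intro: Lim_transform_eventually)
  qed
  have evw: "eventually (\<lambda>u::complex. u ^ (n - 1) \<noteq> 0 \<and> 1 / u \<noteq> 0) (at 0)"
    using eventually_at_0_nonzero by eventually_elim simp
  then have evr: "eventually (\<lambda>u::complex. 1 / u \<noteq> 0) (at 0)" by (rule eventually_mono) simp
  obtain x2 where x2: "eventually (\<lambda>u. poly (P u) (x2 u) = 0) (at 0)" "((\<lambda>u. x2 u / (1 / u)) \<longlongrightarrow> y) (at 0)"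
    using scaled_root_branch[of P n Q "\<lambda>u. u ^ (n - 1)" "\<lambda>u. 1 / u" "at 0" y, OF degP degQ coeffs evw Qy] Q1 ac y0 by auto
  have ux2: "((\<lambda>u. u * x2 u) \<longlongrightarrow> y) (at 0)" using x2(2) by (simp add: mult.commute)
  have "\<exists>x. eventually (\<lambda>u. poly (P u) (x u) = 0) (at 0) \<and> (x \<longlongrightarrow> i) (at 0)" if "i \<in> R1" for i
    using scaled_root_branch[of P n "P 0" "\<lambda>_. 1" "\<lambda>_. 1" "at 0" i] degP
      cont[of E] that simple
    by (simp add: R1_def) (simp add: P_def pderiv_pencil_poly polyfun_om)
  then have "\<forall>i\<in>R1. \<exists>x. eventually (\<lambda>u. poly (P u) (x u) = 0) (at 0) \<and> (x \<longlongrightarrow> i) (at 0)" by blast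
  from bchoice[OF this] obtain x1 where x1: "\<And>i. i \<in> R1 \<Longrightarrow> eventually (\<lambda>u. poly (P u) (x1 i u) = 0) (at 0)"
     "\<And>i. i \<in> R1 \<Longrightarrow> (x1 i \<longlongrightarrow> i) (at 0)" by blast
  define x where "x = case_sum x1 (\<lambda>_::unit. x2)"
  have rootP: "poly (P u) z = om E (N + u *s N' + z *s E)" for u z by (simp add: P_def polyfun_om)
  have ev: "eventually (\<lambda>u. T (N + u *s N') N' = (\<Sum>i\<in>R1 <+> {()}. phi N' (N + u *s N' + x i u *s E))) (at 0)"
  proof (rule T_branches)
    show "finite (R1 <+> {()})" "card (R1 <+> {()}) = n" using fin1 card1 by (simp_all add: card_Plus p)
    show "eventually (\<lambda>u. om (N + u *s N') E \<noteq> 0) (at 0)"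
      using eventually_at_0_nonzero by eventually_elim (use ac in \<open>simp add: tang c_def\<close>)
    show "eventually (\<lambda>u. om E (N + u *s N' + x i u *s E) = 0) (at 0)" if "i \<in> R1 <+> {()}" for i
      using that x1(1) x2(1) by (auto simp: x_def rootP)
    show "eventually (\<lambda>u. x i u \<noteq> x j u) (at 0)" if "i \<in> R1 <+> {()}" "j \<in> R1 <+> {()}" "i \<noteq> j" for i j
    proof -
      have 11: "eventually (\<lambda>u. x1 a u \<noteq> x1 b u) (at 0)" if "a \<in> R1" "b \<in> R1" "a \<noteq> b" for a b
        using tendsto_eventually_neq[OF x1(2)[OF that(1)] x1(2)[OF that(2)] that(3)] .
      have 12: "eventually (\<lambda>u. x1 a u \<noteq> x2 u) (at 0)" if "a \<in> R1" for a
      proof -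
        have "((\<lambda>u. u * x1 a u) \<longlongrightarrow> 0 * a) (at 0)" by (intro tendsto_intros x1 that)
        from tendsto_eventually_neq[OF this ux2] y0 show ?thesis by (auto elim: eventually_mono)
      qed
      have 21: "eventually (\<lambda>u. x2 u \<noteq> x1 a u) (at 0)" if "a \<in> R1" for a
        using 12[OF that] by (rule eventually_mono) auto
      show ?thesis using that by (cases i; cases j) (auto simp: x_def intro: 11 12 21)
    qed
  qed
  have lim1: "((\<lambda>u. u * phi N' (N + u *s N' + x1 i u *s E)) \<longlongrightarrow> 0) (at 0)" if "i \<in> R1" for i
    using phi_regular_limit[OF D _ reg id0 x1(2)[OF that]] that by (auto simp: R1_def P0 polyfun_om)
  have lim2: "((\<lambda>u. u * phi N' (N + u *s N' + x2 u *s E)) \<longlongrightarrow> - (of_nat n * (of_nat n - 1) / 2)) (at 0)"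
  proof -
    define Y where "Y u = N + u *s N' + x2 u *s E" for u
    note F = scaled_poly_pderiv_tendsto[of P n Q "\<lambda>u. u ^ (n - 1)" "\<lambda>u. 1 / u" "at 0" x2 y,
        OF degP degQ coeffs x2(2) evr]
    let ?F1 = "\<lambda>u. u ^ (n - 1) * (1 / u) ^ 1 * f1 (Y u)" and ?F2 = "\<lambda>u. u ^ (n - 1) * (1 / u) ^ 2 * f2 (Y u)"
      and ?F3 = "\<lambda>u. u ^ (n - 1) * (1 / u) ^ 3 * f3 (Y u)"
    have F1: "(?F1 \<longlongrightarrow> c * y ^ p) (at 0)"
      using F[of 1] unfolding P_def pderiv_pencil_poly by (simp add: Y_def Q1)
    have F2: "(?F2 \<longlongrightarrow> 2 * of_nat p * (c * y ^ p) / y) (at 0)"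
      using F[of 2] unfolding P_def pderiv_pencil_poly by (simp add: Y_def numeral_2_eq_2 Q2[unfolded numeral_2_eq_2])
    have F3: "(?F3 \<longlongrightarrow> 3 * of_nat p * (of_nat p - 1) * (c * y ^ p) / y\<^sup>2) (at 0)"
      using F[of 3] Q3 unfolding P_def pderiv_pencil_poly by (simp add: Y_def numeral_3_eq_3)
    define B where "B u = line_poly (om N') (N + u *s N') E" for u
    have degB: "degree (B u) \<le> n + 1" for u
      unfolding B_def by (rule homogeneous_line_poly(1)[OF polyfun_om om_hom])
    have cB: "coeff (B u) (n + 1) = - c" for u
      unfolding B_def homogeneous_line_poly(2)[OF polyfun_om om_hom] c_def by simp
    have coeffB: "((\<lambda>u. u ^ (n + 1) * (1 / u) ^ k * coeff (B u) k) \<longlongrightarrow> coeff (monom (- c) (n + 1)) k) (at 0)" if "k \<le> n + 1" for k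
    proof (cases "k = n + 1")
      case True
      have "eventually (\<lambda>u. - c = u ^ (n + 1) * (1 / u) ^ k * coeff (B u) k) (at 0)"
        using eventually_at_0_nonzero by eventually_elim (simp only: True cB, simp add: field_simps)
      then show ?thesis using True by (auto intro: Lim_transform_eventually[OF tendsto_const])
    next
      case False
      have "((\<lambda>u. u ^ (n + 1 - k) * coeff (B u) k) \<longlongrightarrow> 0 ^ (n + 1 - k) * coeff (line_poly (om N') N E) k) (at 0)"
        unfolding B_def by (intro tendsto_intros cont)
      moreover have "eventually (\<lambda>u. u ^ (n + 1 - k) * coeff (B u) k = u ^ (n + 1) * (1 / u) ^ k * coeff (B u) k) (at 0)"
        using eventually_at_0_nonzero by eventually_elim (use that in \<open>simp add: power_diff field_simps\<close>)
      ultimately show ?thesis using False that by (auto intro: Lim_transform_eventually simp: zero_power)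
    qed
    have b: "((\<lambda>u. u ^ (n + 1) * om N' (Y u)) \<longlongrightarrow> - c * y ^ (n + 1)) (at 0)"
      using scaled_poly_pderiv_tendsto[of B "n + 1" "monom (- c) (n + 1)" "\<lambda>u. u ^ (n + 1)" "\<lambda>u. 1 / u" "at 0" x2 y 0,
        OF degB degree_monom_le coeffB x2(2) evr]
      by (simp add: B_def polyfun_om Y_def poly_monom)
    have lu: "((\<lambda>u. u * (l \<odot> Y u)) \<longlongrightarrow> y * (l \<odot> E)) (at 0)"
    proof -
      have "((\<lambda>u. u * (l \<odot> N) + u * u * (l \<odot> N') + u * x2 u * (l \<odot> E)) \<longlongrightarrow> 0 * (l \<odot> N) + 0 * 0 * (l \<odot> N') + y * (l \<odot> E)) (at 0)"
        by (intro tendsto_intros ux2)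
      then show ?thesis by (simp add: Y_def algebra_simps)
    qed
    have lim: "((\<lambda>u. u ^ (n + 1) * om N' (Y u) / ?F1 u * (?F3 u / (6 * ?F1 u) + ?F2 u / (2 * ?F1 u) * ((l \<odot> E) / (u * (l \<odot> Y u))))) \<longlongrightarrow>
      - c * y ^ (n + 1) / (c * y ^ p) * (3 * of_nat p * (of_nat p - 1) * (c * y ^ p) / y\<^sup>2 / (6 * (c * y ^ p))
       + 2 * of_nat p * (c * y ^ p) / y / (2 * (c * y ^ p)) * ((l \<odot> E) / (y * (l \<odot> E))))) (at 0)"
      using ac y0 lE by (intro tendsto_add tendsto_mult tendsto_divide b F1 F2 F3 lu tendsto_const) auto
    have evq: "eventually (\<lambda>u. u ^ (n + 1) * om N' (Y u) / ?F1 u * (?F3 u / (6 * ?F1 u) + ?F2 u / (2 * ?F1 u) * ((l \<odot> E) / (u * (l \<odot> Y u)))) = u * phi N' (Y u)) (at 0)"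
      using eventually_at_0_nonzero
    proof eventually_elim
      case (elim u)
      define w where "w = u ^ p"
      have w: "w \<noteq> 0" "u ^ (n + 1) = u * u * w" "u ^ (n - 1) = w" using elim by (simp_all add: w_def p)
      show ?case unfolding phi_def w(2,3) using elim w(1)
        by (cases "f1 (Y u) = 0") (simp_all add: field_simps power2_eq_square power3_eq_cube)
    qed
    define z where "z = y ^ p"
    have z0: "z \<noteq> 0" using y0 by (simp add: z_def)
    \<comment> \<open>With \<open>p = n - 1\<close> the value is
      \<open>- (p * (p - 1) / 2 + p)\<close>, the first summand coming from \<open>f3\<close> and
      the second from \<open>f2\<close> and \<open>l\<close>.\<close>
    have val: "- c * y ^ (n + 1) / (c * y ^ p) * (3 * of_nat p * (of_nat p - 1) * (c * y ^ p) / y\<^sup>2 / (6 * (c * y ^ p))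
       + 2 * of_nat p * (c * y ^ p) / y / (2 * (c * y ^ p)) * ((l \<odot> E) / (y * (l \<odot> E)))) = - (of_nat n * (of_nat n - 1) / 2)"
    proof -
      have "y ^ (n + 1) = y * y * z" by (simp add: p z_def)
      then show ?thesis unfolding z_def[symmetric] using z0 y0 ac lE by (simp add: p power2_eq_square field_simps)
    qed
    from Lim_transform_eventually[OF lim evq] show ?thesis unfolding val Y_def .
  qed
  have "((\<lambda>u. \<Sum>i\<in>R1 <+> {()}. u * phi N' (N + u *s N' + x i u *s E)) \<longlongrightarrow> (\<Sum>i\<in>R1 <+> {()}. case_sum (\<lambda>_. 0) (\<lambda>_. - (of_nat n * (of_nat n - 1) / 2)) i)) (at 0)"
    using lim1 lim2 by (intro tendsto_sum) (auto simp: x_def)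
  also have "(\<Sum>i\<in>R1 <+> {()}. case_sum (\<lambda>_. 0) (\<lambda>_. - (of_nat n * (of_nat n - 1) / 2)) i) = - (of_nat n * (of_nat n - 1) / (2::complex))"
    using fin1 by (simp add: sum.Plus)
  finally have lim: "((\<lambda>u. \<Sum>i\<in>R1 <+> {()}. u * phi N' (N + u *s N' + x i u *s E)) \<longlongrightarrow> - (of_nat n * (of_nat n - 1) / 2)) (at 0)" .
  show ?thesis
    by (rule Lim_transform_eventually[OF lim]) (use ev in \<open>eventually_elim, simp add: sum_distrib_left\<close>)
qed

lemma f_scale:
  assumes "t \<noteq> 0"
  shows "f1 (t *s X) = t ^ (n + 1) / t * f1 X" "f2 (t *s X) = t ^ (n + 1) / t / t * f2 X"
    "f3 (t *s X) = t ^ (n + 1) / t / t / t * f3 X"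
proof -
  show 1: "f1 (t *s X) = t ^ (n + 1) / t * f1 X" for X
    unfolding f1_def by (rule dird_scale[OF polyfun_om om_hom assms])
  show 2: "f2 (t *s X) = t ^ (n + 1) / t / t * f2 X" for X
    unfolding f2_def by (rule dird_scale[OF polyfun_f(1) 1 assms])
  show "f3 (t *s X) = t ^ (n + 1) / t / t / t * f3 X"
    unfolding f3_def by (rule dird_scale[OF polyfun_f(2) 2 assms])
qed

text \<open>The transformation rule of a 1-form on the pencil when \<open>t\<close> is replaced by
  \<open>1 / t\<close>. It turns the behaviour at infinity into that at an ordinary line.\<close>

lemma T_swap:
  assumes t: "t \<noteq> 0"
  shows "T (N + t *s N') N' = - (1 / t)\<^sup>2 * T (N' + (1 / t) *s N) N"
proof -
  define u where "u = 1 / t"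
  have u: "u \<noteq> 0" "t * u = 1" using t by (simp_all add: u_def)
  have X: "N + t *s N' + x *s E = t *s (N' + u *s N + (x * u) *s E)" for x
    using u by (simp add: vec_eq_iff algebra_simps)
  have phi: "phi N' (t *s Y) = u * (- u * phi N Y)" if Y: "Y = N' + u *s N + y *s E" "om E Y = 0" for Y y
  proof -
    have "om N' Y + u * om N Y = 0" using om_self[of Y] Y by (simp del: om_self)
    then have N': "om N' Y = - u * om N Y" by (simp add: eq_neg_iff_add_eq_0)
    have "phi N' (t *s Y) = u * (om N' Y / f1 Y * (f3 Y / (6 * f1 Y) + f2 Y / (2 * f1 Y) * (l \<odot> E) / (l \<odot> Y)))"
      unfolding phi_def f_scale[OF t] om_hom u_def using t 
      by (cases "f1 Y = 0") (simp_all add: field_simps power2_eq_square)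
    then show ?thesis unfolding phi_def N' by simp
  qed
  have "T (N + t *s N') N' = (\<Sum>x\<in>rts (N + t *s N'). phi N' (t *s (N' + u *s N + (x * u) *s E)))"
    unfolding T_def X ..
  also have "\<dots> = (\<Sum>y\<in>rts (N' + u *s N). phi N' (t *s (N' + u *s N + y *s E)))"
  proof (rule sum.reindex_bij_witness[of _ "\<lambda>y. y * t" "\<lambda>x. x * u"])
    have z: "om E (N + t *s N' + x *s E) = 0 \<longleftrightarrow> om E (N' + u *s N + (x * u) *s E) = 0" for x
      unfolding X om_hom using t by simp
    show "x * u \<in> rts (N' + u *s N)" if "x \<in> rts (N + t *s N')" for x
      using that z[of x] by (simp add: rts_def)
    show "y * t \<in> rts (N + t *s N')" if "y \<in> rts (N' + u *s N)" for y
      using that z[of "y * t"] u by (simp add: rts_def mult.assoc)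
  qed (use u in \<open>simp_all add: mult.assoc mult.commute[of u t]\<close>)
  also have "\<dots> = (\<Sum>y\<in>rts (N' + u *s N). u * (- u * phi N (N' + u *s N + y *s E)))"
    by (intro sum.cong refl phi) (auto simp: rts_def)
  finally show ?thesis by (simp add: T_def sum_distrib_left u_def power2_eq_square sum_negf)
qed

lemma on_line:
  assumes D: "tri N E N' \<noteq> 0" and a: "a \<in> PP" "tri (rep a) N E = 0"
  obtains \<alpha> \<beta> where "\<alpha> \<noteq> 0" "N + \<beta> *s E = \<alpha> *s rep a"
proof -
  have "tri N E (rep a) = 0" using a(2) tri_rotate[of "rep a" N E] by simp
  then have "tri N E N' *s rep a = tri (rep a) E N' *s N + tri N (rep a) N' *s E"
    using cramer[of N E N' "rep a"] by simp
  then have ra: "rep a = (tri (rep a) E N' / tri N E N') *s N + (tri N (rep a) N' / tri N E N') *s E"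
    using D by (simp add: vec_eq_iff field_simps)
  define p where "p = tri (rep a) E N' / tri N E N'"
  define q where "q = tri N (rep a) N' / tri N E N'"
  have r: "rep a = p *s N + q *s E" using ra by (simp add: p_def q_def)
  have "p \<noteq> 0"
  proof
    assume "p = 0"
    then have "om (rep a) E = 0" using r by simp
    then show False using rep_om[OF a(1)] by simp
  qed
  show ?thesis
  proof (rule that[of "1 / p" "q / p"])
    show "N + (q / p) *s E = (1 / p) *s rep a" unfolding r using \<open>p \<noteq> 0\<close> by (simp add: vec_eq_iff field_simps)
  qed (use \<open>p \<noteq> 0\<close> in simp)
qed

text \<open>Genericity of \<open>E\<close> keeps the special lines of the pencil apart: none
  contains two singular points, and the tangent line at \<open>E\<close> contains none. So each pole
  has a single source.\<close>

lemma on_line_unique: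
  assumes D: "tri N E N' \<noteq> 0" and a: "a \<in> PP" "tri (rep a) N E = 0"
  shows "om N E \<noteq> 0" "b \<in> PP \<Longrightarrow> tri (rep b) N E = 0 \<Longrightarrow> b = a"
proof -
  obtain p q where pq: "p \<noteq> 0" "N + q *s E = p *s rep a" using on_line[OF D a] .
  have "om N E = p * om (rep a) E" using arg_cong[OF pq(2), of "\<lambda>W. om W E"] by simp
  then show "om N E \<noteq> 0" using pq rep_om[OF a(1)] by simp
  assume b: "b \<in> PP" "tri (rep b) N E = 0"
  show "b = a"
  proof (rule ccontr)
    assume ba: "b \<noteq> a"
    have "tri (rep b) (p *s rep a) E = 0" unfolding pq(2)[symmetric] using b by simp
    then have "tri (rep b) (rep a) E = 0" using pq by simp
    then show False using good a(1) b(1) ba unfolding bad_poly_nonzero_iff by blast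
  qed
qed

lemma limit_at_rep:
  assumes D: "tri N E N' \<noteq> 0" and a: "a \<in> PP" "tri (rep a) N E = 0"
  shows "((\<lambda>t. t * T (N + t *s N') N') \<longlongrightarrow> res_const (rep a)) (at 0)"
proof -
  obtain p q where pq: "p \<noteq> 0" "N + q *s E = p *s rep a" using on_line[OF D a] .
  define s where "s = N + q *s E"
  have sa: "s = p *s rep a" using pq by (simp add: s_def)
  have s: "sing s" using PP_sing[OF a(1)] pq Omega_hom[of p "rep a"] unfolding sa sing_def by simp
  have Ds: "tri s E N' \<noteq> 0" using D by (simp add: s_def)
  have lead: "om s E \<noteq> 0" using on_line_unique(1)[OF D a] by (simp add: s_def)
  have Ht: "H (tau s) s E \<noteq> 0" unfolding sa tau_scale[OF pq(1)] H_scale[OF pq(1)] using rep_H[OF a(1)] pq(1) by simp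
  have reg: "\<Omega> (s + x *s E) \<noteq> 0" if x: "x \<noteq> 0" for x
  proof
    assume 0: "\<Omega> (s + x *s E) = 0"
    have "s + x *s E \<noteq> 0"
    proof
      assume "s + x *s E = 0"
      then have "tri (s + x *s E) E N' = 0" by simp
      then show False using Ds by simp
    qed
    then obtain b k where b: "b \<in> PP" "k \<noteq> 0" "s + x *s E = k *s rep b"
      using sing_in_PP[of "s + x *s E"] 0 by (auto simp: sing_def)
    have "tri (k *s rep b) N E = 0" unfolding b(3)[symmetric] by (simp add: s_def tri_rotate[of E])
    then have "b = a" using on_line_unique(2)[OF D a b(1)] b(2) by simp
    then have "x *s E = (k - p) *s rep a" using b(3) sa by (simp add: vec_eq_iff algebra_simps)
    then have "om (x *s E) E = om ((k - p) *s rep a) E" by (simp only:)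
    then have "(k - p) * om (rep a) E = 0" by (simp only: om_linear om_self mult_zero_right)
    then have "k - p = 0" using rep_om[OF a(1)] by simp
    then have "x *s E = 0" using \<open>x *s E = (k - p) *s rep a\<close> by simp
    then have "tri s (x *s E) N' = 0" by (simp only:) simp
    then show False using Ds x by simp
  qed
  have "T (s + t *s N') N' = T (N + t *s N') N'" for t
  proof -
    have "s + t *s N' = N + t *s N' + q *s E" by (simp add: s_def)
    then show ?thesis by (simp only: T_shift)
  qed
  then show ?thesis using singular_limit[OF s Ds lead Ht reg] res_const_scale[OF pq(1), of "rep a"] by (simp add: sa)
qed

lemma off_line_regular:
  assumes D: "tri N E N' \<noteq> 0" and off: "\<forall>a\<in>PP. tri (rep a) N E \<noteq> 0"
  shows "\<Omega> (N + x *s E) \<noteq> 0"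
proof
  assume 0: "\<Omega> (N + x *s E) = 0"
  have "N + x *s E \<noteq> 0"
  proof
    assume "N + x *s E = 0"
    then have "tri (N + x *s E) E N' = 0" by simp
    then show False using D by simp
  qed
  then obtain b k where b: "b \<in> PP" "k \<noteq> 0" "N + x *s E = k *s rep b"
    using sing_in_PP[of "N + x *s E"] 0 by (auto simp: sing_def)
  have "tri (k *s rep b) N E = 0" unfolding b(3)[symmetric] by (simp add: tri_rotate[of E])
  then show False using off b by simp
qed

lemma limit_exists:
  assumes D: "tri N E N' \<noteq> 0"
  shows "\<exists>c. ((\<lambda>t. t * T (N + t *s N') N') \<longlongrightarrow> c) (at 0)"
proof (cases "\<exists>a\<in>PP. tri (rep a) N E = 0")
  case True
  then show ?thesis using limit_at_rep[OF D] by blast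
next
  case off: False
  show ?thesis
  proof (cases "om N E = 0")
    case True
    then show ?thesis using tangent_limit[OF D] by blast
  next
    case False
    have "(\<lambda>t. T (N + t *s N') N') field_differentiable at 0"
      using regular_differentiable[OF D False] off_line_regular[OF D] off by blast
    then have "isCont (\<lambda>t. T (N + t *s N') N') 0" by (rule field_differentiable_imp_continuous_at)
    then have "((\<lambda>t. T (N + t *s N') N') \<longlongrightarrow> T (N + 0 *s N') N') (at 0)" by (simp add: isCont_def)
    then have "((\<lambda>t. t * T (N + t *s N') N') \<longlongrightarrow> 0 * T (N + 0 *s N') N') (at 0)" by (intro tendsto_intros)
    then show ?thesis by blast
  qed
qed

lemma log_deriv_limit:
  fixes p q :: complex
  assumes "p \<noteq> 0 \<or> q \<noteq> 0"
  shows "((\<lambda>h. h * (q / (p + h * q))) \<longlongrightarrow> (if p = 0 then 1 else 0)) (at 0)"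
proof (cases "p = 0")
  case True
  have "eventually (\<lambda>h. 1 = h * (q / (p + h * q))) (at 0)"
    using eventually_at_0_nonzero by eventually_elim (use True assms in simp)
  then show ?thesis using True by (auto intro: Lim_transform_eventually[OF tendsto_const])
next
  case False
  have "((\<lambda>h. h * (q / (p + h * q))) \<longlongrightarrow> 0 * (q / (p + 0 * q))) (at 0)"
    using False by (intro tendsto_intros) auto
  then show ?thesis using False by simp
qed

lemma log_deriv_at_infinity:
  fixes p q :: complex
  shows "((\<lambda>t. q / (p + t * q)) \<longlongrightarrow> 0) at_infinity"
proof (cases "q = 0")
  case False
  have "((\<lambda>u. u * q / (u * p + q)) \<longlongrightarrow> 0 * q / (0 * p + q)) (at 0)"
    using False by (intro tendsto_intros) auto
  moreover have "eventually (\<lambda>u. u * q / (u * p + q) = q / (p + inverse u * q)) (at 0)"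
    using eventually_at_0_nonzero by eventually_elim (simp add: divide_simps mult.commute)
  ultimately show ?thesis
    unfolding lim_at_infinity_0 by (auto simp: o_def intro: Lim_transform_eventually)
qed simp

theorem pencil_formula:
  assumes D: "tri N E N' \<noteq> 0" and off: "\<forall>a\<in>PP. tri (rep a) N E \<noteq> 0" and lead: "om N E \<noteq> 0"
  shows "T N N' = (\<Sum>a\<in>PP. res_const (rep a) * (tri (rep a) N' E / tri (rep a) N E))
     - of_nat n * (of_nat n - 1) / 2 * (om N' E / om N E)"
proof -
  define C :: complex where "C = of_nat n * (of_nat n - 1) / 2"
  define S where "S t = (\<Sum>a\<in>PP. res_const (rep a) * (tri (rep a) N' E / (tri (rep a) N E + t * tri (rep a) N' E)))" for t
  \<comment> \<open>The trace along the whole pencil minus the expected partial fractions; the claim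
    is \<open>g 0 = 0\<close>.\<close>
  define g where "g t = T (N + t *s N') N' - S t + C * (om N' E / (om N E + t * om N' E))" for t
  define K where "K = {t. (\<exists>a\<in>PP. tri (rep a) N E + t * tri (rep a) N' E = 0) \<or> om N E + t * om N' E = 0}"
  have "K \<subseteq> (\<lambda>a. - tri (rep a) N E / tri (rep a) N' E) ` PP \<union> {- om N E / om N' E}"
  proof
    have aux: "t = - p / q" if "p + t * q = 0" "p \<noteq> 0" for p q t :: complex
      using that by (cases "q = 0") (auto simp: field_simps eq_neg_iff_add_eq_0)
    fix t assume "t \<in> K"
    then show "t \<in> (\<lambda>a. - tri (rep a) N E / tri (rep a) N' E) ` PP \<union> {- om N E / om N' E}"
      using aux off lead by (auto simp: K_def)
  qed
  then have finK: "finite K" using finite_PP by (auto intro: finite_subset)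
  have base: "tri (rep a) (N + t *s N') E = tri (rep a) N E + t * tri (rep a) N' E" "om (N + t *s N') E = om N E + t * om N' E"
     "tri (N + t *s N') E N' = tri N E N'" for a t by (simp_all add: tri_rotate[of N' E])
  have "g 0 = 0"
  proof (rule liouville_finite_singularities[where f = g and z = 0, OF finK])
    show "0 \<notin> K" using off lead by (simp add: K_def)
    show "g field_differentiable at t" if t: "t \<notin> K" for t
    proof -
      have "(\<lambda>h. T (N + t *s N' + h *s N') N') field_differentiable at 0"
      proof (rule regular_differentiable)
        show D': "tri (N + t *s N') E N' \<noteq> 0" using D base by simp
        show "om (N + t *s N') E \<noteq> 0" unfolding base using t by (simp add: K_def)
        show "\<Omega> (N + t *s N' + x *s E) \<noteq> 0" for x
          by (rule off_line_regular[OF D']) (use t in \<open>simp only: base K_def, blast\<close>)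
      qed
      moreover have "N + t *s N' + h *s N' = N + (h + t) *s N'" for h by (simp add: vec_eq_iff algebra_simps)
      ultimately have "(\<lambda>h. T (N + (h + t) *s N') N') field_differentiable at 0" by simp
      then have "(\<lambda>t. T (N + t *s N') N') field_differentiable at t"
        unfolding field_differentiable_def using DERIV_shift[of "\<lambda>t. T (N + t *s N') N'" _ 0 t] by auto
      moreover have "(\<lambda>t. res_const (rep a) * (tri (rep a) N' E / (tri (rep a) N E + t * tri (rep a) N' E))) field_differentiable at t" if "a \<in> PP" for a
        using t that by (intro derivative_intros) (auto simp: K_def)
      moreover have "(\<lambda>t. C * (om N' E / (om N E + t * om N' E))) field_differentiable at t"
        using t by (intro derivative_intros) (auto simp: K_def)
      ultimately show ?thesis unfolding g_def[abs_def] S_def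
        by (intro field_differentiable_add field_differentiable_diff field_differentiable_sum)
    qed
    show "((\<lambda>z. (z - k) * g z) \<longlongrightarrow> 0) (at k)" if k: "k \<in> K" for k
    proof -
      define N0 where "N0 = N + k *s N'"
      have D0: "tri N0 E N' \<noteq> 0" using D base by (simp add: N0_def)
      define v where "v = (\<Sum>a\<in>PP. res_const (rep a) * (if tri (rep a) N0 E = 0 then 1 else 0)) - C * (if om N0 E = 0 then 1 else 0)"
      have ab: "tri (rep a) N0 E = tri (rep a) N E + k * tri (rep a) N' E" "om N0 E = om N E + k * om N' E" for a
        by (simp_all add: N0_def)
      have lS: "((\<lambda>h. \<Sum>a\<in>PP. res_const (rep a) * (h * (tri (rep a) N' E / (tri (rep a) N0 E + h * tri (rep a) N' E)))) \<longlongrightarrow> (\<Sum>a\<in>PP. res_const (rep a) * (if tri (rep a) N0 E = 0 then 1 else 0))) (at 0)"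
        using off by (intro tendsto_sum tendsto_mult tendsto_const log_deriv_limit) (auto simp: ab)
      have lC: "((\<lambda>h. C * (h * (om N' E / (om N0 E + h * om N' E)))) \<longlongrightarrow> C * (if om N0 E = 0 then 1 else 0)) (at 0)"
        using lead by (intro tendsto_mult tendsto_const log_deriv_limit) (auto simp: ab)
      have lT: "((\<lambda>h. h * T (N0 + h *s N') N') \<longlongrightarrow> v) (at 0)"
      proof (cases "\<exists>a\<in>PP. tri (rep a) N0 E = 0")
        case True
        then obtain a where a: "a \<in> PP" "tri (rep a) N0 E = 0" by blast
        have "tri (rep b) N0 E = 0 \<longleftrightarrow> b = a" if "b \<in> PP" for b
          using on_line_unique(2)[OF D0 a that] a by blast
        then have "(\<Sum>b\<in>PP. res_const (rep b) * (if tri (rep b) N0 E = 0 then 1 else 0)) = (\<Sum>b\<in>PP. if b = a then res_const (rep b) else 0)"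
          by (intro sum.cong) auto
        then have "v = res_const (rep a)" using on_line_unique(1)[OF D0 a] a finite_PP by (simp add: v_def)
        then show ?thesis using limit_at_rep[OF D0 a] by simp
      next
        case False
        then have "om N0 E = 0" using k by (auto simp: K_def ab)
        moreover have "(\<Sum>b\<in>PP. res_const (rep b) * (if tri (rep b) N0 E = 0 then 1 else 0)) = 0"
          using False by (intro sum.neutral) auto
        ultimately have "v = - (of_nat n * (of_nat n - 1) / 2)" by (simp add: v_def C_def)
        then show ?thesis using tangent_limit[OF D0 \<open>om N0 E = 0\<close>] by simp
      qed
      have "((\<lambda>h. h * T (N0 + h *s N') N' - (\<Sum>a\<in>PP. res_const (rep a) * (h * (tri (rep a) N' E / (tri (rep a) N0 E + h * tri (rep a) N' E))))
          + C * (h * (om N' E / (om N0 E + h * om N' E)))) \<longlongrightarrow> v - (\<Sum>a\<in>PP. res_const (rep a) * (if tri (rep a) N0 E = 0 then 1 else 0)) + C * (if om N0 E = 0 then 1 else 0)) (at 0)"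
        by (intro tendsto_add tendsto_diff lS lC lT)
      moreover have "h * T (N0 + h *s N') N' - (\<Sum>a\<in>PP. res_const (rep a) * (h * (tri (rep a) N' E / (tri (rep a) N0 E + h * tri (rep a) N' E))))
          + C * (h * (om N' E / (om N0 E + h * om N' E))) = (k + h - k) * g (k + h)" for h
      proof -
        have "N0 + h *s N' = N + (k + h) *s N'" by (simp add: N0_def vec_eq_iff algebra_simps)
        moreover have "tri (rep a) N0 E + h * tri (rep a) N' E = tri (rep a) N E + (k + h) * tri (rep a) N' E"
          "om N0 E + h * om N' E = om N E + (k + h) * om N' E" for a by (simp_all add: ab algebra_simps)
        ultimately show ?thesis unfolding g_def S_def
          by (simp only:) (simp add: sum_distrib_left algebra_simps)
      qed
      ultimately have "((\<lambda>h. (k + h - k) * g (k + h)) \<longlongrightarrow> 0) (at 0)" by (simp add: v_def)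
      then show ?thesis using LIM_offset_zero_iff[of k "\<lambda>z. (z - k) * g z" 0] by simp
    qed
    show "(g \<longlongrightarrow> 0) at_infinity"
    proof -
      have Ds: "tri N' E N \<noteq> 0"
      proof -
        have "tri N' E N = - tri N E N'" by (simp add: tri_expand algebra_simps)
        then show ?thesis using D by simp
      qed
      \<comment> \<open>In the variable \<open>u = 1 / t\<close> the trace at the line
        \<open>N'\<close> has at most a simple pole, while \<open>T_swap\<close> supplies the factor
        \<open>u\<^sup>2\<close>; so the trace tends to 0 at infinity.\<close>
      obtain c where c: "((\<lambda>u. u * T (N' + u *s N) N) \<longlongrightarrow> c) (at 0)" using limit_exists[OF Ds] by blast
      then have "((\<lambda>u. - u * (u * T (N' + u *s N) N)) \<longlongrightarrow> - 0 * c) (at 0)" by (intro tendsto_intros)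
      moreover have "eventually (\<lambda>u. - u * (u * T (N' + u *s N) N) = T (N + inverse u *s N') N') (at 0)"
        using eventually_at_0_nonzero
      proof eventually_elim
        case (elim u)
        then have "inverse u \<noteq> 0" "1 / inverse u = u" by (simp_all add: divide_inverse)
        from T_swap[OF this(1), of N N'] show ?case
          unfolding \<open>1 / inverse u = u\<close> by (simp add: power2_eq_square)
      qed
      ultimately have "((\<lambda>t. T (N + t *s N') N') \<longlongrightarrow> 0) at_infinity"
        unfolding lim_at_infinity_0 by (auto simp: o_def intro: Lim_transform_eventually)
      moreover have "(S \<longlongrightarrow> (\<Sum>a\<in>PP. res_const (rep a) * 0)) at_infinity"
        unfolding S_def[abs_def] by (intro tendsto_sum tendsto_mult tendsto_const log_deriv_at_infinity)
      moreover have "((\<lambda>t. C * (om N' E / (om N E + t * om N' E))) \<longlongrightarrow> C * 0) at_infinity"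
        by (intro tendsto_mult tendsto_const log_deriv_at_infinity)
      ultimately have "(g \<longlongrightarrow> 0 - (\<Sum>a\<in>PP. res_const (rep a) * 0) + C * 0) at_infinity"
        unfolding g_def[abs_def] by (intro tendsto_add tendsto_diff)
      then show ?thesis by simp
    qed
  qed
  moreover have "T N N' = g 0 + S 0 - C * (om N' E / om N E)" by (simp add: g_def)
  ultimately show ?thesis by (simp add: S_def C_def)
qed

end

section \<open>Holomorphic functions of two variables\<close>

definition dp :: "(complex \<times> complex \<Rightarrow> complex) \<Rightarrow> complex \<times> complex \<Rightarrow> complex" where
  "dp f z = deriv (\<lambda>s. f (s, snd z)) (fst z)"

definition dq :: "(complex \<times> complex \<Rightarrow> complex) \<Rightarrow> complex \<times> complex \<Rightarrow> complex" where
  "dq f z = deriv (\<lambda>s. f (fst z, s)) (snd z)"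

lemma holomorphic2_partials:
  assumes "open U" "holomorphic2_on f U" "z \<in> U"
  shows "(f has_derivative (\<lambda>v. dp f z * fst v + dq f z * snd v)) (at z)"
    and "((\<lambda>s. f (s, snd z)) has_field_derivative dp f z) (at (fst z))"
    and "((\<lambda>s. f (fst z, s)) has_field_derivative dq f z) (at (snd z))"
proof -
  obtain a b where ab: "(f has_derivative (\<lambda>(h, k). a * h + b * k)) (at z)"
    using assms at_within_open[OF assms(3,1)] unfolding holomorphic2_on_def by metis
  have "((\<lambda>s. (s, snd z)) has_derivative (\<lambda>h. (h, 0))) (at (fst z))"
    by (auto intro!: derivative_eq_intros)
  from has_derivative_compose[OF this, of f "\<lambda>(h, k). a * h + b * k"] ab
  have p: "((\<lambda>s. f (s, snd z)) has_field_derivative a) (at (fst z))"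
    by (simp add: has_field_derivative_def)
  have "((\<lambda>s. (fst z, s)) has_derivative (\<lambda>h. (0, h))) (at (snd z))"
    by (auto intro!: derivative_eq_intros)
  from has_derivative_compose[OF this, of f "\<lambda>(h, k). a * h + b * k"] ab
  have q: "((\<lambda>s. f (fst z, s)) has_field_derivative b) (at (snd z))"
    by (simp add: has_field_derivative_def)
  have "dp f z = a" "dq f z = b" using DERIV_imp_deriv[OF p] DERIV_imp_deriv[OF q] by (simp_all add: dp_def dq_def)
  then show "(f has_derivative (\<lambda>v. dp f z * fst v + dq f z * snd v)) (at z)"
    "((\<lambda>s. f (s, snd z)) has_field_derivative dp f z) (at (fst z))"
    "((\<lambda>s. f (fst z, s)) has_field_derivative dq f z) (at (snd z))" 
    using ab p q by (simp_all add: case_prod_beta')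
qed

lemma holomorphic2_continuous:
  assumes "open U" "holomorphic2_on f U" shows "continuous_on U f"
  using holomorphic2_partials(1)[OF assms] has_derivative_continuous
  by (intro continuous_at_imp_continuous_on) blast

lemma holomorphic2_onI:
  assumes "\<And>z. z \<in> U \<Longrightarrow> (f has_derivative (\<lambda>v. a z * fst v + b z * snd v)) (at z)"
  shows "holomorphic2_on f U"
  unfolding holomorphic2_on_def
proof
  fix z assume "z \<in> U"
  from has_derivative_at_withinI[OF assms[OF this]]
  show "\<exists>a b. (f has_derivative (\<lambda>(h, k). a * h + b * k)) (at z within U)"
    by (intro exI[of _ "a z"] exI[of _ "b z"]) (simp add: case_prod_beta')
qed

lemma box_exists:
  fixes z :: "complex \<times> complex"
  assumes "open U" "z \<in> U"
  obtains r where "r > 0" "cball (fst z) (3 * r) \<times> cball (snd z) (3 * r) \<subseteq> U"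
proof -
  obtain A B where AB: "open A" "open B" "z \<in> A \<times> B" "A \<times> B \<subseteq> U"
    using open_prod_elim[OF assms] by metis
  obtain a where a: "a > 0" "cball (fst z) a \<subseteq> A" using open_contains_cball AB by (metis mem_Times_iff)
  obtain b where b: "b > 0" "cball (snd z) b \<subseteq> B" using open_contains_cball AB by (metis mem_Times_iff)
  define r where "r = min a b / 3"
  have "cball (fst z) (3 * r) \<subseteq> A" "cball (snd z) (3 * r) \<subseteq> B"
    using a b by (auto simp: r_def)
  moreover have "r > 0" using a b by (simp add: r_def)
  ultimately show ?thesis using that[of r] AB(4) by blast
qed

text \<open>\<open>holomorphic2_on\<close> speaks of first derivatives only. Cauchy's estimate in
  the first variable, uniform in the second by compactness, bounds the second derivative and thus
  the Taylor remainder. The radii \<open>r\<close>, \<open>2 * r\<close>, \<open>3 * r\<close> leave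
  room for \<open>h\<close> and for the Cauchy disc.\<close>

lemma difference_quotient_bound:
  assumes U: "open U" "holomorphic2_on f U" and r: "r > 0" and sub: "cball p0 (3 * r) \<times> cball q0 (3 * r) \<subseteq> U"
  shows "\<exists>C. \<forall>p\<in>cball p0 r. \<forall>q\<in>cball q0 r. \<forall>h. h \<noteq> 0 \<longrightarrow> cmod h < r \<longrightarrow>
     cmod ((f (p + h, q) - f (p, q)) / h - dp f (p, q)) \<le> C * cmod h"
proof -
  have "compact (f ` (cball p0 (3 * r) \<times> cball q0 (3 * r)))"
    by (intro compact_continuous_image[OF continuous_on_subset[OF holomorphic2_continuous[OF U] sub]] compact_Times compact_cball)
  then have "bounded (f ` (cball p0 (3 * r) \<times> cball q0 (3 * r)))" by (rule compact_imp_bounded)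
  then obtain B where "\<forall>x\<in>f ` (cball p0 (3 * r) \<times> cball q0 (3 * r)). cmod x \<le> B"
    unfolding bounded_iff by blast
  then have B: "cmod (f z) \<le> B" if "z \<in> cball p0 (3 * r) \<times> cball q0 (3 * r)" for z
    using that by blast
  define K where "K = fact 2 * (B + 1) / r ^ 2"
  have main: "cmod ((f (p + h, q) - f (p, q)) / h - dp f (p, q)) \<le> K * cmod h"
    if p: "p \<in> cball p0 r" and q: "q \<in> cball q0 r" and h: "h \<noteq> 0" "cmod h < r" for p q h
  proof -
    define \<phi> where "\<phi> s = f (s, q)" for s
    have q3: "q \<in> cball q0 (3 * r)" using q r by auto
    have d: "(\<phi> has_field_derivative dp f (s, q)) (at s)" if "s \<in> cball p0 (3 * r)" for s
    proof -
      have "(s, q) \<in> U" using sub that q3 by blast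
      from holomorphic2_partials(2)[OF U this] show ?thesis by (simp add: \<phi>_def[abs_def])
    qed
    have hol: "\<phi> holomorphic_on ball p0 (3 * r)"
    proof -
      have "\<exists>f'. (\<phi> has_field_derivative f') (at x)" if "x \<in> ball p0 (3 * r)" for x
        by (rule exI, rule d) (use that in auto)
      then show ?thesis by (simp add: holomorphic_on_open)
    qed
    have cont: "continuous_on (cball p0 (3 * r)) \<phi>"
      using d by (intro continuous_at_imp_continuous_on ballI DERIV_isCont) blast
    have ders: "((deriv ^^ i) \<phi> has_field_derivative (deriv ^^ (Suc i)) \<phi> x) (at x within ball p0 (2 * r))"
      if "x \<in> ball p0 (2 * r)" for i x
    proof -
      have "x \<in> ball p0 (3 * r)" using that r by auto
      then have "(deriv ^^ i) \<phi> field_differentiable at x"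
        using holomorphic_higher_deriv[OF hol open_ball] holomorphic_on_imp_differentiable_at open_ball by blast
      then show ?thesis by (simp add: field_differentiable_derivI has_field_derivative_at_within)
    qed
    have bd: "cmod ((deriv ^^ (Suc 1)) \<phi> x) \<le> K" if x: "x \<in> ball p0 (2 * r)" for x
    proof -
      have sub': "cball x r \<subseteq> cball p0 (3 * r)"
      proof
        fix w assume "w \<in> cball x r"
        then show "w \<in> cball p0 (3 * r)" using x dist_triangle[of p0 w x] by auto
      qed
      moreover have "ball x r \<subseteq> ball p0 (3 * r)"
      proof
        fix w assume "w \<in> ball x r"
        then show "w \<in> ball p0 (3 * r)" using x dist_triangle[of p0 w x] by auto
      qed
      moreover have "\<phi> w \<in> ball 0 (B + 1)" if "w \<in> ball x r" for w
      proof -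
        have "w \<in> cball p0 (3 * r)" using that sub' ball_subset_cball by blast
        then show ?thesis using B[of "(w, q)"] q3 by (simp add: \<phi>_def)
      qed
      ultimately have "cmod ((deriv ^^ 2) \<phi> x) \<le> fact 2 * (B + 1) / r ^ 2"
        using r by (intro Cauchy_higher_deriv_bound[of \<phi> x r 0 "B + 1" 2])
          (auto intro: holomorphic_on_subset[OF hol] continuous_on_subset[OF cont])
      then show ?thesis by (simp add: K_def numeral_2_eq_2)
    qed
    have pb: "p \<in> ball p0 (2 * r)" "p + h \<in> ball p0 (2 * r)"
    proof -
      show "p \<in> ball p0 (2 * r)" using p r by auto
      have "dist p0 (p + h) \<le> dist p0 p + cmod h"
      proof -
        have "dist p (p + h) = cmod h" by (simp add: dist_norm)
        then show ?thesis using dist_triangle[of p0 "p + h" p] by simp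
      qed
      then show "p + h \<in> ball p0 (2 * r)" using p h by simp
    qed
    have "cmod ((deriv ^^ 0) \<phi> (p + h) - (\<Sum>i\<le>1. (deriv ^^ i) \<phi> p * (p + h - p) ^ i / fact i)) \<le> K * cmod (p + h - p) ^ Suc 1 / fact 1"
      by (rule complex_Taylor[OF convex_ball ders bd pb])
    then have t: "cmod (\<phi> (p + h) - (\<phi> p + deriv \<phi> p * h)) \<le> K * cmod h ^ 2"
      by (simp add: numeral_2_eq_2)
    have "deriv \<phi> p = dp f (p, q)" by (simp add: dp_def \<phi>_def[abs_def])
    then have "(f (p + h, q) - f (p, q)) / h - dp f (p, q) = (\<phi> (p + h) - (\<phi> p + deriv \<phi> p * h)) / h"
      using h by (simp add: \<phi>_def field_simps)
    then have "cmod ((f (p + h, q) - f (p, q)) / h - dp f (p, q)) = cmod (\<phi> (p + h) - (\<phi> p + deriv \<phi> p * h)) / cmod h"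
      by (simp add: norm_divide)
    also have "\<dots> \<le> K * cmod h ^ 2 / cmod h" using t by (intro divide_right_mono) auto
    also have "\<dots> = K * cmod h" using h by (simp add: power2_eq_square)
    finally show ?thesis .
  qed
  then show ?thesis by blast
qed

lemma difference_quotient_uniform:
  assumes U: "open U" "holomorphic2_on f U" and r: "r > 0" and sub: "cball p0 (3 * r) \<times> cball q0 (3 * r) \<subseteq> U"
  shows "uniform_limit (cball p0 r \<times> cball q0 r) (\<lambda>h z. (f (fst z + h, snd z) - f z) / h) (dp f) (at 0)"
proof (rule uniform_limitI)
  fix e :: real assume e: "e > 0"
  obtain C where C: "\<And>p q h. p \<in> cball p0 r \<Longrightarrow> q \<in> cball q0 r \<Longrightarrow> h \<noteq> 0 \<Longrightarrow> cmod h < r \<Longrightarrow>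
     cmod ((f (p + h, q) - f (p, q)) / h - dp f (p, q)) \<le> C * cmod h"
    using difference_quotient_bound[OF assms] by metis
  have "((\<lambda>h. C * cmod h) \<longlongrightarrow> C * cmod 0) (at 0)" by (intro tendsto_intros)
  then have "((\<lambda>h. C * cmod h) \<longlongrightarrow> 0) (at 0)" by simp
  then have "eventually (\<lambda>h. C * cmod h < e) (at 0)" using e by (rule order_tendstoD)
  moreover have "eventually (\<lambda>h. cmod h < r) (at (0::complex))"
    using r by (auto simp: eventually_at intro!: exI[of _ r])
  moreover have "eventually (\<lambda>h::complex. h \<noteq> 0) (at 0)" by (simp add: eventually_at_filter)
  ultimately show "\<forall>\<^sub>F h in at 0. \<forall>z\<in>cball p0 r \<times> cball q0 r. dist ((f (fst z + h, snd z) - f z) / h) (dp f z) < e"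
  proof eventually_elim
    case (elim h)
    show ?case
    proof
      fix z assume z: "z \<in> cball p0 r \<times> cball q0 r"
      then have "cmod ((f (fst z + h, snd z) - f (fst z, snd z)) / h - dp f (fst z, snd z)) \<le> C * cmod h"
        using elim by (intro C) auto
      then show "dist ((f (fst z + h, snd z) - f z) / h) (dp f z) < e"
        using elim by (simp add: dist_norm)
    qed
  qed
qed

lemma cball_shift: "cmod h < r \<Longrightarrow> p \<in> cball p0 r \<Longrightarrow> r > 0 \<Longrightarrow> p + h \<in> cball p0 (3 * r)"
proof -
  assume h: "cmod h < r" "p \<in> cball p0 r" "r > 0"
  have "dist p (p + h) = cmod h" by (simp add: dist_norm)
  then have "dist p0 (p + h) \<le> dist p0 p + cmod h" using dist_triangle[of p0 "p + h" p] by simp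
  then show ?thesis using h by simp
qed

lemma holomorphic2_dp_continuous:
  assumes U: "open U" "holomorphic2_on f U"
  shows "continuous_on U (dp f)"
proof (rule continuous_at_imp_continuous_on, rule ballI)
  fix z assume "z \<in> U"
  then obtain r where r: "r > 0" "cball (fst z) (3 * r) \<times> cball (snd z) (3 * r) \<subseteq> U"
    using box_exists[OF U(1)] by blast
  have "eventually (\<lambda>h. cmod h < r) (at (0::complex))"
    using r by (auto simp: eventually_at intro!: exI[of _ r])
  then have "\<forall>\<^sub>F h in at 0. continuous_on (cball (fst z) r \<times> cball (snd z) r) (\<lambda>w. (f (fst w + h, snd w) - f w) / h)"
  proof (eventually_elim)
    case (elim h)
    have "continuous_on (cball (fst z) r \<times> cball (snd z) r) (\<lambda>w. f (fst w + h, snd w))"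
      by (rule continuous_on_compose2[OF holomorphic2_continuous[OF U]])
        (use r cball_shift[OF elim] in \<open>auto intro!: continuous_intros subsetD[OF r(2)]\<close>)
    moreover have "continuous_on (cball (fst z) r \<times> cball (snd z) r) f"
      by (rule continuous_on_subset[OF holomorphic2_continuous[OF U]]) (use r in auto)
    ultimately have "continuous_on (cball (fst z) r \<times> cball (snd z) r) (\<lambda>w. (1 / h) * (f (fst w + h, snd w) - f w))"
      by (intro continuous_on_mult continuous_on_const continuous_on_diff)
    then show ?case by simp
  qed
  from uniform_limit_theorem[OF this difference_quotient_uniform[OF U r]]
  have "continuous_on (cball (fst z) r \<times> cball (snd z) r) (dp f)" by simp
  then have "continuous_on (ball (fst z) r \<times> ball (snd z) r) (dp f)"
    by (rule continuous_on_subset) auto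
  then show "isCont (dp f) z"
    using continuous_on_eq_continuous_at[OF open_Times[OF open_ball open_ball], of "fst z" r "snd z" r "dp f"] r(1)
    by (simp only: mem_Times_iff centre_in_ball)
qed

lemma holomorphic2_swap:
  assumes U: "open U" "holomorphic2_on f U"
  shows "open (prod.swap ` U)" "holomorphic2_on (f \<circ> prod.swap) (prod.swap ` U)"
    "dp (f \<circ> prod.swap) = dq f \<circ> prod.swap"
proof -
  have eq: "prod.swap ` U = prod.swap -` U" by force
  have "continuous_on UNIV (prod.swap :: complex \<times> complex \<Rightarrow> _)"
    unfolding prod.swap_def[abs_def] by (intro continuous_intros)
  then show o: "open (prod.swap ` U)" unfolding eq using U(1) by (intro open_vimage)
  show "dp (f \<circ> prod.swap) = dq f \<circ> prod.swap" by (simp add: fun_eq_iff dp_def dq_def)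
  show "holomorphic2_on (f \<circ> prod.swap) (prod.swap ` U)"
  proof (rule holomorphic2_onI)
    fix z assume "z \<in> prod.swap ` U"
    then have "prod.swap z \<in> U" by auto
    from holomorphic2_partials(1)[OF U this]
    have "(f has_derivative (\<lambda>v. dp f (prod.swap z) * fst v + dq f (prod.swap z) * snd v)) (at (prod.swap z))" .
    moreover have "(prod.swap has_derivative prod.swap) (at z)"
      unfolding prod.swap_def[abs_def] by (auto intro!: derivative_eq_intros)
    ultimately have "(f \<circ> prod.swap has_derivative (\<lambda>v. dp f (prod.swap z) * fst v + dq f (prod.swap z) * snd v) \<circ> prod.swap) (at z)"
      by (intro diff_chain_at)
    then show "(f \<circ> prod.swap has_derivative (\<lambda>v. dq f (prod.swap z) * fst v + dp f (prod.swap z) * snd v)) (at z)"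
      by (simp add: o_def add.commute)
  qed
qed

lemma holomorphic2_dq_continuous:
  assumes U: "open U" "holomorphic2_on f U"
  shows "continuous_on U (dq f)"
proof -
  have "continuous_on U (\<lambda>z. dp (f \<circ> prod.swap) (prod.swap z))"
    by (rule continuous_on_compose2[OF holomorphic2_dp_continuous[OF holomorphic2_swap(1,2)[OF U]]])
      (auto simp: prod.swap_def intro!: continuous_intros)
  then show ?thesis by (simp add: holomorphic2_swap(3)[OF U])
qed

text \<open>The difference quotients in the first variable are holomorphic in the second and
  converge uniformly, so by Weierstrass their derivatives converge to the derivative of the limit.
  This yields existence and symmetry of the mixed derivatives at once.\<close>

lemma holomorphic2_mixed:
  assumes U: "open U" "holomorphic2_on f U" and z: "z \<in> U"
  shows "\<exists>m. ((\<lambda>s. dq f (s, snd z)) has_field_derivative m) (at (fst z)) \<and>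
    ((\<lambda>s. dp f (fst z, s)) has_field_derivative m) (at (snd z))"
proof -
  obtain r where r: "r > 0" "cball (fst z) (3 * r) \<times> cball (snd z) (3 * r) \<subseteq> U"
    using box_exists[OF U(1) z] by blast
  define p q where "p = fst z" and "q = snd z"
  let ?F = "\<lambda>h w. (f (p + h, w) - f (p, w)) / h" and ?F' = "\<lambda>h w. (dq f (p + h, w) - dq f (p, w)) / h"
  have dqd: "((\<lambda>w. f (s, w)) has_field_derivative dq f (s, w)) (at w)" if "s \<in> cball p (3 * r)" "w \<in> cball q r" for s w
    using holomorphic2_partials(3)[OF U, of "(s, w)"] r that unfolding p_def q_def by force
  have "eventually (\<lambda>h. cmod h < r) (at (0::complex))"
    using r by (auto simp: eventually_at intro!: exI[of _ r])
  then have ev: "\<forall>\<^sub>F h in at 0. continuous_on (cball q r) (?F h) \<and> (\<forall>w\<in>ball q r. (?F h has_field_derivative ?F' h w) (at w))"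
  proof eventually_elim
    case (elim h)
    have d: "(?F h has_field_derivative ?F' h w) (at w)" if "w \<in> cball q r" for w
      using cball_shift[OF elim, of p p] r that by (intro DERIV_cdivide DERIV_diff dqd) auto
    then have "continuous_on (cball q r) (?F h)"
      by (intro continuous_at_imp_continuous_on ballI DERIV_isCont) blast
    then show ?case using d by auto
  qed
  have ul: "uniform_limit (cball q r) ?F (\<lambda>w. dp f (p, w)) (at 0)"
  proof -
    have "\<forall>\<^sub>F h in at 0. \<forall>y\<in>cball p r \<times> cball q r. dist ((f (fst y + h, snd y) - f y) / h) (dp f y) < e" if "e > 0" for e
      using difference_quotient_uniform[OF U r] that unfolding uniform_limit_iff p_def q_def by blast
    note ev = this
    show ?thesis unfolding uniform_limit_iff
    proof (intro allI impI)
      fix e :: real assume "e > 0"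
      show "\<forall>\<^sub>F h in at 0. \<forall>w\<in>cball q r. dist (?F h w) (dp f (p, w)) < e"
        using ev[OF \<open>e > 0\<close>]
      proof eventually_elim
        case (elim h)
        show ?case
        proof
          fix w assume "w \<in> cball q r"
          then have "(p, w) \<in> cball p r \<times> cball q r" using r by simp
          from bspec[OF elim this] show "dist (?F h w) (dp f (p, w)) < e" by simp
        qed
      qed
    qed
  qed
  obtain g' where g': "\<And>w. w \<in> ball q r \<Longrightarrow> ((\<lambda>w. dp f (p, w)) has_field_derivative g' w) (at w) \<and> ((\<lambda>h. ?F' h w) \<longlongrightarrow> g' w) (at 0)"
    using has_complex_derivative_uniform_limit[OF ev ul _ r(1)] by auto
  have "((\<lambda>s. dq f (s, q)) has_field_derivative g' q) (at p)"
    using g'[of q] r(1) by (simp add: DERIV_def)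
  moreover have "((\<lambda>w. dp f (p, w)) has_field_derivative g' q) (at q)" using g'[of q] r(1) by simp
  ultimately show ?thesis unfolding p_def q_def by blast
qed

text \<open>Both partial derivatives are required to exist, since \<open>ext_deriv\<close> is made
  of \<open>deriv\<close>, which is additive only on differentiable functions.\<close>

definition closed_at :: "form1 \<Rightarrow> complex \<times> complex \<Rightarrow> bool" where
  "closed_at \<theta> z \<longleftrightarrow> (\<exists>m. ((\<lambda>s. snd (\<theta> (s, snd z))) has_field_derivative m) (at (fst z)) \<and>
    ((\<lambda>s. fst (\<theta> (fst z, s))) has_field_derivative m) (at (snd z)))"

lemma closed_at_ext_deriv: "closed_at \<theta> z \<Longrightarrow> ext_deriv \<theta> z = 0"
  by (cases z) (auto simp: closed_at_def ext_deriv_def dest!: DERIV_imp_deriv)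

lemma closed_at_add:
  assumes "closed_at \<theta> z" "closed_at \<eta> z"
  shows "closed_at (\<lambda>z. (fst (\<theta> z) + fst (\<eta> z), snd (\<theta> z) + snd (\<eta> z))) z"
proof -
  from assms obtain m k where "((\<lambda>s. snd (\<theta> (s, snd z))) has_field_derivative m) (at (fst z))"
    "((\<lambda>s. fst (\<theta> (fst z, s))) has_field_derivative m) (at (snd z))"
    "((\<lambda>s. snd (\<eta> (s, snd z))) has_field_derivative k) (at (fst z))"
    "((\<lambda>s. fst (\<eta> (fst z, s))) has_field_derivative k) (at (snd z))" by (auto simp: closed_at_def)
  then show ?thesis unfolding closed_at_def by (intro exI[of _ "m + k"]) (auto intro!: DERIV_add)
qed

lemma closed_at_cmult:
  assumes "closed_at \<theta> z"
  shows "closed_at (\<lambda>z. (c * fst (\<theta> z), c * snd (\<theta> z))) z"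
proof -
  from assms obtain m where "((\<lambda>s. snd (\<theta> (s, snd z))) has_field_derivative m) (at (fst z))"
    "((\<lambda>s. fst (\<theta> (fst z, s))) has_field_derivative m) (at (snd z))" by (auto simp: closed_at_def)
  then show ?thesis unfolding closed_at_def by (intro exI[of _ "c * m"]) (auto intro!: DERIV_cmult)
qed

lemma closed_at_sum:
  assumes "\<And>i. i \<in> I \<Longrightarrow> closed_at (\<theta> i) z"
  shows "closed_at (\<lambda>z. (\<Sum>i\<in>I. fst (\<theta> i z), \<Sum>i\<in>I. snd (\<theta> i z))) z"
  using assms
proof (induction I rule: infinite_finite_induct)
  case (insert x F)
  then have "closed_at (\<lambda>z. (fst (\<theta> x z) + fst (\<Sum>i\<in>F. fst (\<theta> i z), \<Sum>i\<in>F. snd (\<theta> i z)), snd (\<theta> x z) + snd (\<Sum>i\<in>F. fst (\<theta> i z), \<Sum>i\<in>F. snd (\<theta> i z)))) z"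
    by (intro closed_at_add) auto
  then show ?case using insert by simp
qed (auto simp: closed_at_def intro!: exI[of _ 0])

definition dlog :: "(complex \<times> complex \<Rightarrow> complex) \<Rightarrow> form1" where
  "dlog g z = (dp g z / g z, dq g z / g z)"

lemma closed_at_dlog:
  assumes U: "open U" "holomorphic2_on g U" and z: "z \<in> U" "g z \<noteq> 0"
  shows "closed_at (dlog g) z"
proof -
  obtain m where m: "((\<lambda>s. dq g (s, snd z)) has_field_derivative m) (at (fst z))"
    "((\<lambda>s. dp g (fst z, s)) has_field_derivative m) (at (snd z))"
    using holomorphic2_mixed[OF U z(1)] by blast
  have "((\<lambda>s. dq g (s, snd z) / g (s, snd z)) has_field_derivative (m * g z - dq g z * dp g z) / (g z * g z)) (at (fst z))"
    using DERIV_divide[OF m(1) holomorphic2_partials(2)[OF U z(1)]] z(2) by simp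
  moreover have "((\<lambda>s. dp g (fst z, s) / g (fst z, s)) has_field_derivative (m * g z - dp g z * dq g z) / (g z * g z)) (at (snd z))"
    using DERIV_divide[OF m(2) holomorphic2_partials(3)[OF U z(1)]] z(2) by simp
  ultimately show ?thesis unfolding closed_at_def dlog_def by (auto simp: mult.commute)
qed

lemma dlog_continuous:
  assumes U: "open U" "holomorphic2_on g U" and nz: "\<And>z. z \<in> U \<Longrightarrow> g z \<noteq> 0"
  shows "continuous_on U (dlog g)"
  unfolding dlog_def[abs_def]
  by (intro continuous_intros holomorphic2_dp_continuous holomorphic2_dq_continuous holomorphic2_continuous assms) (use nz in auto)

section \<open>Rules of calculus and derivatives along a constant field\<close>

lemma holomorphic2_subset: "holomorphic2_on f U \<Longrightarrow> open U \<Longrightarrow> V \<subseteq> U \<Longrightarrow> holomorphic2_on f V"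
  by (rule holomorphic2_onI[of V f "dp f" "dq f"]) (rule holomorphic2_partials(1)[of U], auto)

lemma holomorphic2_const: "holomorphic2_on (\<lambda>z. c) U"
  by (rule holomorphic2_onI[of _ _ "\<lambda>_. 0" "\<lambda>_. 0"]) (auto intro!: derivative_eq_intros)

lemma holomorphic2_coords: "holomorphic2_on fst U" "holomorphic2_on snd U"
  by (rule holomorphic2_onI[of _ _ "\<lambda>_. 1" "\<lambda>_. 0"], auto intro!: derivative_eq_intros,
      rule holomorphic2_onI[of _ _ "\<lambda>_. 0" "\<lambda>_. 1"], auto intro!: derivative_eq_intros)

lemma holomorphic2_add:
  assumes "open U" "holomorphic2_on f U" "holomorphic2_on g U"
  shows "holomorphic2_on (\<lambda>z. f z + g z) U"
proof (rule holomorphic2_onI)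
  fix z assume z: "z \<in> U"
  show "((\<lambda>z. f z + g z) has_derivative (\<lambda>v. (dp f z + dp g z) * fst v + (dq f z + dq g z) * snd v)) (at z)"
    by (rule has_derivative_eq_rhs[OF has_derivative_add[OF holomorphic2_partials(1)[OF assms(1,2) z] holomorphic2_partials(1)[OF assms(1,3) z]]])
      (simp add: fun_eq_iff algebra_simps)
qed

lemma holomorphic2_mult:
  assumes "open U" "holomorphic2_on f U" "holomorphic2_on g U"
  shows "holomorphic2_on (\<lambda>z. f z * g z) U"
proof (rule holomorphic2_onI)
  fix z assume z: "z \<in> U"
  show "((\<lambda>z. f z * g z) has_derivative (\<lambda>v. (f z * dp g z + dp f z * g z) * fst v + (f z * dq g z + dq f z * g z) * snd v)) (at z)"
    by (rule has_derivative_eq_rhs[OF has_derivative_mult[OF holomorphic2_partials(1)[OF assms(1,2) z] holomorphic2_partials(1)[OF assms(1,3) z]]])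
      (simp add: fun_eq_iff algebra_simps)
qed

lemma holomorphic2_diff:
  assumes "open U" "holomorphic2_on f U" "holomorphic2_on g U"
  shows "holomorphic2_on (\<lambda>z. f z - g z) U"
  using holomorphic2_add[OF assms(1,2) holomorphic2_mult[OF assms(1) holomorphic2_const[of "-1"] assms(3)]] by simp

lemma holomorphic2_inverse:
  assumes "open U" "holomorphic2_on f U" "\<And>z. z \<in> U \<Longrightarrow> f z \<noteq> 0"
  shows "holomorphic2_on (\<lambda>z. inverse (f z)) U"
proof (rule holomorphic2_onI)
  fix z assume z: "z \<in> U"
  show "((\<lambda>z. inverse (f z)) has_derivative (\<lambda>v. (- (inverse (f z) * dp f z * inverse (f z))) * fst v + (- (inverse (f z) * dq f z * inverse (f z))) * snd v)) (at z)"
    by (rule has_derivative_eq_rhs[OF Deriv.has_derivative_inverse[OF assms(3)[OF z] holomorphic2_partials(1)[OF assms(1,2) z]]])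
      (simp add: fun_eq_iff algebra_simps)
qed

lemma holomorphic2_divide:
  assumes "open U" "holomorphic2_on f U" "holomorphic2_on g U" "\<And>z. z \<in> U \<Longrightarrow> g z \<noteq> 0"
  shows "holomorphic2_on (\<lambda>z. f z / g z) U"
  using holomorphic2_mult[OF assms(1,2) holomorphic2_inverse[OF assms(1,3,4)]] by (simp add: divide_inverse)

lemma holomorphic2_prod:
  assumes "open U" "\<And>i. i \<in> I \<Longrightarrow> holomorphic2_on (f i) U"
  shows "holomorphic2_on (\<lambda>z. \<Prod>i\<in>I. f i z) U"
  using assms(2)
  by (induction I rule: infinite_finite_induct) (auto intro: holomorphic2_const holomorphic2_mult assms(1))

lemma holomorphic2_cong:
  assumes "open U" "holomorphic2_on f U" "\<And>z. z \<in> U \<Longrightarrow> g z = f z"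
  shows "holomorphic2_on g U"
proof (rule holomorphic2_onI)
  fix z assume z: "z \<in> U"
  show "(g has_derivative (\<lambda>v. dp f z * fst v + dq f z * snd v)) (at z)"
    by (rule has_derivative_transform_within_open[OF holomorphic2_partials(1)[OF assms(1,2) z] assms(1) z])
      (simp add: assms(3))
qed

definition dir :: "complex \<Rightarrow> complex \<Rightarrow> (complex \<times> complex \<Rightarrow> complex) \<Rightarrow> complex \<times> complex \<Rightarrow> complex" where
  "dir a b g z = a * dp g z + b * dq g z"

lemma dir_line:
  assumes "open U" "holomorphic2_on f U" "z \<in> U"
  shows "((\<lambda>h. f (fst z + h * a, snd z + h * b)) has_field_derivative dir a b f z) (at 0)"
proof -
  have "((\<lambda>h. (fst z + h * a, snd z + h * b)) has_derivative (\<lambda>h. (h * a, h * b))) (at (0::complex))"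
    by (auto intro!: derivative_eq_intros)
  from has_derivative_compose[OF this, of f "\<lambda>v. dp f z * fst v + dq f z * snd v"] holomorphic2_partials(1)[OF assms]
  have "((\<lambda>h. f (fst z + h * a, snd z + h * b)) has_derivative (\<lambda>h. dp f z * (h * a) + dq f z * (h * b))) (at 0)" by simp
  then show ?thesis unfolding has_field_derivative_def dir_def
    by (rule has_derivative_eq_rhs) (simp add: fun_eq_iff algebra_simps)
qed

lemma dir_eqI:
  assumes "open U" "holomorphic2_on f U" "z \<in> U"
    "((\<lambda>h. f (fst z + h * a, snd z + h * b)) has_field_derivative D) (at 0)"
  shows "dir a b f z = D"
  using DERIV_unique[OF dir_line[OF assms(1-3)] assms(4)] .

lemma dir_const: "dir a b (\<lambda>z. c) z = 0" by (simp add: dir_def dp_def dq_def)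

lemma dir_add:
  assumes "open U" "holomorphic2_on f U" "holomorphic2_on g U" "z \<in> U"
  shows "dir a b (\<lambda>z. f z + g z) z = dir a b f z + dir a b g z"
  by (rule dir_eqI[OF assms(1) holomorphic2_add[OF assms(1-3)] assms(4)])
    (intro DERIV_add dir_line[OF assms(1)] assms)

lemma dir_diff:
  assumes "open U" "holomorphic2_on f U" "holomorphic2_on g U" "z \<in> U"
  shows "dir a b (\<lambda>z. f z - g z) z = dir a b f z - dir a b g z"
  by (rule dir_eqI[OF assms(1) holomorphic2_diff[OF assms(1-3)] assms(4)])
    (intro DERIV_diff dir_line[OF assms(1)] assms)

lemma dir_mult:
  assumes "open U" "holomorphic2_on f U" "holomorphic2_on g U" "z \<in> U"
  shows "dir a b (\<lambda>z. f z * g z) z = dir a b f z * g z + f z * dir a b g z"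
  using DERIV_mult[OF dir_line[OF assms(1,2,4), of a b] dir_line[OF assms(1,3,4), of a b]]
  by (intro dir_eqI[OF assms(1) holomorphic2_mult[OF assms(1-3)] assms(4)]) (simp add: mult.commute)

lemma dir_prod:
  assumes "open U" "finite I" "\<And>i. i \<in> I \<Longrightarrow> holomorphic2_on (f i) U" "z \<in> U" "\<And>i. i \<in> I \<Longrightarrow> f i z \<noteq> 0"
  shows "dir a b (\<lambda>z. \<Prod>i\<in>I. f i z) z = (\<Prod>i\<in>I. f i z) * (\<Sum>i\<in>I. dir a b (f i) z / f i z)"
  using assms(2,3,5)
proof (induction I rule: finite_induct)
  case (insert i I)
  have "dir a b (\<lambda>z. f i z * (\<Prod>i\<in>I. f i z)) z = dir a b (f i) z * (\<Prod>i\<in>I. f i z) + f i z * dir a b (\<lambda>z. \<Prod>i\<in>I. f i z) z"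
    using insert.prems by (intro dir_mult[OF assms(1)] assms(4) holomorphic2_prod[OF assms(1)]) auto
  then show ?case using insert by (simp add: field_simps)
qed (simp add: dir_const)

lemma dir_cong:
  assumes "open U" "holomorphic2_on f U" "z \<in> U" "\<And>w. w \<in> U \<Longrightarrow> g w = f w"
  shows "dir a b g z = dir a b f z"
proof (rule dir_eqI[OF assms(1) holomorphic2_cong[OF assms(1,2,4)] assms(3)])
  have "continuous_on UNIV (\<lambda>h::complex. (fst z + h * a, snd z + h * b))" by (intro continuous_intros)
  then have oV: "open ((\<lambda>h::complex. (fst z + h * a, snd z + h * b)) -` U)" using assms(1) by (intro open_vimage)
  show "((\<lambda>h. g (fst z + h * a, snd z + h * b)) has_field_derivative dir a b f z) (at 0)"
    by (rule has_field_derivative_transform_within_open[OF dir_line[OF assms(1-3)] oV])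
      (use assms(3,4) in auto)
qed

lemma ext_deriv_dir:
  shows "ext_deriv \<theta> z = dir 1 0 (\<lambda>w. snd (\<theta> w)) z - dir 0 1 (\<lambda>w. fst (\<theta> w)) z"
  by (cases z) (simp add: ext_deriv_def dir_def dp_def dq_def)

section \<open>The 1-forms of a web\<close>

lemma wedge_solve:
  assumes W: "wedge u v \<noteq> 0"
  shows "wedge e u = \<alpha> \<and> wedge e v = \<beta> \<longleftrightarrow>
    e = ((\<beta> * fst u - \<alpha> * fst v) / wedge u v, (\<beta> * snd u - \<alpha> * snd v) / wedge u v)"
proof
  assume *: "wedge e u = \<alpha> \<and> wedge e v = \<beta>"
  have "wedge e v * fst u - wedge e u * fst v = fst e * wedge u v" "wedge e v * snd u - wedge e u * snd v = snd e * wedge u v"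
    by (simp_all add: wedge_def algebra_simps)
  then show "e = ((\<beta> * fst u - \<alpha> * fst v) / wedge u v, (\<beta> * snd u - \<alpha> * snd v) / wedge u v)"
    using W * by (simp add: prod_eq_iff)
next
  assume e: "e = ((\<beta> * fst u - \<alpha> * fst v) / wedge u v, (\<beta> * snd u - \<alpha> * snd v) / wedge u v)"
  define w where "w = wedge u v"
  have e': "fst e * w = \<beta> * fst u - \<alpha> * fst v" "snd e * w = \<beta> * snd u - \<alpha> * snd v"
    using W by (simp_all add: e w_def)
  have "wedge e u * w = (fst e * w) * snd u - (snd e * w) * fst u" "wedge e v * w = (fst e * w) * snd v - (snd e * w) * fst v"
    by (simp_all add: wedge_def algebra_simps)
  then have "wedge e u * w = \<alpha> * w" "wedge e v * w = \<beta> * w"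
    unfolding e' by (simp_all add: w_def wedge_def algebra_simps)
  then show "wedge e u = \<alpha> \<and> wedge e v = \<beta>" using W by (simp add: w_def)
qed

definition theta :: "(nat \<Rightarrow> form1) \<Rightarrow> nat \<Rightarrow> nat \<Rightarrow> nat \<Rightarrow> form1" where
  "theta \<omega> i j k w = scale_covec (wedge (\<omega> j w) (\<omega> k w)) (\<omega> i w)"

locale web =
  fixes d :: nat and U :: "(complex \<times> complex) set" and \<omega> :: "nat \<Rightarrow> form1"
  assumes openU: "open U"
    and hol: "\<And>i. i < d \<Longrightarrow> holomorphic_form1_on (\<omega> i) U"
    and transverse: "\<And>i j z. i < d \<Longrightarrow> j < d \<Longrightarrow> i \<noteq> j \<Longrightarrow> z \<in> U \<Longrightarrow> wedge (\<omega> i z) (\<omega> j z) \<noteq> 0"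
begin

lemma hol_components:
  assumes "i < d"
  shows "holomorphic2_on (\<lambda>z. fst (\<omega> i z)) U" "holomorphic2_on (\<lambda>z. snd (\<omega> i z)) U"
  using hol[OF assms] by (simp_all add: holomorphic_form1_on_def o_def)

lemma hol_wedge: "i < d \<Longrightarrow> j < d \<Longrightarrow> holomorphic2_on (\<lambda>z. wedge (\<omega> i z) (\<omega> j z)) U"
  unfolding wedge_def by (intro holomorphic2_diff holomorphic2_mult openU hol_components)

lemma hol_theta:
  assumes "i < d" "j < d" "k < d"
  shows "holomorphic2_on (\<lambda>z. fst (theta \<omega> i j k z)) U" "holomorphic2_on (\<lambda>z. snd (theta \<omega> i j k z)) U"
  unfolding theta_def scale_covec_def fst_conv snd_conv
  by (intro holomorphic2_mult openU hol_components hol_wedge assms)+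

text \<open>The forms \<open>theta\<close> of the three cyclic orders add up to zero, so the third
  defining equation of \<open>eta\<close> follows from the other two. These have a unique solution,
  because the wedge product of the first two forms is the product of the three pairwise wedge
  products.\<close>

lemma
  assumes rst: "r < d" "s < d" "t < d" "r \<noteq> s" "s \<noteq> t" "r \<noteq> t" and z: "z \<in> U"
  shows wedge_theta: "wedge (theta \<omega> r s t z) (theta \<omega> s t r z) \<noteq> 0"
    and eta_eq: "eta \<omega> r s t z =
      ((ext_deriv (theta \<omega> s t r) z * fst (theta \<omega> r s t z) - ext_deriv (theta \<omega> r s t) z * fst (theta \<omega> s t r z))
          / wedge (theta \<omega> r s t z) (theta \<omega> s t r z),
       (ext_deriv (theta \<omega> s t r) z * snd (theta \<omega> r s t z) - ext_deriv (theta \<omega> r s t) z * snd (theta \<omega> s t r z))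
          / wedge (theta \<omega> r s t z) (theta \<omega> s t r z))" (is "_ = ?e")
    and eta_wedge: "wedge (eta \<omega> r s t z) (theta \<omega> r s t z) = ext_deriv (theta \<omega> r s t) z"
      "wedge (eta \<omega> r s t z) (theta \<omega> s t r z) = ext_deriv (theta \<omega> s t r) z"
proof -
  have "wedge (theta \<omega> r s t z) (theta \<omega> s t r z) = wedge (\<omega> s z) (\<omega> t z) * wedge (\<omega> t z) (\<omega> r z) * wedge (\<omega> r z) (\<omega> s z)"
    by (simp add: theta_def scale_covec_def wedge_def algebra_simps)
  then show W: "wedge (theta \<omega> r s t z) (theta \<omega> s t r z) \<noteq> 0"
    using transverse[OF rst(2,3,5) z] transverse[OF rst(3,1) rst(6)[symmetric] z] transverse[OF rst(1,2,4) z] by simp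
  have sum0: "fst (theta \<omega> t r s w) = 0 - (fst (theta \<omega> r s t w) + fst (theta \<omega> s t r w))"
    "snd (theta \<omega> t r s w) = 0 - (snd (theta \<omega> r s t w) + snd (theta \<omega> s t r w))" for w
    by (simp_all add: theta_def scale_covec_def wedge_def algebra_simps)
  have h: "holomorphic2_on (\<lambda>w. fst (theta \<omega> r s t w) + fst (theta \<omega> s t r w)) U"
    "holomorphic2_on (\<lambda>w. snd (theta \<omega> r s t w) + snd (theta \<omega> s t r w)) U"
    by (intro holomorphic2_add openU hol_theta rst)+
  have D: "ext_deriv (theta \<omega> t r s) z = - (ext_deriv (theta \<omega> r s t) z + ext_deriv (theta \<omega> s t r) z)"
  proof -
    have "dir a b (\<lambda>w. 0 - (f w + g w)) z = - (dir a b f z + dir a b g z)"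
      if "holomorphic2_on f U" "holomorphic2_on g U" for a b f g
      unfolding dir_diff[OF openU holomorphic2_const holomorphic2_add[OF openU that] z] dir_add[OF openU that z]
      by (simp add: dir_const)
    note r = this
    show ?thesis
      unfolding ext_deriv_dir sum0 
      by (subst (1 2) r) (auto intro!: hol_theta rst)
  qed
  have third: "wedge e (theta \<omega> t r s z) = - (wedge e (theta \<omega> r s t z) + wedge e (theta \<omega> s t r z))" for e
    by (simp add: wedge_def sum0 algebra_simps)
  have "(\<forall>(i, j, k) \<in> {(r, s, t), (s, t, r), (t, r, s)}.
        ext_deriv (\<lambda>w. scale_covec (wedge (\<omega> j w) (\<omega> k w)) (\<omega> i w)) z
          = wedge e (scale_covec (wedge (\<omega> j z) (\<omega> k z)) (\<omega> i z))) \<longleftrightarrow>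
     wedge e (theta \<omega> r s t z) = ext_deriv (theta \<omega> r s t) z \<and> wedge e (theta \<omega> s t r z) = ext_deriv (theta \<omega> s t r) z" for e
    using D third[of e] by (auto simp: theta_def[symmetric] theta_def[abs_def, symmetric])
  then have "(\<forall>(i, j, k) \<in> {(r, s, t), (s, t, r), (t, r, s)}.
        ext_deriv (\<lambda>w. scale_covec (wedge (\<omega> j w) (\<omega> k w)) (\<omega> i w)) z
          = wedge e (scale_covec (wedge (\<omega> j z) (\<omega> k z)) (\<omega> i z))) \<longleftrightarrow> e = ?e" for e
    unfolding wedge_solve[OF W] .
  then show "eta \<omega> r s t z = ?e" unfolding eta_def by simp
  then show "wedge (eta \<omega> r s t z) (theta \<omega> r s t z) = ext_deriv (theta \<omega> r s t) z"
      "wedge (eta \<omega> r s t z) (theta \<omega> s t r z) = ext_deriv (theta \<omega> s t r) z"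
    using wedge_solve[OF W, of "eta \<omega> r s t z" "ext_deriv (theta \<omega> r s t) z" "ext_deriv (theta \<omega> s t r) z"] by blast+
qed

lemma dir_continuous: "holomorphic2_on f U \<Longrightarrow> continuous_on U (dir a b f)"
  unfolding dir_def[abs_def]
  by (intro continuous_intros holomorphic2_dp_continuous holomorphic2_dq_continuous openU)

lemma eta_continuous:
  assumes rst: "r < d" "s < d" "t < d" "r \<noteq> s" "s \<noteq> t" "r \<noteq> t"
  shows "continuous_on U (eta \<omega> r s t)"
proof -
  let ?W = "\<lambda>z. wedge (theta \<omega> r s t z) (theta \<omega> s t r z)"
  have c: "continuous_on U (\<lambda>z. fst (theta \<omega> r s t z))" "continuous_on U (\<lambda>z. snd (theta \<omega> r s t z))"
      "continuous_on U (\<lambda>z. fst (theta \<omega> s t r z))" "continuous_on U (\<lambda>z. snd (theta \<omega> s t r z))"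
      "continuous_on U (ext_deriv (theta \<omega> r s t))" "continuous_on U (ext_deriv (theta \<omega> s t r))"
    unfolding ext_deriv_dir[abs_def]
    by (intro holomorphic2_continuous openU hol_theta rst continuous_on_diff dir_continuous)+
  have "continuous_on U (\<lambda>z. ((ext_deriv (theta \<omega> s t r) z * fst (theta \<omega> r s t z) - ext_deriv (theta \<omega> r s t) z * fst (theta \<omega> s t r z)) / ?W z,
       (ext_deriv (theta \<omega> s t r) z * snd (theta \<omega> r s t z) - ext_deriv (theta \<omega> r s t) z * snd (theta \<omega> s t r z)) / ?W z))"
    unfolding wedge_def
    by (intro continuous_on_Pair continuous_on_divide continuous_on_diff continuous_on_mult c ballI)
      (use wedge_theta[OF rst] in \<open>simp_all add: wedge_def\<close>)
  then show ?thesis by (rule continuous_on_eq) (simp add: eta_eq[OF rst])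
qed

end

text \<open>For each of the three foliations, \<open>x\<close> is the slope and \<open>p\<close>,
  \<open>m\<close> are its two partial derivatives; \<open>A1\<close>, \<open>A2\<close> are the
  logarithmic derivatives of the product of the scaling factors. Eliminating \<open>u1\<close>
  separates the foliations: each enters through \<open>p + x * m\<close>, the second derivative of
  its leaf, and through \<open>m\<close>.\<close>

lemma eta_solution:
  fixes u1 u2 :: complex
  assumes "xr \<noteq> xs" "xs \<noteq> xt" "xr \<noteq> xt"
    and E1: "u1 + u2 * xr = A1 + xr * A2 + ((pt - ps) + xr * (mt - ms)) / (xt - xs) + mr"
    and E2: "u1 + u2 * xs = A1 + xs * A2 + ((pr - pt) + xs * (mr - mt)) / (xr - xt) + ms"
  shows "u2 = A2 + (- (pr + xr * mr) / ((xr - xs) * (xr - xt)) + mr * (1 / (xr - xs) + 1 / (xr - xt)))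
    + (- (ps + xs * ms) / ((xs - xt) * (xs - xr)) + ms * (1 / (xs - xt) + 1 / (xs - xr)))
    + (- (pt + xt * mt) / ((xt - xr) * (xt - xs)) + mt * (1 / (xt - xr) + 1 / (xt - xs)))" (is "u2 = ?R")
proof -
  define X Y where "X = xt - xs" and "Y = xr - xt"
  define K where "K = ((pt - ps) + xr * (mt - ms)) / X + mr - ((pr - pt) + xs * (mr - mt)) / Y - ms"
  have nz: "X \<noteq> 0" "Y \<noteq> 0" "X + Y \<noteq> 0" using assms by (auto simp: X_def Y_def)
  have x: "xt = xs + X" "xr = xs + X + Y" by (simp_all add: X_def Y_def)
  have "u2 * (X + Y) = (u1 + u2 * xr) - (u1 + u2 * xs)" by (simp add: X_def Y_def algebra_simps)
  also have "\<dots> = (X + Y) * A2 + ((pt - ps) + xr * (mt - ms)) / X + mr - ((pr - pt) + xs * (mr - mt)) / Y - ms"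
    unfolding E1 E2 by (simp add: X_def Y_def algebra_simps)
  also have "\<dots> = (X + Y) * A2 + K" by (simp add: K_def)
  finally have "u2 = ((X + Y) * A2 + K) / (X + Y)" using nz(3) by (simp add: eq_divide_eq)
  then have "u2 = A2 + (((pt - ps) + xr * (mt - ms)) / X + mr - ((pr - pt) + xs * (mr - mt)) / Y - ms) / (X + Y)"
    using nz(3) by (simp add: add_divide_distrib K_def)
  also have "\<dots> = A2 + ((- (pr + xr * mr) / ((X + Y) * Y) + mr * (1 / (X + Y) + 1 / Y))
    + (- (ps + xs * ms) / ((- X) * (- (X + Y))) + ms * (1 / (- X) + 1 / (- (X + Y))))
    + (- (pt + xt * mt) / ((- Y) * X) + mt * (1 / (- Y) + 1 / X)))"
  proof -
    define S where "S = X + Y"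
    have S: "S \<noteq> 0" "Y = S - X" using nz by (simp_all add: S_def)
    have "(((pt - ps) + xr * (mt - ms)) / X + mr - ((pr - pt) + xs * (mr - mt)) / Y - ms) / S * (X * Y * S)
      = ((pt - ps) + xr * (mt - ms)) * Y + mr * X * Y - ((pr - pt) + xs * (mr - mt)) * X - ms * X * Y"
      using nz S(1) by (simp add: field_simps)
    moreover have "((- (pr + xr * mr) / (S * Y) + mr * (1 / S + 1 / Y))
      + (- (ps + xs * ms) / ((- X) * (- S)) + ms * (1 / (- X) + 1 / (- S)))
      + (- (pt + xt * mt) / ((- Y) * X) + mt * (1 / (- Y) + 1 / X))) * (X * Y * S)
      = - (pr + xr * mr) * X + mr * (X * Y + X * S) - (ps + xs * ms) * Y - ms * (Y * S + X * Y) + (pt + xt * mt) * S + mt * (Y * S - X * S)"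
      using nz S(1) by (simp add: field_simps)
    moreover have "((pt - ps) + xr * (mt - ms)) * Y + mr * X * Y - ((pr - pt) + xs * (mr - mt)) * X - ms * X * Y
      = - (pr + xr * mr) * X + mr * (X * Y + X * S) - (ps + xs * ms) * Y - ms * (Y * S + X * Y) + (pt + xt * mt) * S + mt * (Y * S - X * S)"
      unfolding x S_def by (simp add: algebra_simps)
    ultimately have "(((pt - ps) + xr * (mt - ms)) / X + mr - ((pr - pt) + xs * (mr - mt)) / Y - ms) / S * (X * Y * S)
      = ((- (pr + xr * mr) / (S * Y) + mr * (1 / S + 1 / Y))
      + (- (ps + xs * ms) / ((- X) * (- S)) + ms * (1 / (- X) + 1 / (- S)))
      + (- (pt + xt * mt) / ((- Y) * X) + mt * (1 / (- Y) + 1 / X))) * (X * Y * S)" by (simp only:)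
    then show ?thesis using nz S(1) unfolding S_def[symmetric] by (simp only: mult_right_cancel mult_eq_0_iff simp_thms)
  qed
  also have "\<dots> = ?R"
  proof -
    have "xr - xs = X + Y" "xr - xt = Y" "xs - xt = - X" "xs - xr = - (X + Y)" "xt - xr = - Y" "xt - xs = X"
      by (simp_all add: X_def Y_def)
    then show ?thesis by (simp only: add.assoc)
  qed
  finally show ?thesis .
qed

section \<open>Sums over triples of foliations\<close>

definition triples :: "nat \<Rightarrow> (nat \<times> nat \<times> nat) set" where
  "triples d = {(r, s, t). r < s \<and> s < t \<and> t < d}"

text \<open>Each unordered triple appears once for every distinguished index \<open>i\<close>;
  symmetry in the other two accounts for the factor 2.\<close>

lemma triple_sum:
  fixes G :: "nat \<Rightarrow> nat \<Rightarrow> nat \<Rightarrow> complex"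
  assumes sym: "\<And>i j k. G i j k = G i k j"
  shows "2 * (\<Sum>(r, s, t)\<in>triples d. G r s t + G s t r + G t r s)
    = (\<Sum>i<d. \<Sum>j\<in>{..<d} - {i}. \<Sum>k\<in>{..<d} - {i} - {j}. G i j k)"
proof -
  let ?T = "triples d"
  define O1 where "O1 = {(i, j, k). i < d \<and> j < d \<and> k < d \<and> i \<noteq> j \<and> i \<noteq> k \<and> j < k}"
  define O2 where "O2 = {(i, j, k). i < d \<and> j < d \<and> k < d \<and> i \<noteq> j \<and> i \<noteq> k \<and> k < j}"
  have fin: "finite O1" "finite O2"
    by (rule finite_subset[of _ "{..<d} \<times> {..<d} \<times> {..<d}"], auto simp: O1_def O2_def)+
  have "(\<Sum>i<d. \<Sum>j\<in>{..<d} - {i}. \<Sum>k\<in>{..<d} - {i} - {j}. G i j k) = (\<Sum>(i, j, k)\<in>O1 \<union> O2. G i j k)"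
  proof -
    have "O1 \<union> O2 = (SIGMA i:{..<d}. SIGMA j:{..<d} - {i}. {..<d} - {i} - {j})"
      by (auto simp: O1_def O2_def)
    then show ?thesis by (simp add: sum.Sigma)
  qed
  also have "\<dots> = (\<Sum>(i, j, k)\<in>O1. G i j k) + (\<Sum>(i, j, k)\<in>O2. G i j k)"
    using fin by (intro sum.union_disjoint) (auto simp: O1_def O2_def)
  also have "(\<Sum>(i, j, k)\<in>O2. G i j k) = (\<Sum>(i, j, k)\<in>O1. G i j k)"
    by (rule sum.reindex_bij_witness[of _ "\<lambda>(i, j, k). (i, k, j)" "\<lambda>(i, j, k). (i, k, j)"])
      (auto simp: O1_def O2_def intro: sym)
  also have "(\<Sum>(i, j, k)\<in>O1. G i j k) = (\<Sum>(r, s, t)\<in>?T. G r s t) + (\<Sum>(r, s, t)\<in>?T. G s t r) + (\<Sum>(r, s, t)\<in>?T. G t r s)"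
  proof -
    define A B C where "A = {(i, j, k) \<in> O1. i < j}" and "B = {(i, j, k) \<in> O1. j < i \<and> i < k}" and "C = {(i, j, k) \<in> O1. k < i}"
    have "O1 = A \<union> B \<union> C" by (auto simp: A_def B_def C_def O1_def)
    moreover have "finite A" "finite B" "finite C" using fin by (auto simp: A_def B_def C_def intro: finite_subset[of _ O1])
    moreover have "A \<inter> B = {}" "(A \<union> B) \<inter> C = {}" by (auto simp: A_def B_def C_def O1_def)
    ultimately have "(\<Sum>(i, j, k)\<in>O1. G i j k) = (\<Sum>(i, j, k)\<in>A. G i j k) + (\<Sum>(i, j, k)\<in>B. G i j k) + (\<Sum>(i, j, k)\<in>C. G i j k)"
      by (simp add: sum.union_disjoint)
    moreover have "A = ?T" by (auto simp: A_def O1_def triples_def)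
    moreover have "(\<Sum>(i, j, k)\<in>B. G i j k) = (\<Sum>(r, s, t)\<in>?T. G s t r)"
      by (rule sum.reindex_bij_witness[of _ "\<lambda>(r, s, t). (s, r, t)" "\<lambda>(i, j, k). (j, i, k)"])
        (auto simp: B_def O1_def triples_def intro: sym)
    moreover have "(\<Sum>(i, j, k)\<in>C. G i j k) = (\<Sum>(r, s, t)\<in>?T. G t r s)"
      by (rule sum.reindex_bij_witness[of _ "\<lambda>(r, s, t). (t, r, s)" "\<lambda>(i, j, k). (j, k, i)"])
        (auto simp: C_def O1_def triples_def)
    ultimately show ?thesis by simp
  qed
  finally show ?thesis by (simp add: sum.distrib split_beta algebra_simps)
qed

lemma sum_remove_each:
  fixes f :: "nat \<Rightarrow> complex"
  assumes "finite J"
  shows "(\<Sum>j\<in>J. \<Sum>k\<in>J - {j}. f k) = (of_nat (card J) - 1) * sum f J"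
    "(\<Sum>j\<in>J. \<Sum>k\<in>J - {j}. f j) = (of_nat (card J) - 1) * sum f J"
proof -
  have "(\<Sum>j\<in>J. \<Sum>k\<in>J - {j}. f k) = (\<Sum>j\<in>J. sum f J - f j)"
    using assms by (intro sum.cong) (auto simp: sum_diff1)
  then show "(\<Sum>j\<in>J. \<Sum>k\<in>J - {j}. f k) = (of_nat (card J) - 1) * sum f J"
    by (simp add: sum_subtractf algebra_simps)
  have "(\<Sum>j\<in>J. \<Sum>k\<in>J - {j}. f j) = (\<Sum>j\<in>J. (of_nat (card J) - 1) * f j)"
  proof (rule sum.cong[OF refl])
    fix j assume j: "j \<in> J"
    then have "card J \<ge> 1" using assms by (metis card_0_eq empty_iff less_one not_le)
    then show "(\<Sum>k\<in>J - {j}. f j) = (of_nat (card J) - 1) * f j"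
      using assms j by (simp add: card_Diff_singleton of_nat_diff)
  qed
  then show "(\<Sum>j\<in>J. \<Sum>k\<in>J - {j}. f j) = (of_nat (card J) - 1) * sum f J"
    by (simp add: sum_distrib_left)
qed

text \<open>\<open>E1\<close> and \<open>E2\<close> are the first two elementary symmetric functions
  of the numbers \<open>1 / (x i - x j)\<close>. For a polynomial P with these simple roots they are
  P'' / (2 P') and P''' / (6 P') at \<open>x i\<close>.\<close>

definition E1 :: "nat \<Rightarrow> (nat \<Rightarrow> complex) \<Rightarrow> nat \<Rightarrow> complex" where
  "E1 d x i = (\<Sum>j\<in>{..<d} - {i}. 1 / (x i - x j))"

definition E2 :: "nat \<Rightarrow> (nat \<Rightarrow> complex) \<Rightarrow> nat \<Rightarrow> complex" where
  "E2 d x i = (\<Sum>j\<in>{..<d} - {i}. \<Sum>k\<in>{..<d} - {i} - {j}. 1 / ((x i - x j) * (x i - x k))) / 2"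

text \<open>Only \<open>E2\<close> couples two further indices; in the other terms at least one
  index runs freely, whence the factors containing \<open>d\<close>.\<close>

lemma triple_sum_eval:
  fixes \<beta> \<kappa> m x :: "nat \<Rightarrow> complex"
  shows "(\<Sum>(r, s, t)\<in>triples d. (\<beta> r + \<beta> s + \<beta> t) + (- \<kappa> r / ((x r - x s) * (x r - x t)) + m r * (1 / (x r - x s) + 1 / (x r - x t)))
     + (- \<kappa> s / ((x s - x t) * (x s - x r)) + m s * (1 / (x s - x t) + 1 / (x s - x r)))
     + (- \<kappa> t / ((x t - x r) * (x t - x s)) + m t * (1 / (x t - x r) + 1 / (x t - x s))))
   = (of_nat d - 1) * (of_nat d - 2) / 2 * (\<Sum>i<d. \<beta> i) - (\<Sum>i<d. \<kappa> i * E2 d x i) + (of_nat d - 2) * (\<Sum>i<d. m i * E1 d x i)"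
proof -
  define G where "G i j k = \<beta> i + (- \<kappa> i / ((x i - x j) * (x i - x k)) + m i * (1 / (x i - x j) + 1 / (x i - x k)))" for i j k
  have "2 * (\<Sum>(r, s, t)\<in>triples d. G r s t + G s t r + G t r s)
    = (\<Sum>i<d. \<Sum>j\<in>{..<d} - {i}. \<Sum>k\<in>{..<d} - {i} - {j}. G i j k)"
    by (rule triple_sum) (simp add: G_def mult.commute add.commute)
  also have "\<dots> = (\<Sum>i<d. (of_nat d - 1) * (of_nat d - 2) * \<beta> i - 2 * (\<kappa> i * E2 d x i) + 2 * (of_nat d - 2) * (m i * E1 d x i))"
  proof (rule sum.cong[OF refl])
    fix i assume i: "i \<in> {..<d}"
    let ?J = "{..<d} - {i}"
    have fin: "finite ?J" by simp
    have cJ: "(of_nat (card ?J) :: complex) = of_nat d - 1" using i by (simp add: card_Diff_singleton of_nat_diff)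
    have c2: "of_nat d - 1 - 1 = (of_nat d - 2 :: complex)" by simp
    note s = sum_remove_each[OF fin, unfolded cJ c2]
    have "(\<Sum>j\<in>?J. \<Sum>k\<in>?J - {j}. G i j k) = (\<Sum>j\<in>?J. \<Sum>k\<in>?J - {j}. \<beta> i)
      - (\<Sum>j\<in>?J. \<Sum>k\<in>?J - {j}. \<kappa> i * (1 / ((x i - x j) * (x i - x k))))
      + m i * ((\<Sum>j\<in>?J. \<Sum>k\<in>?J - {j}. 1 / (x i - x j)) + (\<Sum>j\<in>?J. \<Sum>k\<in>?J - {j}. 1 / (x i - x k)))"
    proof -
      have "G i j k = \<beta> i - \<kappa> i * (1 / ((x i - x j) * (x i - x k))) + (m i * (1 / (x i - x j)) + m i * (1 / (x i - x k)))" for j k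
        by (simp add: G_def add_divide_distrib distrib_left)
      then show ?thesis
        by (simp only: sum.distrib sum_subtractf sum_distrib_left[symmetric] distrib_left)
    qed
    also have "(\<Sum>j\<in>?J. \<Sum>k\<in>?J - {j}. \<beta> i) = (of_nat d - 1) * (of_nat d - 2) * \<beta> i"
      using s(2)[of "\<lambda>_. \<beta> i"] cJ by simp
    also have "(\<Sum>j\<in>?J. \<Sum>k\<in>?J - {j}. 1 / (x i - x j)) = (of_nat d - 2) * E1 d x i" unfolding E1_def by (rule s(2))
    also have "(\<Sum>j\<in>?J. \<Sum>k\<in>?J - {j}. 1 / (x i - x k)) = (of_nat d - 2) * E1 d x i" unfolding E1_def by (rule s(1))
    also have "(\<Sum>j\<in>?J. \<Sum>k\<in>?J - {j}. \<kappa> i * (1 / ((x i - x j) * (x i - x k)))) = 2 * (\<kappa> i * E2 d x i)"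
    proof -
      have "(\<Sum>j\<in>?J. \<Sum>k\<in>?J - {j}. \<kappa> i * (1 / ((x i - x j) * (x i - x k)))) = \<kappa> i * (\<Sum>j\<in>?J. \<Sum>k\<in>?J - {j}. 1 / ((x i - x j) * (x i - x k)))"
        by (simp only: sum_distrib_left)
      then show ?thesis by (simp add: E2_def)
    qed
    finally show "(\<Sum>j\<in>?J. \<Sum>k\<in>?J - {j}. G i j k) = (of_nat d - 1) * (of_nat d - 2) * \<beta> i - 2 * (\<kappa> i * E2 d x i) + 2 * (of_nat d - 2) * (m i * E1 d x i)"
      by (simp add: algebra_simps)
  qed
  also have "\<dots> = (of_nat d - 1) * (of_nat d - 2) * (\<Sum>i<d. \<beta> i) - 2 * (\<Sum>i<d. \<kappa> i * E2 d x i) + 2 * (of_nat d - 2) * (\<Sum>i<d. m i * E1 d x i)"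
    by (simp only: sum.distrib sum_subtractf sum_distrib_left)
  finally have 1: "2 * (\<Sum>(r, s, t)\<in>triples d. G r s t + G s t r + G t r s) = 2 * ((of_nat d - 1) * (of_nat d - 2) / 2 * (\<Sum>i<d. \<beta> i) - (\<Sum>i<d. \<kappa> i * E2 d x i) + (of_nat d - 2) * (\<Sum>i<d. m i * E1 d x i))"
    by (simp only:) (simp only: distrib_left right_diff_distrib times_divide_eq_right times_divide_eq_left mult.assoc nonzero_mult_div_cancel_left, simp)
  then have "(\<Sum>(r, s, t)\<in>triples d. G r s t + G s t r + G t r s) = (of_nat d - 1) * (of_nat d - 2) / 2 * (\<Sum>i<d. \<beta> i) - (\<Sum>i<d. \<kappa> i * E2 d x i) + (of_nat d - 2) * (\<Sum>i<d. m i * E1 d x i)"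
    by (simp only: mult_left_cancel zero_neq_numeral[symmetric] simp_thms) 
  then show ?thesis by (simp add: G_def add_ac)
qed

text \<open>If \<open>m\<close> is a derivative of \<open>x\<close>, the left side is a logarithmic
  derivative of the product of all differences. This removes the \<open>E1\<close> terms from the
  trace.\<close>

lemma pair_sum:
  fixes m x :: "nat \<Rightarrow> complex"
  shows "(\<Sum>i<d. \<Sum>j\<in>{..<d} - {i}. (m i - m j) / (x i - x j)) = 2 * (\<Sum>i<d. m i * E1 d x i)"
proof -
  have sw: "(\<Sum>i<d. \<Sum>j\<in>{..<d} - {i}. f i j) = (\<Sum>i<d. \<Sum>j\<in>{..<d} - {i}. f j i)" for f :: "nat \<Rightarrow> nat \<Rightarrow> complex"
  proof -
    have "(\<Sum>i<d. \<Sum>j\<in>{..<d} - {i}. f i j) = (\<Sum>(i, j)\<in>(SIGMA i:{..<d}. {..<d} - {i}). f i j)" by (simp add: sum.Sigma)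
    also have "\<dots> = (\<Sum>(i, j)\<in>(SIGMA i:{..<d}. {..<d} - {i}). f j i)"
      by (rule sum.reindex_bij_witness[of _ prod.swap prod.swap]) auto
    finally show ?thesis by (simp add: sum.Sigma)
  qed
  have "(\<Sum>i<d. \<Sum>j\<in>{..<d} - {i}. (m i - m j) / (x i - x j)) = (\<Sum>i<d. \<Sum>j\<in>{..<d} - {i}. m i / (x i - x j)) + (\<Sum>i<d. \<Sum>j\<in>{..<d} - {i}. m j / (x j - x i))"
    unfolding sum.distrib[symmetric]
  proof (intro sum.cong refl)
    fix i j
    have "m j / (x j - x i) = - (m j / (x i - x j))" by (metis minus_diff_eq minus_divide_right)
    then show "(m i - m j) / (x i - x j) = m i / (x i - x j) + m j / (x j - x i)" by (simp add: diff_divide_distrib)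
  qed
  also have "(\<Sum>i<d. \<Sum>j\<in>{..<d} - {i}. m j / (x j - x i)) = (\<Sum>i<d. \<Sum>j\<in>{..<d} - {i}. m i / (x i - x j))" by (rule sw)
  finally show ?thesis by (simp add: E1_def sum_distrib_left)
qed

lemma pderiv_linear_mult: "pderiv ([:- a, 1:] * Q) = Q + [:- a, 1:] * pderiv (Q :: complex poly)"
proof -
  have p1: "pderiv [:- a, 1:] = (1 :: complex poly)" by (simp add: pderiv_pCons one_pCons)
  show ?thesis by (simp only: pderiv_mult p1 mult_1_right add.commute)
qed

lemma product_poly_derivs:
  fixes y :: "nat \<Rightarrow> complex"
  assumes "finite J" "\<forall>j\<in>J. z \<noteq> y j"
  shows "poly (pderiv (\<Prod>j\<in>J. [:- y j, 1:])) z = poly (\<Prod>j\<in>J. [:- y j, 1:]) z * (\<Sum>j\<in>J. 1 / (z - y j)) \<and>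
    poly (pderiv (pderiv (\<Prod>j\<in>J. [:- y j, 1:]))) z =
      poly (\<Prod>j\<in>J. [:- y j, 1:]) z * (\<Sum>j\<in>J. \<Sum>k\<in>J - {j}. 1 / ((z - y j) * (z - y k)))"
  using assms
proof (induction J rule: finite_induct)
  case (insert i J)
  define Q where "Q = (\<Prod>j\<in>J. [:- y j, 1:])"
  have Q': "(\<Prod>j\<in>insert i J. [:- y j, 1:]) = [:- y i, 1:] * Q"
    unfolding Q_def by (rule prod.insert[OF insert(1,2)])
  have dd: "pderiv (pderiv ([:- y i, 1:] * Q)) = pderiv Q + (pderiv Q + [:- y i, 1:] * pderiv (pderiv Q))"
    by (simp only: pderiv_linear_mult pderiv_add)
  have zi: "z - y i \<noteq> 0" using insert.prems by auto
  let ?S = "\<Sum>j\<in>J. 1 / (z - y j)" and ?SS = "\<Sum>j\<in>J. \<Sum>k\<in>J - {j}. 1 / ((z - y j) * (z - y k))"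
  have IH: "poly (pderiv Q) z = poly Q z * ?S" "poly (pderiv (pderiv Q)) z = poly Q z * ?SS"
    using insert by (auto simp: Q_def)
  have "(\<Sum>j\<in>insert i J. \<Sum>k\<in>insert i J - {j}. 1 / ((z - y j) * (z - y k))) = (\<Sum>k\<in>J. 1 / ((z - y i) * (z - y k))) + (\<Sum>j\<in>J. 1 / ((z - y j) * (z - y i)) + (\<Sum>k\<in>J - {j}. 1 / ((z - y j) * (z - y k))))"
  proof -
    have "insert i J - {i} = J" using insert(2) by auto
    moreover have "(\<Sum>k\<in>insert i J - {j}. 1 / ((z - y j) * (z - y k))) = 1 / ((z - y j) * (z - y i)) + (\<Sum>k\<in>J - {j}. 1 / ((z - y j) * (z - y k)))" if "j \<in> J" for j
    proof -
      have "insert i J - {j} = insert i (J - {j})" using insert(2) that by auto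
      then show ?thesis using insert(1,2) by simp
    qed
    ultimately show ?thesis using insert(1,2) by simp
  qed
  also have "\<dots> = 2 * (?S / (z - y i)) + ?SS"
    by (simp add: sum.distrib sum_divide_distrib mult.commute)
  finally have e: "(\<Sum>j\<in>insert i J. \<Sum>k\<in>insert i J - {j}. 1 / ((z - y j) * (z - y k))) = 2 * (?S / (z - y i)) + ?SS" .
  have S1: "(\<Sum>j\<in>insert i J. 1 / (z - y j)) = 1 / (z - y i) + ?S" using insert(1,2) by simp
  have lin: "poly ([:- y i, 1:] * R) z = (z - y i) * poly R z" for R by (simp add: algebra_simps)
  define Y where "Y = z - y i"
  have "poly (pderiv ([:- y i, 1:] * Q)) z = Y * poly Q z * (1 / Y + ?S)"
    unfolding pderiv_linear_mult poly_add lin IH Y_def[symmetric] using zi by (simp add: Y_def[symmetric] distrib_left)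
  moreover have "poly (pderiv (pderiv ([:- y i, 1:] * Q))) z = Y * poly Q z * (2 * (?S / Y) + ?SS)"
    unfolding dd poly_add lin IH Y_def[symmetric] using zi by (simp add: Y_def[symmetric] distrib_left mult_ac)
  ultimately show ?case unfolding Q' e S1 lin Y_def by blast
qed (simp add: pderiv_1)

text \<open>If Q is the cofactor of the root, then P' = c Q and P''' = 3 c Q'' at
  \<open>x i\<close>. The double sum over the other leaves thus becomes an expression in a single
  tangency point.\<close>

lemma root_poly_E2:
  fixes x :: "nat \<Rightarrow> complex"
  assumes i: "i < d" and dist: "\<And>j. j < d \<Longrightarrow> j \<noteq> i \<Longrightarrow> x i \<noteq> x j" and c: "c \<noteq> 0"
  defines "P \<equiv> smult c (\<Prod>j<d. [:- x j, 1:])"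
  shows "poly (pderiv P) (x i) \<noteq> 0" "poly (pderiv (pderiv (pderiv P))) (x i) / (6 * poly (pderiv P) (x i)) = E2 d x i"
proof -
  let ?J = "{..<d} - {i}"
  define Q where "Q = (\<Prod>j\<in>?J. [:- x j, 1:])"
  have P: "P = smult c ([:- x i, 1:] * Q)" unfolding P_def Q_def using i by (subst prod.remove[of _ i]) auto
  have Qz: "poly Q (x i) \<noteq> 0" using dist by (auto simp: Q_def poly_prod)
  have 1: "pderiv P = smult c (Q + [:- x i, 1:] * pderiv Q)"
    unfolding P by (simp only: pderiv_smult pderiv_linear_mult)
  have 2: "pderiv (pderiv P) = smult c (pderiv Q + (pderiv Q + [:- x i, 1:] * pderiv (pderiv Q)))"
    unfolding 1 by (simp only: pderiv_smult pderiv_add pderiv_linear_mult)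
  have 3: "pderiv (pderiv (pderiv P)) = smult c (pderiv (pderiv Q) + (pderiv (pderiv Q) + (pderiv (pderiv Q) + [:- x i, 1:] * pderiv (pderiv (pderiv Q)))))"
    unfolding 2 by (simp only: pderiv_smult pderiv_add pderiv_linear_mult)
  have "poly (pderiv (pderiv Q)) (x i) = poly Q (x i) * (2 * E2 d x i)"
    using product_poly_derivs[of ?J "x i" x] dist unfolding Q_def E2_def by auto
  moreover have p1: "poly (pderiv P) (x i) = c * poly Q (x i)" unfolding 1 by simp
  moreover have "poly (pderiv (pderiv (pderiv P))) (x i) = c * (3 * poly (pderiv (pderiv Q)) (x i))" unfolding 3 by simp
  ultimately show "poly (pderiv P) (x i) \<noteq> 0" "poly (pderiv (pderiv (pderiv P))) (x i) / (6 * poly (pderiv P) (x i)) = E2 d x i"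
    using Qz c by simp_all
qed

text \<open>Slopes and scaling factors of the forms of a web with respect to the coordinates in which
  the vector field \<open>(- \<epsilon>, 1)\<close> is the second coordinate field; \<open>kappa\<close> is the derivative of the
  slope along the leaf.\<close>

locale web_dir = web +
  fixes \<epsilon> :: complex
  assumes nz: "\<And>i z. i < d \<Longrightarrow> z \<in> U \<Longrightarrow> snd (\<omega> i z) - \<epsilon> * fst (\<omega> i z) \<noteq> 0"
begin

text \<open>In the coordinates P = p + \<epsilon> q and Q = q the form \<open>\<omega> i\<close> is
  \<open>bb i\<close> times dQ - \<open>xx i\<close> dP. The parameter \<open>\<epsilon>\<close>
  makes all slopes \<open>xx\<close> finite, which dq / dp itself may fail to be.\<close>

definition bb :: "nat \<Rightarrow> complex \<times> complex \<Rightarrow> complex" where "bb i z = snd (\<omega> i z) - \<epsilon> * fst (\<omega> i z)"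
definition xx :: "nat \<Rightarrow> complex \<times> complex \<Rightarrow> complex" where "xx i z = - fst (\<omega> i z) / bb i z"

lemma bb_nz: "i < d \<Longrightarrow> z \<in> U \<Longrightarrow> bb i z \<noteq> 0" using nz by (simp add: bb_def)

lemma hol_bb: "i < d \<Longrightarrow> holomorphic2_on (bb i) U"
  unfolding bb_def[abs_def] by (intro holomorphic2_diff holomorphic2_mult holomorphic2_const openU hol_components)

lemma hol_xx: "i < d \<Longrightarrow> holomorphic2_on (xx i) U"
proof -
  assume i: "i < d"
  have "holomorphic2_on (\<lambda>z. (- 1) * fst (\<omega> i z) / bb i z) U"
    using i by (intro holomorphic2_divide holomorphic2_mult holomorphic2_const openU hol_components hol_bb bb_nz)
  then show ?thesis unfolding xx_def[abs_def] by simp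
qed

lemma omega_components:
  assumes "i < d" "z \<in> U"
  shows "fst (\<omega> i z) = - (bb i z * xx i z)" "snd (\<omega> i z) = bb i z * (1 - \<epsilon> * xx i z)"
proof -
  have x: "bb i z * xx i z = - fst (\<omega> i z)" using bb_nz[OF assms] by (simp add: xx_def)
  then show "fst (\<omega> i z) = - (bb i z * xx i z)" by simp
  have "bb i z * (1 - \<epsilon> * xx i z) = bb i z - \<epsilon> * (bb i z * xx i z)" by (simp add: algebra_simps)
  then show "snd (\<omega> i z) = bb i z * (1 - \<epsilon> * xx i z)" unfolding x by (simp add: bb_def)
qed

lemma wedge_bb:
  assumes "i < d" "j < d" "z \<in> U"
  shows "wedge (\<omega> i z) (\<omega> j z) = bb i z * bb j z * (xx j z - xx i z)"
  unfolding wedge_def omega_components[OF assms(1,3)] omega_components[OF assms(2,3)] by (simp add: algebra_simps)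

lemma xx_distinct: "i < d \<Longrightarrow> j < d \<Longrightarrow> i \<noteq> j \<Longrightarrow> z \<in> U \<Longrightarrow> xx i z \<noteq> xx j z"
  using transverse[of i j z] wedge_bb[of i j z] by auto

text \<open>The form \<open>theta \<omega> r s t\<close> is \<open>\<Phi>\<close> times dQ -
  \<open>xx r\<close> dP, and dP \<and> dQ equals dp \<and> dq, so its exterior derivative is the
  product rule in the adapted coordinates.\<close>

lemma ext_deriv_theta:
  assumes rst: "r < d" "s < d" "t < d" and z: "z \<in> U"
  defines "\<Phi> \<equiv> \<lambda>w. bb r w * bb s w * bb t w * (xx t w - xx s w)"
  shows "ext_deriv (theta \<omega> r s t) z = dir 1 0 \<Phi> z + xx r z * dir (- \<epsilon>) 1 \<Phi> z + \<Phi> z * dir (- \<epsilon>) 1 (xx r) z"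
    "wedge e (theta \<omega> r s t z) = \<Phi> z * (fst e + (snd e - \<epsilon> * fst e) * xx r z)"
    "dir a b \<Phi> z = dir a b (\<lambda>w. bb r w * bb s w * bb t w) z * (xx t z - xx s z)
       + bb r z * bb s z * bb t z * (dir a b (xx t) z - dir a b (xx s) z)"
proof -
  have th: "fst (theta \<omega> r s t w) = - 1 * (\<Phi> w * xx r w)" "snd (theta \<omega> r s t w) = \<Phi> w * (1 - \<epsilon> * xx r w)" if "w \<in> U" for w
    unfolding theta_def scale_covec_def fst_conv snd_conv wedge_bb[OF rst(2,3) that] omega_components[OF rst(1) that] \<Phi>_def
    by (simp_all add: algebra_simps)
  have hB: "holomorphic2_on (\<lambda>w. bb r w * bb s w * bb t w) U" by (intro holomorphic2_mult openU hol_bb rst)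
  have h\<Phi>: "holomorphic2_on \<Phi> U" unfolding \<Phi>_def by (intro holomorphic2_mult holomorphic2_diff openU hol_bb hol_xx rst)
  have h1: "holomorphic2_on (\<lambda>w. 1 - \<epsilon> * xx r w) U" by (intro holomorphic2_mult holomorphic2_diff holomorphic2_const openU hol_xx rst)
  have h2: "holomorphic2_on (\<lambda>w. \<Phi> w * xx r w) U" "holomorphic2_on (\<lambda>w. \<Phi> w * (1 - \<epsilon> * xx r w)) U"
    "holomorphic2_on (\<lambda>w. - 1 * (\<Phi> w * xx r w)) U"
    by (intro holomorphic2_mult holomorphic2_const openU h\<Phi> hol_xx rst h1)+
  have hx: "holomorphic2_on (\<lambda>w. \<epsilon> * xx r w) U" by (intro holomorphic2_mult holomorphic2_const openU hol_xx rst)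
  have c1: "dir a b (\<lambda>w. fst (theta \<omega> r s t w)) z = dir a b (\<lambda>w. - 1 * (\<Phi> w * xx r w)) z" for a b
    by (rule dir_cong[OF openU h2(3) z]) (rule th(1))
  have c2: "dir a b (\<lambda>w. snd (theta \<omega> r s t w)) z = dir a b (\<lambda>w. \<Phi> w * (1 - \<epsilon> * xx r w)) z" for a b
    by (rule dir_cong[OF openU h2(2) z]) (rule th(2))
  have a: "dir a b (\<lambda>w. fst (theta \<omega> r s t w)) z = - (dir a b \<Phi> z * xx r z + \<Phi> z * dir a b (xx r) z)" for a b
    unfolding c1 dir_mult[OF openU holomorphic2_const h2(1) z] dir_mult[OF openU h\<Phi> hol_xx[OF rst(1)] z]
    by (simp add: dir_const algebra_simps)
  have b: "dir a b (\<lambda>w. snd (theta \<omega> r s t w)) z = dir a b \<Phi> z * (1 - \<epsilon> * xx r z) - \<Phi> z * (\<epsilon> * dir a b (xx r) z)" for a b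
    unfolding c2 dir_mult[OF openU h\<Phi> h1 z] dir_diff[OF openU holomorphic2_const hx z]
      dir_mult[OF openU holomorphic2_const hol_xx[OF rst(1)] z]
    by (simp add: dir_const)
  show "ext_deriv (theta \<omega> r s t) z = dir 1 0 \<Phi> z + xx r z * dir (- \<epsilon>) 1 \<Phi> z + \<Phi> z * dir (- \<epsilon>) 1 (xx r) z"
    unfolding ext_deriv_dir a b by (simp add: dir_def algebra_simps)
  show "wedge e (theta \<omega> r s t z) = \<Phi> z * (fst e + (snd e - \<epsilon> * fst e) * xx r z)"
    unfolding wedge_def th[OF z] by (simp add: algebra_simps)
  show "dir a b \<Phi> z = dir a b (\<lambda>w. bb r w * bb s w * bb t w) z * (xx t z - xx s z)
       + bb r z * bb s z * bb t z * (dir a b (xx t) z - dir a b (xx s) z)"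
    unfolding \<Phi>_def dir_mult[OF openU hB holomorphic2_diff[OF openU hol_xx[OF rst(3)] hol_xx[OF rst(2)]] z]
      dir_diff[OF openU hol_xx[OF rst(3)] hol_xx[OF rst(2)] z] ..
qed

definition beta where "beta i z = dir (- \<epsilon>) 1 (bb i) z / bb i z"
definition slope2 where "slope2 i z = dir (- \<epsilon>) 1 (xx i) z"
definition kappa where "kappa i z = dir 1 0 (xx i) z + xx i z * slope2 i z"

lemma eta_dir:
  assumes rst: "r < d" "s < d" "t < d" "r \<noteq> s" "s \<noteq> t" "r \<noteq> t" and z: "z \<in> U"
  shows "snd (eta \<omega> r s t z) - \<epsilon> * fst (eta \<omega> r s t z) = (beta r z + beta s z + beta t z)
     + (- kappa r z / ((xx r z - xx s z) * (xx r z - xx t z)) + slope2 r z * (1 / (xx r z - xx s z) + 1 / (xx r z - xx t z)))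
     + (- kappa s z / ((xx s z - xx t z) * (xx s z - xx r z)) + slope2 s z * (1 / (xx s z - xx t z) + 1 / (xx s z - xx r z)))
     + (- kappa t z / ((xx t z - xx r z) * (xx t z - xx s z)) + slope2 t z * (1 / (xx t z - xx r z) + 1 / (xx t z - xx s z)))"
proof -
  define e where "e = eta \<omega> r s t z"
  define B where "B = (\<lambda>w. bb r w * bb s w * bb t w)"
  have Bz: "B z \<noteq> 0" using bb_nz rst z by (simp add: B_def)
  have B': "(\<lambda>w. bb s w * bb t w * bb r w) = B" by (simp add: B_def fun_eq_iff mult_ac)
  have x: "xx r z \<noteq> xx s z" "xx s z \<noteq> xx t z" "xx r z \<noteq> xx t z" using xx_distinct rst z by auto
  have b2: "dir (- \<epsilon>) 1 B z / B z = beta r z + beta s z + beta t z"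
  proof -
    have "dir (- \<epsilon>) 1 B z = (dir (- \<epsilon>) 1 (bb r) z * bb s z + bb r z * dir (- \<epsilon>) 1 (bb s) z) * bb t z + bb r z * bb s z * dir (- \<epsilon>) 1 (bb t) z"
      unfolding B_def dir_mult[OF openU holomorphic2_mult[OF openU hol_bb[OF rst(1)] hol_bb[OF rst(2)]] hol_bb[OF rst(3)] z]
        dir_mult[OF openU hol_bb[OF rst(1)] hol_bb[OF rst(2)] z] ..
    then show ?thesis using bb_nz rst z by (simp add: beta_def B_def field_simps)
  qed
  note rs = ext_deriv_theta[OF rst(1,2,3) z]
  have sr: "s < d" "t < d" "r < d" using rst by auto
  note ss = ext_deriv_theta[OF sr z]
  have eq1: "B z * (xx t z - xx s z) * (fst e + (snd e - \<epsilon> * fst e) * xx r z) =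
      (dir 1 0 B z * (xx t z - xx s z) + B z * (dir 1 0 (xx t) z - dir 1 0 (xx s) z))
      + xx r z * (dir (- \<epsilon>) 1 B z * (xx t z - xx s z) + B z * (slope2 t z - slope2 s z)) + B z * (xx t z - xx s z) * slope2 r z"
    using eta_wedge(1)[OF rst z] unfolding rs(1,2) unfolding rs(3) e_def slope2_def B_def .
  have eq2: "B z * (xx r z - xx t z) * (fst e + (snd e - \<epsilon> * fst e) * xx s z) =
      (dir 1 0 B z * (xx r z - xx t z) + B z * (dir 1 0 (xx r) z - dir 1 0 (xx t) z))
      + xx s z * (dir (- \<epsilon>) 1 B z * (xx r z - xx t z) + B z * (slope2 r z - slope2 t z)) + B z * (xx r z - xx t z) * slope2 s z"
    using eta_wedge(2)[OF rst z] unfolding ss(1,2) unfolding ss(3) B' e_def slope2_def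
    by (simp only: B_def mult.commute mult.left_commute mult.assoc)
  have E1: "fst e + (snd e - \<epsilon> * fst e) * xx r z = dir 1 0 B z / B z + xx r z * (dir (- \<epsilon>) 1 B z / B z)
     + ((dir 1 0 (xx t) z - dir 1 0 (xx s) z) + xx r z * (slope2 t z - slope2 s z)) / (xx t z - xx s z) + slope2 r z"
  proof -
    have X: "xx t z - xx s z \<noteq> 0" using x by auto
    define X where "X = xx t z - xx s z"
    have "fst e + (snd e - \<epsilon> * fst e) * xx r z = (B z * X * (fst e + (snd e - \<epsilon> * fst e) * xx r z)) / (B z * X)"
      using Bz X by (simp add: X_def)
    also have "\<dots> = dir 1 0 B z / B z + xx r z * (dir (- \<epsilon>) 1 B z / B z)
     + ((dir 1 0 (xx t) z - dir 1 0 (xx s) z) + xx r z * (slope2 t z - slope2 s z)) / X + slope2 r z"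
      unfolding X_def eq1 unfolding X_def[symmetric] using Bz X[folded X_def] by (simp add: add_divide_distrib distrib_left)
    finally show ?thesis unfolding X_def .
  qed
  have E2: "fst e + (snd e - \<epsilon> * fst e) * xx s z = dir 1 0 B z / B z + xx s z * (dir (- \<epsilon>) 1 B z / B z)
     + ((dir 1 0 (xx r) z - dir 1 0 (xx t) z) + xx s z * (slope2 r z - slope2 t z)) / (xx r z - xx t z) + slope2 s z"
  proof -
    have X: "xx r z - xx t z \<noteq> 0" using x by auto
    define X where "X = xx r z - xx t z"
    have "fst e + (snd e - \<epsilon> * fst e) * xx s z = (B z * X * (fst e + (snd e - \<epsilon> * fst e) * xx s z)) / (B z * X)"
      using Bz X by (simp add: X_def)
    also have "\<dots> = dir 1 0 B z / B z + xx s z * (dir (- \<epsilon>) 1 B z / B z)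
     + ((dir 1 0 (xx r) z - dir 1 0 (xx t) z) + xx s z * (slope2 r z - slope2 t z)) / X + slope2 s z"
      unfolding X_def eq2 unfolding X_def[symmetric] using Bz X[folded X_def] by (simp add: add_divide_distrib distrib_left)
    finally show ?thesis unfolding X_def .
  qed
  show ?thesis using eta_solution[OF x E1 E2] unfolding e_def b2 kappa_def .
qed

text \<open>The left side is the dQ-coefficient of the sum, that is, its value on the field
  \<open>(- \<epsilon>, 1)\<close>.\<close>

lemma eta_sum_dir:
  assumes z: "z \<in> U"
  shows "snd (\<Sum>(r, s, t)\<in>triples d. eta \<omega> r s t z) - \<epsilon> * fst (\<Sum>(r, s, t)\<in>triples d. eta \<omega> r s t z)
   = (of_nat d - 1) * (of_nat d - 2) / 2 * (\<Sum>i<d. beta i z) - (\<Sum>i<d. kappa i z * E2 d (\<lambda>i. xx i z) i)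
     + (of_nat d - 2) * (\<Sum>i<d. slope2 i z * E1 d (\<lambda>i. xx i z) i)"
proof -
  have "snd (\<Sum>(r, s, t)\<in>triples d. eta \<omega> r s t z) - \<epsilon> * fst (\<Sum>(r, s, t)\<in>triples d. eta \<omega> r s t z)
     = (\<Sum>(r, s, t)\<in>triples d. snd (eta \<omega> r s t z) - \<epsilon> * fst (eta \<omega> r s t z))"
    by (simp add: snd_sum fst_sum sum_subtractf sum_distrib_left split_beta)
  also have "\<dots> = (\<Sum>(r, s, t)\<in>triples d. (beta r z + beta s z + beta t z)
     + (- kappa r z / ((xx r z - xx s z) * (xx r z - xx t z)) + slope2 r z * (1 / (xx r z - xx s z) + 1 / (xx r z - xx t z)))
     + (- kappa s z / ((xx s z - xx t z) * (xx s z - xx r z)) + slope2 s z * (1 / (xx s z - xx t z) + 1 / (xx s z - xx r z)))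
     + (- kappa t z / ((xx t z - xx r z) * (xx t z - xx s z)) + slope2 t z * (1 / (xx t z - xx r z) + 1 / (xx t z - xx s z))))"
    by (rule sum.cong[OF refl], clarify, rule eta_dir) (use z in \<open>auto simp: triples_def\<close>)
  finally show ?thesis unfolding triple_sum_eval[of "\<lambda>i. beta i z" "\<lambda>i. kappa i z" "\<lambda>i. xx i z" "\<lambda>i. slope2 i z"] .
qed

text \<open>Identifies the terms \<open>slope2 * E1\<close> of \<open>eta_sum_dir\<close>, up to a
  multiple of the sum of the \<open>beta\<close>, as logarithmic derivatives of globally defined
  functions on \<open>U\<close>.\<close>

lemma wedge_log_sum:
  assumes z: "z \<in> U"
  shows "(\<Sum>i<d. \<Sum>j\<in>{..<d} - {i}. dir (- \<epsilon>) 1 (\<lambda>w. wedge (\<omega> i w) (\<omega> j w)) z / wedge (\<omega> i z) (\<omega> j z))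
   = 2 * (of_nat d - 1) * (\<Sum>i<d. beta i z) + 2 * (\<Sum>i<d. slope2 i z * E1 d (\<lambda>i. xx i z) i)"
proof -
  have w: "dir (- \<epsilon>) 1 (\<lambda>w. wedge (\<omega> i w) (\<omega> j w)) z / wedge (\<omega> i z) (\<omega> j z) = beta i z + beta j z + (slope2 i z - slope2 j z) / (xx i z - xx j z)"
    if ij: "i < d" "j < d" "i \<noteq> j" for i j
  proof -
    have X: "xx i z - xx j z \<noteq> 0" using xx_distinct ij z by simp
    have hb: "holomorphic2_on (\<lambda>w. bb i w * bb j w) U" by (intro holomorphic2_mult openU hol_bb ij)
    have hx: "holomorphic2_on (\<lambda>w. xx j w - xx i w) U" by (intro holomorphic2_diff openU hol_xx ij)
    have "dir (- \<epsilon>) 1 (\<lambda>w. wedge (\<omega> i w) (\<omega> j w)) z =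
       (dir (- \<epsilon>) 1 (bb i) z * bb j z + bb i z * dir (- \<epsilon>) 1 (bb j) z) * (xx j z - xx i z) + bb i z * bb j z * (slope2 j z - slope2 i z)"
    proof -
      have c: "dir (- \<epsilon>) 1 (\<lambda>w. wedge (\<omega> i w) (\<omega> j w)) z = dir (- \<epsilon>) 1 (\<lambda>w. bb i w * bb j w * (xx j w - xx i w)) z"
        by (rule dir_cong[OF openU holomorphic2_mult[OF openU hb hx] z]) (rule wedge_bb[OF ij(1,2)])
      show ?thesis
        unfolding c dir_mult[OF openU hb hx z]
        dir_mult[OF openU hol_bb[OF ij(1)] hol_bb[OF ij(2)] z] dir_diff[OF openU hol_xx[OF ij(2)] hol_xx[OF ij(1)] z] slope2_def ..
    qed
    note eq = this
    define Y where "Y = xx j z - xx i z"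
    have Y: "xx i z - xx j z = - Y" "Y \<noteq> 0" using X by (auto simp: Y_def)
    define p q where "p = bb i z" and "q = bb j z"
    have pq: "p \<noteq> 0" "q \<noteq> 0" using bb_nz ij z by (simp_all add: p_def q_def)
    show ?thesis unfolding beta_def wedge_bb[OF ij(1,2) z] eq Y(1) Y_def[symmetric] p_def[symmetric] q_def[symmetric]
      using pq Y(2) by (simp add: divide_simps) (simp add: algebra_simps)
  qed
  have c: "of_nat (card ({..<d} - {i})) = (of_nat d - 1 :: complex)" if "i < d" for i
    using that by (simp add: card_Diff_singleton of_nat_diff)
  have "(\<Sum>i<d. \<Sum>j\<in>{..<d} - {i}. dir (- \<epsilon>) 1 (\<lambda>w. wedge (\<omega> i w) (\<omega> j w)) z / wedge (\<omega> i z) (\<omega> j z))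
    = (\<Sum>i<d. \<Sum>j\<in>{..<d} - {i}. (beta i z + beta j z) + (slope2 i z - slope2 j z) / (xx i z - xx j z))"
    by (intro sum.cong refl) (use w in auto)
  also have "\<dots> = (\<Sum>i<d. \<Sum>j\<in>{..<d} - {i}. beta i z) + (\<Sum>i<d. \<Sum>j\<in>{..<d} - {i}. beta j z) + 2 * (\<Sum>i<d. slope2 i z * E1 d (\<lambda>i. xx i z) i)"
    by (simp add: sum.distrib pair_sum)
  also have "(\<Sum>i<d. \<Sum>j\<in>{..<d} - {i}. beta i z) = (of_nat d - 1) * (\<Sum>i<d. beta i z)"
    using sum_remove_each(2)[of "{..<d}" "\<lambda>i. beta i z"] by simp
  also have "(\<Sum>i<d. \<Sum>j\<in>{..<d} - {i}. beta j z) = (of_nat d - 1) * (\<Sum>i<d. beta i z)"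
    using sum_remove_each(1)[of "{..<d}" "\<lambda>i. beta i z"] by simp
  finally show ?thesis by (simp add: algebra_simps)
qed

end

section \<open>The Legendre transform\<close>

lemma holomorphic2_polyfun:
  assumes "open U" "polyfun g" "\<And>i. holomorphic2_on (\<lambda>z. F z $ i) U"
  shows "holomorphic2_on (\<lambda>z. g (F z)) U"
  using assms(2)
proof induction
  case (add f g)
  then show ?case by (intro holomorphic2_add assms(1))
next
  case (mult f g)
  then show ?case by (intro holomorphic2_mult assms(1))
qed (auto intro: holomorphic2_const assms(3))

lemma holomorphic2_local:
  assumes "\<And>z. z \<in> U \<Longrightarrow> \<exists>V. open V \<and> z \<in> V \<and> holomorphic2_on f V"
  shows "holomorphic2_on f U"
proof (rule holomorphic2_onI)
  fix z assume "z \<in> U"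
  then obtain V where "open V" "z \<in> V" "holomorphic2_on f V" using assms by blast
  then show "(f has_derivative (\<lambda>v. dp f z * fst v + dq f z * snd v)) (at z)" by (intro holomorphic2_partials(1))
qed

lemma dir_shift_eventually:
  fixes z :: "complex \<times> complex"
  assumes "open V" "z \<in> V"
  shows "eventually (\<lambda>h. (fst z + h * a, snd z + h * b) \<in> V) (nhds 0)"
proof -
  have "continuous_on UNIV (\<lambda>h::complex. (fst z + h * a, snd z + h * b))" by (intro continuous_intros)
  then have "open ((\<lambda>h::complex. (fst z + h * a, snd z + h * b)) -` V)" using assms(1) by (intro open_vimage)
  then show ?thesis using assms(2) by (auto simp: eventually_nhds)
qed

locale leg_web = convex_prefoliation n \<Omega> l + web d U \<omega>
  for n \<Omega> l d U \<omega> +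
  fixes M :: "complex^3^3"
  assumes invM: "invertible M" and dn: "d = n + 1" and d3: "d \<ge> 3"
    and pres: "\<And>z. z \<in> U \<Longrightarrow> \<exists>c. c \<noteq> 0 \<and> (\<forall>x. Leg M l \<Omega> z x = c * (\<Prod>i<d. fst (\<omega> i z) + snd (\<omega> i z) * x))"
begin

definition c1 where "c1 = column 1 M"
definition c2 where "c2 = column 2 M"
definition c3 where "c3 = column 3 M"

lemma M_columns: "M *v vector [a, b, c] = a *s c1 + b *s c2 + c *s c3"
  by (simp add: vec_eq_iff matrix_vector_mult_def sum_3 column_def c1_def c2_def c3_def mult.commute)

lemma tri_columns: "tri c1 c2 c3 \<noteq> 0"
proof -
  have "tri c1 c2 c3 = det M"
    by (simp add: tri_expand det_3 column_def c1_def c2_def c3_def algebra_simps)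
  then show ?thesis using invM by (simp add: invertible_det_nz)
qed

text \<open>The point \<open>z = (p, q)\<close> of the chart is the line spanned by \<open>X1 z\<close> and \<open>Nz z\<close>. It turns about
  the point \<open>Ee \<epsilon> z\<close> when \<open>z\<close> moves along \<open>(- \<epsilon>, 1)\<close>.\<close>

definition X1 where "X1 z = c1 + fst z *s c2"
definition Nz where "Nz z = c3 - snd z *s c2"
definition Ee where "Ee \<epsilon> z = X1 z - \<epsilon> *s Nz z"

text \<open>The point with affine coordinates \<open>(x, p * x - q)\<close> is
  \<open>Nz z + x *s X1 z\<close>, and the tangent vector \<open>(1, p)\<close> of the line is
  \<open>X1 z\<close>. So \<open>Leg\<close> is the equation of \<open>l\<close> times the tangency
  polynomial.\<close>

lemma Leg_eq: "Leg M l \<Omega> z x = (l \<odot> (Nz z + x *s X1 z)) * om (X1 z) (Nz z + x *s X1 z)"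
proof -
  obtain p q where z: "z = (p, q)" by (cases z)
  have pt: "affine_pt M x (p * x - q) = Nz z + x *s X1 z"
    unfolding affine_pt_def M_columns by (simp add: Nz_def X1_def z vec_eq_iff algebra_simps)
  have "(transpose M *v w) $ 1 + p * (transpose M *v w) $ 2 = w \<odot> X1 z" for w
    by (simp add: matrix_vector_mult_def transpose_def sum_3 sprod_3 X1_def c1_def c2_def column_def z algebra_simps)
  then show ?thesis unfolding Leg_def z
    by (simp add: affine_line_eq_def affine_form_def pt[unfolded z] om_def z)
qed

lemma tri_frame: "tri (Nz z) (Ee \<epsilon> z) (- c2) \<noteq> 0"
proof -
  have "tri (Nz z) (Ee \<epsilon> z) (- c2) = - tri c1 c2 c3"
    by (simp add: Nz_def Ee_def X1_def tri_expand algebra_simps)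
  then show ?thesis using tri_columns by simp
qed

lemma frame_move: "Ee \<epsilon> (fst z + h * (- \<epsilon>), snd z + h * 1) = Ee \<epsilon> z" "Nz (fst z + h * (- \<epsilon>), snd z + h * 1) = Nz z + h *s (- c2)"
  "Ee \<epsilon> (fst z + h * 1, snd z + h * 0) = Ee \<epsilon> z + h *s c2" "Nz (fst z + h * 1, snd z + h * 0) = Nz z"
  by (simp_all add: Ee_def Nz_def X1_def vec_eq_iff algebra_simps)

definition gam where "gam z = (SOME c. c \<noteq> 0 \<and> (\<forall>x. Leg M l \<Omega> z x = c * (\<Prod>i<d. fst (\<omega> i z) + snd (\<omega> i z) * x)))"

lemma gam: assumes "z \<in> U" shows "gam z \<noteq> 0" "Leg M l \<Omega> z x = gam z * (\<Prod>i<d. fst (\<omega> i z) + snd (\<omega> i z) * x)"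
  using someI_ex[OF pres[OF assms], folded gam_def] by blast+

lemma omega_nonzero: assumes "i < d" "z \<in> U" shows "fst (\<omega> i z) \<noteq> 0 \<or> snd (\<omega> i z) \<noteq> 0"
proof -
  have "(if i = 0 then 1 else 0) < d" "i \<noteq> (if i = 0 then 1 else 0)" using d3 by auto
  then obtain j where j: "j < d" "i \<noteq> j" by blast
  then show ?thesis using transverse[OF assms(1) j assms(2)] by (auto simp: wedge_def)
qed

lemma hol_Leg: "holomorphic2_on (\<lambda>z. Leg M l \<Omega> z x) U"
proof -
  have h: "holomorphic2_on (\<lambda>z. Nz z $ i) U" "holomorphic2_on (\<lambda>z. X1 z $ i) U" for i
    unfolding Nz_def X1_def by (simp_all add: holomorphic2_diff holomorphic2_add holomorphic2_mult holomorphic2_const holomorphic2_coords openU)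
  have p: "holomorphic2_on (\<lambda>z. (Nz z + x *s X1 z) $ i) U" for i
    by (simp add: holomorphic2_add holomorphic2_mult holomorphic2_const h openU)
  have "polyfun (\<lambda>X. l \<odot> X)" by (intro polyfun_intros)
  then have 1: "holomorphic2_on (\<lambda>z. l \<odot> (Nz z + x *s X1 z)) U"
    by (rule holomorphic2_polyfun[OF openU _ p])
  have "holomorphic2_on (\<lambda>z. \<Omega> (Nz z + x *s X1 z) $ i * X1 z $ i) U" for i
    by (intro holomorphic2_mult openU h holomorphic2_polyfun[OF openU polyfun_Omega p])
  then have "holomorphic2_on (\<lambda>z. om (X1 z) (Nz z + x *s X1 z)) U"
    unfolding om_def sprod_3 by (intro holomorphic2_add openU)
  with 1 show ?thesis unfolding Leg_eq by (intro holomorphic2_mult openU)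
qed

text \<open>\<open>gam\<close> is chosen point by point, but near a given point it is a quotient of
  holomorphic functions, taken at a fixed \<open>x\<close> that is no root.\<close>

lemma hol_gam: "holomorphic2_on gam U"
proof (rule holomorphic2_local)
  fix z assume z: "z \<in> U"
  let ?Q = "\<lambda>w x. \<Prod>i<d. fst (\<omega> i w) + snd (\<omega> i w) * x"
  have "(\<Prod>i<d. [:fst (\<omega> i z), snd (\<omega> i z):]) \<noteq> 0"
    using omega_nonzero[OF _ z] by (auto simp: prod_zero_iff)
  then obtain x where "poly (\<Prod>i<d. [:fst (\<omega> i z), snd (\<omega> i z):]) x \<noteq> 0" using poly_all_0_iff_0 by blast
  then have x: "?Q z x \<noteq> 0" by (simp add: poly_prod mult.commute)
  have hQ: "holomorphic2_on (\<lambda>w. ?Q w x) U"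
    by (intro holomorphic2_prod holomorphic2_add holomorphic2_mult holomorphic2_const openU hol_components) auto
  define V where "V = {w \<in> U. ?Q w x \<noteq> 0}"
  have V: "V = U \<inter> (\<lambda>w. ?Q w x) -` (- {0})" by (auto simp: V_def)
  have oV: "open V" unfolding V
    by (rule continuous_open_preimage[OF holomorphic2_continuous[OF openU hQ] openU]) (simp add: open_Compl)
  have sub: "V \<subseteq> U" by (auto simp: V_def)
  have "holomorphic2_on (\<lambda>w. Leg M l \<Omega> w x / ?Q w x) V"
    by (rule holomorphic2_divide[OF oV holomorphic2_subset[OF hol_Leg openU sub] holomorphic2_subset[OF hQ openU sub]])
      (simp add: V_def)
  moreover have "gam w = Leg M l \<Omega> w x / ?Q w x" if "w \<in> V" for w
    using gam(2)[of w x] that by (simp add: V_def)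
  ultimately have "holomorphic2_on gam V" by (rule holomorphic2_cong[OF oV])
  then show "\<exists>V. open V \<and> z \<in> V \<and> holomorphic2_on gam V" using oV z x by (auto simp: V_def)
qed

text \<open>\<open>lam a = 0\<close> is the equation of the line dual to the singular point \<open>a\<close>.\<close>

definition lam where "lam a z = tri (rep a) (Nz z) (X1 z)"

lemma hol_lam: "holomorphic2_on (lam a) U"
proof -
  have h: "holomorphic2_on (\<lambda>z. Nz z $ i) U" "holomorphic2_on (\<lambda>z. X1 z $ i) U" for i
    unfolding Nz_def X1_def by (simp_all add: holomorphic2_diff holomorphic2_add holomorphic2_mult holomorphic2_const holomorphic2_coords openU)
  show ?thesis unfolding lam_def[abs_def] tri_expand
    by (intro holomorphic2_add holomorphic2_diff holomorphic2_mult holomorphic2_const h openU)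
qed

lemma lam_Ee: "lam a z = tri (rep a) (Nz z) (Ee \<epsilon> z)"
  by (simp add: lam_def Ee_def)

end

section \<open>The Legendre web in coordinates adapted to a pencil of lines\<close>

locale leg_web_dir = leg_web n \<Omega> l d U \<omega> M + W: web_dir d W \<omega> \<epsilon>
  for n \<Omega> l d U \<omega> M W \<epsilon> +
  assumes sub: "W \<subseteq> U"
begin

text \<open>Parametrizing the line by \<open>Ee\<close> instead of \<open>X1\<close> is a Moebius
  change of variable with denominator \<open>k = 1 - \<epsilon> * x\<close>. The powers of
  \<open>k\<close> are absorbed by homogeneity and by the relation
  \<open>om N Y + x * om E Y = 0\<close> at \<open>Y = N + x *s E\<close>.\<close>

lemma pencil_poly_factor:
  assumes w: "w \<in> W"
  shows "line_poly (\<lambda>X. l \<odot> X) (Nz w) (Ee \<epsilon> w) * line_poly (om (Ee \<epsilon> w)) (Nz w) (Ee \<epsilon> w)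
    = smult (gam w * (\<Prod>i<d. W.bb i w)) (\<Prod>i<d. [:- W.xx i w, 1:])"
\<comment> \<open>The excluded parameter is the zero of \<open>k\<close>. For
  \<open>\<epsilon> = 0\<close> the set is \<open>{0}\<close> by the convention on division, and the
  argument still covers all other points.\<close>
proof (rule poly_eqI_cofinite[of "{1 / \<epsilon>}"])
  fix x assume x: "x \<notin> {1 / \<epsilon>}"
  define k where "k = 1 - \<epsilon> * x"
  have k: "k \<noteq> 0" using x by (cases "\<epsilon> = 0") (auto simp: k_def field_simps)
  define N E P where "N = Nz w" and "E = Ee \<epsilon> w" and "P = Nz w + (x / k) *s X1 w"
  have Y: "N + x *s E = k *s P"
    using k by (simp add: N_def E_def P_def Ee_def vec_eq_iff) (simp add: k_def algebra_simps)
  have "om N (N + x *s E) + x * om E (N + x *s E) = 0" using om_self[of "N + x *s E"] unfolding om_linear .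
  then have oN: "om N (k *s P) = - (x * om E (k *s P))" unfolding Y by (simp only: eq_neg_iff_add_eq_0)
  have o1: "om (X1 w) Y = om E Y + \<epsilon> * om N Y" for Y
    by (simp add: E_def N_def Ee_def)
  have "k * u = u + \<epsilon> * (- (x * u))" for u by (simp add: k_def algebra_simps)
  then have oE: "k * om E (k *s P) = om (X1 w) (k *s P)" unfolding o1 oN .
  have "k * ((l \<odot> (N + x *s E)) * om E (N + x *s E)) = (l \<odot> (k *s P)) * (k * om E (k *s P))"
    unfolding Y by (simp only: mult_ac)
  also have "\<dots> = k * (l \<odot> P) * (k ^ (n + 1) * om (X1 w) P)"
    unfolding oE by (simp add: om_hom)
  also have "\<dots> = k * k ^ d * Leg M l \<Omega> w (x / k)"
    unfolding Leg_eq P_def[symmetric] dn by (simp only: mult_ac)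
  also have "\<dots> = k * (gam w * (\<Prod>i<d. k * (fst (\<omega> i w) + snd (\<omega> i w) * (x / k))))"
    using gam(2)[OF subsetD[OF sub w], of "x / k"] by (simp only: prod.distrib prod_constant card_lessThan mult_ac)
  also have "(\<Prod>i<d. k * (fst (\<omega> i w) + snd (\<omega> i w) * (x / k))) = (\<Prod>i<d. W.bb i w * (x - W.xx i w))"
  proof (rule prod.cong[OF refl])
    fix i assume i: "i \<in> {..<d}"
    have k1: "k * (b * (x / k)) = b * x" for b using k by simp
    have st: "k * (fst (\<omega> i w) + snd (\<omega> i w) * (x / k)) = fst (\<omega> i w) + W.bb i w * x"
      unfolding distrib_left k1 by (simp add: W.bb_def k_def algebra_simps)
    have eq: "- (B * X) + B * x = B * (x - X)" for B X :: complex by (simp add: right_diff_distrib)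
    show "k * (fst (\<omega> i w) + snd (\<omega> i w) * (x / k)) = W.bb i w * (x - W.xx i w)"
      unfolding st unfolding W.omega_components(1)[OF i[unfolded lessThan_iff] w] by (rule eq)
  qed
  finally have "(l \<odot> (N + x *s E)) * om E (N + x *s E) = gam w * (\<Prod>i<d. W.bb i w * (x - W.xx i w))"
    using k unfolding mult_cancel_left by blast
  moreover have "polyfun (\<lambda>X. l \<odot> X)" by (intro polyfun_intros)
  ultimately show "poly (line_poly (\<lambda>X. l \<odot> X) (Nz w) (Ee \<epsilon> w) * line_poly (om (Ee \<epsilon> w)) (Nz w) (Ee \<epsilon> w)) x
    = poly (smult (gam w * (\<Prod>i<d. W.bb i w)) (\<Prod>i<d. [:- W.xx i w, 1:])) x"
    unfolding poly_mult poly_smult poly_prod poly_line_poly[OF polyfun_om] using poly_line_poly[of "\<lambda>X. l \<odot> X" "Nz w" "Ee \<epsilon> w" x]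
    by (simp add: N_def E_def prod.distrib mult.assoc del: sprod_linear om_linear)
qed simp

lemma scal_nonzero: "w \<in> W \<Longrightarrow> gam w * (\<Prod>i<d. W.bb i w) \<noteq> 0"
  using gam(1) sub W.bb_nz by (simp add: subset_iff del: split_paired_All)

text \<open>Comparison of leading coefficients. It will turn the tangent-line term of
  \<open>pencil_formula\<close> into logarithmic derivatives of \<open>gam\<close> and the
  \<open>bb\<close>.\<close>

lemma lead_eq:
  assumes w: "w \<in> W"
  shows "- (l \<odot> Ee \<epsilon> w) * om (Nz w) (Ee \<epsilon> w) = gam w * (\<Prod>i<d. W.bb i w)"
proof -
  have lp: "polyfun (\<lambda>X. l \<odot> X)" by (intro polyfun_intros)
  have "line_poly (\<lambda>X. l \<odot> X) (Nz w) (Ee \<epsilon> w) = [:l \<odot> Nz w, l \<odot> Ee \<epsilon> w:]"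
    by (rule poly_eqI_cofinite[of "{}"]) (simp_all add: lp)
  then have "coeff ([:l \<odot> Nz w, l \<odot> Ee \<epsilon> w:] * line_poly (om (Ee \<epsilon> w)) (Nz w) (Ee \<epsilon> w)) d
     = coeff (smult (gam w * (\<Prod>i<d. W.bb i w)) (\<Prod>i<d. [:- W.xx i w, 1:])) d"
    using pencil_poly_factor[OF w] by simp
  moreover have "coeff (\<Prod>i<d. [:- W.xx i w, 1:]) d = 1"
  proof -
    have "degree (\<Prod>i<d. [:- W.xx i w, 1:]) = d" by (subst degree_prod_eq_sum_degree) auto
    then show ?thesis using lead_coeff_prod[of "\<lambda>i. [:- W.xx i w, 1:]" "{..<d}"] by simp
  qed
  moreover have "coeff (line_poly (om (Ee \<epsilon> w)) (Nz w) (Ee \<epsilon> w)) (Suc n) = 0"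
    by (rule coeff_eq_0) (use degree_pencil_poly[of "Ee \<epsilon> w" "Nz w"] in simp)
  ultimately show ?thesis by (simp add: dn lead_pencil_poly)
qed

lemma simple_point:
  assumes w: "w \<in> W" and i: "i < d"
  defines "X \<equiv> Nz w + W.xx i w *s Ee \<epsilon> w"
  shows "(l \<odot> X) * om (Ee \<epsilon> w) X = 0"
    "(l \<odot> Ee \<epsilon> w) * om (Ee \<epsilon> w) X + (l \<odot> X) * Am (Ee \<epsilon> w) (Ee \<epsilon> w) X \<noteq> 0"
proof -
  let ?P = "line_poly (\<lambda>X. l \<odot> X) (Nz w) (Ee \<epsilon> w) * line_poly (om (Ee \<epsilon> w)) (Nz w) (Ee \<epsilon> w)"
  have lp: "polyfun (\<lambda>X. l \<odot> X)" by (intro polyfun_intros)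
  have "poly ?P (W.xx i w) = 0" unfolding pencil_poly_factor[OF w] using i by (auto simp: poly_prod prod_zero_iff)
  then show "(l \<odot> X) * om (Ee \<epsilon> w) X = 0" by (simp add: lp polyfun_om X_def)
  define A Q where "A = line_poly (\<lambda>X. l \<odot> X) (Nz w) (Ee \<epsilon> w)" and "Q = line_poly (om (Ee \<epsilon> w)) (Nz w) (Ee \<epsilon> w)"
  have "poly (pderiv (A * Q)) (W.xx i w) \<noteq> 0"
    unfolding A_def Q_def pencil_poly_factor[OF w]
    using root_poly_E2(1)[of i d "\<lambda>i. W.xx i w" "gam w * (\<Prod>i<d. W.bb i w)"] i W.xx_distinct[OF i _ _ w] scal_nonzero[OF w] by auto
  moreover have "A = [:l \<odot> Nz w, l \<odot> Ee \<epsilon> w:]"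
    unfolding A_def by (rule poly_eqI_cofinite[of "{}"]) (simp_all add: lp)
  then have "poly (pderiv A) (W.xx i w) = l \<odot> Ee \<epsilon> w" by (simp add: pderiv_pCons)
  moreover have "poly A (W.xx i w) = l \<odot> X" unfolding A_def X_def by (rule poly_line_poly[OF lp])
  moreover have "poly Q (W.xx i w) = om (Ee \<epsilon> w) X" unfolding Q_def X_def by (rule poly_line_poly[OF polyfun_om])
  moreover have "poly (pderiv Q) (W.xx i w) = Am (Ee \<epsilon> w) (Ee \<epsilon> w) X"
    unfolding Q_def X_def Am_def pderiv_line_poly[OF polyfun_om] by (rule poly_line_poly[OF polyfun_dird[OF polyfun_om]])
  ultimately show "(l \<odot> Ee \<epsilon> w) * om (Ee \<epsilon> w) X + (l \<odot> X) * Am (Ee \<epsilon> w) (Ee \<epsilon> w) X \<noteq> 0"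
    by (simp add: pderiv_mult algebra_simps)
qed

text \<open>Where the web is smooth, the line \<open>w\<close> does not pass through a singular point with non-zero
  residue, since the tangency polynomial would have a multiple root there.\<close>

lemma lam_nonzero:
  assumes w: "w \<in> W" and a: "a \<in> PP" and c: "res_const (rep a) \<noteq> 0"
  shows "lam a w \<noteq> 0"
proof
  assume "lam a w = 0"
  define N E where "N = Nz w" and "E = Ee \<epsilon> w"
  have 0: "tri (rep a) N E = 0" using \<open>lam a w = 0\<close> lam_Ee[of a w \<epsilon>] by (simp add: N_def E_def)
  have D: "tri N E (- c2) \<noteq> 0" using tri_frame by (simp add: N_def E_def)
  have lead: "om N E \<noteq> 0" using lead_eq[OF w] scal_nonzero[OF w] by (auto simp: N_def E_def)
  have s: "sing (rep a)" by (rule PP_sing[OF a])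
  have "tri N E (rep a) = 0" using 0 tri_rotate[of "rep a" N E] by simp
  then have "tri N E (- c2) *s rep a = tri (rep a) E (- c2) *s N + tri N (rep a) (- c2) *s E"
    using cramer[of N E "- c2" "rep a"] by simp
  then have r: "rep a = (tri (rep a) E (- c2) / tri N E (- c2)) *s N + (tri N (rep a) (- c2) / tri N E (- c2)) *s E"
    using D by (simp add: vec_eq_iff field_simps)
  define p q where "p = tri (rep a) E (- c2) / tri N E (- c2)" and "q = tri N (rep a) (- c2) / tri N E (- c2)"
  have r: "rep a = p *s N + q *s E" using r by (simp add: p_def q_def)
  have "p \<noteq> 0"
  proof
    assume "p = 0"
    then have "rep a = q *s E" using r by simp
    then have "q ^ (n + 1) *s \<Omega> E = 0" "q \<noteq> 0" using s Omega_hom[of q E] by (auto simp: sing_def)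
    then have "\<Omega> E = 0" by simp
    then show False using lead by (simp add: om_def)
  qed
  define X where "X = N + (q / p) *s E"
  have X: "X = (1 / p) *s rep a" unfolding r X_def using \<open>p \<noteq> 0\<close> by (simp add: vec_eq_iff field_simps)
  have "tau (rep a) \<noteq> 1"
  proof
    assume "tau (rep a) = 1"
    then have "res_const (rep a) = 0" by (simp add: res_const_def)
    then show False using c by simp
  qed
  then have "tau X \<ge> 2" using tau_pos[OF s] tau_scale[of "1 / p" "rep a"] \<open>p \<noteq> 0\<close> unfolding X by auto
  then have A: "Am E E X = 0" using below_tau[of 1 X E] H_1 by simp
  have "\<Omega> X = 0" using s Omega_hom[of "1 / p" "rep a"] unfolding X by (simp add: sing_def)
  then have om0: "om V X = 0" for V by (simp add: om_def)
  have lp: "polyfun (\<lambda>X. l \<odot> X)" by (intro polyfun_intros)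
  have "poly (smult (gam w * (\<Prod>i<d. W.bb i w)) (\<Prod>i<d. [:- W.xx i w, 1:])) (q / p) = 0"
    unfolding pencil_poly_factor[OF w, symmetric] using om0[of E] by (simp add: lp polyfun_om X_def N_def E_def)
  then have "(\<Prod>i<d. q / p - W.xx i w) = 0" using scal_nonzero[OF w] by (simp add: poly_prod)
  then obtain i where "i < d" "W.xx i w = q / p" by (auto simp: prod_zero_iff)
  then show False using simple_point(2)[OF w, of i] om0 A by (simp add: X_def N_def E_def)
qed

end

lemma deriv_of_zero:
  fixes g :: "complex \<Rightarrow> complex"
  assumes "eventually (\<lambda>h. g h = 0) (nhds 0)" "(g has_field_derivative D) (at 0)"
  shows "D = 0"
proof -
  have "((\<lambda>h. 0) has_field_derivative D) (at (0::complex))"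
    using DERIV_cong_ev[OF refl assms(1) refl, of D] assms(2) by simp
  from DERIV_unique[OF this DERIV_const] show ?thesis .
qed

lemma moving_point_deriv:
  fixes \<xi> :: "complex \<Rightarrow> complex" and N E F G :: "complex^3"
  assumes "(\<xi> has_field_derivative D) (at 0)"
  shows "((\<lambda>h. (N + h *s G + \<xi> h *s (E + h *s F)) $ k) has_field_derivative (D *s E + \<xi> 0 *s F + G) $ k) (at 0)"
  using assms by (auto intro!: derivative_eq_intros)

context leg_web_dir
begin

lemma line_scal: "line_poly (\<lambda>X. l \<odot> X) N E = [:l \<odot> N, l \<odot> E:]"
proof -
  have lp: "polyfun (\<lambda>X. l \<odot> X)" by (intro polyfun_intros)
  show ?thesis by (rule poly_eqI_cofinite[of "{}"]) (simp_all add: lp)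
qed

text \<open>The leaves of the \<open>i\<close>-th foliation of the web are tangent at \<open>w\<close> to the line dual to
  \<open>pt i w\<close>, which is a tangency point of the line \<open>w\<close> with the foliation or its point on \<open>l\<close>.\<close>

definition pt where "pt i w = Nz w + W.xx i w *s Ee \<epsilon> w"

lemma pt_deriv:
  assumes g: "polyfun g" and i: "i < d" and z: "z \<in> W"
  shows "((\<lambda>h. g (pt i (fst z + h * 1, snd z + h * 0))) has_field_derivative
      dir 1 0 (W.xx i) z * dird g (Ee \<epsilon> z) (pt i z) + W.xx i z * dird g c2 (pt i z)) (at 0)"
    and "((\<lambda>h. g (pt i (fst z + h * (- \<epsilon>), snd z + h * 1))) has_field_derivative
      W.slope2 i z * dird g (Ee \<epsilon> z) (pt i z) - dird g c2 (pt i z)) (at 0)"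
proof -
  note D = dir_line[OF W.openU W.hol_xx[OF i] z]
  have 1: "((\<lambda>h. pt i (fst z + h * 1, snd z + h * 0) $ k) has_field_derivative
      (dir 1 0 (W.xx i) z *s Ee \<epsilon> z + W.xx i z *s c2) $ k) (at 0)" for k
    unfolding pt_def frame_move
    using moving_point_deriv[OF D[of 1 0], of "Nz z" 0 "Ee \<epsilon> z" c2 k] by simp
  have 2: "((\<lambda>h. pt i (fst z + h * (- \<epsilon>), snd z + h * 1) $ k) has_field_derivative
      (W.slope2 i z *s Ee \<epsilon> z - c2) $ k) (at 0)" for k
    unfolding pt_def frame_move W.slope2_def
    using moving_point_deriv[OF D[of "- \<epsilon>" 1], of "Nz z" "- c2" "Ee \<epsilon> z" 0 k] by simp
  show "((\<lambda>h. g (pt i (fst z + h * 1, snd z + h * 0))) has_field_derivative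
      dir 1 0 (W.xx i) z * dird g (Ee \<epsilon> z) (pt i z) + W.xx i z * dird g c2 (pt i z)) (at 0)"
    using polyfun_chain[OF g 1] by (simp add: dird_def)
  show "((\<lambda>h. g (pt i (fst z + h * (- \<epsilon>), snd z + h * 1))) has_field_derivative
      W.slope2 i z * dird g (Ee \<epsilon> z) (pt i z) - dird g c2 (pt i z)) (at 0)"
    using polyfun_chain[OF g 2] by (simp add: dird_def)
qed

lemma pt_continuous:
  assumes i: "i < d"
  shows "continuous_on W (pt i)"
proof -
  have "continuous_on W (W.xx i)" by (rule holomorphic2_continuous[OF W.openU W.hol_xx[OF i]])
  then have "continuous_on W (\<lambda>w. pt i w $ k)" for k
    unfolding pt_def Nz_def Ee_def X1_def by (simp, intro continuous_intros)
  then have "continuous_on W (\<lambda>w. \<chi> k. pt i w $ k)" by (intro continuous_on_vec_lambda)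
  then show ?thesis by simp
qed

lemma nearby_nonzero:
  assumes g: "continuous_on W g" and z: "z \<in> W" "g z \<noteq> (0::complex)"
  obtains V where "open V" "z \<in> V" "V \<subseteq> W" "\<And>w. w \<in> V \<Longrightarrow> g w \<noteq> 0"
proof
  show "open (W \<inter> g -` (- {0}))" by (rule continuous_open_preimage[OF g W.openU]) (simp add: open_Compl)
qed (use z in auto)

text \<open>The equation of the moving point \<open>pt i\<close> is differentiated in the two
  coordinate directions, and the combination \<open>kappa\<close> eliminates
  \<open>Am c2 (Ee \<epsilon> z)\<close>. For the foliation dual to \<open>l\<close> the equation is
  linear and the second derivative is 0: its leaves are straight.\<close>

lemma kappa_eq:
  assumes z: "z \<in> W" and i: "i < d"
  shows "l \<odot> pt i z \<noteq> 0 \<Longrightarrow> om (Ee \<epsilon> z) (pt i z) = 0 \<and> W.kappa i z = om (- c2) (pt i z) / Am (Ee \<epsilon> z) (Ee \<epsilon> z) (pt i z)"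
    "l \<odot> pt i z = 0 \<Longrightarrow> om (Ee \<epsilon> z) (pt i z) \<noteq> 0 \<and> W.kappa i z = 0"
proof -
  have lp: "polyfun (\<lambda>X. l \<odot> X)" by (intro polyfun_intros)
  have sp: "l \<odot> pt i w = 0 \<or> om (Ee \<epsilon> w) (pt i w) = 0" if "w \<in> W" for w
    using simple_point(1)[OF that i] by (simp add: pt_def)
  have sp2: "l \<odot> Ee \<epsilon> z * om (Ee \<epsilon> z) (pt i z) + l \<odot> pt i z * Am (Ee \<epsilon> z) (Ee \<epsilon> z) (pt i z) \<noteq> 0"
    using simple_point(2)[OF z i] by (simp add: pt_def)
  {
    assume 0: "l \<odot> pt i z \<noteq> 0"
    then have o: "om (Ee \<epsilon> z) (pt i z) = 0" using sp[OF z] by blast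
    with sp2 have A: "Am (Ee \<epsilon> z) (Ee \<epsilon> z) (pt i z) \<noteq> 0" by auto
    \<comment> \<open>By continuity this factor stays non-zero near \<open>z\<close>, so the other
      factor in \<open>sp\<close> vanishes identically there and may be differentiated.\<close>
    have "continuous_on W (\<lambda>w. l \<odot> pt i w)"
      unfolding sprod_3 by (intro continuous_intros pt_continuous i)
    from nearby_nonzero[OF this z 0] obtain V where V: "open V" "z \<in> V" "V \<subseteq> W" "\<And>w. w \<in> V \<Longrightarrow> l \<odot> pt i w \<noteq> 0"
      by blast
    have van: "om (Ee \<epsilon> w) (pt i w) = 0" if "w \<in> V" for w using sp V that by blast
    have "eventually (\<lambda>h. om (Ee \<epsilon> z) (pt i (fst z + h * 1, snd z + h * 0)) + h * om c2 (pt i (fst z + h * 1, snd z + h * 0)) = 0) (nhds 0)"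
      using dir_shift_eventually[OF V(1,2), of 1 0]
    proof eventually_elim
      case (elim h)
      show ?case using van[OF elim] unfolding frame_move by simp
    qed
    moreover have "((\<lambda>h. om (Ee \<epsilon> z) (pt i (fst z + h * 1, snd z + h * 0)) + h * om c2 (pt i (fst z + h * 1, snd z + h * 0)))
      has_field_derivative (dir 1 0 (W.xx i) z * Am (Ee \<epsilon> z) (Ee \<epsilon> z) (pt i z) + W.xx i z * Am c2 (Ee \<epsilon> z) (pt i z)) + om c2 (pt i z)) (at 0)"
      using DERIV_add[OF pt_deriv(1)[OF polyfun_om i z, of "Ee \<epsilon> z"] DERIV_mult[OF DERIV_ident pt_deriv(1)[OF polyfun_om i z, of c2]]]
      by (simp add: Am_def)
    ultimately have e1: "(dir 1 0 (W.xx i) z * Am (Ee \<epsilon> z) (Ee \<epsilon> z) (pt i z) + W.xx i z * Am c2 (Ee \<epsilon> z) (pt i z)) + om c2 (pt i z) = 0"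
      by (rule deriv_of_zero)
    have "eventually (\<lambda>h. om (Ee \<epsilon> z) (pt i (fst z + h * (- \<epsilon>), snd z + h * 1)) = 0) (nhds 0)"
      using dir_shift_eventually[OF V(1,2), of "- \<epsilon>" 1]
    proof eventually_elim
      case (elim h)
      show ?case using van[OF elim] unfolding frame_move .
    qed
    from deriv_of_zero[OF this pt_deriv(2)[OF polyfun_om i z]]
    have e2: "Am c2 (Ee \<epsilon> z) (pt i z) = W.slope2 i z * Am (Ee \<epsilon> z) (Ee \<epsilon> z) (pt i z)"
      by (simp add: Am_def)
    have neg: "om (- c2) X = - om c2 X" for X using om_linear(3)[of "- 1" c2 X] by simp
    have "W.kappa i z * Am (Ee \<epsilon> z) (Ee \<epsilon> z) (pt i z) + om c2 (pt i z) = 0"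
      using e1 unfolding e2 W.kappa_def by (simp only: distrib_right mult.assoc mult.left_commute)
    then have "W.kappa i z * Am (Ee \<epsilon> z) (Ee \<epsilon> z) (pt i z) = om (- c2) (pt i z)"
      unfolding neg by (simp only: eq_neg_iff_add_eq_0)
    then show "om (Ee \<epsilon> z) (pt i z) = 0 \<and> W.kappa i z = om (- c2) (pt i z) / Am (Ee \<epsilon> z) (Ee \<epsilon> z) (pt i z)"
      using A o by (simp add: eq_divide_eq)
  next
    assume 0: "l \<odot> pt i z = 0"
    with sp2 have o: "om (Ee \<epsilon> z) (pt i z) \<noteq> 0" and lE: "l \<odot> Ee \<epsilon> z \<noteq> 0" by auto
    have "continuous_on W (\<lambda>w. om (Ee \<epsilon> w) (pt i w))"
    proof -
      have "continuous_on W (\<lambda>w. g (pt i w))" if "polyfun g" for g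
        using that
      proof induction
        case (coord k)
        show ?case by (intro continuous_intros pt_continuous i)
      qed (intro continuous_intros | assumption)+
      note cO = this[OF polyfun_Omega]
      have cE: "continuous_on W (\<lambda>w. Ee \<epsilon> w $ k)" for k
        unfolding Ee_def X1_def Nz_def vector_minus_component vector_add_component vector_smult_component
        by (intro continuous_intros)
      show ?thesis unfolding om_def sprod_3 by (intro continuous_on_add continuous_on_mult cO cE)
    qed
    from nearby_nonzero[OF this z o] obtain V where V: "open V" "z \<in> V" "V \<subseteq> W" "\<And>w. w \<in> V \<Longrightarrow> om (Ee \<epsilon> w) (pt i w) \<noteq> 0"
      by blast
    have van: "l \<odot> pt i w = 0" if "w \<in> V" for w using sp V that by blast
    have dl: "dird (\<lambda>X. l \<odot> X) Y X = l \<odot> Y" for X Y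
      by (rule dird_eqI[OF lp]) (auto intro!: derivative_eq_intros)
    have "eventually (\<lambda>h. l \<odot> pt i (fst z + h * 1, snd z + h * 0) = 0) (nhds 0)"
      using dir_shift_eventually[OF V(1,2), of 1 0] by eventually_elim (rule van)
    from deriv_of_zero[OF this pt_deriv(1)[OF lp i z]]
    have e1: "dir 1 0 (W.xx i) z * (l \<odot> Ee \<epsilon> z) + W.xx i z * (l \<odot> c2) = 0" unfolding dl .
    have "eventually (\<lambda>h. l \<odot> pt i (fst z + h * (- \<epsilon>), snd z + h * 1) = 0) (nhds 0)"
      using dir_shift_eventually[OF V(1,2), of "- \<epsilon>" 1] by eventually_elim (rule van)
    from deriv_of_zero[OF this pt_deriv(2)[OF lp i z]]
    have e2: "l \<odot> c2 = W.slope2 i z * (l \<odot> Ee \<epsilon> z)" unfolding dl by simp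
    have "W.kappa i z * (l \<odot> Ee \<epsilon> z) = 0"
      using e1 unfolding e2 W.kappa_def by (simp add: algebra_simps)
    then show "om (Ee \<epsilon> z) (pt i z) \<noteq> 0 \<and> W.kappa i z = 0"
      using lE o by simp
  }
qed

text \<open>Logarithmic derivative of \<open>lead_eq\<close>. Along \<open>(- \<epsilon>, 1)\<close>
  the centre \<open>Ee \<epsilon> z\<close> is fixed, so the factor containing \<open>l\<close> is
  constant.\<close>

lemma lead_log_deriv:
  assumes z: "z \<in> W"
  shows "om (- c2) (Ee \<epsilon> z) / om (Nz z) (Ee \<epsilon> z) = dir (- \<epsilon>) 1 gam z / gam z + (\<Sum>i<d. W.beta i z)"
proof -
  let ?P = "\<lambda>w. \<Prod>i<d. W.bb i w"
  have hg: "holomorphic2_on gam W" by (rule holomorphic2_subset[OF hol_gam openU sub])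
  have hP: "holomorphic2_on ?P W" by (intro holomorphic2_prod W.openU W.hol_bb) auto
  have P0: "?P z \<noteq> 0" using W.bb_nz z by (simp add: prod_zero_iff)
  have g0: "gam z \<noteq> 0" using gam(1) z sub by blast
  have dP: "dir (- \<epsilon>) 1 ?P z = ?P z * (\<Sum>i<d. W.beta i z)"
    unfolding W.beta_def by (rule dir_prod[OF W.openU]) (use W.hol_bb W.bb_nz z in auto)
  have "dir (- \<epsilon>) 1 (\<lambda>w. gam w * ?P w) z = - (l \<odot> Ee \<epsilon> z) * om (- c2) (Ee \<epsilon> z)"
  proof (rule dir_eqI[OF W.openU holomorphic2_mult[OF W.openU hg hP] z])
    define L where "L h = - (l \<odot> Ee \<epsilon> z) * (om (Nz z) (Ee \<epsilon> z) + h * om (- c2) (Ee \<epsilon> z))" for h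
    have ev: "eventually (\<lambda>h. L h = gam (fst z + h * (- \<epsilon>), snd z + h * 1) * ?P (fst z + h * (- \<epsilon>), snd z + h * 1)) (nhds 0)"
      using dir_shift_eventually[OF W.openU z, of "- \<epsilon>" 1]
    proof eventually_elim
      case (elim h)
      show ?case using lead_eq[OF elim] unfolding frame_move om_linear L_def .
    qed
    have "(L has_field_derivative - (l \<odot> Ee \<epsilon> z) * om (- c2) (Ee \<epsilon> z)) (at 0)"
      unfolding L_def by (auto intro!: derivative_eq_intros)
    then show "((\<lambda>h. gam (fst z + h * (- \<epsilon>), snd z + h * 1) * ?P (fst z + h * (- \<epsilon>), snd z + h * 1))
      has_field_derivative - (l \<odot> Ee \<epsilon> z) * om (- c2) (Ee \<epsilon> z)) (at 0)"
      using DERIV_cong_ev[OF refl ev refl] by blast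
  qed
  then have 1: "- (l \<odot> Ee \<epsilon> z) * om (- c2) (Ee \<epsilon> z) = dir (- \<epsilon>) 1 gam z * ?P z + gam z * (?P z * (\<Sum>i<d. W.beta i z))"
    unfolding dir_mult[OF W.openU hg hP z] dP by simp
  have 2: "- (l \<odot> Ee \<epsilon> z) * om (Nz z) (Ee \<epsilon> z) = gam z * ?P z" by (rule lead_eq[OF z])
  have nz: "- (l \<odot> Ee \<epsilon> z) \<noteq> 0" using scal_nonzero[OF z] 2 by auto
  have "om (- c2) (Ee \<epsilon> z) / om (Nz z) (Ee \<epsilon> z) = (- (l \<odot> Ee \<epsilon> z) * om (- c2) (Ee \<epsilon> z)) / (- (l \<odot> Ee \<epsilon> z) * om (Nz z) (Ee \<epsilon> z))"
    by (rule mult_divide_mult_cancel_left[OF nz, symmetric])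
  also have "\<dots> = dir (- \<epsilon>) 1 gam z / gam z + (\<Sum>i<d. W.beta i z)"
    unfolding 1 2 using P0 g0 by (simp add: add_divide_distrib)
  finally show ?thesis .
qed

lemma lam_log_deriv:
  assumes z: "z \<in> W"
  shows "dir (- \<epsilon>) 1 (lam a) z = tri (rep a) (- c2) (Ee \<epsilon> z)"
proof (rule dir_eqI[OF W.openU holomorphic2_subset[OF hol_lam openU sub] z])
  show "((\<lambda>h. lam a (fst z + h * (- \<epsilon>), snd z + h * 1)) has_field_derivative tri (rep a) (- c2) (Ee \<epsilon> z)) (at 0)"
    unfolding lam_Ee[of _ _ \<epsilon>] frame_move tri_linear by (auto intro!: derivative_eq_intros)
qed

end

section \<open>The sum of the forms as a closed form\<close>

context leg_web
begin

definition S where "S z = (\<Sum>(r, s, t)\<in>triples d. eta \<omega> r s t z)"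

text \<open>Points of residue 0 are left out because their dual lines may cross \<open>U\<close>,
  where \<open>dlog (lam a)\<close> is singular. By \<open>lam_nonzero\<close> this cannot happen
  for the others.\<close>

definition PS where "PS = {a \<in> PP. res_const (rep a) \<noteq> 0}"

text \<open>The coefficient of \<open>dlog gam\<close> is minus the residue at the tangent line. The
  double sum takes up the \<open>slope2\<close> terms together with \<open>n * (n - 1)\<close> times
  the sum of the \<open>beta\<close>: one half of that comes from \<open>eta_sum_dir\<close>, the
  other from \<open>lead_log_deriv\<close>.\<close>

definition Xi where
  "Xi z = scale_covec (of_nat n * (of_nat n - 1) / 2) (dlog gam z)
     + scale_covec ((of_nat d - 2) / 2) (\<Sum>i<d. \<Sum>j\<in>{..<d} - {i}. dlog (\<lambda>w. wedge (\<omega> i w) (\<omega> j w)) z)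
     + (\<Sum>a\<in>PS. scale_covec (- res_const (rep a)) (dlog (lam a) z))"

end

context leg_web_dir
begin

text \<open>Only leaves dual to tangency points contribute. Their slopes are the roots in
  \<open>rts\<close>, and by \<open>root_poly_E2\<close> each summand is a value of
  \<open>phi\<close>; so the sum is the trace \<open>T\<close>, evaluated by
  \<open>pencil_formula\<close>.\<close>

lemma kappa_sum:
  assumes z: "z \<in> W" and good: "bad_poly (Ee \<epsilon> z) \<noteq> 0" and off: "\<forall>a\<in>PP. lam a z \<noteq> 0"
  shows "(\<Sum>i<d. W.kappa i z * E2 d (\<lambda>i. W.xx i z) i)
    = (\<Sum>a\<in>PP. res_const (rep a) * (dir (- \<epsilon>) 1 (lam a) z / lam a z))
     - of_nat n * (of_nat n - 1) / 2 * (om (- c2) (Ee \<epsilon> z) / om (Nz z) (Ee \<epsilon> z))"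
proof -
  interpret G: good_pencil n \<Omega> l "Ee \<epsilon> z" by unfold_locales (rule good)
  define E N where "E = Ee \<epsilon> z" and "N = Nz z"
  define I where "I = {i. i < d \<and> l \<odot> pt i z \<noteq> 0}"
  have ptE: "pt i z = N + W.xx i z *s E" for i by (simp add: pt_def E_def N_def)
  define A Q where "A = line_poly (\<lambda>X. l \<odot> X) N E" and "Q = line_poly (om E) N E"
  have A: "A = [:l \<odot> N, l \<odot> E:]" unfolding A_def by (rule line_scal)
  have AQ: "A * Q = smult (gam z * (\<Prod>i<d. W.bb i z)) (\<Prod>i<d. [:- W.xx i z, 1:])"
    unfolding A_def Q_def E_def N_def by (rule pencil_poly_factor[OF z])
  have pA: "poly A x = l \<odot> (N + x *s E)" "poly (pderiv A) x = l \<odot> E" "pderiv (pderiv A) = 0" for x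
    by (simp_all add: A pderiv_pCons)
  have pQ: "poly Q x = om E (N + x *s E)" "poly (pderiv Q) x = G.f1 (N + x *s E)"
    "poly (pderiv (pderiv Q)) x = G.f2 (N + x *s E)" "poly (pderiv (pderiv (pderiv Q))) x = G.f3 (N + x *s E)" for x
    using G.pderiv_pencil_poly[of N x] by (simp_all add: Q_def E_def numeral_2_eq_2 numeral_3_eq_3 del: om_linear)
  have inj: "inj_on (\<lambda>i. W.xx i z) I"
    using W.xx_distinct[OF _ _ _ z] by (auto simp: inj_on_def I_def)
  have im: "(\<lambda>i. W.xx i z) ` I = G.rts N"
  proof
    show "(\<lambda>i. W.xx i z) ` I \<subseteq> G.rts N"
    proof
      fix x assume "x \<in> (\<lambda>i. W.xx i z) ` I"
      then obtain i where i: "i < d" "l \<odot> pt i z \<noteq> 0" "x = W.xx i z" by (auto simp: I_def)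
      then show "x \<in> G.rts N" using kappa_eq(1)[OF z i(1,2)] unfolding G.rts_def ptE E_def by blast
    qed
    show "G.rts N \<subseteq> (\<lambda>i. W.xx i z) ` I"
    proof
      fix x assume "x \<in> G.rts N"
      then have x: "om E (N + x *s E) = 0" unfolding G.rts_def E_def by blast
      then have "poly (A * Q) x = 0" unfolding poly_mult pQ by simp
      then have "(\<Prod>i<d. x - W.xx i z) = 0" using scal_nonzero[OF z] unfolding AQ by (simp add: poly_prod)
      then obtain i where i: "i < d" "x = W.xx i z" by (auto simp: prod_zero_iff)
      have "l \<odot> pt i z \<noteq> 0" using kappa_eq(2)[OF z i(1)] x unfolding ptE E_def[symmetric] i(2) by blast
      then show "x \<in> (\<lambda>i. W.xx i z) ` I" using i by (auto simp: I_def)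
    qed
  qed
  have summand: "W.kappa i z * E2 d (\<lambda>i. W.xx i z) i = G.phi (- c2) (N + W.xx i z *s E)" if "i \<in> I" for i
  proof -
    have i: "i < d" and lX: "l \<odot> pt i z \<noteq> 0" using that by (auto simp: I_def)
    define X where "X = N + W.xx i z *s E"
    have X: "pt i z = X" by (simp add: ptE X_def)
    have k: "om E X = 0" "W.kappa i z = om (- c2) X / G.f1 X"
      using kappa_eq(1)[OF z i lX] unfolding X G.f1_Am E_def by blast+
    have nz: "\<And>j. j < d \<Longrightarrow> j \<noteq> i \<Longrightarrow> W.xx i z \<noteq> W.xx j z" using W.xx_distinct i z by blast
    note R = root_poly_E2[where x = "\<lambda>i. W.xx i z" and d = d, OF i nz scal_nonzero[OF z], folded AQ]
    have p1: "poly (pderiv (A * Q)) (W.xx i z) = (l \<odot> X) * G.f1 X"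
      unfolding pderiv_mult poly_add poly_mult pA pQ X_def[symmetric] k(1) by simp
    have "pderiv (pderiv (pderiv (A * Q))) = A * pderiv (pderiv (pderiv Q)) + 3 * (pderiv A * pderiv (pderiv Q))"
      by (simp add: pderiv_mult pderiv_add pA(3) algebra_simps)
    then have p3: "poly (pderiv (pderiv (pderiv (A * Q)))) (W.xx i z) = (l \<odot> X) * G.f3 X + 3 * ((l \<odot> E) * G.f2 X)"
      by (simp add: pA(1,2) pQ X_def del: om_linear sprod_linear)
    have f: "G.f1 X \<noteq> 0" using R(1) unfolding p1 by auto
    have lX': "l \<odot> X \<noteq> 0" using lX unfolding X .
    have "E2 d (\<lambda>i. W.xx i z) i = ((l \<odot> X) * G.f3 X + 3 * ((l \<odot> E) * G.f2 X)) / (6 * ((l \<odot> X) * G.f1 X))"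
      using R(2) unfolding p1 p3 by simp
    also have "\<dots> = G.f3 X / (6 * G.f1 X) + G.f2 X / (2 * G.f1 X) * (l \<odot> E) / (l \<odot> X)"
      using f lX' by (simp add: divide_simps)
    finally show ?thesis unfolding X_def[symmetric] unfolding G.phi_def k(2) unfolding E_def[symmetric] by simp
  qed
  have "(\<Sum>i<d. W.kappa i z * E2 d (\<lambda>i. W.xx i z) i) = (\<Sum>i\<in>I. W.kappa i z * E2 d (\<lambda>i. W.xx i z) i)"
  proof (rule sum.mono_neutral_right)
    show "\<forall>i\<in>{..<d} - I. W.kappa i z * E2 d (\<lambda>i. W.xx i z) i = 0"
      using kappa_eq(2)[OF z] by (auto simp: I_def)
  qed (auto simp: I_def)
  also have "\<dots> = (\<Sum>i\<in>I. G.phi (- c2) (N + W.xx i z *s E))" by (rule sum.cong[OF refl summand])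
  also have "\<dots> = G.T N (- c2)"
    unfolding G.T_def im[symmetric] E_def by (simp only: sum.reindex[OF inj] o_def)
  also have "\<dots> = (\<Sum>a\<in>PP. res_const (rep a) * (tri (rep a) (- c2) E / tri (rep a) N E))
     - of_nat n * (of_nat n - 1) / 2 * (om (- c2) E / om N E)"
    unfolding E_def
  proof (rule G.pencil_formula)
    show "tri N (Ee \<epsilon> z) (- c2) \<noteq> 0" unfolding N_def by (rule tri_frame)
    show "\<forall>a\<in>PP. tri (rep a) N (Ee \<epsilon> z) \<noteq> 0" using off unfolding lam_Ee[of _ _ \<epsilon>] N_def .
    show "om N (Ee \<epsilon> z) \<noteq> 0" using lead_eq[OF z] scal_nonzero[OF z] unfolding N_def by auto
  qed
  finally show ?thesis unfolding E_def N_def lam_log_deriv[OF z] lam_Ee[of _ _ \<epsilon>, symmetric] .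
qed

lemma S_Xi_dir:
  assumes z: "z \<in> W" and good: "bad_poly (Ee \<epsilon> z) \<noteq> 0" and off: "\<forall>a\<in>PP. lam a z \<noteq> 0"
  shows "snd (S z) - \<epsilon> * fst (S z) = snd (Xi z) - \<epsilon> * fst (Xi z)"
proof -
  define P where "P v = snd v - \<epsilon> * fst v" for v :: "complex \<times> complex"
  have Padd: "P (u + v) = P u + P v" for u v by (simp add: P_def algebra_simps)
  have Psc: "P (scale_covec c u) = c * P u" for c u by (simp add: P_def scale_covec_def algebra_simps)
  have Psum: "P (sum f I) = (\<Sum>i\<in>I. P (f i))" for f :: "'q \<Rightarrow> complex \<times> complex" and I
    by (simp add: P_def fst_sum snd_sum sum_distrib_left sum_subtractf)
  have Pdl: "P (dlog g z) = dir (- \<epsilon>) 1 g z / g z" for g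
    by (simp add: P_def dlog_def dir_def diff_divide_distrib)
  have "(\<Sum>a\<in>PP. res_const (rep a) * (dir (- \<epsilon>) 1 (lam a) z / lam a z)) = (\<Sum>a\<in>PS. res_const (rep a) * (dir (- \<epsilon>) 1 (lam a) z / lam a z))"
    by (rule sum.mono_neutral_right[OF finite_PP]) (auto simp: PS_def)
  note ks = kappa_sum[OF assms, unfolded this lead_log_deriv[OF z]]
  define B Sl L G :: complex where "B = (\<Sum>i<d. W.beta i z)" and "Sl = (\<Sum>i<d. W.slope2 i z * E1 d (\<lambda>i. W.xx i z) i)"
    and "L = (\<Sum>a\<in>PS. res_const (rep a) * (dir (- \<epsilon>) 1 (lam a) z / lam a z))" and "G = dir (- \<epsilon>) 1 gam z / gam z"
  have d1: "of_nat d = (of_nat n + 1 :: complex)" by (simp add: dn)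
  have "P (S z) = (of_nat d - 1) * (of_nat d - 2) / 2 * B - (L - of_nat n * (of_nat n - 1) / 2 * (G + B)) + (of_nat d - 2) * Sl"
    unfolding P_def S_def W.eta_sum_dir[OF z] ks B_def Sl_def L_def G_def ..
  moreover have "P (Xi z) = of_nat n * (of_nat n - 1) / 2 * G + (of_nat d - 2) / 2 * (2 * (of_nat d - 1) * B + 2 * Sl) - L"
    unfolding Xi_def Padd Psc Psum Pdl W.wedge_log_sum[OF z] B_def Sl_def L_def G_def by (simp add: sum_negf)
  moreover have "(m + 1 - 1) * (m + 1 - 2) / 2 * B - (L - m * (m - 1) / 2 * (G + B)) + (m + 1 - 2) * Sl
    = m * (m - 1) / 2 * G + (m + 1 - 2) / 2 * (2 * (m + 1 - 1) * B + 2 * Sl) - L" for m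
    by (simp add: field_simps)
  ultimately have "P (S z) = P (Xi z)" unfolding d1 by (simp only:)
  then show ?thesis unfolding P_def .
qed

end

lemma ext_deriv_cong:
  assumes "open U" "z \<in> U" "\<And>w. w \<in> U \<Longrightarrow> \<theta> w = \<eta> w"
  shows "ext_deriv \<theta> z = ext_deriv \<eta> z"
proof -
  obtain p q where z: "z = (p, q)" by (cases z)
  have "open ((\<lambda>s. (s, q)) -` U)" "open ((\<lambda>s. (p, s)) -` U)"
    by (intro open_vimage assms(1) continuous_intros)+
  then have "eventually (\<lambda>s. s \<in> (\<lambda>s. (s, q)) -` U) (nhds p)" "eventually (\<lambda>s. s \<in> (\<lambda>s. (p, s)) -` U) (nhds q)"
    using assms(2) eventually_nhds_in_open[of "(\<lambda>s. (s, q)) -` U" p]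
      eventually_nhds_in_open[of "(\<lambda>s. (p, s)) -` U" q] by (auto simp: z)
  then have 1: "eventually (\<lambda>s. snd (\<theta> (s, q)) = snd (\<eta> (s, q))) (nhds p)"
    and 2: "eventually (\<lambda>s. fst (\<theta> (p, s)) = fst (\<eta> (p, s))) (nhds q)"
    using assms(3) by (auto elim: eventually_mono)
  show ?thesis unfolding z ext_deriv_def prod.case deriv_cong_ev[OF 1 refl] deriv_cong_ev[OF 2 refl] ..
qed

lemma closed_at_plus:
  assumes "closed_at \<theta> z" "closed_at \<eta> z"
  shows "closed_at (\<lambda>z. \<theta> z + \<eta> z) z"
  using closed_at_add[OF assms] by (simp add: plus_prod_def)

lemma closed_at_scale: "closed_at \<theta> z \<Longrightarrow> closed_at (\<lambda>z. scale_covec c (\<theta> z)) z"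
  unfolding scale_covec_def by (rule closed_at_cmult)

lemma closed_at_setsum:
  assumes "\<And>i. i \<in> I \<Longrightarrow> closed_at (\<theta> i) z"
  shows "closed_at (\<lambda>z. \<Sum>i\<in>I. \<theta> i z) z"
proof -
  have "(\<lambda>z. \<Sum>i\<in>I. \<theta> i z) = (\<lambda>z. (\<Sum>i\<in>I. fst (\<theta> i z), \<Sum>i\<in>I. snd (\<theta> i z)))"
    by (intro ext prod_eqI) (simp_all add: fst_sum snd_sum)
  then show ?thesis using closed_at_sum[OF assms] by simp
qed

lemma continuous_on_scale_covec: "continuous_on U \<theta> \<Longrightarrow> continuous_on U (\<lambda>z. scale_covec c (\<theta> z))"
  unfolding scale_covec_def by (intro continuous_intros)

context leg_web
begin

lemma direction_neighbourhood:
  assumes z: "z \<in> U" and nz: "\<And>i. i < d \<Longrightarrow> snd (\<omega> i z) - \<epsilon> * fst (\<omega> i z) \<noteq> 0"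
  obtains W where "z \<in> W" "leg_web_dir n \<Omega> l d U \<omega> M W \<epsilon>"
proof
  let ?g = "\<lambda>w. \<Prod>i<d. snd (\<omega> i w) - \<epsilon> * fst (\<omega> i w)"
  define W where "W = U \<inter> ?g -` (- {0})"
  have "holomorphic2_on ?g U"
    by (rule holomorphic2_prod[OF openU])
      (intro holomorphic2_diff holomorphic2_mult holomorphic2_const openU hol_components, simp_all)
  from holomorphic2_continuous[OF openU this] have oW: "open W" unfolding W_def
    by (rule continuous_open_preimage[OF _ openU]) (simp add: open_Compl)
  have sub: "W \<subseteq> U" by (auto simp: W_def)
  show "z \<in> W" using z nz by (auto simp: W_def prod_zero_iff)
  have "web_dir d W \<omega> \<epsilon>"
  proof
    show "holomorphic_form1_on (\<omega> i) W" if "i < d" for i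
      using hol[OF that] holomorphic2_subset[OF _ openU sub] by (simp add: holomorphic_form1_on_def)
    show "wedge (\<omega> i w) (\<omega> j w) \<noteq> 0" if "i < d" "j < d" "i \<noteq> j" "w \<in> W" for i j w
      using transverse[OF that(1-3)] that(4) sub by blast
    show "snd (\<omega> i w) - \<epsilon> * fst (\<omega> i w) \<noteq> 0" if "i < d" "w \<in> W" for i w
      using that unfolding W_def by (auto simp: prod_zero_iff)
  qed (rule oW)
  then show "leg_web_dir n \<Omega> l d U \<omega> M W \<epsilon>"
    using sub leg_web_axioms by (intro leg_web_dir.intro leg_web_dir_axioms.intro)
qed

lemma finite_bad_directions:
  assumes z: "z \<in> U"
  shows "finite {\<epsilon>. \<exists>i<d. snd (\<omega> i z) - \<epsilon> * fst (\<omega> i z) = 0}"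
proof -
  have "{\<epsilon>. \<exists>i<d. snd (\<omega> i z) - \<epsilon> * fst (\<omega> i z) = 0} \<subseteq> (\<lambda>i. snd (\<omega> i z) / fst (\<omega> i z)) ` {..<d}"
  proof
    fix \<epsilon> assume "\<epsilon> \<in> {\<epsilon>. \<exists>i<d. snd (\<omega> i z) - \<epsilon> * fst (\<omega> i z) = 0}"
    then obtain i where i: "i < d" "snd (\<omega> i z) = \<epsilon> * fst (\<omega> i z)" by auto
    then have "fst (\<omega> i z) \<noteq> 0" using omega_nonzero[OF i(1) z] by auto
    then have "\<epsilon> = snd (\<omega> i z) / fst (\<omega> i z)" using i by simp
    then show "\<epsilon> \<in> (\<lambda>i. snd (\<omega> i z) / fst (\<omega> i z)) ` {..<d}" using i(1) by blast
  qed
  then show ?thesis by (rule finite_subset) simp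
qed

lemma lam_PS_nonzero:
  assumes z: "z \<in> U" and a: "a \<in> PS"
  shows "lam a z \<noteq> 0"
proof -
  obtain \<epsilon> where "\<epsilon> \<notin> {\<epsilon>. \<exists>i<d. snd (\<omega> i z) - \<epsilon> * fst (\<omega> i z) = 0}"
    using ex_new_if_finite[OF infinite_UNIV_char_0 finite_bad_directions[OF z]] by blast
  then have "\<And>i. i < d \<Longrightarrow> snd (\<omega> i z) - \<epsilon> * fst (\<omega> i z) \<noteq> 0" by blast
  from direction_neighbourhood[OF z this] obtain W where W: "z \<in> W" "leg_web_dir n \<Omega> l d U \<omega> M W \<epsilon>" by blast
  interpret leg_web_dir n \<Omega> l d U \<omega> M W \<epsilon> by (rule W(2))
  show ?thesis using lam_nonzero[OF W(1)] a by (simp add: PS_def)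
qed

text \<open>A covector is determined by its values on two independent vectors, and all but finitely
  many \<open>\<epsilon>\<close> give an admissible direction with a generic centre on the line
  \<open>z\<close>.\<close>

lemma S_Xi_generic:
  assumes z: "z \<in> U" and good: "bad_poly (Ee \<epsilon>0 z) \<noteq> 0" and off: "\<forall>a\<in>PP. lam a z \<noteq> 0"
  shows "S z = Xi z"
proof -
  let ?P = "line_poly bad_poly (X1 z) (- Nz z)"
  have P: "poly ?P \<epsilon> = bad_poly (Ee \<epsilon> z)" for \<epsilon>
    by (simp add: polyfun_bad_poly Ee_def)
  define K where "K = {\<epsilon>. \<exists>i<d. snd (\<omega> i z) - \<epsilon> * fst (\<omega> i z) = 0} \<union> {\<epsilon>. poly ?P \<epsilon> = 0}"
  have "?P \<noteq> 0" using P[of \<epsilon>0] good by auto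
  then have fin: "finite K" using poly_roots_finite finite_bad_directions[OF z] by (simp add: K_def)
  obtain e1 where e1: "e1 \<notin> K" using ex_new_if_finite[OF infinite_UNIV_char_0 fin] by blast
  obtain e2 where e2: "e2 \<notin> insert e1 K" using ex_new_if_finite[OF infinite_UNIV_char_0, of "insert e1 K"] fin by blast
  have key: "snd (S z) - e * fst (S z) = snd (Xi z) - e * fst (Xi z)" if "e \<notin> K" for e
  proof -
    have "\<And>i. i < d \<Longrightarrow> snd (\<omega> i z) - e * fst (\<omega> i z) \<noteq> 0" using that by (auto simp: K_def)
    from direction_neighbourhood[OF z this] obtain W where W: "z \<in> W" "leg_web_dir n \<Omega> l d U \<omega> M W e" by blast
    interpret leg_web_dir n \<Omega> l d U \<omega> M W e by (rule W(2))
    show ?thesis using S_Xi_dir[OF W(1) _ off] that P by (simp add: K_def)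
  qed
  have "snd (S z) - snd (Xi z) = e * (fst (S z) - fst (Xi z))" if "e \<notin> K" for e
    using key[OF that] by (simp add: algebra_simps)
  from this[of e1] this[of e2] have "(e1 - e2) * (fst (S z) - fst (Xi z)) = 0"
    using e1 e2 by (simp add: left_diff_distrib)
  then have "fst (S z) = fst (Xi z)" using e2 by auto
  then show ?thesis using key[OF e1] by (simp add: prod_eq_iff)
qed

text \<open>By its coordinates in the basis of columns, every \<open>E\<close> outside the plane of
  \<open>c2\<close> and \<open>c3\<close> is proportional to a point \<open>Ee \<epsilon> z\<close>,
  even with second coordinate of \<open>z\<close> equal to 0.\<close>

lemma pencil_good_ex: "\<exists>\<epsilon> z. bad_poly (Ee \<epsilon> z) \<noteq> 0"
proof -
  obtain E0 where "bad_poly E0 \<noteq> 0" using bad_poly_nonzero by blast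
  moreover have "tri c2 c3 c1 \<noteq> 0" using tri_columns tri_rotate[of c1 c2 c3] by simp
  ultimately obtain E where E: "bad_poly E \<noteq> 0" "tri c2 c3 E \<noteq> 0"
    using polyfun_common_nonzero[OF polyfun_bad_poly polyfun_tri] by blast
  define D \<alpha> where "D = tri c1 c2 c3" and "\<alpha> = tri E c2 c3"
  have \<alpha>: "\<alpha> \<noteq> 0" "D \<noteq> 0" using E(2) tri_columns tri_rotate[of E c2 c3] by (simp_all add: \<alpha>_def D_def)
  have "D *s E = \<alpha> *s c1 + tri c1 E c3 *s c2 + tri c1 c2 E *s c3"
    unfolding D_def \<alpha>_def by (rule cramer)
  then have "(1 / \<alpha>) *s (D *s E) = (1 / \<alpha>) *s (\<alpha> *s c1 + tri c1 E c3 *s c2 + tri c1 c2 E *s c3)" by simp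
  also have "\<dots> = Ee (- tri c1 c2 E / \<alpha>) (tri c1 E c3 / \<alpha>, 0)"
    using \<alpha> by (simp add: Ee_def X1_def Nz_def vec_eq_iff field_simps)
  finally have "Ee (- tri c1 c2 E / \<alpha>) (tri c1 E c3 / \<alpha>, 0) = (D / \<alpha>) *s E"
    by (simp add: vec_eq_iff)
  moreover have "bad_poly ((D / \<alpha>) *s E) \<noteq> 0" using bad_poly_scale[of "D / \<alpha>" E] \<alpha> E(1) by simp
  ultimately show ?thesis by metis
qed

lemma lam_nonzero_ex:
  assumes a: "a \<in> PP"
  shows "\<exists>z. lam a z \<noteq> 0"
proof (rule ccontr)
  assume "\<not> (\<exists>z. lam a z \<noteq> 0)"
  then have "lam a (0, 0) = 0" "lam a (1, 0) = 0" "lam a (0, 1) = 0" by auto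
  then have 0: "tri (rep a) c3 c1 = 0" "tri (rep a) c3 c2 = 0" "tri (rep a) c2 c1 = 0"
    by (simp_all add: lam_def X1_def Nz_def)
  have "tri (rep a) c2 c3 = - tri (rep a) c3 c2" "tri c1 (rep a) c3 = tri (rep a) c3 c1" "tri c1 c2 (rep a) = - tri (rep a) c2 c1"
    by (simp_all add: tri_expand algebra_simps)
  then have "tri c1 c2 c3 *s rep a = 0" using cramer[of c1 c2 c3 "rep a"] 0 by simp
  then show False using tri_columns rep(1)[OF a] by simp
qed

text \<open>For a fixed \<open>\<epsilon>\<close> the conditions are polynomial in \<open>z\<close>
  and not identically violated. On a line from \<open>z0\<close> to a point that satisfies them they
  fail at finitely many parameters only.\<close>

lemma generic_dense:
  assumes V: "open V" "z0 \<in> V"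
  shows "\<exists>z \<epsilon>. z \<in> V \<and> bad_poly (Ee \<epsilon> z) \<noteq> 0 \<and> (\<forall>a\<in>PP. lam a z \<noteq> 0)"
proof -
  \<comment> \<open>\<open>polyfun\<close> concerns three variables, so functions of
    \<open>z\<close> are regarded as functions of a vector that ignore its third component.\<close>
  define \<pi> where "\<pi> X = (X $ 1, X $ 2)" for X :: "complex^3"
  have \<pi>_surj: "\<exists>X. \<pi> X = z" for z
    by (rule exI[of _ "vector [fst z, snd z, 0]"]) (simp add: \<pi>_def)
  have pX: "polyfun (\<lambda>X. Nz (\<pi> X) $ i)" "polyfun (\<lambda>X. X1 (\<pi> X) $ i)" "polyfun (\<lambda>X. Ee \<epsilon> (\<pi> X) $ i)" for i \<epsilon>
    unfolding Ee_def Nz_def X1_def \<pi>_def vector_minus_component vector_add_component vector_smult_component fst_conv snd_conv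
    by (intro polyfun_intros)+
  obtain \<epsilon> z where Bz: "bad_poly (Ee \<epsilon> z) \<noteq> 0" using pencil_good_ex by blast
  have pB: "polyfun (\<lambda>X. bad_poly (Ee \<epsilon> (\<pi> X)))" by (rule polyfun_compose[OF polyfun_bad_poly pX(3)])
  have pl: "polyfun (\<lambda>X. lam a (\<pi> X))" for a
    unfolding lam_def tri_expand by (intro polyfun_intros pX)
  have "\<exists>X. (\<Prod>a\<in>PP. lam a (\<pi> X)) \<noteq> 0"
    by (rule polyfun_prod_nonzero[OF finite_PP pl]) (use lam_nonzero_ex \<pi>_surj in metis)
  moreover have "\<exists>X. bad_poly (Ee \<epsilon> (\<pi> X)) \<noteq> 0" using Bz \<pi>_surj by metis
  moreover have ppl: "polyfun (\<lambda>X. \<Prod>a\<in>PP. lam a (\<pi> X))" by (intro polyfun_intros pl)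
  ultimately obtain Y where Y: "bad_poly (Ee \<epsilon> (\<pi> Y)) \<noteq> 0" "(\<Prod>a\<in>PP. lam a (\<pi> Y)) \<noteq> 0"
    using polyfun_common_nonzero[OF pB ppl] by blast
  obtain X0 where X0: "\<pi> X0 = z0" using \<pi>_surj by blast
  define g where "g X = bad_poly (Ee \<epsilon> (\<pi> X)) * (\<Prod>a\<in>PP. lam a (\<pi> X))" for X
  have pg: "polyfun g" unfolding g_def by (intro polyfun.mult pB ppl)
  let ?P = "line_poly g X0 (Y - X0)"
  have "poly ?P 1 \<noteq> 0" using Y by (simp add: pg g_def)
  then have fin: "finite {h. poly ?P h = 0}" using poly_roots_finite[of ?P] by force
  have "eventually (\<lambda>h. (fst z0 + h * (Y $ 1 - X0 $ 1), snd z0 + h * (Y $ 2 - X0 $ 2)) \<in> V) (nhds 0)"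
    by (rule dir_shift_eventually[OF V])
  then have "eventually (\<lambda>h. (fst z0 + h * (Y $ 1 - X0 $ 1), snd z0 + h * (Y $ 2 - X0 $ 2)) \<in> V) (at 0)"
    by (simp add: eventually_nhds_conv_at)
  moreover have "eventually (\<lambda>h. h \<notin> {h. poly ?P h = 0}) (at 0)"
  proof -
    have "eventually (\<lambda>h. h \<in> - ({h. poly ?P h = 0} - {0})) (nhds 0)"
      by (rule eventually_nhds_in_open, rule open_Compl, rule finite_imp_closed) (use fin in auto)
    then show ?thesis unfolding eventually_at_filter by eventually_elim auto
  qed
  ultimately have "eventually (\<lambda>h. (fst z0 + h * (Y $ 1 - X0 $ 1), snd z0 + h * (Y $ 2 - X0 $ 2)) \<in> V \<and> h \<notin> {h. poly ?P h = 0}) (at 0)"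
    by (rule eventually_conj)
  then obtain h where h: "(fst z0 + h * (Y $ 1 - X0 $ 1), snd z0 + h * (Y $ 2 - X0 $ 2)) \<in> V" "poly ?P h \<noteq> 0"
    using eventually_happens[of _ "at (0::complex)"] by auto
  have "\<pi> (X0 + h *s (Y - X0)) \<in> V" using h(1) X0 by (auto simp: \<pi>_def right_diff_distrib)
  moreover have "g (X0 + h *s (Y - X0)) \<noteq> 0" using h(2) pg by simp
  then have "bad_poly (Ee \<epsilon> (\<pi> (X0 + h *s (Y - X0)))) \<noteq> 0 \<and> (\<forall>a\<in>PP. lam a (\<pi> (X0 + h *s (Y - X0))) \<noteq> 0)"
    unfolding g_def using finite_PP by (simp add: prod_zero_iff)
  ultimately show ?thesis by blast
qed

lemma S_continuous: "continuous_on U S"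
  unfolding S_def
proof (rule continuous_on_sum)
  fix u assume "u \<in> triples d"
  then show "continuous_on U (\<lambda>z. case u of (r, s, t) \<Rightarrow> eta \<omega> r s t z)"
    by (cases u) (auto simp: triples_def intro!: eta_continuous)
qed

lemma Xi_continuous: "continuous_on U Xi"
proof -
  have "continuous_on U (dlog gam)" by (rule dlog_continuous[OF openU hol_gam gam(1)])
  moreover have "continuous_on U (dlog (\<lambda>w. wedge (\<omega> i w) (\<omega> j w)))" if "i < d" "j \<in> {..<d} - {i}" for i j
    by (rule dlog_continuous[OF openU]) (use hol_wedge transverse that in auto)
  moreover have "continuous_on U (dlog (lam a))" if "a \<in> PS" for a
    by (rule dlog_continuous[OF openU hol_lam lam_PS_nonzero[OF _ that]])
  ultimately show ?thesis unfolding Xi_def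
    by (intro continuous_on_add continuous_on_scale_covec continuous_on_sum) auto
qed

lemma S_eq_Xi:
  assumes z: "z \<in> U"
  shows "S z = Xi z"
proof (rule ccontr)
  assume ne: "S z \<noteq> Xi z"
  define V where "V = U \<inter> (\<lambda>w. S w - Xi w) -` (- {0})"
  have "open V" unfolding V_def
    by (rule continuous_open_preimage[OF continuous_on_diff[OF S_continuous Xi_continuous] openU]) (simp add: open_Compl)
  moreover have "z \<in> V" using z ne by (simp add: V_def)
  ultimately obtain w \<epsilon> where w: "w \<in> V" "bad_poly (Ee \<epsilon> w) \<noteq> 0" "\<forall>a\<in>PP. lam a w \<noteq> 0"
    using generic_dense by blast
  then show False using S_Xi_generic[of w \<epsilon>] by (simp add: V_def)
qed

lemma closed_Xi:
  assumes z: "z \<in> U"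
  shows "closed_at Xi z"
proof -
  have "closed_at (dlog gam) z" by (rule closed_at_dlog[OF openU hol_gam z gam(1)[OF z]])
  moreover have "closed_at (dlog (\<lambda>w. wedge (\<omega> i w) (\<omega> j w))) z" if "i < d" "j \<in> {..<d} - {i}" for i j
    by (rule closed_at_dlog[OF openU _ z]) (use hol_wedge transverse z that in auto)
  moreover have "closed_at (dlog (lam a)) z" if "a \<in> PS" for a
    by (rule closed_at_dlog[OF openU hol_lam z lam_PS_nonzero[OF z that]])
  ultimately show ?thesis unfolding Xi_def[abs_def]
    by (intro closed_at_plus closed_at_scale closed_at_setsum) auto
qed

lemma curvature_zero:
  assumes z: "z \<in> U"
  shows "web_curvature d \<omega> z = 0"
proof -
  have "web_curvature d \<omega> z = ext_deriv S z"
    unfolding web_curvature_def S_def[abs_def] triples_def ..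
  also have "\<dots> = ext_deriv Xi z" by (rule ext_deriv_cong[OF openU z S_eq_Xi])
  also have "\<dots> = 0" by (rule closed_at_ext_deriv[OF closed_Xi[OF z]])
  finally show ?thesis .
qed

end

theorem theoremE:
  fixes d :: nat and l :: "complex^3" and \<Omega> :: "complex^3 \<Rightarrow> complex^3"
  assumes "d \<ge> 3"
    and "reduced_convex_pre_foliation d l \<Omega>"
  shows "Leg_flat d l \<Omega>"
  unfolding Leg_flat_def flat_in_chart_def
proof (intro allI impI ballI)
  fix M U \<omega> z
  assume M: "invertible M" and P: "web_presentation d (Leg M l \<Omega>) U \<omega>" and z: "z \<in> U"
  have fol: "foliation (d - 1) \<Omega>" "l \<noteq> 0" "invariant_line \<Omega> (line_of l)" "finite {L. invariant_line \<Omega> L}"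
    "card {L. invariant_line \<Omega> L} = 3 * (d - 1)" "d - 1 \<ge> 1"
    using assms(2) by (auto simp: reduced_convex_pre_foliation_def pre_foliation_def reduced_convex_foliation_def)
  interpret leg_web "d - 1" \<Omega> l d U \<omega> M
  proof
    show "homogeneous_poly (d - 1 + 1) (\<lambda>X. \<Omega> X $ i)" for i using fol(1) unfolding foliation_def by blast
    show "X \<odot> \<Omega> X = 0" for X using fol(1) unfolding foliation_def by blast
    show "open U" "\<And>i. i < d \<Longrightarrow> holomorphic_form1_on (\<omega> i) U"
      "\<And>i j z. i < d \<Longrightarrow> j < d \<Longrightarrow> i \<noteq> j \<Longrightarrow> z \<in> U \<Longrightarrow> wedge (\<omega> i z) (\<omega> j z) \<noteq> 0"
      "\<And>z. z \<in> U \<Longrightarrow> \<exists>c. c \<noteq> 0 \<and> (\<forall>x. Leg M l \<Omega> z x = c * (\<Prod>i<d. fst (\<omega> i z) + snd (\<omega> i z) * x))"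
      using P unfolding web_presentation_def by blast+
  qed (use fol M assms(1) in auto)
  show "web_curvature d \<omega> z = 0" by (rule curvature_zero[OF z])
qed

end
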